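(* (i) If $P(D)$ is a $\mathcal{G}$-elliptic partial differential operator on $\mathbb{R}^n$ with coefficients in $\widetilde{\mathbb{C}}$, then it is $\mathcal{G}$-hypoelliptic in $\mathbb{R}^n$. (ii) If $P(D)$ is a $\mathcal{G}^\infty$-elliptic partial differential operator on $\mathbb{R}^n$ with coefficients in $\mathcal{G}^{\rm sc}_{\mathbb{C}}$, then it is $\mathcal{G}^\infty$-hypoelliptic in $\mathbb{R}^n$.
   Context: All nets are indexed by $\varepsilon\in(0,1]$; $O(\cdot)$ is as $\varepsilon\to0$. $\widetilde{\mathbb{C}}$ (resp. $\widetilde{\mathbb{R}}$) is the ring of complex (resp. real) nets that are moderate ($\exists N\in\mathbb{N}$: $|r_\varepsilon|=O(\varepsilon^{-N})$) modulo negligible nets ($\forall q\in\mathbb{N}$: $|r_\varepsilon|=O(\varepsilon^{q})$). A slow scale net is a net $(r_\varepsilon)_\varepsilon\in\mathbb{C}^{(0,1]}$ with $\forall q\ge0\ \exists c_q>0\ \forall\varepsilon\in(0,1]$: $|r_\varepsilon|^q\le c_q\varepsilon^{-1}$. $\mathcal{G}^{\rm sc}_{\mathbb{C}}\subseteq\widetilde{\mathbb{C}}$ is the set of classes of nets that are $O(\omega_\varepsilon)$ for some slow scale net $(\omega_\varepsilon)_\varepsilon$. $r\in\widetilde{\mathbb{C}}$ is slow scale-invertible if there are a (positive) slow scale net $(\omega_\varepsilon)_\varepsilon$ and a representative $(r_\varepsilon)_\varepsilon$ of $r$ with $|r_\varepsilon|\ge\omega_\varepsilon^{-1}$ for $\varepsilon$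 small enough. $\mathcal{G}(\Omega)$ ($\Omega\subseteq\mathbb{R}^n$ open) is the Colombeau algebra: nets $(u_\varepsilon)_\varepsilon$ in $C^\infty(\Omega)$ with $\forall K\Subset\Omega\,\forall\alpha\,\exists N$: $\sup_K|\partial^\alpha u_\varepsilon|=O(\varepsilon^{-N})$, modulo nets with $\forall K\,\forall\alpha\,\forall q$: $\sup_K|\partial^\alpha u_\varepsilon|=O(\varepsilon^q)$. $\mathcal{G}^\infty(\Omega)\subseteq\mathcal{G}(\Omega)$ is the subalgebra of elements having a representative with $\forall K\,\exists N\,\forall\alpha$: $\sup_K|\partial^\alpha u_\varepsilon|=O(\varepsilon^{-N})$. $\mathcal{G}_c(\Omega)$ consists of the elements with compact support (representatives are chosen with supports in one compact set independent of $\varepsilon$). Topology: for $K\Subset\Omega$, $\mathcal{G}_K(\Omega)=\{u\in\mathcal{G}_c(\Omega):\mathrm{supp}\,u\subseteq K\}$ carries the ultra-pseudo-seminorms $e^{-\mathrm{v}_{K,j}(u)}$, $\mathrm{v}_{K,j}(u)=\sup\{b\in\mathbb{R}:\sup_{x\in K',|\alpha|\le j}|\partial^\alpha u_\varepsilon(x)|=O(\varepsilon^b)\}$, with $K'\Subset\Omega$ a compact neighbourhood of $K$ (choice irrelevant); $\mathcal{G}_c(\Omega)$ is the strict inductive limit of the $\mathcal{G}_{K}(\Omega)$; $\widetilde{\mathbb{C}}$ carries $|r|_{\rm e}=e^{-\mathrm{v}(r)}$, $\mathrm{v}(r)=\sup\{b:|r_\varepsilon|=O(\varepsilon^b)\}$.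 $\mathcal{L}(\mathcal{G}_c(\Omega),\widetilde{\mathbb{C}})$ is the set of continuous $\widetilde{\mathbb{C}}$-linear functionals. Such a $T$ is basic if there is a net $(T_\varepsilon)_\varepsilon$ in $\mathcal{D}'(\Omega)$ such that $\forall K\Subset\Omega\ \exists j,N\in\mathbb{N},c>0,\eta\in(0,1]$ with $|T_\varepsilon(f)|\le c\,\varepsilon^{-N}\sup_{x\in K,|\alpha|\le j}|\partial^\alpha f(x)|$ for all $f\in C^\infty_K(\Omega)$, $\varepsilon\in(0,\eta]$, and $T(u)=[(T_\varepsilon(u_\varepsilon))_\varepsilon]$ for all $u\in\mathcal{G}_c(\Omega)$. $\mathcal{G}(\Omega)$ is embedded in $\mathcal{L}(\mathcal{G}_c(\Omega),\widetilde{\mathbb{C}})$ by $u\mapsto(v\mapsto\int uv\,dx)$. $\mathrm{sing\,supp}_{\mathcal{G}}T$ (resp. $\mathrm{sing\,supp}_{\mathcal{G}^\infty}T$) is the complement of the set of points $x\in\Omega$ having an open neighbourhood $V$ with $T|_V\in\mathcal{G}(V)$ (resp. $\mathcal{G}^\infty(V)$), where $T|_V$ is the restriction of $T$ to $\mathcal{G}_c(V)$. For $P(D)=\sum_{|\alpha|\le m}c_\alpha D^\alpha$ of order $m$, $D^\alpha=(-i)^{|\alpha|}\partial^\alpha$: $P(D)T(u)=T({}^tP(D)u)$, ${}^tP(D)=\sum(-1)^{|\alpha|}c_\alpha D^\alpha$. With representatives $(c_{\alpha,\varepsilon})_\varepsilon$ of $c_\alpha$ put $P_{m,\varepsilon}(\xi)=\sum_{|\alpha|=m}c_{\alpha,\varepsilon}\xi^\alpha$.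 $P(D)$ is $\mathcal{G}$-elliptic if the generalized number $[(\inf_{\xi\in\mathbb{R}^n,|\xi|=1}|P_{m,\varepsilon}(\xi)|)_\varepsilon]$ (independent of the choice of representatives) is invertible in $\widetilde{\mathbb{R}}$, and $\mathcal{G}^\infty$-elliptic if it is slow scale-invertible. $P(D)$ is $\mathcal{G}$-hypoelliptic if for every open $\Omega\subseteq\mathbb{R}^n$, $\mathrm{sing\,supp}_{\mathcal{G}}P(D)T=\mathrm{sing\,supp}_{\mathcal{G}}T$ for all basic $T\in\mathcal{L}(\mathcal{G}_c(\Omega),\widetilde{\mathbb{C}})$; $\mathcal{G}^\infty$-hypoelliptic is defined in the same way with $\mathrm{sing\,supp}_{\mathcal{G}^\infty}$. *)

theory Defs
  imports "HOL-Analysis.Analysis" "HOL-Library.Landau_Symbols"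
begin

section \<open>Generalized numbers\<close>

text \<open>
  A net indexed by \<open>(0,1]\<close> is a function on \<^typ>\<open>real\<close> of which only the values on
  \<^term>\<open>{0<..1::real}\<close> matter; \<open>O(_)\<close> as \<open>\<epsilon> \<rightarrow> 0\<close> is \<open>O[at_right 0](_)\<close>.
\<close>

definition moderate :: "(real \<Rightarrow> 'a::real_normed_field) \<Rightarrow> bool" where
  "moderate r \<longleftrightarrow> (\<exists>N::nat. (\<lambda>\<epsilon>. norm (r \<epsilon>)) \<in> O[at_right 0](\<lambda>\<epsilon>. \<epsilon> powr (- real N)))"

definition negligible_net :: "(real \<Rightarrow> 'a::real_normed_field) \<Rightarrow> bool" where
  "negligible_net r \<longleftrightarrow> (\<forall>q::nat. (\<lambda>\<epsilon>. norm (r \<epsilon>)) \<in> O[at_right 0](\<lambda>\<epsilon>. \<epsilon> powr real q))"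

definition net_eq :: "(real \<Rightarrow> 'a::real_normed_field) \<Rightarrow> (real \<Rightarrow> 'a) \<Rightarrow> bool" where
  "net_eq r s \<longleftrightarrow> moderate r \<and> moderate s \<and> negligible_net (\<lambda>\<epsilon>. r \<epsilon> - s \<epsilon>)"

lemma powr_bigo_mono:
  assumes "b \<le> (a::real)"
  shows "(\<lambda>\<epsilon>. \<epsilon> powr a) \<in> O[at_right 0](\<lambda>\<epsilon>::real. \<epsilon> powr b)"
proof (rule bigoI[where c = 1])
  have "eventually (\<lambda>\<epsilon>::real. \<epsilon> \<in> {0<..<1}) (at_right 0)"
    by (rule eventually_at_right_real) simp
  then show "eventually (\<lambda>\<epsilon>::real. norm (\<epsilon> powr a) \<le> 1 * norm (\<epsilon> powr b)) (at_right 0)"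
    by eventually_elim (use assms in \<open>auto intro: powr_mono'\<close>)
qed

lemma norm_powr_bigo_mono:
  assumes "f \<in> O[at_right 0](\<lambda>\<epsilon>::real. \<epsilon> powr a)" "b \<le> (a::real)"
  shows "f \<in> O[at_right 0](\<lambda>\<epsilon>::real. \<epsilon> powr b)"
  using landau_o.big_trans[OF assms(1) powr_bigo_mono[OF assms(2)]] .

lemma norm_add_bigo:
  fixes r s :: "real \<Rightarrow> 'a::real_normed_vector"
  assumes "(\<lambda>\<epsilon>. norm (r \<epsilon>)) \<in> O[F](g)" "(\<lambda>\<epsilon>. norm (s \<epsilon>)) \<in> O[F](g)"
  shows "(\<lambda>\<epsilon>. norm (r \<epsilon> + s \<epsilon>)) \<in> O[F](g)"
proof -
  have "(\<lambda>\<epsilon>. norm (r \<epsilon> + s \<epsilon>)) \<in> O[F](\<lambda>\<epsilon>. norm (r \<epsilon>) + norm (s \<epsilon>))"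
    by (rule landau_o.big_mono) (auto intro!: always_eventually order_trans[OF norm_triangle_ineq])
  also have "(\<lambda>\<epsilon>. norm (r \<epsilon>) + norm (s \<epsilon>)) \<in> O[F](g)"
    using assms by (rule sum_in_bigo)
  finally show ?thesis .
qed

lemma norm_mult_bigo:
  fixes r s :: "real \<Rightarrow> 'a::real_normed_field"
  assumes "(\<lambda>\<epsilon>. norm (r \<epsilon>)) \<in> O[at_right 0](\<lambda>\<epsilon>. \<epsilon> powr a)"
    and "(\<lambda>\<epsilon>. norm (s \<epsilon>)) \<in> O[at_right 0](\<lambda>\<epsilon>. \<epsilon> powr b)"
  shows "(\<lambda>\<epsilon>. norm (r \<epsilon> * s \<epsilon>)) \<in> O[at_right 0](\<lambda>\<epsilon>. \<epsilon> powr (a + b))"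
  using landau_o.big.mult[OF assms] by (simp add: norm_mult powr_add)

lemma negligible_imp_moderate: "negligible_net r \<Longrightarrow> moderate r"
  unfolding negligible_net_def moderate_def
  by (metis of_nat_0 neg_0_equal_iff_equal)

lemma negligible_bigo:
  assumes "negligible_net r"
  shows "(\<lambda>\<epsilon>. norm (r \<epsilon>)) \<in> O[at_right 0](\<lambda>\<epsilon>. \<epsilon> powr b)"
  using assms norm_powr_bigo_mono[of _ "real (nat \<lceil>b\<rceil>)" b]
  unfolding negligible_net_def by (meson real_nat_ceiling_ge)

lemma moderate_add: "moderate r \<Longrightarrow> moderate s \<Longrightarrow> moderate (\<lambda>\<epsilon>. r \<epsilon> + s \<epsilon>)"
  unfolding moderate_def
proof (elim exE)
  fix M N :: nat
  assume "(\<lambda>\<epsilon>. norm (r \<epsilon>)) \<in> O[at_right 0](\<lambda>\<epsilon>. \<epsilon> powr (- real M))"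
    and "(\<lambda>\<epsilon>. norm (s \<epsilon>)) \<in> O[at_right 0](\<lambda>\<epsilon>. \<epsilon> powr (- real N))"
  then show "\<exists>N::nat. (\<lambda>\<epsilon>. norm (r \<epsilon> + s \<epsilon>)) \<in> O[at_right 0](\<lambda>\<epsilon>. \<epsilon> powr (- real N))"
    by (intro exI[of _ "max M N"] norm_add_bigo) (erule norm_powr_bigo_mono, simp)+
qed

lemma moderate_mult: "moderate r \<Longrightarrow> moderate s \<Longrightarrow> moderate (\<lambda>\<epsilon>. r \<epsilon> * s \<epsilon>)"
  unfolding moderate_def
proof (elim exE)
  fix M N :: nat
  assume "(\<lambda>\<epsilon>. norm (r \<epsilon>)) \<in> O[at_right 0](\<lambda>\<epsilon>. \<epsilon> powr (- real M))"
    and "(\<lambda>\<epsilon>. norm (s \<epsilon>)) \<in> O[at_right 0](\<lambda>\<epsilon>. \<epsilon> powr (- real N))"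
  from norm_mult_bigo[OF this]
  show "\<exists>N::nat. (\<lambda>\<epsilon>. norm (r \<epsilon> * s \<epsilon>)) \<in> O[at_right 0](\<lambda>\<epsilon>. \<epsilon> powr (- real N))"
    by (intro exI[of _ "M + N"]) simp
qed

lemma moderate_uminus: "moderate r \<Longrightarrow> moderate (\<lambda>\<epsilon>. - r \<epsilon>)"
  by (simp add: moderate_def)

lemma moderate_const: "moderate (\<lambda>_. c)"
  unfolding moderate_def
proof (intro exI bigoI)
  have "eventually (\<lambda>\<epsilon>::real. \<epsilon> \<in> {0<..<1}) (at_right 0)"
    by (rule eventually_at_right_real) simp
  then show "eventually (\<lambda>\<epsilon>::real. norm (norm c) \<le> norm c * norm (\<epsilon> powr (- real 0))) (at_right 0)"
    by eventually_elim simp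
qed

lemma negligible_add:
  "negligible_net r \<Longrightarrow> negligible_net s \<Longrightarrow> negligible_net (\<lambda>\<epsilon>. r \<epsilon> + s \<epsilon>)"
  unfolding negligible_net_def by (blast intro: norm_add_bigo)

lemma negligible_uminus: "negligible_net r \<Longrightarrow> negligible_net (\<lambda>\<epsilon>. - r \<epsilon>)"
  by (simp add: negligible_net_def)

lemma negligible_mult:
  assumes "negligible_net r" "moderate s"
  shows "negligible_net (\<lambda>\<epsilon>. r \<epsilon> * s \<epsilon>)"
  unfolding negligible_net_def
proof
  fix q :: nat
  obtain N where N: "(\<lambda>\<epsilon>. norm (s \<epsilon>)) \<in> O[at_right 0](\<lambda>\<epsilon>. \<epsilon> powr (- real N))"
    using assms(2) by (auto simp: moderate_def)
  show "(\<lambda>\<epsilon>. norm (r \<epsilon> * s \<epsilon>)) \<in> O[at_right 0](\<lambda>\<epsilon>. \<epsilon> powr real q)"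
    using norm_mult_bigo[OF negligible_bigo[OF assms(1), of "real q + real N"] N] by simp
qed

lemma negligible_zero: "negligible_net (\<lambda>_. 0)"
  by (simp add: negligible_net_def)

lemma not_negligible_one: "\<not> negligible_net (\<lambda>_. 1 :: 'a::real_normed_field)"
proof
  assume "negligible_net (\<lambda>_. 1 :: 'a)"
  from negligible_bigo[OF this, of 1]
  obtain c where c: "c > 0"
    "eventually (\<lambda>\<epsilon>::real. norm (1::real) \<le> c * norm (\<epsilon> powr 1)) (at_right 0)"
    by (auto elim: landau_o.bigE)
  have "eventually (\<lambda>\<epsilon>::real. \<epsilon> \<in> {0<..<inverse c}) (at_right 0)"
    by (rule eventually_at_right_real) (use c(1) in simp)
  with c(2) have "eventually (\<lambda>\<epsilon>::real. False) (at_right 0)"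
    by eventually_elim (use c(1) in \<open>auto simp: field_simps\<close>)
  then show False by simp
qed

quotient_type (overloaded) 'a gnum = "real \<Rightarrow> 'a::real_normed_field" / partial: net_eq
proof (rule part_equivpI)
  show "\<exists>x::real \<Rightarrow> 'a. net_eq x x"
    by (auto intro!: exI[of _ "\<lambda>_. 0"] simp: net_eq_def negligible_zero moderate_const)
  show "symp (net_eq :: (real \<Rightarrow> 'a) \<Rightarrow> _)"
  proof (rule sympI)
    fix r s :: "real \<Rightarrow> 'a" assume "net_eq r s"
    then show "net_eq s r"
      using negligible_uminus[of "\<lambda>\<epsilon>. r \<epsilon> - s \<epsilon>"] by (simp add: net_eq_def)
  qed
  show "transp (net_eq :: (real \<Rightarrow> 'a) \<Rightarrow> _)"
  proof (rule transpI)
    fix r s t :: "real \<Rightarrow> 'a" assume "net_eq r s" "net_eq s t"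
    then show "net_eq r t"
      using negligible_add[of "\<lambda>\<epsilon>. r \<epsilon> - s \<epsilon>" "\<lambda>\<epsilon>. s \<epsilon> - t \<epsilon>"] by (simp add: net_eq_def)
  qed
qed

instantiation gnum :: (real_normed_field) comm_ring_1
begin

lift_definition zero_gnum :: "'a gnum" is "\<lambda>_. 0"
  by (simp add: net_eq_def moderate_const negligible_zero)

lift_definition one_gnum :: "'a gnum" is "\<lambda>_. 1"
  by (simp add: net_eq_def moderate_const negligible_zero)

lift_definition plus_gnum :: "'a gnum \<Rightarrow> 'a gnum \<Rightarrow> 'a gnum" is "\<lambda>r s \<epsilon>. r \<epsilon> + s \<epsilon>"
proof -
  fix r r' s s' :: "real \<Rightarrow> 'a" assume *: "net_eq r r'" "net_eq s s'"
  then show "net_eq (\<lambda>\<epsilon>. r \<epsilon> + s \<epsilon>) (\<lambda>\<epsilon>. r' \<epsilon> + s' \<epsilon>)"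
    using negligible_add[of "\<lambda>\<epsilon>. r \<epsilon> - r' \<epsilon>" "\<lambda>\<epsilon>. s \<epsilon> - s' \<epsilon>"]
    by (simp add: net_eq_def moderate_add algebra_simps)
qed

lift_definition uminus_gnum :: "'a gnum \<Rightarrow> 'a gnum" is "\<lambda>r \<epsilon>. - r \<epsilon>"
proof -
  fix r r' :: "real \<Rightarrow> 'a" assume *: "net_eq r r'"
  then show "net_eq (\<lambda>\<epsilon>. - r \<epsilon>) (\<lambda>\<epsilon>. - r' \<epsilon>)"
    using negligible_uminus[of "\<lambda>\<epsilon>. r \<epsilon> - r' \<epsilon>"]
    by (simp add: net_eq_def moderate_uminus algebra_simps)
qed

lift_definition minus_gnum :: "'a gnum \<Rightarrow> 'a gnum \<Rightarrow> 'a gnum" is "\<lambda>r s \<epsilon>. r \<epsilon> - s \<epsilon>"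
proof -
  fix r r' s s' :: "real \<Rightarrow> 'a" assume *: "net_eq r r'" "net_eq s s'"
  then show "net_eq (\<lambda>\<epsilon>. r \<epsilon> - s \<epsilon>) (\<lambda>\<epsilon>. r' \<epsilon> - s' \<epsilon>)"
    using negligible_add[of "\<lambda>\<epsilon>. r \<epsilon> - r' \<epsilon>" "\<lambda>\<epsilon>. - (s \<epsilon> - s' \<epsilon>)"]
      negligible_uminus[of "\<lambda>\<epsilon>. s \<epsilon> - s' \<epsilon>"]
      moderate_add[of r "\<lambda>\<epsilon>. - s \<epsilon>"] moderate_add[of r' "\<lambda>\<epsilon>. - s' \<epsilon>"]
    by (simp add: net_eq_def moderate_uminus algebra_simps)
qed

lift_definition times_gnum :: "'a gnum \<Rightarrow> 'a gnum \<Rightarrow> 'a gnum" is "\<lambda>r s \<epsilon>. r \<epsilon> * s \<epsilon>"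
proof -
  fix r r' s s' :: "real \<Rightarrow> 'a" assume *: "net_eq r r'" "net_eq s s'"
  then have "negligible_net (\<lambda>\<epsilon>. (r \<epsilon> - r' \<epsilon>) * s \<epsilon>)" "negligible_net (\<lambda>\<epsilon>. (s \<epsilon> - s' \<epsilon>) * r' \<epsilon>)"
    by (auto simp: net_eq_def intro: negligible_mult)
  from negligible_add[OF this] show "net_eq (\<lambda>\<epsilon>. r \<epsilon> * s \<epsilon>) (\<lambda>\<epsilon>. r' \<epsilon> * s' \<epsilon>)"
    using * by (simp add: net_eq_def moderate_mult algebra_simps)
qed

instance
proof
  fix a b c :: "'a gnum"
  show "a + b + c = a + (b + c)"
    by transfer (simp add: net_eq_def moderate_add negligible_zero add.assoc)
  show "a + b = b + a"
    by transfer (simp add: net_eq_def moderate_add negligible_zero add.commute)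
  show "0 + a = a" by transfer simp
  show "- a + a = 0"
    by transfer (simp add: net_eq_def moderate_const negligible_zero)
  show "a - b = a + - b"
    by transfer (use moderate_add moderate_uminus in \<open>fastforce simp: net_eq_def negligible_zero\<close>)
  show "a * b * c = a * (b * c)"
    by transfer (simp add: net_eq_def moderate_mult negligible_zero mult.assoc)
  show "a * b = b * a"
    by transfer (simp add: net_eq_def moderate_mult negligible_zero mult.commute)
  show "1 * a = a" by transfer simp
  show "(a + b) * c = a * c + b * c"
    by transfer (simp add: net_eq_def moderate_mult moderate_add negligible_zero distrib_right)
  show "(0::'a gnum) \<noteq> 1"
    by transfer (use not_negligible_one negligible_uminus in \<open>fastforce simp: net_eq_def\<close>)
qed

end

definition representatives :: "'a::real_normed_field gnum \<Rightarrow> (real \<Rightarrow> 'a) set" where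
  "representatives r = {x. moderate x \<and> abs_gnum x = r}"

text \<open>The valuation takes the value \<open>\<infinity>\<close> exactly at \<open>0\<close>, where \<open>e\<^sup>-\<^sup>v\<close> is \<open>0\<close>.\<close>

definition exp_neg :: "ereal \<Rightarrow> real" where
  "exp_neg v = (if v = \<infinity> then 0 else exp (- real_of_ereal v))"

lift_definition gvaluation :: "'a::real_normed_field gnum \<Rightarrow> ereal" is
  "\<lambda>r. Sup (ereal ` {b. (\<lambda>\<epsilon>. norm (r \<epsilon>)) \<in> O[at_right 0](\<lambda>\<epsilon>. \<epsilon> powr b)})"
proof -
  fix r s :: "real \<Rightarrow> 'a" assume rs: "net_eq r s"
  have "(\<lambda>\<epsilon>. norm (r \<epsilon>)) \<in> O[at_right 0](\<lambda>\<epsilon>. \<epsilon> powr b)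
      \<longleftrightarrow> (\<lambda>\<epsilon>. norm (s \<epsilon>)) \<in> O[at_right 0](\<lambda>\<epsilon>. \<epsilon> powr b)" for b
  proof -
    have n: "negligible_net (\<lambda>\<epsilon>. r \<epsilon> - s \<epsilon>)" "negligible_net (\<lambda>\<epsilon>. - (r \<epsilon> - s \<epsilon>))"
      using rs negligible_uminus[of "\<lambda>\<epsilon>. r \<epsilon> - s \<epsilon>"] by (auto simp: net_eq_def)
    show ?thesis
      using norm_add_bigo[OF _ negligible_bigo[OF n(1), of b], of s]
        norm_add_bigo[OF _ negligible_bigo[OF n(2), of b], of r] by auto
  qed
  then show "Sup (ereal ` {b. (\<lambda>\<epsilon>. norm (r \<epsilon>)) \<in> O[at_right 0](\<lambda>\<epsilon>. \<epsilon> powr b)}) =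
    Sup (ereal ` {b. (\<lambda>\<epsilon>. norm (s \<epsilon>)) \<in> O[at_right 0](\<lambda>\<epsilon>. \<epsilon> powr b)})" by simp
qed

definition ultra_norm :: "'a::real_normed_field gnum \<Rightarrow> real" where
  "ultra_norm r = exp_neg (gvaluation r)"

lemma gvaluation_not_MInf: "gvaluation r \<noteq> -\<infinity>"
proof transfer
  fix r :: "real \<Rightarrow> 'a" assume "net_eq r r"
  then obtain N :: nat where "(\<lambda>\<epsilon>. norm (r \<epsilon>)) \<in> O[at_right 0](\<lambda>\<epsilon>. \<epsilon> powr (- real N))"
    by (auto simp: net_eq_def moderate_def)
  then have "ereal (- real N) \<le> Sup (ereal ` {b. (\<lambda>\<epsilon>. norm (r \<epsilon>)) \<in> O[at_right 0](\<lambda>\<epsilon>. \<epsilon> powr b)})"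
    by (intro Sup_upper) auto
  then show "Sup (ereal ` {b. (\<lambda>\<epsilon>. norm (r \<epsilon>)) \<in> O[at_right 0](\<lambda>\<epsilon>. \<epsilon> powr b)}) \<noteq> -\<infinity>"
    by auto
qed

lemma gvaluation_minus: "gvaluation (r - s) = gvaluation (s - r)"
  by transfer (simp add: norm_minus_commute)

lemma gvaluation_add: "min (gvaluation r) (gvaluation s) \<le> gvaluation (r + s)"
proof transfer
  fix r s :: "real \<Rightarrow> 'a"
  define V where "V r = {b. (\<lambda>\<epsilon>. norm (r \<epsilon>)) \<in> O[at_right 0](\<lambda>\<epsilon>. \<epsilon> powr b)}" for r :: "real \<Rightarrow> 'a"
  have "min (Sup (ereal ` V r)) (Sup (ereal ` V s)) \<le> Sup (ereal ` V (\<lambda>\<epsilon>. r \<epsilon> + s \<epsilon>))"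
  proof (rule dense_le)
    fix x assume "x < min (Sup (ereal ` V r)) (Sup (ereal ` V s))"
    then obtain b c where bc: "b \<in> V r" "x < ereal b" "c \<in> V s" "x < ereal c"
      by (auto simp: less_Sup_iff)
    then have "min b c \<in> V (\<lambda>\<epsilon>. r \<epsilon> + s \<epsilon>)"
      unfolding V_def by (auto intro!: norm_add_bigo elim: norm_powr_bigo_mono)
    then have "ereal (min b c) \<le> Sup (ereal ` V (\<lambda>\<epsilon>. r \<epsilon> + s \<epsilon>))"
      by (intro Sup_upper imageI)
    moreover have "x \<le> ereal (min b c)" using bc by (auto simp: min_def)
    ultimately show "x \<le> Sup (ereal ` V (\<lambda>\<epsilon>. r \<epsilon> + s \<epsilon>))" by (rule order_trans[rotated])
  qed
  then show "min (Sup (ereal ` {b. (\<lambda>\<epsilon>. norm (r \<epsilon>)) \<in> O[at_right 0](\<lambda>\<epsilon>. \<epsilon> powr b)}))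
      (Sup (ereal ` {b. (\<lambda>\<epsilon>. norm (s \<epsilon>)) \<in> O[at_right 0](\<lambda>\<epsilon>. \<epsilon> powr b)}))
     \<le> Sup (ereal ` {b. (\<lambda>\<epsilon>. norm (r \<epsilon> + s \<epsilon>)) \<in> O[at_right 0](\<lambda>\<epsilon>. \<epsilon> powr b)})"
    by (simp add: V_def)
qed

lemma gvaluation_eq_PInf_iff: "gvaluation r = \<infinity> \<longleftrightarrow> r = 0"
proof transfer
  fix r :: "real \<Rightarrow> 'a" assume r: "net_eq r r"
  define V where "V = {b. (\<lambda>\<epsilon>. norm (r \<epsilon>)) \<in> O[at_right 0](\<lambda>\<epsilon>. \<epsilon> powr b)}"
  have "Sup (ereal ` V) = \<infinity> \<longleftrightarrow> negligible_net r"
  proof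
    assume S: "Sup (ereal ` V) = \<infinity>"
    show "negligible_net r"
      unfolding negligible_net_def
    proof
      fix q :: nat
      have "ereal (real q) < Sup (ereal ` V)" using S by simp
      then obtain b where "b \<in> V" "real q < b" by (auto simp: less_Sup_iff)
      then show "(\<lambda>\<epsilon>. norm (r \<epsilon>)) \<in> O[at_right 0](\<lambda>\<epsilon>. \<epsilon> powr real q)"
        by (auto simp: V_def elim: norm_powr_bigo_mono)
    qed
  next
    assume "negligible_net r"
    then have "V = UNIV" by (auto simp: V_def negligible_bigo)
    then have "ereal b \<le> Sup (ereal ` V)" for b by (intro Sup_upper) auto
    then show "Sup (ereal ` V) = \<infinity>" by (rule ereal_top)
  qed
  then show "Sup (ereal ` {b. (\<lambda>\<epsilon>. norm (r \<epsilon>)) \<in> O[at_right 0](\<lambda>\<epsilon>. \<epsilon> powr b)}) = \<infinity>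
      \<longleftrightarrow> net_eq r (\<lambda>_. 0)"
    using r by (simp add: V_def net_eq_def moderate_const)
qed

lemma exp_neg_antimono: "v \<noteq> -\<infinity> \<Longrightarrow> v \<le> w \<Longrightarrow> exp_neg w \<le> exp_neg v"
  by (cases v; cases w) (auto simp: exp_neg_def)

lemma exp_neg_nonneg: "0 \<le> exp_neg v"
  by (simp add: exp_neg_def)

lemma ultra_norm_add: "ultra_norm (r + s) \<le> max (ultra_norm r) (ultra_norm s)"
proof (cases "gvaluation r \<le> gvaluation s")
  case True
  then have "ultra_norm (r + s) \<le> ultra_norm r"
    unfolding ultra_norm_def using gvaluation_add[of r s]
    by (intro exp_neg_antimono gvaluation_not_MInf) (simp add: min_def)
  then show ?thesis by simp
next
  case False
  then have "ultra_norm (r + s) \<le> ultra_norm s"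
    unfolding ultra_norm_def using gvaluation_add[of r s]
    by (intro exp_neg_antimono gvaluation_not_MInf) (simp add: min_def)
  then show ?thesis by simp
qed

instantiation gnum :: (real_normed_field) metric_space
begin

definition dist_gnum :: "'a gnum \<Rightarrow> 'a gnum \<Rightarrow> real" where
  "dist_gnum r s = ultra_norm (r - s)"

definition uniformity_gnum :: "('a gnum \<times> 'a gnum) filter" where
  "uniformity_gnum = (INF e\<in>{0<..}. principal {(x, y). dist x y < e})"

definition open_gnum :: "'a gnum set \<Rightarrow> bool" where
  "open_gnum U \<longleftrightarrow> (\<forall>x\<in>U. eventually (\<lambda>(x', y). x' = x \<longrightarrow> y \<in> U) uniformity)"

instance
proof
  fix x y z :: "'a gnum"
  show "dist x y = 0 \<longleftrightarrow> x = y"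
    using gvaluation_eq_PInf_iff[of "x - y"]
    by (auto simp: dist_gnum_def ultra_norm_def exp_neg_def)
  have "ultra_norm ((x - z) + (z - y)) \<le> max (ultra_norm (x - z)) (ultra_norm (z - y))"
    by (rule ultra_norm_add)
  also have "ultra_norm (z - y) = ultra_norm (y - z)"
    by (simp add: ultra_norm_def gvaluation_minus)
  also have "max (ultra_norm (x - z)) (ultra_norm (y - z)) \<le> ultra_norm (x - z) + ultra_norm (y - z)"
    by (simp add: ultra_norm_def exp_neg_nonneg)
  finally show "dist x y \<le> dist x z + dist y z"
    by (simp add: dist_gnum_def)
qed (simp_all add: uniformity_gnum_def open_gnum_def)

end

definition slow_scale :: "(real \<Rightarrow> 'a::real_normed_field) \<Rightarrow> bool" where
  "slow_scale r \<longleftrightarrow> (\<forall>q\<ge>0. \<exists>c>0. \<forall>\<epsilon>\<in>{0<..1}. norm (r \<epsilon>) powr q \<le> c * inverse \<epsilon>)"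

definition slow_scale_numbers :: "complex gnum set" where
  "slow_scale_numbers =
     {r. \<exists>x\<in>representatives r. \<exists>\<omega>::real \<Rightarrow> complex. slow_scale \<omega> \<and> x \<in> O[at_right 0](\<omega>)}"

definition slow_scale_invertible :: "'a::real_normed_field gnum \<Rightarrow> bool" where
  "slow_scale_invertible r \<longleftrightarrow>
     (\<exists>\<omega>::real \<Rightarrow> real. slow_scale \<omega> \<and> (\<forall>\<epsilon>\<in>{0<..1}. 0 < \<omega> \<epsilon>) \<and>
        (\<exists>x\<in>representatives r. eventually (\<lambda>\<epsilon>. norm (x \<epsilon>) \<ge> inverse (\<omega> \<epsilon>)) (at_right 0)))"


section \<open>Smooth functions\<close>

definition mi_order :: "('n::finite \<Rightarrow> nat) \<Rightarrow> nat" where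
  "mi_order \<alpha> = (\<Sum>i\<in>UNIV. \<alpha> i)"

definition pd :: "'n::finite \<Rightarrow> (real^'n \<Rightarrow> complex) \<Rightarrow> real^'n \<Rightarrow> complex" where
  "pd i f = (\<lambda>x. frechet_derivative f (at x) (axis i 1))"

definition smooth_on :: "(real^'n) set \<Rightarrow> (real^'n::finite \<Rightarrow> complex) \<Rightarrow> bool" where
  "smooth_on \<Omega> f \<longleftrightarrow> (\<forall>is :: 'n list. fold pd is f differentiable_on \<Omega>)"

text \<open>
  \<open>\<partial>\<^sup>\<alpha>\<close> differentiates along an arbitrary enumeration of the coordinates; on smooth
  functions the order of differentiation is immaterial.
\<close>

definition coordinates :: "'n::finite list" where
  "coordinates = (SOME is. distinct is \<and> set is = UNIV)"

definition pderivs :: "('n \<Rightarrow> nat) \<Rightarrow> (real^'n::finite \<Rightarrow> complex) \<Rightarrow> real^'n \<Rightarrow> complex" where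
  "pderivs \<alpha> = fold (\<lambda>i. pd i ^^ \<alpha> i) coordinates"

text \<open>The element \<open>0\<close> is inserted only to give the supremum over the empty set the value \<open>0\<close>.\<close>

definition sup_norm :: "(real^'n::finite) set \<Rightarrow> (real^'n \<Rightarrow> complex) \<Rightarrow> real" where
  "sup_norm K g = Sup (insert 0 ((\<lambda>x. norm (g x)) ` K))"

definition C_norm :: "(real^'n::finite) set \<Rightarrow> nat \<Rightarrow> (real^'n \<Rightarrow> complex) \<Rightarrow> real" where
  "C_norm K j f = Sup (insert 0 {norm (pderivs \<alpha> f x) | \<alpha> x. mi_order \<alpha> \<le> j \<and> x \<in> K})"

text \<open>
  Compactly supported functions on an open set are identified with their extensions by zero.
\<close>

definition test_functions_in :: "(real^'n::finite) set \<Rightarrow> (real^'n \<Rightarrow> complex) set" where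
  "test_functions_in K = {f. smooth_on UNIV f \<and> (\<forall>x. x \<notin> K \<longrightarrow> f x = 0)}"

definition test_functions :: "(real^'n::finite) set \<Rightarrow> (real^'n \<Rightarrow> complex) set" where
  "test_functions \<Omega> = (\<Union>K\<in>{K. compact K \<and> K \<subseteq> \<Omega>}. test_functions_in K)"

definition distributions ::
  "(real^'n::finite) set \<Rightarrow> ((real^'n \<Rightarrow> complex) \<Rightarrow> complex) set" where
  "distributions \<Omega> = {T.
     (\<forall>f\<in>test_functions \<Omega>. \<forall>g\<in>test_functions \<Omega>. T (\<lambda>x. f x + g x) = T f + T g) \<and>
     (\<forall>a. \<forall>f\<in>test_functions \<Omega>. T (\<lambda>x. a * f x) = a * T f) \<and>
     (\<forall>K. compact K \<and> K \<subseteq> \<Omega> \<longrightarrow>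
        (\<exists>j. \<exists>c>0. \<forall>f\<in>test_functions_in K. norm (T f) \<le> c * C_norm K j f))}"


section \<open>The Colombeau algebra\<close>

type_synonym 'n net = "real \<Rightarrow> real^'n \<Rightarrow> complex"

definition smooth_nets :: "(real^'n::finite) set \<Rightarrow> 'n net set" where
  "smooth_nets \<Omega> = {u. \<forall>\<epsilon>\<in>{0<..1}. smooth_on \<Omega> (u \<epsilon>)}"

definition moderate_nets :: "(real^'n::finite) set \<Rightarrow> 'n net set" where
  "moderate_nets \<Omega> = {u \<in> smooth_nets \<Omega>. \<forall>K \<alpha>. compact K \<and> K \<subseteq> \<Omega> \<longrightarrow>
     (\<exists>N::nat. (\<lambda>\<epsilon>. sup_norm K (pderivs \<alpha> (u \<epsilon>))) \<in> O[at_right 0](\<lambda>\<epsilon>. \<epsilon> powr (- real N)))}"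

definition negligible_nets :: "(real^'n::finite) set \<Rightarrow> 'n net set" where
  "negligible_nets \<Omega> = {u \<in> smooth_nets \<Omega>. \<forall>K \<alpha>. compact K \<and> K \<subseteq> \<Omega> \<longrightarrow>
     (\<forall>q::nat. (\<lambda>\<epsilon>. sup_norm K (pderivs \<alpha> (u \<epsilon>))) \<in> O[at_right 0](\<lambda>\<epsilon>. \<epsilon> powr real q))}"

definition colombeau_rel :: "(real^'n::finite) set \<Rightarrow> ('n net \<times> 'n net) set" where
  "colombeau_rel \<Omega> = {(u, v). u \<in> moderate_nets \<Omega> \<and> v \<in> moderate_nets \<Omega> \<and>
     (\<lambda>\<epsilon> x. u \<epsilon> x - v \<epsilon> x) \<in> negligible_nets \<Omega>}"

abbreviation colombeau_class :: "(real^'n::finite) set \<Rightarrow> 'n net \<Rightarrow> 'n net set" where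
  "colombeau_class \<Omega> u \<equiv> colombeau_rel \<Omega> `` {u}"

definition colombeau :: "(real^'n::finite) set \<Rightarrow> 'n net set set" where
  "colombeau \<Omega> = moderate_nets \<Omega> // colombeau_rel \<Omega>"

definition colombeau_infty :: "(real^'n::finite) set \<Rightarrow> 'n net set set" where
  "colombeau_infty \<Omega> = {U \<in> colombeau \<Omega>. \<exists>u\<in>U. \<forall>K. compact K \<and> K \<subseteq> \<Omega> \<longrightarrow>
     (\<exists>N::nat. \<forall>\<alpha>. (\<lambda>\<epsilon>. sup_norm K (pderivs \<alpha> (u \<epsilon>))) \<in> O[at_right 0](\<lambda>\<epsilon>. \<epsilon> powr (- real N)))}"

definition gsupport :: "(real^'n::finite) set \<Rightarrow> 'n net set \<Rightarrow> (real^'n) set" where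
  "gsupport \<Omega> U = \<Omega> - {x. \<exists>V. open V \<and> x \<in> V \<and> V \<subseteq> \<Omega> \<and> U \<subseteq> negligible_nets V}"

definition colombeau_c :: "(real^'n::finite) set \<Rightarrow> 'n net set set" where
  "colombeau_c \<Omega> = {U \<in> colombeau \<Omega>. compact (gsupport \<Omega> U)}"

definition colombeau_in :: "(real^'n::finite) set \<Rightarrow> (real^'n) set \<Rightarrow> 'n net set set" where
  "colombeau_in \<Omega> K = {U \<in> colombeau_c \<Omega>. gsupport \<Omega> U \<subseteq> K}"

text \<open>Representatives whose supports lie in one compact set independent of \<open>\<epsilon>\<close>.\<close>

definition c_nets :: "(real^'n::finite) set \<Rightarrow> 'n net set" where
  "c_nets \<Omega> = {u \<in> moderate_nets \<Omega>.
     \<exists>K. compact K \<and> K \<subseteq> \<Omega> \<and> (\<forall>\<epsilon>\<in>{0<..1}. u \<epsilon> \<in> test_functions_in K)}"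

text \<open>
  Operations on classes are unions of the classes obtained from representatives, which all
  coincide.  \<^const>\<open>rep_gnum\<close> picks a representative of a generalized number.
\<close>

definition gadd :: "(real^'n::finite) set \<Rightarrow> 'n net set \<Rightarrow> 'n net set \<Rightarrow> 'n net set" where
  "gadd \<Omega> U V = (\<Union>u\<in>U. \<Union>v\<in>V. colombeau_class \<Omega> (\<lambda>\<epsilon> x. u \<epsilon> x + v \<epsilon> x))"

definition gscale :: "(real^'n::finite) set \<Rightarrow> complex gnum \<Rightarrow> 'n net set \<Rightarrow> 'n net set" where
  "gscale \<Omega> r U = (\<Union>u\<in>U. colombeau_class \<Omega> (\<lambda>\<epsilon> x. rep_gnum r \<epsilon> * u \<epsilon> x))"

definition gextend ::
  "(real^'n::finite) set \<Rightarrow> (real^'n) set \<Rightarrow> 'n net set \<Rightarrow> 'n net set" where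
  "gextend V \<Omega> U = (\<Union>u\<in>U \<inter> c_nets V. colombeau_class \<Omega> u)"


section \<open>Topology and dual\<close>

definition ultra_seminorm :: "(real^'n::finite) set \<Rightarrow> nat \<Rightarrow> 'n net set \<Rightarrow> real" where
  "ultra_seminorm K' j U = exp_neg (Sup (ereal ` {b. \<exists>u\<in>U.
     (\<lambda>\<epsilon>. C_norm K' j (u \<epsilon>)) \<in> O[at_right 0](\<lambda>\<epsilon>. \<epsilon> powr b)}))"

text \<open>
  Neighbourhoods of \<open>0\<close> in \<open>\<G>\<^sub>K(\<Omega>)\<close>: they contain finite intersections of balls.  The
  seminorms do not depend on the compact neighbourhood \<open>K'\<close> of \<open>K\<close>; all of them are used.
\<close>

definition zero_nbhd_in ::
  "(real^'n::finite) set \<Rightarrow> (real^'n) set \<Rightarrow> 'n net set set \<Rightarrow> bool" where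
  "zero_nbhd_in \<Omega> K W \<longleftrightarrow> (\<exists>F e. finite F \<and> 0 < e \<and>
     (\<forall>(K', j)\<in>F. compact K' \<and> K \<subseteq> interior K' \<and> K' \<subseteq> \<Omega>) \<and>
     {U \<in> colombeau_in \<Omega> K. \<forall>(K', j)\<in>F. ultra_seminorm K' j U < e} \<subseteq> W)"

text \<open>
  The inductive limit topology is the finest locally convex topology (over the ring of
  generalized numbers) for which the inclusions of the \<open>\<G>\<^sub>K(\<Omega>)\<close> are continuous: a base of
  neighbourhoods of \<open>0\<close> is given by the convex (\<open>W + W \<subseteq> W\<close> and \<open>[(\<epsilon>\<^sup>b)] W \<subseteq> W\<close> for \<open>b \<ge> 0\<close>)
  and balanced sets whose traces on all \<open>\<G>\<^sub>K(\<Omega>)\<close> are neighbourhoods of \<open>0\<close>.  Such sets are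
  absorbent, and the second half of convexity is subsumed by balancedness.
\<close>

definition convex_zero_nbhd :: "(real^'n::finite) set \<Rightarrow> 'n net set set \<Rightarrow> bool" where
  "convex_zero_nbhd \<Omega> W \<longleftrightarrow> W \<subseteq> colombeau_c \<Omega> \<and>
     (\<forall>U\<in>W. \<forall>V\<in>W. gadd \<Omega> U V \<in> W) \<and>
     (\<forall>r. ultra_norm r \<le> 1 \<longrightarrow> (\<forall>U\<in>W. gscale \<Omega> r U \<in> W)) \<and>
     (\<forall>K. compact K \<and> K \<subseteq> \<Omega> \<longrightarrow> zero_nbhd_in \<Omega> K W)"

definition colombeau_c_topology :: "(real^'n::finite) set \<Rightarrow> 'n net set topology" where
  "colombeau_c_topology \<Omega> = topology (\<lambda>A. A \<subseteq> colombeau_c \<Omega> \<and>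
     (\<forall>U\<in>A. \<exists>W. convex_zero_nbhd \<Omega> W \<and> gadd \<Omega> U ` W \<subseteq> A))"

lemma zero_nbhd_in_Int:
  assumes "zero_nbhd_in \<Omega> K W" "zero_nbhd_in \<Omega> K W'"
  shows "zero_nbhd_in \<Omega> K (W \<inter> W')"
proof -
  obtain F1 e1 where 1: "finite F1" "0 < e1"
    "\<forall>(K', j)\<in>F1. compact K' \<and> K \<subseteq> interior K' \<and> K' \<subseteq> \<Omega>"
    "{U \<in> colombeau_in \<Omega> K. \<forall>(K', j)\<in>F1. ultra_seminorm K' j U < e1} \<subseteq> W"
    using assms(1) unfolding zero_nbhd_in_def by blast
  obtain F2 e2 where 2: "finite F2" "0 < e2"
    "\<forall>(K', j)\<in>F2. compact K' \<and> K \<subseteq> interior K' \<and> K' \<subseteq> \<Omega>"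
    "{U \<in> colombeau_in \<Omega> K. \<forall>(K', j)\<in>F2. ultra_seminorm K' j U < e2} \<subseteq> W'"
    using assms(2) unfolding zero_nbhd_in_def by blast
  show ?thesis
    unfolding zero_nbhd_in_def
  proof (intro exI conjI)
    show "{U \<in> colombeau_in \<Omega> K. \<forall>(K', j)\<in>F1 \<union> F2. ultra_seminorm K' j U < min e1 e2} \<subseteq> W \<inter> W'"
      using 1(4) 2(4) by fastforce
    show "\<forall>(K', j)\<in>F1 \<union> F2. compact K' \<and> K \<subseteq> interior K' \<and> K' \<subseteq> \<Omega>"
      using 1(3) 2(3) by blast
  qed (use 1(1,2) 2(1,2) in auto)
qed

lemma convex_zero_nbhd_Int:
  "convex_zero_nbhd \<Omega> W \<Longrightarrow> convex_zero_nbhd \<Omega> W' \<Longrightarrow> convex_zero_nbhd \<Omega> (W \<inter> W')"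
  unfolding convex_zero_nbhd_def by (auto intro: zero_nbhd_in_Int)

lemma openin_colombeau_c_topology:
  "openin (colombeau_c_topology \<Omega>) A \<longleftrightarrow> A \<subseteq> colombeau_c \<Omega> \<and>
     (\<forall>U\<in>A. \<exists>W. convex_zero_nbhd \<Omega> W \<and> gadd \<Omega> U ` W \<subseteq> A)"
proof -
  have "istopology (\<lambda>A. A \<subseteq> colombeau_c \<Omega> \<and>
     (\<forall>U\<in>A. \<exists>W. convex_zero_nbhd \<Omega> W \<and> gadd \<Omega> U ` W \<subseteq> A))"
    unfolding istopology_def
  proof (intro conjI allI impI ballI; (elim conjE)?)
    fix A B U
    assume A: "\<forall>U\<in>A. \<exists>W. convex_zero_nbhd \<Omega> W \<and> gadd \<Omega> U ` W \<subseteq> A"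
      and B: "\<forall>U\<in>B. \<exists>W. convex_zero_nbhd \<Omega> W \<and> gadd \<Omega> U ` W \<subseteq> B"
      and U: "U \<in> A \<inter> B"
    obtain W where W: "convex_zero_nbhd \<Omega> W" "gadd \<Omega> U ` W \<subseteq> A" using A U by blast
    obtain W' where W': "convex_zero_nbhd \<Omega> W'" "gadd \<Omega> U ` W' \<subseteq> B" using B U by blast
    show "\<exists>W. convex_zero_nbhd \<Omega> W \<and> gadd \<Omega> U ` W \<subseteq> A \<inter> B"
      using W W' by (intro exI[of _ "W \<inter> W'"]) (auto intro: convex_zero_nbhd_Int)
  next
    fix \<A> U
    assume \<A>: "\<forall>A\<in>\<A>. A \<subseteq> colombeau_c \<Omega> \<and>
        (\<forall>U\<in>A. \<exists>W. convex_zero_nbhd \<Omega> W \<and> gadd \<Omega> U ` W \<subseteq> A)" and "U \<in> \<Union>\<A>"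
    then obtain A where "A \<in> \<A>" "U \<in> A" by blast
    moreover obtain W where "convex_zero_nbhd \<Omega> W" "gadd \<Omega> U ` W \<subseteq> A"
      using \<A> calculation by blast
    ultimately show "\<exists>W. convex_zero_nbhd \<Omega> W \<and> gadd \<Omega> U ` W \<subseteq> \<Union>\<A>" by blast
  qed blast+
  then show ?thesis
    by (simp add: colombeau_c_topology_def)
qed

type_synonym 'n functional = "'n net set \<Rightarrow> complex gnum"

definition dual :: "(real^'n::finite) set \<Rightarrow> 'n functional set" where
  "dual \<Omega> = {T.
     (\<forall>U\<in>colombeau_c \<Omega>. \<forall>V\<in>colombeau_c \<Omega>. T (gadd \<Omega> U V) = T U + T V) \<and>
     (\<forall>r. \<forall>U\<in>colombeau_c \<Omega>. T (gscale \<Omega> r U) = r * T U) \<and>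
     continuous_map (colombeau_c_topology \<Omega>) euclidean T}"

definition basic_functionals :: "(real^'n::finite) set \<Rightarrow> 'n functional set" where
  "basic_functionals \<Omega> = {T \<in> dual \<Omega>. \<exists>S :: real \<Rightarrow> (real^'n \<Rightarrow> complex) \<Rightarrow> complex.
     (\<forall>\<epsilon>\<in>{0<..1}. S \<epsilon> \<in> distributions \<Omega>) \<and>
     (\<forall>K. compact K \<and> K \<subseteq> \<Omega> \<longrightarrow> (\<exists>(j::nat) (N::nat). \<exists>c>0. \<exists>\<eta>\<in>{0<..1}.
        \<forall>f\<in>test_functions_in K. \<forall>\<epsilon>\<in>{0<..\<eta>}.
          norm (S \<epsilon> f) \<le> c * \<epsilon> powr (- real N) * C_norm K j f)) \<and>
     (\<forall>u\<in>c_nets \<Omega>. T (colombeau_class \<Omega> u) = abs_gnum (\<lambda>\<epsilon>. S \<epsilon> (u \<epsilon>)))}"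

definition restrict_functional ::
  "(real^'n::finite) set \<Rightarrow> (real^'n) set \<Rightarrow> 'n functional \<Rightarrow> 'n functional" where
  "restrict_functional \<Omega> V T = (\<lambda>U. T (gextend V \<Omega> U))"

text \<open>The functional \<open>T\<close> on \<open>\<G>\<^sub>c(V)\<close> is \<open>v \<mapsto> \<integral>\<^sub>V u v dx\<close>, where \<open>u\<close> has the class \<open>U\<close>.\<close>

definition given_by :: "(real^'n::finite) set \<Rightarrow> 'n net set \<Rightarrow> 'n functional \<Rightarrow> bool" where
  "given_by V U T \<longleftrightarrow> (\<forall>u\<in>U. \<forall>v\<in>c_nets V.
     T (colombeau_class V v) = abs_gnum (\<lambda>\<epsilon>. LINT x:V|lborel. u \<epsilon> x * v \<epsilon> x))"

definition sing_supp_G :: "(real^'n::finite) set \<Rightarrow> 'n functional \<Rightarrow> (real^'n) set" where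
  "sing_supp_G \<Omega> T = \<Omega> - {x. \<exists>V. open V \<and> x \<in> V \<and> V \<subseteq> \<Omega> \<and>
     (\<exists>U\<in>colombeau V. given_by V U (restrict_functional \<Omega> V T))}"

definition sing_supp_Ginf :: "(real^'n::finite) set \<Rightarrow> 'n functional \<Rightarrow> (real^'n) set" where
  "sing_supp_Ginf \<Omega> T = \<Omega> - {x. \<exists>V. open V \<and> x \<in> V \<and> V \<subseteq> \<Omega> \<and>
     (\<exists>U\<in>colombeau_infty V. given_by V U (restrict_functional \<Omega> V T))}"


section \<open>Differential operators with constant coefficients\<close>

text \<open>
  The operator \<open>P(D) = \<Sum>\<^bsub>|\<alpha>| \<le> m\<^esub> c\<^sub>\<alpha> D\<^sup>\<alpha>\<close> is given by \<open>m\<close> and the family \<open>c\<close>, whose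
  values at \<open>|\<alpha>| > m\<close> are irrelevant.
\<close>

type_synonym 'n coeffs = "('n \<Rightarrow> nat) \<Rightarrow> complex gnum"

definition Dop :: "('n \<Rightarrow> nat) \<Rightarrow> (real^'n::finite \<Rightarrow> complex) \<Rightarrow> real^'n \<Rightarrow> complex" where
  "Dop \<alpha> f = (\<lambda>x. (- \<i>) ^ mi_order \<alpha> * pderivs \<alpha> f x)"

definition transpose_coeffs :: "'n::finite coeffs \<Rightarrow> 'n coeffs" where
  "transpose_coeffs c = (\<lambda>\<alpha>. (- 1) ^ mi_order \<alpha> * c \<alpha>)"

definition apply_op ::
  "(real^'n::finite) set \<Rightarrow> nat \<Rightarrow> 'n coeffs \<Rightarrow> 'n net set \<Rightarrow> 'n net set" where
  "apply_op \<Omega> m c U = (\<Union>u\<in>U. colombeau_class \<Omega>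
     (\<lambda>\<epsilon> x. \<Sum>\<alpha> | mi_order \<alpha> \<le> m. rep_gnum (c \<alpha>) \<epsilon> * Dop \<alpha> (u \<epsilon>) x))"

definition apply_op_functional ::
  "(real^'n::finite) set \<Rightarrow> nat \<Rightarrow> 'n coeffs \<Rightarrow> 'n functional \<Rightarrow> 'n functional" where
  "apply_op_functional \<Omega> m c T = (\<lambda>U. T (apply_op \<Omega> m (transpose_coeffs c) U))"

definition principal_symbol ::
  "nat \<Rightarrow> (('n::finite \<Rightarrow> nat) \<Rightarrow> complex) \<Rightarrow> real^'n \<Rightarrow> complex" where
  "principal_symbol m a \<xi> =
     (\<Sum>\<alpha> | mi_order \<alpha> = m. a \<alpha> * of_real (\<Prod>i\<in>UNIV. (\<xi> $ i) ^ \<alpha> i))"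

definition ellipticity_number :: "nat \<Rightarrow> 'n::finite coeffs \<Rightarrow> real gnum" where
  "ellipticity_number m c = abs_gnum
     (\<lambda>\<epsilon>. INF \<xi>\<in>{\<xi>::real^'n. norm \<xi> = 1}. norm (principal_symbol m (\<lambda>\<alpha>. rep_gnum (c \<alpha>) \<epsilon>) \<xi>))"

definition G_elliptic :: "nat \<Rightarrow> 'n::finite coeffs \<Rightarrow> bool" where
  "G_elliptic m c \<longleftrightarrow> ellipticity_number m c dvd 1"

definition Ginf_elliptic :: "nat \<Rightarrow> 'n::finite coeffs \<Rightarrow> bool" where
  "Ginf_elliptic m c \<longleftrightarrow> slow_scale_invertible (ellipticity_number m c)"

definition G_hypoelliptic :: "nat \<Rightarrow> 'n::finite coeffs \<Rightarrow> bool" where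
  "G_hypoelliptic m c \<longleftrightarrow> (\<forall>\<Omega> :: (real^'n) set. open \<Omega> \<longrightarrow> (\<forall>T\<in>basic_functionals \<Omega>.
     sing_supp_G \<Omega> (apply_op_functional \<Omega> m c T) = sing_supp_G \<Omega> T))"

definition Ginf_hypoelliptic :: "nat \<Rightarrow> 'n::finite coeffs \<Rightarrow> bool" where
  "Ginf_hypoelliptic m c \<longleftrightarrow> (\<forall>\<Omega> :: (real^'n) set. open \<Omega> \<longrightarrow> (\<forall>T\<in>basic_functionals \<Omega>.
     sing_supp_Ginf \<Omega> (apply_op_functional \<Omega> m c T) = sing_supp_Ginf \<Omega> T))"

end

theory Submission
  imports Defs "HOL-Computational_Algebra.Polynomial"
begin

text \<open>
  Near a point \<open>x\<^sub>0\<close> the problem is transferred to a torus, on which the transposed operator acts on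
  Fourier coefficients as multiplication by its symbol \<open>p(k)\<close>.  Ellipticity makes \<open>1/p\<close> a symbol
  of negative order outside a finite set of frequencies, so its Fourier series, divided by enough
  powers of \<open>1 + |k|\<^sup>2\<close> to converge absolutely, is smooth away from the lattice.  Cutting it off near
  the diagonal changes the multiplier only by a rapidly decreasing sequence and gives a multiplier
  \<open>\<gamma>\<close> that preserves locality, with \<open>p \<gamma> + \<rho> = 1\<close> and \<open>\<rho>\<close> rapidly decreasing.  Hence every test
  function \<open>v\<close> supported near \<open>x\<^sub>0\<close> is the transposed operator applied to a test function \<open>z\<close> with
  support near \<open>x\<^sub>0\<close>, plus a remainder obtained by the smoothing multiplier \<open>\<rho>\<close>.  Applying \<open>T\<close> and
  using \<open>P(D) T = u\<close> exhibits \<open>T(v)\<close> as the integral of \<open>v\<close> against a function \<open>w\<close> whose Fourier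
  coefficients are \<open>\<gamma>\<close> times those of a cutoff of \<open>u\<close> plus \<open>\<rho>\<close> times the polynomially bounded
  values of \<open>T\<close> at localized exponentials.

  All constants are bounded by powers of one number \<open>A\<^sub>\<epsilon>\<close> that dominates the coefficients and the
  inverse of the ellipticity number.  If \<open>A\<^sub>\<epsilon>\<close> is moderate, so is \<open>w\<close>.  If \<open>A\<^sub>\<epsilon>\<close> is of slow scale,
  every power of it is \<open>O(\<epsilon>\<^sup>-\<^sup>1)\<close>, so the order of growth of the derivatives of \<open>w\<close> is uniform as
  soon as it is so for \<open>u\<close>.
\<close>

section \<open>Calculus of smooth functions\<close>

text \<open>The obstacle is uniformity in \<epsilon>: every constant in the construction of a
  parametrix, even the set of frequencies at which the symbol may vanish, depends on the
  coefficients. Hence all estimates are made for a whole family at once, and the excluded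
  frequencies lie in a ball whose radius is itself tame.

  For the second claim the exponent of A may grow with the number of derivatives, which is harmless
  for slow scale nets. The functional contributes one fixed power of 1/\<epsilon> and one fixed
  power of the frequency, both determined by the compact set that carries the cutoff; the power of
  the frequency is absorbed by \<rho>.

  Radii about x0: test functions live within \<delta>, and the kernel is cut down to radius
  \<delta>, so the uncut solution vanishes between 2 \<delta> and 4 \<delta>. The cutoff \<kappa> is
  1 up to 3 \<delta> and 0 from 4 \<delta> on, so it varies only there. Differences of the points
  involved stay below 5 \<delta>, up to which the outer cutoff of the kernel is 1; it ends at 6
  \<delta>. Since \<delta> \<le> 1/2 gives 6 \<delta> < pi, everything takes place inside one
  period.\<close>

lemma pd_cong_open:
  assumes "open \<Omega>" "x \<in> \<Omega>" "\<And>y. y \<in> \<Omega> \<Longrightarrow> f y = g y"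
  shows "pd i f x = pd i g x"
proof -
  have "(f has_derivative D) (at x) \<longleftrightarrow> (g has_derivative D) (at x)" for D
    using has_derivative_transform_within_open[of _ D x UNIV \<Omega>] assms by metis
  then show ?thesis by (simp add: pd_def frechet_derivative_def)
qed

lemma fold_pd_cong_open:
  assumes "open \<Omega>" "\<And>y. y \<in> \<Omega> \<Longrightarrow> f y = g y" "x \<in> \<Omega>"
  shows "fold pd is f x = fold pd is g x"
  using assms
proof (induction "is" arbitrary: f g)
  case (Cons i js)
  show ?case
    using Cons.prems by (auto intro!: Cons.IH intro: pd_cong_open)
qed auto

lemma pd_eqI: "(f has_derivative D) (at x) \<Longrightarrow> pd i f x = D (axis i 1)"
  by (metis pd_def frechet_derivative_at)

lemma has_derivative_pd:
  fixes f :: "real^'n::finite \<Rightarrow> complex"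
  assumes "f differentiable at x"
  shows "(f has_derivative (\<lambda>h. \<Sum>i\<in>UNIV. (h $ i) *\<^sub>R pd i f x)) (at x)"
proof -
  let ?D = "frechet_derivative f (at x)"
  have D: "(f has_derivative ?D) (at x)"
    using assms by (simp add: frechet_derivative_works)
  then have lin: "linear ?D" by (rule has_derivative_linear)
  have "?D h = (\<Sum>i\<in>UNIV. (h $ i) *\<^sub>R pd i f x)" for h
  proof -
    have "?D h = ?D (\<Sum>i\<in>UNIV. (h $ i) *\<^sub>R axis i 1)"
      by (metis basis_expansion scalar_mult_eq_scaleR)
    also have "\<dots> = (\<Sum>i\<in>UNIV. (h $ i) *\<^sub>R ?D (axis i 1))"
      by (simp add: linear_sum[OF lin] linear_scale[OF lin])
    finally show ?thesis by (simp add: pd_def)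
  qed
  then have "?D = (\<lambda>h. \<Sum>i\<in>UNIV. (h $ i) *\<^sub>R pd i f x)" by auto
  with D show ?thesis by simp
qed

lemma pd_add:
  assumes "f differentiable at x" "g differentiable at x"
  shows "pd i (\<lambda>x. f x + g x) x = pd i f x + pd i g x"
  using pd_eqI[OF has_derivative_add[OF assms[THEN frechet_derivative_works[THEN iffD1]]]]
  by (simp add: pd_def)

lemma pd_mult:
  assumes "f differentiable at x" "g differentiable at x"
  shows "pd i (\<lambda>x. f x * g x) x = pd i f x * g x + f x * pd i g x"
  using pd_eqI[OF has_derivative_mult[OF assms[THEN frechet_derivative_works[THEN iffD1]]]]
  by (simp add: pd_def)

lemma pd_const [simp]: "pd i (\<lambda>_. c) = (\<lambda>_. 0)"
  using pd_eqI[OF has_derivative_const] by auto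

lemma pd_cmult:
  assumes "f differentiable at x"
  shows "pd i (\<lambda>x. c * f x) x = c * pd i f x"
  using pd_mult[OF _ assms, of "\<lambda>_. c"] by simp

lemma pd_inverse:
  assumes "f differentiable at x" "f x \<noteq> 0"
  shows "pd i (\<lambda>x. inverse (f x)) x = - (pd i f x * inverse (f x) * inverse (f x))"
  using pd_eqI[OF Deriv.has_derivative_inverse[OF assms(2) frechet_derivative_works[THEN iffD1, OF assms(1)]]]
  by (simp add: pd_def mult_ac)

text \<open>Smoothness of finite order supplies the induction that \<open>smooth_on\<close>, a
  statement about all lists of derivatives at once, does not offer for products and inverses;
  \<open>smooth_on_iff_Ck\<close> carries the closure rules over.\<close>

primrec Ck :: "nat \<Rightarrow> (real^'n::finite) set \<Rightarrow> (real^'n \<Rightarrow> complex) \<Rightarrow> bool" where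
  "Ck 0 \<Omega> f \<longleftrightarrow> True"
| "Ck (Suc k) \<Omega> f \<longleftrightarrow> f differentiable_on \<Omega> \<and> (\<forall>i. Ck k \<Omega> (pd i f))"

lemma smooth_on_differentiable: "smooth_on \<Omega> f \<Longrightarrow> f differentiable_on \<Omega>"
  unfolding smooth_on_def by (drule spec[of _ "[]"]) simp

lemma smooth_on_pd: "smooth_on \<Omega> f \<Longrightarrow> smooth_on \<Omega> (pd i f)"
  unfolding smooth_on_def
proof (intro allI)
  fix js assume "\<forall>is. fold pd is f differentiable_on \<Omega>"
  then have "fold pd (i # js) f differentiable_on \<Omega>" ..
  then show "fold pd js (pd i f) differentiable_on \<Omega>" by simp
qed

lemma smooth_on_stepI:
  assumes "f differentiable_on \<Omega>" "\<And>i. smooth_on \<Omega> (pd i f)"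
  shows "smooth_on \<Omega> f"
  unfolding smooth_on_def
proof
  fix js show "fold pd js f differentiable_on \<Omega>"
    using assms by (cases js) (auto simp: smooth_on_def)
qed

lemma smooth_on_imp_Ck: "smooth_on \<Omega> f \<Longrightarrow> Ck k \<Omega> f"
proof (induction k arbitrary: f)
  case (Suc k)
  show ?case
    by (simp add: Suc.IH smooth_on_pd[OF Suc.prems] smooth_on_differentiable[OF Suc.prems])
qed simp

lemma Ck_fold_pd: "Ck (Suc (length is)) \<Omega> f \<Longrightarrow> fold pd is f differentiable_on \<Omega>"
  by (induction "is" arbitrary: f) auto

lemma smooth_on_iff_Ck: "smooth_on \<Omega> f \<longleftrightarrow> (\<forall>k. Ck k \<Omega> f)"
  using smooth_on_imp_Ck Ck_fold_pd unfolding smooth_on_def by blast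

lemma Ck_Suc_imp: "Ck (Suc k) \<Omega> f \<Longrightarrow> Ck k \<Omega> f"
  by (induction k arbitrary: f) auto

lemma Ck_diff:
  assumes "open \<Omega>" "Ck (Suc k) \<Omega> f" "x \<in> \<Omega>" shows "f differentiable at x"
  using assms at_within_open[of x \<Omega>] by (auto simp: differentiable_on_def)

lemma differentiable_on_cong_open:
  fixes f g :: "real^'n::finite \<Rightarrow> complex"
  assumes "\<And>x. x \<in> \<Omega> \<Longrightarrow> f x = g x" "f differentiable_on \<Omega>"
  shows "g differentiable_on \<Omega>"
  unfolding differentiable_on_def differentiable_def
proof
  fix x assume x: "x \<in> \<Omega>"
  then obtain D where "(f has_derivative D) (at x within \<Omega>)"
    using assms(2) by (auto simp: differentiable_on_def differentiable_def)
  then have "(g has_derivative D) (at x within \<Omega>)"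
    by (rule has_derivative_transform[OF x, rotated]) (simp add: assms(1))
  then show "\<exists>D. (g has_derivative D) (at x within \<Omega>)" by (intro exI[of _ D])
qed

lemma Ck_cong:
  assumes "open \<Omega>" "\<And>x. x \<in> \<Omega> \<Longrightarrow> f x = g x" "Ck k \<Omega> f"
  shows "Ck k \<Omega> g"
  using assms(2,3)
proof (induction k arbitrary: f g)
  case (Suc k)
  show ?case
    using Suc.prems differentiable_on_cong_open[of \<Omega> f g] Suc.IH[of "pd _ f" "pd _ g"]
      pd_cong_open[OF assms(1)] by (metis Ck.simps(2))
qed auto

lemma Ck_const: "Ck k \<Omega> (\<lambda>_. c)"
  by (induction k arbitrary: c) auto

lemma Ck_add:
  assumes "open \<Omega>" "Ck k \<Omega> f" "Ck k \<Omega> g"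
  shows "Ck k \<Omega> (\<lambda>x. f x + g x)"
  using assms(2,3)
proof (induction k arbitrary: f g)
  case (Suc k)
  have "Ck k \<Omega> (pd i (\<lambda>x. f x + g x))" for i
    by (rule Ck_cong[OF assms(1) _ Suc.IH[of "pd i f" "pd i g"]])
       (use Suc.prems assms(1) in \<open>auto simp: pd_add Ck_diff\<close>)
  then show ?case using Suc.prems by (auto intro: differentiable_on_add)
qed auto

lemma Ck_mult:
  assumes "open \<Omega>" "Ck k \<Omega> f" "Ck k \<Omega> g"
  shows "Ck k \<Omega> (\<lambda>x. f x * g x)"
  using assms(2,3)
proof (induction k arbitrary: f g)
  case (Suc k)
  have "Ck k \<Omega> (pd i (\<lambda>x. f x * g x))" for i
    by (rule Ck_cong[OF assms(1) _ Ck_add[OF assms(1) Suc.IH[of "pd i f" g] Suc.IH[of f "pd i g"]]])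
       (use Suc.prems assms(1) Ck_Suc_imp in \<open>auto simp: pd_mult Ck_diff\<close>)
  then show ?case using Suc.prems by (auto intro: differentiable_on_mult)
qed auto

text \<open>The derivative of 1/f is - f' (1/f)^2, which involves 1/f only with one order less; so
  the induction hypothesis for the same f suffices.\<close>

lemma Ck_inverse:
  assumes "open \<Omega>" "Ck k \<Omega> f" "\<And>x. x \<in> \<Omega> \<Longrightarrow> f x \<noteq> 0"
  shows "Ck k \<Omega> (\<lambda>x. inverse (f x))"
  using assms(2)
proof (induction k)
  case (Suc k)
  have "Ck k \<Omega> (pd i (\<lambda>x. inverse (f x)))" for i
  proof (rule Ck_cong[OF assms(1)])
    show "Ck k \<Omega> (\<lambda>x. (- 1) * (pd i f x * inverse (f x) * inverse (f x)))"
      using Suc Ck_Suc_imp assms(1) by (intro Ck_mult Ck_const) auto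
  qed (use Suc.prems assms(1,3) in \<open>auto simp: pd_inverse Ck_diff\<close>)
  then show ?case
    using Suc.prems assms(1,3) by (auto simp: differentiable_on_def intro!: differentiable_inverse)
qed auto

lemma smooth_on_diff: "open \<Omega> \<Longrightarrow> smooth_on \<Omega> f \<Longrightarrow> x \<in> \<Omega> \<Longrightarrow> f differentiable at x"
  by (metis smooth_on_imp_Ck Ck_diff)

lemma smooth_on_fold_pd: "smooth_on \<Omega> f \<Longrightarrow> smooth_on \<Omega> (fold pd is f)"
  by (induction "is" arbitrary: f) (auto simp: smooth_on_pd)

lemma smooth_on_cong:
  assumes "open \<Omega>" "\<And>x. x \<in> \<Omega> \<Longrightarrow> f x = g x" "smooth_on \<Omega> f" shows "smooth_on \<Omega> g"
  using assms(3) Ck_cong[OF assms(1,2)] by (simp add: smooth_on_iff_Ck)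

lemma smooth_on_const: "smooth_on \<Omega> (\<lambda>_. c)"
  by (simp add: smooth_on_iff_Ck Ck_const)

lemma smooth_on_add:
  "open \<Omega> \<Longrightarrow> smooth_on \<Omega> f \<Longrightarrow> smooth_on \<Omega> g \<Longrightarrow> smooth_on \<Omega> (\<lambda>x. f x + g x)"
  by (simp add: smooth_on_iff_Ck Ck_add)

lemma smooth_on_mult:
  "open \<Omega> \<Longrightarrow> smooth_on \<Omega> f \<Longrightarrow> smooth_on \<Omega> g \<Longrightarrow> smooth_on \<Omega> (\<lambda>x. f x * g x)"
  by (simp add: smooth_on_iff_Ck Ck_mult)

lemma smooth_on_cmult: "open \<Omega> \<Longrightarrow> smooth_on \<Omega> f \<Longrightarrow> smooth_on \<Omega> (\<lambda>x. c * f x)"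
  by (simp add: smooth_on_mult smooth_on_const)

lemma smooth_on_uminus: "open \<Omega> \<Longrightarrow> smooth_on \<Omega> f \<Longrightarrow> smooth_on \<Omega> (\<lambda>x. - f x)"
  using smooth_on_cmult[of \<Omega> f "-1"] by simp

lemma smooth_on_minus:
  "open \<Omega> \<Longrightarrow> smooth_on \<Omega> f \<Longrightarrow> smooth_on \<Omega> g \<Longrightarrow> smooth_on \<Omega> (\<lambda>x. f x - g x)"
  using smooth_on_add[of \<Omega> f "\<lambda>x. - g x"] by (simp add: smooth_on_uminus)

lemma smooth_on_inverse:
  "open \<Omega> \<Longrightarrow> smooth_on \<Omega> f \<Longrightarrow> (\<And>x. x \<in> \<Omega> \<Longrightarrow> f x \<noteq> 0) \<Longrightarrow> smooth_on \<Omega> (\<lambda>x. inverse (f x))"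
  by (simp add: smooth_on_iff_Ck Ck_inverse)

lemma smooth_on_sum:
  assumes "open \<Omega>" "\<And>a. a \<in> A \<Longrightarrow> smooth_on \<Omega> (f a)"
  shows "smooth_on \<Omega> (\<lambda>x. \<Sum>a\<in>A. f a x)"
  using assms(2)
  by (induction A rule: infinite_finite_induct) (auto simp: smooth_on_const intro!: smooth_on_add assms(1))

lemma smooth_on_power: "open \<Omega> \<Longrightarrow> smooth_on \<Omega> f \<Longrightarrow> smooth_on \<Omega> (\<lambda>x. f x ^ k)"
  by (induction k) (auto simp: smooth_on_const intro!: smooth_on_mult)

lemma smooth_on_subset: "smooth_on \<Omega> f \<Longrightarrow> \<Omega>' \<subseteq> \<Omega> \<Longrightarrow> smooth_on \<Omega>' f"
  by (meson smooth_on_def differentiable_on_subset)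

text \<open>For functions that are given by different formulas on overlapping open sets, such as
  quotients near zeros of the denominator.\<close>

lemma smooth_on_local:
  assumes "\<And>x. x \<in> \<Omega> \<Longrightarrow> \<exists>U. open U \<and> x \<in> U \<and> smooth_on U f"
  shows "smooth_on \<Omega> f"
  unfolding smooth_on_def differentiable_on_def
proof safe
  fix js x assume "x \<in> \<Omega>"
  then obtain U where U: "open U" "x \<in> U" "smooth_on U f" using assms by blast
  then have "fold pd js f differentiable at x"
    using smooth_on_diff smooth_on_fold_pd by blast
  then show "fold pd js f differentiable at x within \<Omega>"
    by (rule differentiable_at_withinI)
qed

lemma smooth_on_imp_continuous: "smooth_on \<Omega> f \<Longrightarrow> continuous_on \<Omega> f"
  by (intro differentiable_imp_continuous_on smooth_on_differentiable)

lemma smooth_coord: "smooth_on UNIV (\<lambda>x::real^'n::finite. of_real (x $ j))"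
proof -
  have d: "((\<lambda>x::real^'n. complex_of_real (x $ j)) has_derivative (\<lambda>h. of_real (h $ j))) (at x)" for x
    using bounded_linear.has_derivative[OF bounded_linear_of_real
        bounded_linear_imp_has_derivative[OF bounded_linear_vec_nth]] .
  have "pd i (\<lambda>x::real^'n. complex_of_real (x $ j)) = (\<lambda>_. of_real (axis i 1 $ j))" for i
    using pd_eqI[OF d] by auto
  moreover have "(\<lambda>x::real^'n. complex_of_real (x $ j)) differentiable_on UNIV"
    using d by (auto simp: differentiable_on_def differentiable_def)
  ultimately show ?thesis
    using smooth_on_stepI[of "\<lambda>x::real^'n. complex_of_real (x $ j)" UNIV] by (simp add: smooth_on_const)
qed

lemma pd_compose_real:
  assumes "(\<lambda>x. complex_of_real (\<rho> x)) differentiable at x" "(h has_real_derivative h') (at (\<rho> x))"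
  shows "(\<lambda>x. complex_of_real (h (\<rho> x))) differentiable at x"
    and "pd i (\<lambda>x. complex_of_real (h (\<rho> x))) x = of_real h' * pd i (\<lambda>x. complex_of_real (\<rho> x)) x"
proof -
  obtain D where D: "((\<lambda>x. complex_of_real (\<rho> x)) has_derivative D) (at x)"
    using assms(1) by (auto simp: differentiable_def)
  have r: "(\<rho> has_derivative (\<lambda>h. Re (D h))) (at x)"
    using bounded_linear.has_derivative[OF bounded_linear_Re D] by simp
  have e: "of_real (Re (D h)) = D h" for h
    using has_derivative_unique[OF D bounded_linear.has_derivative[OF bounded_linear_of_real r]]
    by metis
  have h: "(h has_derivative (*) h') (at (\<rho> x))"
    using assms(2) by (simp add: has_field_derivative_def)
  have "((\<lambda>x. complex_of_real (h (\<rho> x))) has_derivative (\<lambda>d. of_real (h' * Re (D d)))) (at x)"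
    using bounded_linear.has_derivative[OF bounded_linear_of_real has_derivative_compose[OF r h]] .
  then have *: "((\<lambda>x. complex_of_real (h (\<rho> x))) has_derivative (\<lambda>d. of_real h' * D d)) (at x)"
    by (simp add: e)
  from pd_eqI[OF *] pd_eqI[OF D]
  show "pd i (\<lambda>x. complex_of_real (h (\<rho> x))) x = of_real h' * pd i (\<lambda>x. complex_of_real (\<rho> x)) x"
    by simp
  show "(\<lambda>x. complex_of_real (h (\<rho> x))) differentiable at x"
    using * by (auto simp: differentiable_def)
qed

text \<open>The outer function comes with the whole tower \<open>H\<close> of its derivatives, so
  that the induction on the order merely moves from \<open>j\<close> to \<open>Suc j\<close> and no
  separate notion of smoothness on the line is required.\<close>

lemma smooth_compose_real:
  assumes H: "\<And>j t. (H j has_real_derivative H (Suc j) t) (at t)"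
    and \<rho>: "smooth_on UNIV (\<lambda>x. complex_of_real (\<rho> x))"
  shows "smooth_on UNIV (\<lambda>x. complex_of_real (H j (\<rho> x)))"
proof -
  have d: "(\<lambda>x. complex_of_real (\<rho> x)) differentiable at x" for x
    using smooth_on_diff[OF open_UNIV \<rho>] by simp
  have "Ck k UNIV (\<lambda>x. complex_of_real (H j (\<rho> x)))" for k
  proof (induction k arbitrary: j)
    case (Suc k)
    have "pd i (\<lambda>x. complex_of_real (H j (\<rho> x))) =
        (\<lambda>x. of_real (H (Suc j) (\<rho> x)) * pd i (\<lambda>x. complex_of_real (\<rho> x)) x)" for i
      using pd_compose_real(2)[OF d H] by auto
    moreover have "Ck k UNIV (pd i (\<lambda>x. complex_of_real (\<rho> x)))" for i
      by (intro smooth_on_imp_Ck smooth_on_pd \<rho>)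
    ultimately show ?case
      using pd_compose_real(1)[OF d H] Ck_mult[OF open_UNIV Suc]
      by (auto simp: differentiable_on_def)
  qed simp
  then show ?thesis by (simp add: smooth_on_iff_Ck)
qed

lemma fold_pd_add:
  assumes "open \<Omega>" "smooth_on \<Omega> f" "smooth_on \<Omega> g" "x \<in> \<Omega>"
  shows "fold pd is (\<lambda>x. f x + g x) x = fold pd is f x + fold pd is g x"
  using assms(2,3)
proof (induction "is" arbitrary: f g)
  case (Cons i js)
  have "fold pd js (pd i (\<lambda>x. f x + g x)) x = fold pd js (\<lambda>x. pd i f x + pd i g x) x"
    by (rule fold_pd_cong_open[OF assms(1) _ assms(4)])
       (use Cons.prems assms(1) in \<open>simp add: pd_add smooth_on_diff\<close>)
  with Cons show ?case by (simp add: smooth_on_pd)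
qed simp

lemma fold_pd_cmult:
  assumes "open \<Omega>" "smooth_on \<Omega> f" "x \<in> \<Omega>"
  shows "fold pd is (\<lambda>x. c * f x) x = c * fold pd is f x"
  using assms(2)
proof (induction "is" arbitrary: f)
  case (Cons i js)
  have "fold pd js (pd i (\<lambda>x. c * f x)) x = fold pd js (\<lambda>x. c * pd i f x) x"
    by (rule fold_pd_cong_open[OF assms(1) _ assms(3)])
       (use Cons.prems assms(1) in \<open>simp add: pd_cmult smooth_on_diff\<close>)
  with Cons show ?case by (simp add: smooth_on_pd)
qed simp

lemma fold_pd_zero: "fold pd is (\<lambda>_. 0) = (\<lambda>_. 0)"
  by (induction "is") auto

lemma fold_pd_sum:
  assumes "open \<Omega>" "\<And>a. a \<in> A \<Longrightarrow> smooth_on \<Omega> (f a)" "x \<in> \<Omega>"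
  shows "fold pd is (\<lambda>x. \<Sum>a\<in>A. f a x) x = (\<Sum>a\<in>A. fold pd is (f a) x)"
  using assms(2)
  by (induction A rule: infinite_finite_induct)
     (auto simp: fold_pd_zero smooth_on_sum fold_pd_add[OF assms(1) _ _ assms(3)] assms(1))

lemma fold_pd_vanish:
  assumes "closed K" "\<And>x. x \<notin> K \<Longrightarrow> f x = 0" "x \<notin> K"
  shows "fold pd is f x = 0"
  using fold_pd_cong_open[of "- K" f "\<lambda>_. 0" x "is"] assms by (simp add: fold_pd_zero open_Compl)

subsection \<open>Symmetry of higher derivatives\<close>

text \<open>The second difference is invariant under exchange of i and j, which is what makes the
  derivatives commute. It is the increment along axis i of s |-> f (x + t b + s a) - f (x + s a), so
  the mean value inequality reduces it to two values of \<open>pd i f\<close>, and differentiability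
  of \<open>pd i f\<close> at the one point x finishes.\<close>

lemma mixed_difference_limit:
  fixes f :: "real^'n::finite \<Rightarrow> complex"
  assumes "open \<Omega>" "x \<in> \<Omega>" "f differentiable_on \<Omega>" "pd i f differentiable at x"
  shows "((\<lambda>t. (f (x + t *\<^sub>R axis i 1 + t *\<^sub>R axis j 1) - f (x + t *\<^sub>R axis i 1)
      - f (x + t *\<^sub>R axis j 1) + f x) /\<^sub>R t\<^sup>2) \<longlongrightarrow> pd j (pd i f) x) (at_right 0)"
proof (rule tendstoI)
  fix e :: real assume e: "e > 0"
  define a b where "a = (axis i 1 :: real^'n)" and "b = (axis j 1 :: real^'n)"
  have nab: "norm a = 1" "norm b = 1" by (simp_all add: a_def b_def)
  let ?D = "frechet_derivative (pd i f) (at x)"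
  have D: "(pd i f has_derivative ?D) (at x)"
    using assms(4) by (simp add: frechet_derivative_works)
  then have lin: "linear ?D" by (rule has_derivative_linear)
  have Db: "?D b = pd j (pd i f) x" by (simp add: pd_def b_def)
  \<comment> \<open>The errors at two points, at distance at most 2 t and t from x, will add up to
    (e/6) (3 t) = (e/2) t.\<close>
  obtain d where d: "d > 0" "\<And>y. norm (y - x) < d \<Longrightarrow>
      norm (pd i f y - pd i f x - ?D (y - x)) \<le> e/6 * norm (y - x)"
    using D[unfolded has_derivative_at_alt, THEN conjunct2, rule_format, of "e/6"] e by auto
  obtain r where r: "r > 0" "ball x r \<subseteq> \<Omega>"
    using assms(1,2) by (meson open_contains_ball)
  define \<delta> where "\<delta> = min d r / 2"
  have \<delta>: "\<delta> > 0" using d r by (simp add: \<delta>_def)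
  have ev: "eventually (\<lambda>t. t \<in> {0<..<\<delta>}) (at_right (0::real))"
    by (rule eventually_at_right_real[OF \<delta>])
  have df: "(f has_derivative (\<lambda>h. \<Sum>i\<in>UNIV. (h $ i) *\<^sub>R pd i f y)) (at y)" if "norm (y - x) < r" for y
  proof -
    have "y \<in> \<Omega>" using that r by (auto simp: dist_norm norm_minus_commute subset_iff)
    then show ?thesis
      using assms(1,3) at_within_open[of y \<Omega>] by (intro has_derivative_pd) (auto simp: differentiable_on_def)
  qed
  have comp: "((\<lambda>s. f (z + s *\<^sub>R a)) has_vector_derivative pd i f (z + s *\<^sub>R a)) (at s)"
    if "norm (z + s *\<^sub>R a - x) < r" for z s
  proof -
    have "((\<lambda>s. z + s *\<^sub>R a) has_derivative (\<lambda>t. t *\<^sub>R a)) (at s)"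
      by (auto intro!: derivative_eq_intros)
    from has_derivative_compose[OF this df[OF that]]
    have "((\<lambda>s. f (z + s *\<^sub>R a)) has_derivative
        (\<lambda>t. \<Sum>k\<in>UNIV. ((t *\<^sub>R a) $ k) *\<^sub>R pd k f (z + s *\<^sub>R a))) (at s)" .
    moreover have "(\<Sum>k\<in>UNIV. ((t *\<^sub>R a) $ k) *\<^sub>R pd k f (z + s *\<^sub>R a)) = t *\<^sub>R pd i f (z + s *\<^sub>R a)" for t
      by (subst sum.remove[of _ i]) (auto simp: a_def axis_def intro!: sum.neutral)
    ultimately show ?thesis by (simp add: has_vector_derivative_def)
  qed
  show "\<forall>\<^sub>F t in at_right 0. dist ((f (x + t *\<^sub>R axis i 1 + t *\<^sub>R axis j 1) - f (x + t *\<^sub>R axis i 1)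
      - f (x + t *\<^sub>R axis j 1) + f x) /\<^sub>R t\<^sup>2) (pd j (pd i f) x) < e"
    using ev
  proof eventually_elim
    fix t :: real assume t: "t \<in> {0<..<\<delta>}"
    \<comment> \<open>With the expected value subtracted, the derivative in s is a pure remainder of
      size (e/2) t, and \<open>\<phi> t - \<phi> 0\<close> is t^2 times the error to be
      estimated.\<close>
    define \<phi> where "\<phi> s = f (x + t *\<^sub>R b + s *\<^sub>R a) - f (x + s *\<^sub>R a) - (s * t) *\<^sub>R ?D b" for s
    have nb: "norm (x + t *\<^sub>R b + s *\<^sub>R a - x) \<le> 2 * t" "norm (x + s *\<^sub>R a - x) \<le> t" if "s \<in> {0..t}" for s
      using that norm_triangle_ineq[of "t *\<^sub>R b" "s *\<^sub>R a"] nab by auto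
    have t2: "2 * t < r" "2 * t < d" using t by (auto simp: \<delta>_def)
    have der: "(\<phi> has_derivative (\<lambda>h. h *\<^sub>R (pd i f (x + t *\<^sub>R b + s *\<^sub>R a) - pd i f (x + s *\<^sub>R a) - t *\<^sub>R ?D b)))
        (at s within {0..t})" if s: "s \<in> {0..t}" for s
    proof -
      have "(\<phi> has_vector_derivative (pd i f (x + t *\<^sub>R b + s *\<^sub>R a) - pd i f (x + s *\<^sub>R a) - t *\<^sub>R ?D b)) (at s)"
        unfolding \<phi>_def
        using nb[OF s] t2 t
        by (auto intro!: derivative_eq_intros comp simp: has_vector_derivative_def[of "\<lambda>s. (s * t) *\<^sub>R _"])
      then show ?thesis
        by (simp add: has_vector_derivative_def has_derivative_at_withinI)
    qed
    have bd: "norm (pd i f (x + t *\<^sub>R b + s *\<^sub>R a) - pd i f (x + s *\<^sub>R a) - t *\<^sub>R ?D b) \<le> e/2 * t"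
      if s: "s \<in> {0..t}" for s
    proof -
      let ?y = "x + t *\<^sub>R b + s *\<^sub>R a" and ?z = "x + s *\<^sub>R a"
      have "norm (pd i f ?y - pd i f x - ?D (?y - x)) \<le> e/6 * (2 * t)"
        using nb[OF s] t2 e by (intro order_trans[OF d(2)] mult_left_mono) auto
      moreover have "norm (pd i f ?z - pd i f x - ?D (?z - x)) \<le> e/6 * t"
        using nb[OF s] t2 t e by (intro order_trans[OF d(2)] mult_left_mono) auto
      moreover have "e/6 * (2 * t) + e/6 * t = e/2 * t" by (simp add: field_simps)
      moreover have "pd i f ?y - pd i f ?z - t *\<^sub>R ?D b =
          (pd i f ?y - pd i f x - ?D (?y - x)) - (pd i f ?z - pd i f x - ?D (?z - x))"
        by (simp add: linear_add[OF lin] linear_scale[OF lin] algebra_simps)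
      ultimately show ?thesis
        using norm_triangle_ineq4[of "pd i f ?y - pd i f x - ?D (?y - x)" "pd i f ?z - pd i f x - ?D (?z - x)"]
        by (smt (verit))
    qed
    have "norm (\<phi> t - \<phi> 0) \<le> (e/2 * t) * norm (t - 0)"
    proof (rule differentiable_bound[OF convex_real_interval(5)[of 0 t] der])
      fix s assume s: "s \<in> {0..t}"
      show "onorm (\<lambda>h. h *\<^sub>R (pd i f (x + t *\<^sub>R b + s *\<^sub>R a) - pd i f (x + s *\<^sub>R a) - t *\<^sub>R ?D b)) \<le> e/2 * t"
      proof (intro onorm_le)
        fix h :: real
        show "norm (h *\<^sub>R (pd i f (x + t *\<^sub>R b + s *\<^sub>R a) - pd i f (x + s *\<^sub>R a) - t *\<^sub>R ?D b)) \<le> e/2 * t * norm h"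
          using mult_right_mono[OF bd[OF s], of "norm h"] by (simp only: norm_scaleR real_norm_def mult.commute abs_ge_zero)
      qed
    qed (use t in auto)
    then have "norm (\<phi> t - \<phi> 0) \<le> e/2 * t\<^sup>2" using t by (simp add: power2_eq_square)
    moreover have "(f (x + t *\<^sub>R a + t *\<^sub>R b) - f (x + t *\<^sub>R a) - f (x + t *\<^sub>R b) + f x) /\<^sub>R t\<^sup>2
        - ?D b = (\<phi> t - \<phi> 0) /\<^sub>R t\<^sup>2"
      using t unfolding \<phi>_def
      by (simp add: algebra_simps power2_eq_square)
    ultimately have "norm ((f (x + t *\<^sub>R a + t *\<^sub>R b) - f (x + t *\<^sub>R a) - f (x + t *\<^sub>R b) + f x) /\<^sub>R t\<^sup>2
        - ?D b) \<le> e/2"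
      using t by (simp add: divide_simps mult.commute)
    then show "dist ((f (x + t *\<^sub>R axis i 1 + t *\<^sub>R axis j 1) - f (x + t *\<^sub>R axis i 1)
      - f (x + t *\<^sub>R axis j 1) + f x) /\<^sub>R t\<^sup>2) (pd j (pd i f) x) < e"
      using e unfolding dist_norm Db[symmetric] a_def b_def by simp
  qed
qed

lemma pd_commute:
  fixes f :: "real^'n::finite \<Rightarrow> complex"
  assumes "open \<Omega>" "smooth_on \<Omega> f" "x \<in> \<Omega>"
  shows "pd j (pd i f) x = pd i (pd j f) x"
proof (rule tendsto_unique)
  have d: "f differentiable_on \<Omega>" "pd i f differentiable at x" "pd j f differentiable at x"
    using assms by (auto intro: smooth_on_differentiable smooth_on_diff smooth_on_pd)
  show "((\<lambda>t. (f (x + t *\<^sub>R axis i 1 + t *\<^sub>R axis j 1) - f (x + t *\<^sub>R axis i 1)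
      - f (x + t *\<^sub>R axis j 1) + f x) /\<^sub>R t\<^sup>2) \<longlongrightarrow> pd j (pd i f) x) (at_right 0)"
    by (rule mixed_difference_limit[OF assms(1,3) d(1,2)])
  show "((\<lambda>t. (f (x + t *\<^sub>R axis i 1 + t *\<^sub>R axis j 1) - f (x + t *\<^sub>R axis i 1)
      - f (x + t *\<^sub>R axis j 1) + f x) /\<^sub>R t\<^sup>2) \<longlongrightarrow> pd i (pd j f) x) (at_right 0)"
    using mixed_difference_limit[OF assms(1,3) d(1,3), of i] by (simp add: algebra_simps)
qed simp

lemma fold_pd_move:
  assumes "open \<Omega>" "smooth_on \<Omega> f" "x \<in> \<Omega>"
  shows "fold pd (js @ [i]) f x = fold pd (i # js) f x"
  using assms(2,3)
proof (induction js arbitrary: f)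
  case (Cons j js)
  have "fold pd ((j # js) @ [i]) f x = fold pd (i # js) (pd j f) x"
    using Cons by (simp add: smooth_on_pd)
  also have "\<dots> = fold pd js (pd j (pd i f)) x"
    using fold_pd_cong_open[OF assms(1), of "pd i (pd j f)" "pd j (pd i f)" x js]
      pd_commute[OF assms(1) Cons.prems(1)] Cons.prems(2) by simp
  finally show ?case by simp
qed simp

lemma fold_pd_mset:
  assumes "open \<Omega>" "mset js = mset is" "smooth_on \<Omega> f" "x \<in> \<Omega>"
  shows "fold pd js f x = fold pd is f x"
  using assms(2,3)
proof (induction js arbitrary: "is" f)
  case (Cons j js)
  obtain u v where uv: "is = u @ j # v"
    by (metis Cons.prems(1) list.set_intros(1) set_mset_mset split_list)
  have "fold pd is f x = fold pd v (fold pd (u @ [j]) f) x" by (simp add: uv)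
  also have "\<dots> = fold pd v (fold pd (j # u) f) x"
    by (rule fold_pd_cong_open[OF assms(1) fold_pd_move[OF assms(1) Cons.prems(2)] assms(4)])
  also have "\<dots> = fold pd (u @ v) (pd j f) x" by simp
  also have "\<dots> = fold pd js (pd j f) x"
    using Cons.prems uv by (intro Cons.IH[symmetric]) (auto simp: smooth_on_pd)
  finally show ?case by simp
qed simp

definition mi_list :: "('n::finite \<Rightarrow> nat) \<Rightarrow> 'n list" where
  "mi_list \<alpha> = concat (map (\<lambda>i. replicate (\<alpha> i) i) coordinates)"

lemma coordinates: "distinct (coordinates :: 'n::finite list)" "set (coordinates :: 'n list) = UNIV"
proof -
  have "\<exists>is::'n list. distinct is \<and> set is = UNIV"
    using finite_distinct_list[OF finite[of "UNIV::'n set"]] by auto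
  then show "distinct (coordinates :: 'n::finite list)" "set (coordinates :: 'n list) = UNIV"
    unfolding coordinates_def by (metis (mono_tags, lifting) someI_ex)+
qed

lemma pderivs_eq_fold: "pderivs \<alpha> f = fold pd (mi_list \<alpha>) f"
proof -
  have "fold pd (replicate k i) g = (pd i ^^ k) g" for k i and g :: "real^'a::finite \<Rightarrow> complex"
    by (induction k arbitrary: g) (auto simp: funpow_swap1)
  then have "fold (\<lambda>i. pd i ^^ \<alpha> i) js f = fold pd (concat (map (\<lambda>i. replicate (\<alpha> i) i) js)) f" for js
    by (induction js arbitrary: f) auto
  then show ?thesis by (simp add: pderivs_def mi_list_def)
qed

lemma count_mi_list: "count (mset (mi_list \<alpha>)) i = \<alpha> i"
proof -
  have "distinct js \<Longrightarrow> count (mset (concat (map (\<lambda>i. replicate (\<alpha> i) i) js))) i = (if i \<in> set js then \<alpha> i else 0)" for js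
    by (induction js) auto
  then show ?thesis using coordinates[where 'n='a] by (simp add: mi_list_def)
qed

lemma length_mi_list: "length (mi_list \<alpha>) = mi_order \<alpha>"
proof -
  have "length (concat (map (\<lambda>i. replicate (\<alpha> i) i) js)) = sum_list (map \<alpha> js)" for js
    by (induction js) auto
  then show ?thesis
    using coordinates[where 'n='a] sum_list_distinct_conv_sum_set[of coordinates \<alpha>]
    by (simp add: mi_list_def mi_order_def)
qed

text \<open>The multi-index counts occurrences in the list and is fixed before the domain, the
  function and the point. Bounds indexed by lists, which suit induction, can therefore be exchanged
  for bounds indexed by multi-indices, uniformly over a net.\<close>

lemma fold_pd_eq_pderivs:
  fixes "is" :: "'n::finite list"
  obtains \<alpha> where "mi_order \<alpha> = length is"
    "\<And>\<Omega> f x. open \<Omega> \<Longrightarrow> smooth_on \<Omega> f \<Longrightarrow> x \<in> \<Omega> \<Longrightarrow> fold pd is f x = pderivs \<alpha> f x"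
proof
  let ?\<alpha> = "count (mset is)"
  have m: "mset (mi_list ?\<alpha>) = mset is"
    by (rule multiset_eqI) (simp add: count_mi_list)
  then show "mi_order ?\<alpha> = length is"
    by (metis length_mi_list size_mset)
  show "fold pd is f x = pderivs ?\<alpha> f x" if "open \<Omega>" "smooth_on \<Omega> f" "x \<in> \<Omega>" for \<Omega> f x
    unfolding pderivs_eq_fold using fold_pd_mset[OF that(1) m that(2,3)] by simp
qed

lemma finite_mi_order: "finite {\<alpha>::'n::finite \<Rightarrow> nat. mi_order \<alpha> \<le> m}"
proof (rule finite_subset)
  show "{\<alpha>::'n \<Rightarrow> nat. mi_order \<alpha> \<le> m} \<subseteq> {\<alpha>. \<forall>i. (i \<in> UNIV \<longrightarrow> \<alpha> i \<in> {..m}) \<and> (i \<notin> UNIV \<longrightarrow> \<alpha> i = 0)}"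
  proof (intro subsetI CollectI allI conjI impI)
    fix \<alpha> :: "'n \<Rightarrow> nat" and i assume "\<alpha> \<in> {\<alpha>. mi_order \<alpha> \<le> m}"
    then show "\<alpha> i \<in> {..m}"
      using member_le_sum[of i UNIV \<alpha>] by (simp add: mi_order_def)
  qed simp
  show "finite {\<alpha>::'n \<Rightarrow> nat. \<forall>i. (i \<in> UNIV \<longrightarrow> \<alpha> i \<in> {..m}) \<and> (i \<notin> UNIV \<longrightarrow> \<alpha> i = 0)}"
    by (rule finite_set_of_finite_funs) auto
qed

subsection \<open>Cutoff functions\<close>

text \<open>The polynomial parameter closes the family under differentiation; \<open>flat 1\<close>
  is the classical flat function exp (-1/t).\<close>

definition flat :: "real poly \<Rightarrow> real \<Rightarrow> real" where
  "flat p t = (if t \<le> 0 then 0 else poly p (inverse t) * exp (- inverse t))"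

text \<open>Comes from \<open>(p(1/t) e\<^sup>-\<^sup>1\<^sup>/\<^sup>t)' = ((p(1/t) - p'(1/t)) / t\<^sup>2) e\<^sup>-\<^sup>1\<^sup>/\<^sup>t\<close>.\<close>

definition flat_deriv :: "real poly \<Rightarrow> real poly" where
  "flat_deriv p = [:0, 0, 1:] * (p - pderiv p)"

lemma poly_exp_tendsto_0: "((\<lambda>y. poly p y * exp (- y)) \<longlongrightarrow> 0) at_top" for p :: "real poly"
proof -
  have "((\<lambda>y. \<Sum>i\<le>degree p. coeff p i * (y ^ i / exp y)) \<longlongrightarrow> (\<Sum>i\<le>degree p. coeff p i * 0)) at_top"
    by (intro tendsto_sum tendsto_mult tendsto_const tendsto_power_div_exp_0)
  then show ?thesis
    by (simp add: poly_altdef sum_distrib_right exp_minus divide_inverse mult.assoc)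
qed

lemma flat_has_derivative: "(flat p has_real_derivative flat (flat_deriv p) t) (at t)"
proof -
  consider "t < 0" | "t > 0" | "t = 0" by linarith
  then show ?thesis
  proof cases
    case 1
    have "((\<lambda>_. 0) has_real_derivative 0) (at t)" by simp
    then have "(flat p has_real_derivative 0) (at t)"
      by (rule has_field_derivative_transform_within_open[of _ _ _ "{..<0}"])
         (use 1 in \<open>auto simp: flat_def\<close>)
    then show ?thesis using 1 by (simp add: flat_def)
  next
    case 2
    have "((\<lambda>t. poly p (inverse t) * exp (- inverse t)) has_real_derivative
        flat (flat_deriv p) t) (at t)"
      using 2 by (auto intro!: derivative_eq_intros poly_DERIV[THEN DERIV_chain2]
        simp: flat_def flat_deriv_def algebra_simps power2_eq_square)
    then show ?thesis
      by (rule has_field_derivative_transform_within_open[of _ _ _ "{0<..}"])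
         (use 2 in \<open>auto simp: flat_def\<close>)
  next
    \<comment> \<open>At 0 the left quotient is identically 0. On the right, division by h
      multiplies p by the variable, and the exponential beats every polynomial in 1/h.\<close>
    case 3
    have "((\<lambda>h. flat p h / h) \<longlongrightarrow> 0) (at_left 0)"
    proof (rule tendsto_eventually)
      show "eventually (\<lambda>h. flat p h / h = 0) (at_left 0)"
        by (auto simp: eventually_at_left_field flat_def intro!: exI[of _ "-1"])
    qed
    moreover have "((\<lambda>h. flat p h / h) \<longlongrightarrow> 0) (at_right 0)"
    proof (rule Lim_transform_eventually)
      show "((\<lambda>h::real. poly ([:0, 1:] * p) (inverse h) * exp (- inverse h)) \<longlongrightarrow> 0) (at_right 0)"
        by (rule filterlim_compose[OF poly_exp_tendsto_0 filterlim_inverse_at_top_right])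
      show "eventually (\<lambda>h. poly ([:0, 1:] * p) (inverse h) * exp (- inverse h) = flat p h / h) (at_right 0)"
        by (auto simp: eventually_at_right_field flat_def divide_inverse intro!: exI[of _ 1])
    qed
    ultimately have "((\<lambda>h. flat p h / h) \<longlongrightarrow> 0) (at 0)"
      by (rule filterlim_split_at)
    then show ?thesis
      using 3 by (simp add: DERIV_def flat_def)
  qed
qed

lemma smooth_flat:
  assumes "smooth_on UNIV (\<lambda>x. complex_of_real (\<rho> x))"
  shows "smooth_on UNIV (\<lambda>x. complex_of_real (flat 1 (\<rho> x)))"
  using smooth_compose_real[where H = "\<lambda>j. flat ((flat_deriv ^^ j) 1)" and j = 0, OF _ assms]
    flat_has_derivative by simp

text \<open>The quotient u / (u + v) works, where u and v are flat functions of b^2 - \<rho> and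
  \<rho> - a^2; since a^2 < b^2 they never vanish together. The squared distance \<rho> is used
  because, unlike the norm, it is smooth at x0.\<close>

lemma smooth_cutoff:
  fixes x0 :: "real^'n::finite"
  assumes "0 < a" "a < b"
  obtains \<psi> :: "real^'n \<Rightarrow> complex"
  where "smooth_on UNIV \<psi>" "\<And>x. norm (x - x0) \<le> a \<Longrightarrow> \<psi> x = 1" "\<And>x. b \<le> norm (x - x0) \<Longrightarrow> \<psi> x = 0"
proof
  define \<rho> :: "real^'n \<Rightarrow> real" where "\<rho> x = (norm (x - x0))\<^sup>2" for x
  have \<rho>: "\<rho> x = (\<Sum>j\<in>UNIV. (x $ j - x0 $ j)\<^sup>2)" for x
    unfolding \<rho>_def power2_norm_eq_inner by (simp add: inner_vec_def power2_eq_square)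
  have "smooth_on UNIV (\<lambda>x::real^'n. \<Sum>j\<in>UNIV. (complex_of_real (x $ j) - of_real (x0 $ j))\<^sup>2)"
    by (intro smooth_on_sum smooth_on_power smooth_on_minus smooth_coord smooth_on_const open_UNIV)
  then have s\<rho>: "smooth_on UNIV (\<lambda>x. complex_of_real (\<rho> x))"
    by (simp add: \<rho>)
  define u v :: "real^'n \<Rightarrow> complex"
    where "u x = of_real (flat 1 (b\<^sup>2 - \<rho> x))" and "v x = of_real (flat 1 (\<rho> x - a\<^sup>2))" for x
  have su: "smooth_on UNIV u" unfolding u_def
    by (rule smooth_flat, simp, rule smooth_on_minus) (auto simp: s\<rho> smooth_on_const[of _ "(of_real b)\<^sup>2"])
  have sv: "smooth_on UNIV v" unfolding v_def
    by (rule smooth_flat, simp, rule smooth_on_minus) (auto simp: s\<rho> smooth_on_const[of _ "(of_real a)\<^sup>2"])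
  have ab: "a\<^sup>2 < b\<^sup>2" using assms by (simp add: power_strict_mono)
  have pos: "u x + v x \<noteq> 0" for x
  proof -
    have "flat 1 (b\<^sup>2 - \<rho> x) + flat 1 (\<rho> x - a\<^sup>2) > 0"
      using ab by (auto simp: flat_def add_pos_pos)
    then show ?thesis unfolding u_def v_def by (metis less_irrefl of_real_add of_real_eq_0_iff)
  qed
  show "smooth_on UNIV (\<lambda>x. u x * inverse (u x + v x))"
    using pos by (intro smooth_on_mult smooth_on_inverse smooth_on_add su sv open_UNIV)
  show "u x * inverse (u x + v x) = 1" if "norm (x - x0) \<le> a" for x
  proof -
    have "\<rho> x \<le> a\<^sup>2" using that assms by (simp add: \<rho>_def power_mono)
    then have "v x = 0" by (simp add: v_def flat_def)
    then show ?thesis using pos[of x] by simp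
  qed
  show "u x * inverse (u x + v x) = 0" if "b \<le> norm (x - x0)" for x
  proof -
    have "b\<^sup>2 \<le> \<rho> x" using that assms by (simp add: \<rho>_def power_mono)
    then show ?thesis by (simp add: u_def flat_def)
  qed
qed

subsection \<open>Exponentials\<close>

text \<open>These are the characters of the torus with period 2 pi in each coordinate.\<close>

definition wave :: "('n::finite \<Rightarrow> int) \<Rightarrow> real^'n \<Rightarrow> complex" where
  "wave k x = cis (\<Sum>j\<in>UNIV. of_int (k j) * x $ j)"

lemma norm_wave [simp]: "norm (wave k x) = 1"
  by (simp add: wave_def)

lemma wave_diff: "wave k (x - y) = wave k x * wave (\<lambda>j. - k j) y"
  by (simp add: wave_def cis_mult algebra_simps sum_subtractf sum_negf)

lemma wave_mult: "wave k x * wave l x = wave (\<lambda>j. k j + l j) x"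
  by (simp add: wave_def cis_mult algebra_simps sum.distrib)

lemma wave_0 [simp]: "wave (\<lambda>_. 0) x = 1" "wave k 0 = 1"
  by (simp_all add: wave_def)

lemma wave_has_derivative:
  "(wave k has_derivative (\<lambda>h. \<i> * of_real (\<Sum>j\<in>UNIV. of_int (k j) * h $ j) * wave k x)) (at x)"
proof -
  have "((\<lambda>x. \<Sum>j\<in>UNIV. of_int (k j) * x $ j) has_derivative (\<lambda>h. \<Sum>j\<in>UNIV. of_int (k j) * h $ j)) (at x)"
    by (intro has_derivative_sum has_derivative_mult_right
        bounded_linear_imp_has_derivative[OF bounded_linear_vec_nth])
  moreover have "(cis has_derivative (\<lambda>h. \<i> * of_real h * cis t)) (at t)" for t
  proof -
    have "((\<lambda>t. exp (\<i> * of_real t)) has_vector_derivative (\<i> * exp (\<i> * of_real t))) (at t)"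
      by (rule has_vector_derivative_real_field) (auto intro!: derivative_eq_intros)
    then show ?thesis
      by (simp add: cis_conv_exp[abs_def] has_vector_derivative_def scaleR_conv_of_real mult_ac)
  qed
  ultimately show ?thesis
    unfolding wave_def by (rule has_derivative_compose)
qed

lemma pd_wave: "pd i (wave k) = (\<lambda>x. (\<i> * of_int (k i)) * wave k x)"
proof
  fix x
  have "(\<Sum>j\<in>UNIV. real_of_int (k j) * axis i 1 $ j) = k i"
    by (simp add: axis_def if_distrib cong: if_cong)
  then show "pd i (wave k) x = (\<i> * of_int (k i)) * wave k x"
    using pd_eqI[OF wave_has_derivative, of i k x] by simp
qed

lemma smooth_wave: "smooth_on UNIV (wave k)"
proof -
  have d: "wave k differentiable at x" for x
    using wave_has_derivative by (auto simp: differentiable_def)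
  have "Ck m UNIV (wave k)" for m
  proof (induction m)
    case (Suc m)
    show ?case
      using d Ck_mult[OF open_UNIV Ck_const Suc]
      by (auto simp: pd_wave differentiable_on_def)
  qed simp
  then show ?thesis by (simp add: smooth_on_iff_Ck)
qed

lemma fold_pd_wave: "fold pd is (wave k) x = (\<Prod>i\<leftarrow>is. \<i> * of_int (k i)) * wave k x"
proof (induction "is")
  case (Cons i js)
  have "fold pd (i # js) (wave k) x = fold pd js (\<lambda>x. (\<i> * of_int (k i)) * wave k x) x"
    by (simp add: pd_wave)
  also have "\<dots> = (\<i> * of_int (k i)) * fold pd js (wave k) x"
    by (rule fold_pd_cmult[OF open_UNIV smooth_wave]) simp
  finally show ?case using Cons by simp
qed simp

lemma continuous_on_wave [continuous_intros]: "continuous_on A (wave k)"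
  using continuous_on_subset[OF smooth_on_imp_continuous[OF smooth_wave]] by blast

text \<open>The sum of |1 - exp (i x_j)|^2, a periodic substitute for |x|^2. It vanishes only on the
  period lattice, and multiplication by it acts on Fourier coefficients as the difference operator
  \<open>lap\<close>.\<close>

definition theta :: "real^'n::finite \<Rightarrow> real" where
  "theta x = (\<Sum>j\<in>UNIV. 2 - 2 * cos (x $ j))"

lemma theta_pos:
  assumes "norm x < 2 * pi" "x \<noteq> 0"
  shows "theta x > 0"
proof -
  obtain j where j: "x $ j \<noteq> 0" using assms(2) by (metis vec_eq_iff zero_index)
  have "\<bar>x $ j\<bar> < 2 * pi" using component_le_norm_cart[of x j] assms(1) by linarith
  have "cos (x $ j) \<noteq> 1"
  proof
    assume "cos (x $ j) = 1"
    then obtain n :: int where n: "x $ j = of_int n * 2 * pi"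
      using cos_one_2pi_int[of "x $ j"] by auto
    then have "\<bar>real_of_int n\<bar> * (2 * pi) < 1 * (2 * pi)" "n \<noteq> 0"
      using j \<open>\<bar>x $ j\<bar> < 2 * pi\<close> by (auto simp: abs_mult)
    then show False by (simp only: mult_less_cancel_right) auto
  qed
  then have "2 - 2 * cos (x $ j) > 0" using cos_le_one[of "x $ j"] by linarith
  then show ?thesis
    unfolding theta_def by (intro sum_pos2[of _ j]) (auto simp: cos_le_one)
qed

lemma smooth_theta: "smooth_on UNIV (\<lambda>x::real^'n::finite. complex_of_real (theta x))"
proof -
  let ?e = "\<lambda>j s. (\<lambda>i::'n. if i = j then s else (0::int))"
  have w: "wave (?e j s) x = cis (of_int s * x $ j)" for j s and x :: "real^'n"
  proof -
    have "(\<Sum>i\<in>UNIV. real_of_int (?e j s i) * x $ i) = (\<Sum>i\<in>UNIV. if i = j then of_int s * x $ j else 0)"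
      by (intro sum.cong) auto
    then show ?thesis by (simp add: wave_def)
  qed
  have "smooth_on UNIV (\<lambda>x::real^'n. \<Sum>j\<in>UNIV. 2 - (wave (?e j 1) x + wave (?e j (- 1)) x))"
    by (intro smooth_on_sum smooth_on_minus smooth_on_add smooth_wave smooth_on_const open_UNIV)
  moreover have "2 - (wave (?e j 1) x + wave (?e j (- 1)) x) = of_real (2 - 2 * cos (x $ j))" for j and x :: "real^'n"
    by (simp add: w complex_eq_iff)
  ultimately show ?thesis by (simp add: theta_def)
qed

section \<open>Integrals and Fourier coefficients of test functions\<close>

lemma integrable_compact_support:
  fixes f :: "real^'n::finite \<Rightarrow> complex"
  assumes "continuous_on UNIV f" "compact K" "\<And>x. x \<notin> K \<Longrightarrow> f x = 0"
  shows "integrable lborel f"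
proof -
  have "integrable lborel (\<lambda>x. indicator K x *\<^sub>R f x)"
    using assms by (intro borel_integrable_compact) (auto intro: continuous_on_subset)
  also have "(\<lambda>x. indicator K x *\<^sub>R f x) = f"
    using assms(3) by (auto simp: indicator_def)
  finally show ?thesis .
qed

lemma norm_integral_compact_support_le:
  fixes f :: "real^'n::finite \<Rightarrow> complex"
  assumes "continuous_on UNIV f" "compact K" "\<And>x. x \<notin> K \<Longrightarrow> f x = 0" "\<And>x. x \<in> K \<Longrightarrow> norm (f x) \<le> M"
  shows "norm (LINT x|lborel. f x) \<le> measure lborel K * M"
proof -
  have K: "emeasure lborel K < \<infinity>" "K \<in> sets lborel"
    using emeasure_compact_finite[OF assms(2)] borel_compact[OF assms(2)] by auto
  have "norm (LINT x|lborel. f x) \<le> (LINT x|lborel. norm (f x))"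
    by (rule integral_norm_bound)
  also have "\<dots> \<le> (LINT x|lborel. indicator K x * M)"
  proof (rule integral_mono)
    show "integrable lborel (\<lambda>x. norm (f x))"
      by (intro integrable_norm integrable_compact_support[OF assms(1-3)])
    show "integrable lborel (\<lambda>x. indicator K x * M)"
      using K by (intro integrable_mult_left integrable_real_indicator) auto
  qed (use assms(3,4) in \<open>auto simp: indicator_def\<close>)
  also have "\<dots> = measure lborel K * M" using K by simp
  finally show ?thesis .
qed

lemma test_function_continuous: "f \<in> test_functions_in K \<Longrightarrow> continuous_on A f"
  using continuous_on_subset[OF smooth_on_imp_continuous] unfolding test_functions_in_def by blast

lemma test_function_integrable: "compact K \<Longrightarrow> f \<in> test_functions_in K \<Longrightarrow> integrable lborel f"
  by (rule integrable_compact_support[of f K]) (auto intro: test_function_continuous simp: test_functions_in_def)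

lemma test_functions_pd: "closed K \<Longrightarrow> f \<in> test_functions_in K \<Longrightarrow> pd i f \<in> test_functions_in K"
  using fold_pd_vanish[of K f _ "[i]"] by (auto simp: test_functions_in_def smooth_on_pd)

lemma test_functions_fold_pd: "closed K \<Longrightarrow> f \<in> test_functions_in K \<Longrightarrow> fold pd is f \<in> test_functions_in K"
  by (induction "is" arbitrary: f) (auto simp: test_functions_pd)

lemma test_functions_mult_smooth:
  "f \<in> test_functions_in K \<Longrightarrow> smooth_on UNIV g \<Longrightarrow> (\<lambda>x. g x * f x) \<in> test_functions_in K"
  by (auto simp: test_functions_in_def intro: smooth_on_mult)

lemma test_functions_add:
  "f \<in> test_functions_in K \<Longrightarrow> g \<in> test_functions_in K \<Longrightarrow> (\<lambda>x. f x + g x) \<in> test_functions_in K"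
  by (auto simp: test_functions_in_def intro: smooth_on_add)

lemma test_functions_cmult: "f \<in> test_functions_in K \<Longrightarrow> (\<lambda>x. c * f x) \<in> test_functions_in K"
  by (auto simp: test_functions_in_def intro: smooth_on_cmult)

lemma test_functions_sum:
  "(\<And>a. a \<in> A \<Longrightarrow> f a \<in> test_functions_in K) \<Longrightarrow> (\<lambda>x. \<Sum>a\<in>A. f a x) \<in> test_functions_in K"
  by (auto simp: test_functions_in_def intro!: smooth_on_sum)

lemma test_functions_bounded:
  assumes "compact K" "f \<in> test_functions_in K"
  obtains M where "0 \<le> M" "\<And>x. norm (f x) \<le> M"
proof -
  have "compact (f ` K)"
    using assms by (intro compact_continuous_image test_function_continuous)
  then obtain M where M: "\<And>x. x \<in> K \<Longrightarrow> norm (f x) \<le> M"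
    by (force dest!: compact_imp_bounded simp: bounded_iff)
  have "norm (f x) \<le> max M 0" for x
    using M[of x] assms(2) by (cases "x \<in> K") (auto simp: test_functions_in_def)
  then show thesis by (intro that[of "max M 0"]) auto
qed

lemma integral_translation:
  fixes f :: "real^'n::finite \<Rightarrow> complex"
  assumes "f \<in> borel_measurable borel"
  shows "(LINT x|lborel. f (x + c)) = (LINT x|lborel. f x)"
proof -
  have "(LINT x|lborel. f x) = (LINT x|distr lborel borel ((+) c). f x)"
    by (simp add: lborel_distr_plus)
  also have "\<dots> = (LINT x|lborel. f (c + x))"
    using assms by (intro integral_distr) auto
  finally show ?thesis by (simp add: add.commute)
qed

lemma norm_diff_le_pd:
  fixes f :: "real^'n::finite \<Rightarrow> complex"
  assumes "\<And>x. f differentiable at x" "\<And>i x. norm (pd i f x) \<le> M i"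
  shows "norm (f y - f x) \<le> (\<Sum>i\<in>UNIV. M i) * norm (y - x)"
proof (rule differentiable_bound[OF convex_UNIV])
  show "(f has_derivative (\<lambda>h. \<Sum>i\<in>UNIV. (h $ i) *\<^sub>R pd i f x)) (at x within UNIV)" for x
    using has_derivative_pd[OF assms(1)] by simp
  show "onorm (\<lambda>h. \<Sum>i\<in>UNIV. (h $ i) *\<^sub>R pd i f x) \<le> (\<Sum>i\<in>UNIV. M i)" for x
  proof (rule onorm_le)
    fix h :: "real^'n"
    have "norm (\<Sum>i\<in>UNIV. (h $ i) *\<^sub>R pd i f x) \<le> (\<Sum>i\<in>UNIV. norm h * M i)"
      by (intro sum_norm_le) (auto intro!: mult_mono assms(2) component_le_norm_cart)
    then show "norm (\<Sum>i\<in>UNIV. (h $ i) *\<^sub>R pd i f x) \<le> (\<Sum>i\<in>UNIV. M i) * norm h"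
      by (simp add: sum_distrib_left mult.commute)
  qed
qed auto

lemma has_vector_derivative_quotient:
  assumes "(g has_vector_derivative v) (at 0)"
  shows "((\<lambda>t::real. (g t - g 0) /\<^sub>R t) \<longlongrightarrow> v) (at 0)"
proof -
  have "((\<lambda>t. norm (g (0 + t) - g 0 - t *\<^sub>R v) / norm t) \<longlongrightarrow> 0) (at 0)"
    using assms by (auto simp: has_vector_derivative_def has_derivative_at)
  then have "((\<lambda>t. norm ((g t - g 0) /\<^sub>R t - v)) \<longlongrightarrow> 0) (at 0)"
  proof (rule Lim_transform_eventually)
    have "norm (g (0 + t) - g 0 - t *\<^sub>R v) / norm t = norm ((g t - g 0) /\<^sub>R t - v)" if "t \<noteq> 0" for t
    proof -
      have "(g t - g 0) /\<^sub>R t - v = (g t - g 0 - t *\<^sub>R v) /\<^sub>R t"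
        using that by (simp add: scaleR_diff_right)
      then show ?thesis by (simp add: divide_inverse mult.commute)
    qed
    then show "\<forall>\<^sub>F t in at 0. norm (g (0 + t) - g 0 - t *\<^sub>R v) / norm t = norm ((g t - g 0) /\<^sub>R t - v)"
      by (auto simp: eventually_at_filter)
  qed
  then show ?thesis by (simp add: tendsto_norm_zero_iff LIM_zero_iff)
qed

text \<open>Translation invariance makes the integral of each difference quotient 0; dominated
  convergence passes to the derivative.\<close>

lemma integral_pd_zero:
  fixes f :: "real^'n::finite \<Rightarrow> complex"
  assumes "compact K" "f \<in> test_functions_in K"
  shows "(LINT x|lborel. pd i f x) = 0"
proof -
  define h where "h n = inverse (real (Suc n))" for n
  have h: "0 < h n" "h n \<le> 1" for n by (auto simp: h_def field_simps)
  have h0: "h \<longlonglongrightarrow> 0" unfolding h_def by (rule LIMSEQ_inverse_real_of_nat)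
  define a where "a = (axis i 1 :: real^'n)"
  have na: "norm a = 1" by (simp add: a_def)
  define q where "q n x = (f (x + h n *\<^sub>R a) - f x) /\<^sub>R h n" for n x
  have sm: "smooth_on UNIV f" using assms(2) by (simp add: test_functions_in_def)
  have d: "f differentiable at x" for x using smooth_on_diff[OF open_UNIV sm] by simp
  have fm: "f \<in> borel_measurable borel"
    by (intro borel_measurable_continuous_onI test_function_continuous[OF assms(2)])
  have "\<exists>M. \<forall>x. norm (pd j f x) \<le> M" for j
    using test_functions_bounded[OF assms(1) test_functions_pd[OF compact_imp_closed[OF assms(1)] assms(2)]]
    by metis
  then obtain M where M: "\<And>j x. norm (pd j f x) \<le> M j" by metis
  obtain R where R: "\<And>x. x \<in> K \<Longrightarrow> norm x \<le> R"
    using compact_imp_bounded[OF assms(1)] by (auto simp: bounded_iff)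
  have "(\<lambda>n. LINT x|lborel. q n x) \<longlonglongrightarrow> (LINT x|lborel. pd i f x)"
  \<comment> \<open>The radius R + 1 contains the supports of all difference quotients, because the
    steps \<open>h n\<close> are at most 1.\<close>
  proof (rule integral_dominated_convergence[where w = "\<lambda>x. indicator (cball 0 (R + 1)) x * (\<Sum>i\<in>UNIV. M i)"])
    show "pd i f \<in> borel_measurable lborel"
      using borel_measurable_continuous_onI[OF test_function_continuous[OF test_functions_pd[OF compact_imp_closed[OF assms(1)] assms(2)]]]
      by simp
    show "q n \<in> borel_measurable lborel" for n
      unfolding q_def using fm by measurable
    show "integrable lborel (\<lambda>x::real^'n. indicator (cball 0 (R + 1)) x * (\<Sum>i\<in>UNIV. M i))"
      by (intro integrable_mult_left integrable_real_indicator emeasure_bounded_finite) auto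
    show "AE x in lborel. (\<lambda>n. q n x) \<longlonglongrightarrow> pd i f x"
    proof (rule AE_I2)
      fix x
      have "((\<lambda>t. x + t *\<^sub>R a) has_derivative (\<lambda>t. t *\<^sub>R a)) (at 0)"
        by (auto intro!: derivative_eq_intros)
      moreover have "(f has_derivative (\<lambda>h. \<Sum>j\<in>UNIV. (h $ j) *\<^sub>R pd j f x)) (at (x + 0 *\<^sub>R a))"
        using has_derivative_pd[OF d] by simp
      ultimately have "((\<lambda>t. f (x + t *\<^sub>R a)) has_derivative
          (\<lambda>t. \<Sum>j\<in>UNIV. ((t *\<^sub>R a) $ j) *\<^sub>R pd j f x)) (at 0)"
        by (rule has_derivative_compose)
      moreover have "(\<Sum>j\<in>UNIV. ((t *\<^sub>R a) $ j) *\<^sub>R pd j f x) = t *\<^sub>R pd i f x" for t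
        by (subst sum.remove[of _ i]) (auto simp: a_def axis_def intro!: sum.neutral)
      ultimately have "((\<lambda>t. f (x + t *\<^sub>R a)) has_vector_derivative pd i f x) (at 0)"
        by (simp add: has_vector_derivative_def)
      then have "((\<lambda>t. (f (x + t *\<^sub>R a) - f x) /\<^sub>R t) \<longlongrightarrow> pd i f x) (at 0)"
        using has_vector_derivative_quotient by fastforce
      moreover have "filterlim h (at 0) sequentially"
        using h0 h(1) by (simp add: filterlim_at less_imp_neq[THEN not_sym] order_less_imp_not_eq2)
      ultimately show "(\<lambda>n. q n x) \<longlonglongrightarrow> pd i f x"
        unfolding q_def by (rule filterlim_compose)
    qed
    show "AE x in lborel. norm (q n x) \<le> indicator (cball 0 (R + 1)) x * (\<Sum>i\<in>UNIV. M i)" for n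
    proof (rule AE_I2)
      fix x
      show "norm (q n x) \<le> indicator (cball 0 (R + 1)) x * (\<Sum>i\<in>UNIV. M i)"
      proof (cases "norm x \<le> R + 1")
        case True
        have "norm (f (x + h n *\<^sub>R a) - f x) \<le> (\<Sum>i\<in>UNIV. M i) * h n"
          using norm_diff_le_pd[of f M "x + h n *\<^sub>R a" x, OF d M] na h(1)[of n] by simp
        then show ?thesis using True h(1)[of n] by (simp add: q_def divide_simps mult.commute)
      next
        case False
        have "x \<notin> K" "x + h n *\<^sub>R a \<notin> K"
          using False R[of x] R[of "x + h n *\<^sub>R a"] norm_triangle_ineq4[of "x + h n *\<^sub>R a" "h n *\<^sub>R a"] na h[of n]
          by auto
        then show ?thesis using assms(2) False by (simp add: q_def test_functions_in_def)
      qed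
    qed
  qed
  moreover have "(LINT x|lborel. q n x) = 0" for n
  proof -
    have i: "integrable lborel (\<lambda>x. f (x + h n *\<^sub>R a))"
      using integrable_distr_eq[of "(+) (h n *\<^sub>R a)" lborel borel f] fm test_function_integrable[OF assms]
      by (simp add: lborel_distr_plus add.commute)
    then show ?thesis
      unfolding q_def using integral_translation[OF fm] test_function_integrable[OF assms] by simp
  qed
  ultimately show ?thesis by (simp add: LIMSEQ_const_iff)
qed

lemma integral_by_parts:
  fixes f :: "real^'n::finite \<Rightarrow> complex"
  assumes "compact K" "f \<in> test_functions_in K" "smooth_on UNIV g"
  shows "(LINT x|lborel. g x * pd i f x) = - (LINT x|lborel. pd i g x * f x)"
proof -
  have sf: "smooth_on UNIV f" using assms(2) by (simp add: test_functions_in_def)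
  have "pd i (\<lambda>x. g x * f x) = (\<lambda>x. pd i g x * f x + g x * pd i f x)"
    using smooth_on_diff[OF open_UNIV sf] smooth_on_diff[OF open_UNIV assms(3)] by (auto simp: pd_mult)
  moreover have "(\<lambda>x. pd i g x * f x) \<in> test_functions_in K" "(\<lambda>x. g x * pd i f x) \<in> test_functions_in K"
    "(\<lambda>x. g x * f x) \<in> test_functions_in K"
    using assms by (auto intro!: test_functions_mult_smooth smooth_on_pd test_functions_pd compact_imp_closed)
  ultimately show ?thesis
    using integral_pd_zero[OF assms(1), of "\<lambda>x. g x * f x" i] test_function_integrable[OF assms(1)]
    by (simp add: add_eq_0_iff)
qed

text \<open>The integral extends over the whole space, so these are the Fourier coefficients of the
  periodization of f, which agrees with f inside a period box containing the support.\<close>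

definition fc :: "(real^'n::finite \<Rightarrow> complex) \<Rightarrow> ('n \<Rightarrow> int) \<Rightarrow> complex" where
  "fc f k = inverse (of_real ((2 * pi) ^ CARD('n))) * (LINT x|lborel. wave (\<lambda>j. - k j) x * f x)"

text \<open>The weight is at least 1 and submultiplicative under addition of frequencies
  (\<open>jap_add_le\<close>), which lets it be split in convolutions and compared under
  shifts.\<close>

definition jap :: "('n::finite \<Rightarrow> int) \<Rightarrow> real" where
  "jap k = 1 + (\<Sum>j\<in>UNIV. \<bar>of_int (k j)\<bar>)"

lemma jap_ge_1: "1 \<le> jap k"
  by (simp add: jap_def sum_nonneg)

lemma jap_pos [simp]: "0 < jap k" "0 \<le> jap k" "jap k \<noteq> 0"
  using jap_ge_1[of k] by auto

lemma abs_le_jap: "\<bar>of_int (k j)\<bar> \<le> jap k"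
  using member_le_sum[of j UNIV "\<lambda>j. \<bar>real_of_int (k j)\<bar>"] by (simp add: jap_def)

lemma jap_uminus [simp]: "jap (\<lambda>j. - k j) = jap k"
  by (simp add: jap_def)

lemma jap_add_le: "jap (\<lambda>j. k j + l j) \<le> jap k * jap l"
proof -
  define a b where "a = (\<Sum>j\<in>UNIV. \<bar>real_of_int (k j)\<bar>)" and "b = (\<Sum>j\<in>UNIV. \<bar>real_of_int (l j)\<bar>)"
  have "0 \<le> a" "0 \<le> b" by (simp_all add: a_def b_def sum_nonneg)
  have "(\<Sum>j\<in>UNIV. \<bar>real_of_int (k j + l j)\<bar>) \<le> a + b"
    unfolding a_def b_def sum.distrib[symmetric] by (intro sum_mono) simp
  then show ?thesis
    using mult_nonneg_nonneg[OF \<open>0 \<le> a\<close> \<open>0 \<le> b\<close>]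
    unfolding jap_def a_def[symmetric] b_def[symmetric] distrib_left distrib_right by linarith
qed

lemma fc_pd:
  assumes "compact K" "f \<in> test_functions_in K"
  shows "fc (pd i f) k = \<i> * of_int (k i) * fc f k"
  using integral_by_parts[OF assms smooth_wave[of "\<lambda>j. - k j"], of i]
  by (simp add: fc_def pd_wave mult.assoc)

lemma norm_fc_le:
  fixes f :: "real^'n::finite \<Rightarrow> complex"
  assumes "continuous_on UNIV f" "compact K" "\<And>x. x \<notin> K \<Longrightarrow> f x = 0" "\<And>x. norm (f x) \<le> M"
  shows "norm (fc f k) \<le> measure lborel K * M"
proof -
  have "norm (LINT x|lborel. wave (\<lambda>j. - k j) x * f x) \<le> measure lborel K * M"
    by (rule norm_integral_compact_support_le[OF _ assms(2)])
       (auto intro!: continuous_intros assms simp: norm_mult)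
  moreover have "inverse ((2 * pi) ^ CARD('n)) \<le> 1"
    using pi_ge_two by (intro inverse_le_1_iff[THEN iffD2] disjI2 one_le_power) auto
  ultimately have "inverse ((2 * pi) ^ CARD('n)) * norm (LINT x|lborel. wave (\<lambda>j. - k j) x * f x)
     \<le> 1 * (measure lborel K * M)"
    by (intro mult_mono) auto
  then show ?thesis by (simp add: fc_def norm_mult norm_inverse norm_power)
qed

text \<open>Each further factor 1 + sum |k_j| distributes over the coefficients of f and of its
  first derivatives. The constant depends on K and s alone and so serves all members of a net of
  test functions supported in K.\<close>

lemma fc_decay:
  fixes K :: "(real^'n::finite) set"
  assumes "compact K"
  obtains C where "0 \<le> C" "\<And>f M k. f \<in> test_functions_in K \<Longrightarrow>
    (\<And>is x. length is \<le> s \<Longrightarrow> norm (fold pd is f x) \<le> M) \<Longrightarrow> norm (fc f k) * jap k ^ s \<le> C * M"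
proof -
  have "\<exists>C\<ge>0. \<forall>f M k. f \<in> test_functions_in K \<longrightarrow>
    (\<forall>is x. length is \<le> s \<longrightarrow> norm (fold pd is f x) \<le> M) \<longrightarrow> norm (fc f k) * jap k ^ s \<le> C * M"
  proof (induction s)
    case 0
    show ?case
    proof (intro exI[of _ "measure lborel K"] conjI allI impI)
      fix f M k assume f: "f \<in> test_functions_in K" and M: "\<forall>is x. length is \<le> 0 \<longrightarrow> norm (fold pd is f x) \<le> M"
      have "norm (f x) \<le> M" for x
        using M[rule_format, of "[]"] by simp
      then show "norm (fc f k) * jap k ^ 0 \<le> measure lborel K * M"
        using norm_fc_le[OF test_function_continuous[OF f] assms] f by (simp add: test_functions_in_def)
    qed simp
  next
    case (Suc s)
    then obtain C where C: "C \<ge> 0" "\<And>f M k. f \<in> test_functions_in K \<Longrightarrow>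
      (\<And>is x. length is \<le> s \<Longrightarrow> norm (fold pd is f x) \<le> M) \<Longrightarrow> norm (fc f k) * jap k ^ s \<le> C * M" by blast
    show ?case
    proof (intro exI[of _ "(1 + CARD('n)) * C"] conjI allI impI)
      fix f M k assume f: "f \<in> test_functions_in K"
        and M: "\<forall>is x. length is \<le> Suc s \<longrightarrow> norm (fold pd is f x) \<le> M"
      have 1: "norm (fc f k) * jap k ^ s \<le> C * M"
        using M by (intro C f) auto
      have 2: "norm (fc (pd j f) k) * jap k ^ s \<le> C * M" for j
        using M[rule_format, of "j # _"] by (intro C test_functions_pd compact_imp_closed assms f) auto
      have "norm (fc f k) * jap k ^ Suc s = norm (fc f k) * jap k ^ s + (\<Sum>j\<in>UNIV. norm (fc (pd j f) k) * jap k ^ s)"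
      proof -
        have "norm (fc f k) * jap k ^ Suc s = (norm (fc f k) * jap k ^ s) * (1 + (\<Sum>j\<in>UNIV. \<bar>of_int (k j)\<bar>))"
          unfolding jap_def[symmetric] by simp
        also have "\<dots> = norm (fc f k) * jap k ^ s + (\<Sum>j\<in>UNIV. norm (fc (pd j f) k) * jap k ^ s)"
          unfolding fc_pd[OF assms f] by (simp add: norm_mult distrib_left sum_distrib_left mult_ac)
        finally show ?thesis .
      qed
      also have "\<dots> \<le> C * M + (\<Sum>j\<in>(UNIV::'n set). C * M)"
        by (intro add_mono sum_mono 1 2)
      finally show "norm (fc f k) * jap k ^ Suc s \<le> real (1 + CARD('n)) * C * M"
        by (simp add: algebra_simps)
    qed (use C in auto)
  qed
  then show thesis using that by blast
qed

lemma test_functions_derivs_bounded: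
  assumes "compact K" "f \<in> test_functions_in K"
  obtains M where "0 \<le> M" "\<And>is x. length is \<le> s \<Longrightarrow> norm (fold pd is f x) \<le> M"
proof -
  have "\<exists>M. 0 \<le> M \<and> (\<forall>x. norm (fold pd is f x) \<le> M)" for "is"
    using test_functions_bounded[OF assms(1) test_functions_fold_pd[OF compact_imp_closed[OF assms(1)] assms(2)]]
    by metis
  then obtain B where B: "\<And>is. 0 \<le> B is" "\<And>is x. norm (fold pd is f x) \<le> B is" by metis
  have fin: "finite {is::'a list. length is \<le> s}"
    using finite_lists_length_le[OF finite[of "UNIV::'a set"]] by simp
  have "norm (fold pd is f x) \<le> (\<Sum>is | length is \<le> s. B is)" if "length is \<le> s" for "is" x
    using member_le_sum[of "is" "{is. length is \<le> s}" B] that fin B by (fastforce intro: order_trans)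
  moreover have "0 \<le> (\<Sum>is | length is \<le> s. B is)" using B by (auto intro: sum_nonneg)
  ultimately show thesis by (rule that[rotated])
qed

lemma fc_rapid_decay:
  assumes "compact K" "f \<in> test_functions_in K"
  obtains C where "0 \<le> C" "\<And>k. norm (fc f k) * jap k ^ s \<le> C"
proof -
  obtain C where C: "0 \<le> C" "\<And>f M k. f \<in> test_functions_in K \<Longrightarrow>
    (\<And>is x. length is \<le> s \<Longrightarrow> norm (fold pd is f x) \<le> M) \<Longrightarrow> norm (fc f k) * jap k ^ s \<le> C * M"
    using fc_decay[OF assms(1), of s] by blast
  obtain M where "0 \<le> M" "\<And>is x. length is \<le> s \<Longrightarrow> norm (fold pd is f x) \<le> M"
    using test_functions_derivs_bounded[OF assms, of s] by blast
  then show thesis using C assms(2) by (intro that[of "C * M"]) auto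
qed

subsection \<open>Trigonometric polynomials on a period box\<close>

abbreviation pbox :: "real^'n::finite \<Rightarrow> (real^'n) set" where
  "pbox z \<equiv> cbox (z - vec pi) (z + vec pi)"

abbreviation pobox :: "real^'n::finite \<Rightarrow> (real^'n) set" where
  "pobox z \<equiv> box (z - vec pi) (z + vec pi)"

lemma Basis_cart: "(Basis :: (real^'n::finite) set) = range (\<lambda>i. axis i 1)"
  by (auto simp: Basis_vec_def)

text \<open>Lebesgue measure is the image of the product measure over \<open>Basis\<close>, whose
  elements are the unit vectors; \<open>g\<close> relabels the factors from coordinates to unit
  vectors so that Fubini for finite products applies.\<close>

lemma integral_prod_cart:
  fixes f :: "'n::finite \<Rightarrow> real \<Rightarrow> complex"
  assumes int: "\<And>i. integrable lborel (f i)"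
  shows "(LINT x|lborel. (\<Prod>i\<in>UNIV. f i (x $ i))) = (\<Prod>i\<in>UNIV. LINT t|lborel. f i t)"
proof -
  interpret product_sigma_finite "\<lambda>_::real^'n. lborel :: real measure" by standard
  define g where "g b = f (inv (\<lambda>i. axis i (1::real)) b)" for b :: "real^'n"
  have inj: "inj (\<lambda>i::'n. axis i (1::real))"
    by (auto intro!: injI simp: axis_eq_axis)
  have g: "g (axis i 1) = f i" for i using inv_f_f[OF inj, of i] by (simp add: g_def)
  have [measurable]: "f i \<in> borel_measurable borel" for i
    using borel_measurable_integrable[OF int] by simp
  have [measurable]: "(\<lambda>x::real^'n. x $ i) \<in> borel_measurable borel" for i
    by (intro borel_measurable_continuous_onI continuous_intros)
  have coord: "(\<Sum>b\<in>Basis. h b *\<^sub>R b) $ i = h (axis i 1)" for h :: "real^'n \<Rightarrow> real" and i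
  proof -
    have "(\<Sum>b\<in>Basis. h b *\<^sub>R b) $ i = (\<Sum>b\<in>Basis. h b *\<^sub>R b) \<bullet> axis i 1"
      by (simp add: inner_axis)
    also have "\<dots> = h (axis i 1)" by (intro inner_sum_left_Basis) auto
    finally show ?thesis .
  qed
  have "(LINT x|lborel. (\<Prod>i\<in>UNIV. f i (x $ i)))
      = (LINT h|(\<Pi>\<^sub>M b\<in>(Basis :: (real^'n) set). lborel). (\<Prod>i\<in>UNIV. f i ((\<Sum>b\<in>Basis. h b *\<^sub>R b) $ i)))"
    by (subst lborel_eq, rule integral_distr) measurable
  also have "\<dots> = (LINT h|(\<Pi>\<^sub>M b\<in>(Basis :: (real^'n) set). lborel). (\<Prod>b\<in>Basis. g b (h b)))"
    unfolding coord by (simp add: Basis_cart prod.reindex[OF inj] g)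
  also have "\<dots> = (\<Prod>b\<in>Basis. LINT t|lborel. g b t)"
    by (rule product_integral_prod) (auto simp: g_def int)
  also have "\<dots> = (\<Prod>i\<in>UNIV. LINT t|lborel. f i t)"
    by (simp add: Basis_cart prod.reindex[OF inj] g)
  finally show ?thesis .
qed

lemma wave_as_prod: "wave k x = (\<Prod>i\<in>UNIV. cis (of_int (k i) * x $ i))"
proof -
  have "cis (\<Sum>i\<in>A. g i) = (\<Prod>i\<in>A. cis (g i))" if "finite A" for A and g :: "'a \<Rightarrow> real"
    using that by (induction A) (auto simp: cis_mult[symmetric])
  then show ?thesis by (simp add: wave_def)
qed

lemma integral_cis_period:
  fixes m :: int and a :: real
  shows "integrable lborel (\<lambda>t. indicator {a - pi..a + pi} t *\<^sub>R cis (of_int m * t))" (is ?I)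
    and "(LINT t|lborel. indicator {a - pi..a + pi} t *\<^sub>R cis (of_int m * t)) = (if m = 0 then 2 * pi else 0)" (is ?E)
proof -
  have c: "continuous_on A (\<lambda>t. cis (of_int m * t))" for A
    by (intro continuous_intros)
  show ?I by (intro borel_integrable_compact c) auto
  show ?E
  proof (cases "m = 0")
    case True
    then show ?thesis by (simp add: scaleR_conv_of_real)
  next
    case False
    define F where "F t = cis (of_int m * t) / (\<i> * of_int m)" for t :: real
    have "(F has_vector_derivative cis (of_int m * t)) (at t within S)" for t S
    proof -
      have "((\<lambda>t. exp (\<i> * of_int m * of_real t) / (\<i> * of_int m)) has_vector_derivative
          exp (\<i> * of_int m * of_real t)) (at t within S)"
        using False by (intro has_vector_derivative_real_field) (auto intro!: derivative_eq_intros)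
      then show ?thesis by (simp add: F_def[abs_def] cis_conv_exp mult.assoc)
    qed
    then have "(LINT t|lborel. indicator {a - pi..a + pi} t *\<^sub>R cis (of_int m * t)) = F (a + pi) - F (a - pi)"
      by (intro integral_FTC_Icc c) auto
    also have "cis (of_int m * (a + pi)) = cis (of_int m * (a - pi)) * cis (2 * pi * of_int m)"
      by (simp add: cis_mult algebra_simps)
    then have "F (a + pi) - F (a - pi) = 0"
      by (simp add: F_def cis_multiple_2pi)
    finally show ?thesis using False by simp
  qed
qed

lemma integral_wave_period:
  fixes k :: "'n::finite \<Rightarrow> int"
  shows "(LINT x|lborel. indicator (pbox z) x *\<^sub>R wave k x) = (if k = (\<lambda>_. 0) then of_real ((2 * pi) ^ CARD('n)) else 0)"
proof -
  have ind: "indicator (pbox z) x = (\<Prod>i\<in>UNIV. indicator {z $ i - pi..z $ i + pi} (x $ i) :: real)" for x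
    by (auto simp: indicator_def mem_box_cart)
  have "(LINT x|lborel. indicator (pbox z) x *\<^sub>R wave k x)
      = (LINT x|lborel. (\<Prod>i\<in>UNIV. indicator {z $ i - pi..z $ i + pi} (x $ i) *\<^sub>R cis (of_int (k i) * x $ i)))"
    unfolding ind wave_as_prod by (simp add: scaleR_conv_of_real prod.distrib)
  also have "\<dots> = (\<Prod>i\<in>UNIV. LINT t|lborel. indicator {z $ i - pi..z $ i + pi} t *\<^sub>R cis (of_int (k i) * t))"
    by (rule integral_prod_cart) (rule integral_cis_period)
  also have "\<dots> = (\<Prod>i\<in>UNIV. if k i = 0 then of_real (2 * pi) else 0)"
    unfolding integral_cis_period(2) by (intro prod.cong) auto
  also have "\<dots> = (if k = (\<lambda>_. 0) then of_real ((2 * pi) ^ CARD('n)) else 0)"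
    by (auto simp: fun_eq_iff prod_zero_iff)
  finally show ?thesis .
qed

text \<open>Generation by waves, sums and multiples is all that is needed to extend a linear
  functional that kills every wave.\<close>

inductive trig :: "(real^'n::finite \<Rightarrow> complex) \<Rightarrow> bool" where
  trig_wave: "trig (wave k)"
| trig_add: "trig f \<Longrightarrow> trig g \<Longrightarrow> trig (\<lambda>x. f x + g x)"
| trig_cmult: "trig f \<Longrightarrow> trig (\<lambda>x. c * f x)"

lemma trig_const: "trig (\<lambda>_. c)"
  using trig_cmult[OF trig_wave[of "\<lambda>_. 0"], of c] by simp

lemma trig_mult: "trig f \<Longrightarrow> trig g \<Longrightarrow> trig (\<lambda>x. f x * g x)"
proof (induction rule: trig.induct)
  case (trig_wave k)
  from trig_wave show ?case
  proof (induction rule: trig.induct)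
    case (trig_wave l)
    then show ?case by (simp add: wave_mult trig.trig_wave)
  next
    case (trig_add f g)
    then show ?case using trig.trig_add by (simp add: distrib_left)
  next
    case (trig_cmult f c)
    then show ?case using trig.trig_cmult[of "\<lambda>x. wave k x * f x" c] by (simp add: mult_ac)
  qed
next
  case (trig_add f1 f2)
  then show ?case using trig.trig_add by (simp add: distrib_right)
next
  case (trig_cmult f c)
  then show ?case using trig.trig_cmult[of "\<lambda>x. f x * g x" c] by (simp add: mult_ac)
qed

lemma trig_prod: "(\<And>a. a \<in> A \<Longrightarrow> trig (f a)) \<Longrightarrow> trig (\<lambda>x. \<Prod>a\<in>A. f a x)"
  by (induction A rule: infinite_finite_induct) (auto intro: trig_const trig_mult)

lemma trig_power: "trig f \<Longrightarrow> trig (\<lambda>x. f x ^ n)"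
  by (induction n) (auto intro: trig_const trig_mult)

lemma trig_continuous: "trig f \<Longrightarrow> continuous_on A f"
  by (induction rule: trig.induct) (auto intro!: continuous_intros)

text \<open>Each factor is 1/2 + (exp (i (y_j - x_j)) + exp (-i (y_j - x_j))) / 4. The product takes
  values in [0,1] and equals 1 at y = x.\<close>

lemma trig_bump:
  fixes x :: "real^'n::finite"
  shows "trig (\<lambda>y. of_real (\<Prod>j\<in>UNIV. (1 + cos (y $ j - x $ j)) / 2))"
proof -
  let ?e = "\<lambda>j s. (\<lambda>i::'n. if i = j then s else (0::int))"
  have w: "wave (?e j s) y = cis (of_int s * y $ j)" for j s and y :: "real^'n"
  proof -
    have "(\<Sum>i\<in>UNIV. real_of_int (?e j s i) * y $ i) = (\<Sum>i\<in>UNIV. if i = j then of_int s * y $ j else 0)"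
      by (intro sum.cong) auto
    then show ?thesis by (simp add: wave_def)
  qed
  have "trig (\<lambda>y::real^'n. \<Prod>j\<in>UNIV. 1/2 + (cis (- x $ j) / 4 * wave (?e j 1) y + cis (x $ j) / 4 * wave (?e j (- 1)) y))"
    by (intro trig_prod trig_add trig_cmult trig_wave trig_const)
  moreover have "1/2 + (cis (- x $ j) / 4 * wave (?e j 1) y + cis (x $ j) / 4 * wave (?e j (- 1)) y)
      = of_real ((1 + cos (y $ j - x $ j)) / 2)" for j y
    by (simp add: w complex_eq_iff cos_diff sin_diff cos_add sin_add field_simps)
  ultimately show ?thesis by (simp only: of_real_prod)
qed

text \<open>The powers of a trigonometric polynomial that peaks at \<open>x\<close> act as an approximate identity.\<close>

lemma fourier_uniqueness:
  fixes h :: "real^'n::finite \<Rightarrow> complex"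
  assumes cont: "continuous_on UNIV h"
    and zero: "\<And>k. (LINT y|lborel. indicator (pbox z) y *\<^sub>R (h y * wave k y)) = 0"
    and x: "x \<in> pobox z"
  shows "h x = 0"
proof (rule ccontr)
  assume hx: "h x \<noteq> 0"
  define C where "C = pbox z"
  have Cc: "compact C" unfolding C_def by (rule compact_cbox)
  have xC: "x \<in> C" using x box_subset_cbox by (auto simp: C_def)
  define g where "g y = h y / h x" for y
  have gc: "continuous_on A g" for A
    unfolding g_def using hx by (intro continuous_intros continuous_on_subset[OF cont]) auto
  have gx: "g x = 1" using hx by (simp add: g_def)
  define w where "w y = (\<Prod>j\<in>UNIV. (1 + cos (y $ j - x $ j)) / 2)" for y :: "real^'n"
  have wc: "continuous_on A w" for A
    unfolding w_def by (intro continuous_intros) auto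
  have fac0: "0 \<le> (1 + cos t) / 2" for t :: real
    using add_left_mono[OF cos_ge_minus_one[of t], of 1] by simp
  have fac1: "(1 + cos t) / 2 \<le> 1" for t :: real
    using add_left_mono[OF cos_le_one[of t], of 1] by simp
  note fac = fac0 fac1
  have w01: "0 \<le> w y" "w y \<le> 1" for y
    unfolding w_def using fac by (auto intro!: prod_nonneg prod_le_1)
  have wx: "w x = 1" by (simp add: w_def)
  have wlt: "w y < 1" if yC: "y \<in> C" and yx: "y \<noteq> x" for y
  proof -
    obtain j where j: "y $ j \<noteq> x $ j" using yx by (metis vec_eq_iff)
    have "\<bar>y $ j - x $ j\<bar> < 2 * pi"
      using yC x by (auto simp: C_def mem_box_cart dest!: spec[of _ j])
    have "cos (y $ j - x $ j) \<noteq> 1"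
    proof
      assume "cos (y $ j - x $ j) = 1"
      then obtain n :: int where n: "y $ j - x $ j = of_int n * 2 * pi"
        using cos_one_2pi_int[of "y $ j - x $ j"] by auto
      then have "\<bar>real_of_int n\<bar> * (2 * pi) < 1 * (2 * pi)" "n \<noteq> 0"
        using j \<open>\<bar>y $ j - x $ j\<bar> < 2 * pi\<close> by (auto simp: abs_mult)
      then show False by (simp only: mult_less_cancel_right) auto
    qed
    then have "cos (y $ j - x $ j) < 1" using cos_le_one[of "y $ j - x $ j"] by (rule le_neq_trans[rotated])
    moreover have "(1 + c) / 2 < 1" if "c < 1" for c :: real using that by simp
    ultimately have lt: "(1 + cos (y $ j - x $ j)) / 2 < 1" by blast
    have "w y = (1 + cos (y $ j - x $ j)) / 2 * (\<Prod>j\<in>UNIV-{j}. (1 + cos (y $ j - x $ j)) / 2)"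
      unfolding w_def by (rule prod.remove) auto
    also have "\<dots> \<le> (1 + cos (y $ j - x $ j)) / 2 * 1"
      using fac by (intro mult_left_mono prod_le_1) auto
    finally show ?thesis using lt by simp
  qed
  define U where "U = {y. norm (g y - 1) < 1/2}"
  have U: "open U"
    unfolding U_def by (intro open_Collect_less continuous_intros gc)
  have xU: "x \<in> U" by (simp add: U_def gx)
  have "\<exists>\<rho>. 0 < \<rho> \<and> \<rho> < 1 \<and> (\<forall>y\<in>C - U. w y \<le> \<rho>)"
  proof (cases "C - U = {}")
    case True
    then show ?thesis by (intro exI[of _ "1/2"]) auto
  next
    case False
    have "compact (C - U)" using Cc U by (rule compact_diff)
    from continuous_attains_sup[OF this False wc]
    obtain y where y: "y \<in> C - U" "\<forall>u\<in>C - U. w u \<le> w y" by blast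
    then have "w y < 1" using xU by (intro wlt) auto
    then show ?thesis using y by (intro exI[of _ "max (w y) (1/2)"]) (auto simp: le_max_iff_disj)
  qed
  then obtain \<rho> where \<rho>: "0 < \<rho>" "\<rho> < 1" "\<And>y. y \<in> C \<Longrightarrow> y \<notin> U \<Longrightarrow> w y \<le> \<rho>" by auto
  \<comment> \<open>Any number strictly between \<rho> and 1 would do: where w exceeds it, inside C,
    the point lies in U and hence Re g is at least 1/2.\<close>
  define r where "r = (1 + \<rho>) / 2"
  have r: "\<rho> < r" "r < 1" using \<rho> by (auto simp: r_def)
  define B where "B = pobox z \<inter> {y. r < w y}"
  have B: "open B" unfolding B_def by (intro open_Int open_box open_Collect_less continuous_intros wc)
  have xB: "x \<in> B" using x wx r by (simp add: B_def)
  have BC: "B \<subseteq> C" using box_subset_cbox by (auto simp: B_def C_def)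
  have fmC: "C \<in> sets lborel" "emeasure lborel C < \<infinity>"
    using emeasure_compact_finite[OF Cc] Cc by (auto simp: borel_compact)
  have fmB: "B \<in> sets lborel" "emeasure lborel B < \<infinity>"
    using B emeasure_mono[OF BC fmC(1)] fmC(2) by (auto intro: le_less_trans)
  have Bpos: "measure lborel B > 0"
  proof -
    have "emeasure lborel B \<noteq> 0"
      using B xB open_not_negligible[OF B] negligible_iff_null_sets[of B] fmB
      by (auto simp: null_sets_def null_sets_completion_iff)
    then show ?thesis using fmB by (simp add: measure_def enn2real_positive_iff less_top zero_less_iff_neq_zero)
  qed
  obtain M where M: "\<And>y. y \<in> C \<Longrightarrow> norm (g y) \<le> M" "0 \<le> M"
  proof -
    have "compact (g ` C)" by (intro compact_continuous_image gc Cc)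
    then obtain M where M: "\<And>y. y \<in> C \<Longrightarrow> norm (g y) \<le> M"
      by (force dest!: compact_imp_bounded simp: bounded_iff)
    then have "0 \<le> M" using xC norm_ge_zero order_trans by blast
    then show thesis using that M by blast
  qed
  \<comment> \<open>The integral of g w^N over C is 0. In its real part B contributes at least r^N
    |B| / 2, the points outside U at least - M \<rho>^N |C|, and the rest is nonnegative. As N
    grows, \<rho> < r forces |B| = 0.\<close>
  have key: "measure lborel B * r ^ N / 2 \<le> M * \<rho> ^ N * measure lborel C" for N
  proof -
    have tz: "(LINT y|lborel. indicator C y *\<^sub>R (h y * t y)) = 0" if "trig t" for t
      using that
    proof (induction rule: trig.induct)
      case (trig_wave k)
      then show ?case using zero by (simp add: C_def)
    next
      case (trig_add f1 f2)
      have "integrable lborel (\<lambda>y. indicator C y *\<^sub>R (h y * f y))" if "trig f" for f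
        using that by (intro borel_integrable_compact Cc continuous_intros trig_continuous continuous_on_subset[OF cont]) auto
      then show ?case using trig_add by (simp add: distrib_left scaleR_add_right)
    next
      case (trig_cmult f c)
      have "(\<lambda>y. indicator C y *\<^sub>R (h y * (c * f y))) = (\<lambda>y. c * (indicator C y *\<^sub>R (h y * f y)))"
        by (auto simp: scaleR_conv_of_real mult_ac)
      then show ?case using trig_cmult.IH by (metis integral_mult_right_zero mult_zero_right)
    qed
    have "trig (\<lambda>y. of_real (w y) ^ N)"
      unfolding w_def by (rule trig_power[OF trig_bump])
    from tz[OF this] have "(LINT y|lborel. indicator C y *\<^sub>R (h y * of_real (w y) ^ N)) / h x = 0" by simp
    then have "(LINT y|lborel. indicator C y *\<^sub>R (h y * of_real (w y) ^ N) / h x) = 0"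
      by simp
    moreover have "indicator C y *\<^sub>R (h y * of_real (w y) ^ N) / h x = indicator C y *\<^sub>R (g y * of_real (w y ^ N))" for y
      by (simp add: g_def scaleR_conv_of_real)
    ultimately have "(LINT y|lborel. indicator C y *\<^sub>R (g y * of_real (w y ^ N))) = 0" by simp
    moreover have int: "integrable lborel (\<lambda>y. indicator C y *\<^sub>R (g y * of_real (w y ^ N)))"
      by (intro borel_integrable_compact Cc continuous_intros gc wc)
    ultimately have "(LINT y|lborel. Re (indicator C y *\<^sub>R (g y * of_real (w y ^ N)))) = 0"
      by (metis integral_Re zero_complex.simps(1))
    moreover have "(LINT y|lborel. indicator B y * (r ^ N / 2) - indicator C y * (M * \<rho> ^ N))
        \<le> (LINT y|lborel. Re (indicator C y *\<^sub>R (g y * of_real (w y ^ N))))"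
    proof (rule integral_mono)
      show "integrable lborel (\<lambda>y. indicator B y * (r ^ N / 2) - indicator C y * (M * \<rho> ^ N))"
        using fmB fmC by (intro Bochner_Integration.integrable_diff integrable_mult_left integrable_real_indicator) auto
      show "integrable lborel (\<lambda>y. Re (indicator C y *\<^sub>R (g y * of_real (w y ^ N))))"
        using int by (rule integrable_Re)
      fix y
      have pr: "0 \<le> M * \<rho> ^ N" using M \<rho> by simp
      have reU: "Re (g y) \<ge> 1/2" if "y \<in> U"
        using that abs_Re_le_cmod[of "g y - 1"] by (simp add: U_def)
      show "indicator B y * (r ^ N / 2) - indicator C y * (M * \<rho> ^ N) \<le> Re (indicator C y *\<^sub>R (g y * of_real (w y ^ N)))"
      proof (cases "y \<in> C")
        case False
        then show ?thesis using BC by (auto simp: indicator_def)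
      next
        case True
        show ?thesis
        proof (cases "y \<in> U")
          case False
          then have "w y \<le> \<rho>" using True \<rho>(3) by blast
          then have "y \<notin> B" using r by (auto simp: B_def)
          have "\<bar>Re (g y)\<bar> * w y ^ N \<le> M * \<rho> ^ N"
            using M True \<open>w y \<le> \<rho>\<close> w01 abs_Re_le_cmod[of "g y"]
            by (intro mult_mono power_mono) (auto intro: order_trans)
          moreover have "- (\<bar>Re (g y)\<bar> * w y ^ N) \<le> Re (g y) * w y ^ N"
            using w01[of y] by (metis abs_ge_minus_self abs_mult abs_of_nonneg minus_le_iff zero_le_power)
          ultimately show ?thesis using True \<open>y \<notin> B\<close> by (simp add: indicator_def)
        next
          case yU: True
          show ?thesis
          proof (cases "y \<in> B")
            case True
            then have "r ^ N \<le> w y ^ N" using r \<rho> by (intro power_mono) (auto simp: B_def)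
            then have "1/2 * r ^ N \<le> Re (g y) * w y ^ N"
              using reU[OF yU] w01 r \<rho> by (intro mult_mono) auto
            then show ?thesis using \<open>y \<in> C\<close> True pr by (simp add: indicator_def)
          next
            case False
            have "0 \<le> Re (g y) * w y ^ N" using reU[OF yU] w01 by simp
            then show ?thesis using \<open>y \<in> C\<close> False pr by (simp add: indicator_def)
          qed
        qed
      qed
    qed
    moreover have "(LINT y|lborel. indicator B y * (r ^ N / 2) - indicator C y * (M * \<rho> ^ N))
       = measure lborel B * (r ^ N / 2) - measure lborel C * (M * \<rho> ^ N)"
      using fmB fmC by (subst Bochner_Integration.integral_diff) (auto intro!: integrable_mult_left integrable_real_indicator)
    ultimately show ?thesis by (simp add: mult_ac)
  qed
  have "(\<lambda>N. (\<rho> / r) ^ N) \<longlonglongrightarrow> 0"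
    using \<rho> r by (intro LIMSEQ_realpow_zero) (auto simp: divide_simps)
  from tendsto_mult[OF tendsto_const this, of "2 * M * measure lborel C"]
  have "(\<lambda>N. 2 * M * measure lborel C * (\<rho> / r) ^ N) \<longlonglongrightarrow> 2 * M * measure lborel C * 0" .
  moreover have "measure lborel B \<le> 2 * M * measure lborel C * (\<rho> / r) ^ N" for N
    using key[of N] r \<rho> by (simp add: power_divide field_simps)
  ultimately have "measure lborel B \<le> 0"
    using LIMSEQ_le_const[of _ "2 * M * measure lborel C * 0"] by auto
  then show False using Bpos by simp
qed

section \<open>Series over the integer lattice\<close>

text \<open>The right-hand side is chosen to telescope: the two new terms are together at most 4 /
  ((N+1) (N+2)) = 4 / (N+1) - 4 / (N+2), and N = 0 gives equality.\<close>

lemma sum_inverse_square_int: "(\<Sum>i\<in>{- int N..int N}. inverse (1 + (real_of_int i)\<^sup>2)) \<le> 5 - 4 / (real N + 1)"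
proof (induction N)
  case (Suc N)
  have "{- int (Suc N)..int (Suc N)} = insert (- int (Suc N)) (insert (int (Suc N)) {- int N..int N})" by auto
  then have "(\<Sum>i\<in>{- int (Suc N)..int (Suc N)}. inverse (1 + (real_of_int i)\<^sup>2))
      = 2 * inverse (1 + (real N + 1)\<^sup>2) + (\<Sum>i\<in>{- int N..int N}. inverse (1 + (real_of_int i)\<^sup>2))"
    by (simp add: add.commute power2_commute[of "-1"] power2_eq_square algebra_simps)
  also have "\<dots> \<le> 2 * inverse (1 + (real N + 1)\<^sup>2) + (5 - 4 / (real N + 1))"
    using Suc by simp
  also have "\<dots> \<le> 5 - 4 / (real (Suc N) + 1)"
  proof -
    have "inverse (1 + (real N + 1)\<^sup>2) \<le> inverse ((real N + 1) * (real N + 2) / 2)"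
    proof (rule le_imp_inverse_le)
      show "(real N + 1) * (real N + 2) / 2 \<le> 1 + (real N + 1)\<^sup>2"
        by (simp add: power2_eq_square algebra_simps)
      show "0 < (real N + 1) * (real N + 2) / 2" by (intro divide_pos_pos mult_pos_pos) auto
    qed
    also have "\<dots> = 2 / (real N + 1) - 2 / (real N + 2)" by (simp add: divide_simps)
    finally show ?thesis by (simp add: algebra_simps)
  qed
  finally show ?case .
qed simp

text \<open>Each 1 + k_j^2 is at most jap k squared, so the summand is dominated by a product of
  one-dimensional terms. Over a box the sum of such products factorizes into n sums of size at most
  5. This fixes the exponent 2 n.\<close>

lemma jap_summable: "(\<lambda>k::'n::finite \<Rightarrow> int. inverse (jap k ^ (2 * CARD('n)))) summable_on UNIV"
proof (rule nonneg_bdd_above_summable_on)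
  show "bdd_above (sum (\<lambda>k::'n \<Rightarrow> int. inverse (jap k ^ (2 * CARD('n)))) ` {F. F \<subseteq> UNIV \<and> finite F})"
  proof (rule bdd_aboveI2)
    fix F :: "('n \<Rightarrow> int) set" assume "F \<in> {F. F \<subseteq> UNIV \<and> finite F}"
    then have F: "finite F" by simp
    define N where "N = (\<Sum>k\<in>F. \<Sum>j\<in>UNIV. nat \<bar>k j\<bar>)"
    have N: "\<bar>k j\<bar> \<le> int N" if "k \<in> F" for k j
    proof -
      have "nat \<bar>k j\<bar> \<le> (\<Sum>j\<in>UNIV. nat \<bar>k j\<bar>)" by (intro member_le_sum) auto
      also have "\<dots> \<le> N" unfolding N_def using that F by (intro member_le_sum) auto
      finally show ?thesis by linarith
    qed
    have "(\<Sum>k\<in>F. inverse (jap k ^ (2 * CARD('n)))) \<le> (\<Sum>k\<in>F. \<Prod>j\<in>UNIV. inverse (1 + (real_of_int (k j))\<^sup>2))"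
    proof (rule sum_mono)
      fix k :: "'n \<Rightarrow> int"
      have "1 + (real_of_int (k j))\<^sup>2 \<le> (jap k)\<^sup>2" for j
      proof -
        have "1 + \<bar>real_of_int (k j)\<bar> \<le> jap k"
          using member_le_sum[of j UNIV "\<lambda>j. \<bar>real_of_int (k j)\<bar>"] by (simp add: jap_def)
        then have "(1 + \<bar>real_of_int (k j)\<bar>)\<^sup>2 \<le> (jap k)\<^sup>2" by (intro power_mono) auto
        then show ?thesis by (simp add: power2_sum)
      qed
      then have "(\<Prod>j\<in>UNIV. 1 + (real_of_int (k j))\<^sup>2) \<le> (\<Prod>j\<in>(UNIV::'n set). (jap k)\<^sup>2)"
        by (intro prod_mono) auto
      then have "inverse (\<Prod>j\<in>(UNIV::'n set). (jap k)\<^sup>2) \<le> inverse (\<Prod>j\<in>UNIV. 1 + (real_of_int (k j))\<^sup>2)"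
        by (intro le_imp_inverse_le) (auto intro!: prod_pos simp: add_pos_nonneg)
      then show "inverse (jap k ^ (2 * CARD('n))) \<le> (\<Prod>j\<in>UNIV. inverse (1 + (real_of_int (k j))\<^sup>2))"
        by (simp add: power_mult inverse_eq_divide prod_dividef)
    qed
    also have "\<dots> \<le> (\<Sum>k\<in>PiE (UNIV::'n set) (\<lambda>_. {- int N..int N}). \<Prod>j\<in>UNIV. inverse (1 + (real_of_int (k j))\<^sup>2))"
    proof (rule sum_mono2)
      show "finite (PiE UNIV (\<lambda>_::'n. {- int N..int N}))" by (intro finite_PiE) auto
      show "F \<subseteq> PiE UNIV (\<lambda>_. {- int N..int N})"
        using N by (auto simp: abs_le_iff minus_le_iff)
    qed (auto intro!: prod_nonneg)
    also have "\<dots> = (\<Prod>j\<in>(UNIV::'n set). \<Sum>i\<in>{- int N..int N}. inverse (1 + (real_of_int i)\<^sup>2))"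
      by (rule prod_sum_PiE[symmetric]) auto
    also have "\<dots> \<le> (\<Prod>j\<in>(UNIV::'n set). 5)"
    proof (rule prod_mono, intro conjI)
      have "0 \<le> 4 / (real N + 1)" by simp
      then show "(\<Sum>i\<in>{- int N..int N}. inverse (1 + (real_of_int i)\<^sup>2)) \<le> 5"
        using sum_inverse_square_int[of N] by linarith
    qed (auto intro: sum_nonneg)
    finally show "(\<Sum>k\<in>F. inverse (jap k ^ (2 * CARD('n)))) \<le> 5 ^ CARD('n)" by simp
  qed
qed simp

text \<open>A surplus of 2 n powers of the frequency buys absolute summability; the explicit bound
  on the sum is what keeps later estimates uniform in the family.\<close>

lemma summable_on_of_decay:
  fixes f :: "('n::finite \<Rightarrow> int) \<Rightarrow> real"
  assumes "\<And>k. 0 \<le> f k" "\<And>k. f k * jap k ^ (2 * CARD('n)) \<le> C"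
  shows "f summable_on UNIV" "infsum f UNIV \<le> C * infsum (\<lambda>k::'n \<Rightarrow> int. inverse (jap k ^ (2 * CARD('n)))) UNIV"
proof -
  have le: "f k \<le> C * inverse (jap k ^ (2 * CARD('n)))" for k
    using assms(2)[of k] by (simp add: divide_simps mult.commute flip: divide_inverse)
  have s: "(\<lambda>k::'n \<Rightarrow> int. C * inverse (jap k ^ (2 * CARD('n)))) summable_on UNIV"
    by (intro summable_on_cmult_right jap_summable)
  show f: "f summable_on UNIV"
    by (rule summable_on_comparison_test[OF s]) (auto simp: le assms(1))
  have "infsum f UNIV \<le> infsum (\<lambda>k::'n \<Rightarrow> int. C * inverse (jap k ^ (2 * CARD('n)))) UNIV"
    by (intro infsum_mono f s le)
  then show "infsum f UNIV \<le> C * infsum (\<lambda>k::'n \<Rightarrow> int. inverse (jap k ^ (2 * CARD('n)))) UNIV"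
    by (simp add: infsum_cmult_right')
qed

lemma infsum_Compl:
  fixes f :: "'a \<Rightarrow> 'b::banach"
  assumes "f summable_on UNIV" "finite F"
  shows "infsum f UNIV - sum f F = infsum f (- F)"
proof -
  have "infsum f (F \<union> - F) = infsum f F + infsum f (- F)"
    using assms by (intro infsum_Un_disjoint summable_on_finite summable_on_subset_banach[OF assms(1)]) auto
  then show ?thesis using assms(2) by simp
qed

text \<open>For exchanging a series with an integral or a distribution: applied to the remainder,
  either is controlled by the tail of one summable majorant.\<close>

lemma has_sum_of_tail_bound:
  fixes a :: "'a \<Rightarrow> 'b::banach"
  assumes M: "M summable_on UNIV"
    and bound: "\<And>F. finite F \<Longrightarrow> norm (L - sum a F) \<le> D * infsum M (- F)"
  shows "(a has_sum L) UNIV"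
  unfolding has_sum_def
proof (rule LIM_zero_cancel, rule Lim_null_comparison)
  show "\<forall>\<^sub>F F in finite_subsets_at_top UNIV. norm (sum a F - L) \<le> D * (infsum M UNIV - sum M F)"
    using bound infsum_Compl[OF M]
    by (auto intro!: eventually_finite_subsets_at_top_weakI simp: norm_minus_commute)
  have "((\<lambda>F. D * (infsum M UNIV - sum M F)) \<longlongrightarrow> D * (infsum M UNIV - infsum M UNIV)) (finite_subsets_at_top UNIV)"
    by (intro tendsto_intros infsum_tendsto M)
  then show "((\<lambda>F. D * (infsum M UNIV - sum M F)) \<longlongrightarrow> 0) (finite_subsets_at_top UNIV)" by simp
qed

lemma summable_on_norm_comparison:
  fixes f :: "'a \<Rightarrow> 'b::banach"
  assumes "M summable_on A" "\<And>k. norm (f k) \<le> M k"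
  shows "f summable_on A" "norm (infsum f A) \<le> infsum M A"
proof -
  have a: "(\<lambda>k. norm (f k)) summable_on A"
    using Infinite_Sum.abs_summable_on_comparison_test'[OF assms(1), of f] assms(2) by blast
  then show s: "f summable_on A" by (rule abs_summable_summable)
  show "norm (infsum f A) \<le> infsum M A"
    by (rule norm_infsum_le[OF has_sum_infsum[OF s] has_sum_infsum[OF assms(1)]]) (rule assms(2))
qed

lemma has_sum_sum_finite:
  fixes f :: "'i \<Rightarrow> 'a \<Rightarrow> 'b::banach"
  assumes "\<And>i. i \<in> I \<Longrightarrow> (f i has_sum S i) A"
  shows "((\<lambda>k. \<Sum>i\<in>I. f i k) has_sum (\<Sum>i\<in>I. S i)) A"
  using assms
proof (induction I rule: infinite_finite_induct)
  case (insert i I)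
  then have "((\<lambda>k. f i k + (\<Sum>i\<in>I. f i k)) has_sum (S i + (\<Sum>i\<in>I. S i))) A"
    by (intro has_sum_add) auto
  with insert show ?case by simp
qed auto

lemma has_sum_minus:
  fixes f :: "'a \<Rightarrow> 'b::banach"
  assumes "(f has_sum S) A" "(g has_sum T) A"
  shows "((\<lambda>k. f k - g k) has_sum (S - T)) A"
  using has_sum_add[OF assms(1), of "\<lambda>k. - g k" "- T"] assms(2) by (simp add: has_sum_uminus)

subsection \<open>Termwise differentiation\<close>

text \<open>The mean value inequality is applied to f minus its linearization at x; the derivative
  of that difference is again estimated by the mean value inequality for the first partial
  derivatives. Factors 1/2 are not pursued.\<close>

lemma second_order_remainder:
  fixes f :: "real^'n::finite \<Rightarrow> complex"
  assumes sm: "smooth_on UNIV f" and B: "\<And>i j x. norm (pd j (pd i f) x) \<le> B i j"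
  shows "norm (f y - f x - (\<Sum>i\<in>UNIV. ((y - x) $ i) *\<^sub>R pd i f x)) \<le> (\<Sum>i\<in>UNIV. \<Sum>j\<in>UNIV. B i j) * norm (y - x) ^ 2"
proof -
  let ?D = "\<lambda>z h. \<Sum>i\<in>UNIV. (h $ i) *\<^sub>R pd i f z"
  have d: "f differentiable at z" "pd i f differentiable at z" for z i
    using smooth_on_diff[OF open_UNIV] sm smooth_on_pd by blast+
  have B0: "0 \<le> B i j" for i j using B[of j i 0] norm_ge_zero order_trans by blast
  define C where "C = (\<Sum>i\<in>UNIV. \<Sum>j\<in>UNIV. B i j)"
  have lin: "linear (?D x)" using has_derivative_linear[OF has_derivative_pd[OF d(1)]] .
  define g where "g z = f z - ?D x z" for z
  have "norm (g y - g x) \<le> C * norm (y - x) * norm (y - x)"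
  proof (rule differentiable_bound[where S = "closed_segment x y" and f' = "\<lambda>z h. ?D z h - ?D x h"])
    show "(g has_derivative (\<lambda>h. ?D z h - ?D x h)) (at z within closed_segment x y)" for z
      unfolding g_def
      by (rule has_derivative_at_withinI, rule has_derivative_diff, rule has_derivative_pd[OF d(1)],
          rule bounded_linear_imp_has_derivative, rule has_derivative_bounded_linear[OF has_derivative_pd[OF d(1)]])
    fix z assume z: "z \<in> closed_segment x y"
    have zx: "norm (z - x) \<le> norm (y - x)"
      using segment_bound1[OF z] by (simp add: norm_minus_commute)
    show "onorm (\<lambda>h. ?D z h - ?D x h) \<le> C * norm (y - x)"
    proof (rule onorm_le)
      fix h :: "real^'n"
      have "?D z h - ?D x h = (\<Sum>i\<in>UNIV. (h $ i) *\<^sub>R (pd i f z - pd i f x))"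
        by (simp add: sum_subtractf scaleR_diff_right)
      also have "norm \<dots> \<le> (\<Sum>i\<in>UNIV. norm h * ((\<Sum>j\<in>UNIV. B i j) * norm (y - x)))"
      proof (rule sum_norm_le)
        fix i
        have "norm (pd i f z - pd i f x) \<le> (\<Sum>j\<in>UNIV. B i j) * norm (z - x)"
          by (rule norm_diff_le_pd[OF d(2) B])
        also have "\<dots> \<le> (\<Sum>j\<in>UNIV. B i j) * norm (y - x)"
          by (intro mult_left_mono zx sum_nonneg B0)
        finally show "norm ((h $ i) *\<^sub>R (pd i f z - pd i f x)) \<le> norm h * ((\<Sum>j\<in>UNIV. B i j) * norm (y - x))"
          using component_le_norm_cart[of h i] by (simp add: mult_mono)
      qed
      also have "\<dots> = C * norm (y - x) * norm h"
        by (simp add: C_def sum_distrib_left sum_distrib_right mult_ac)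
      finally show "norm (?D z h - ?D x h) \<le> C * norm (y - x) * norm h" .
    qed
  qed auto
  moreover have "g y - g x = f y - f x - ?D x (y - x)"
    unfolding g_def linear_diff[OF lin, of y x] by (simp only: algebra_simps)
  ultimately show ?thesis by (simp add: C_def power2_eq_square mult.assoc)
qed

text \<open>The quadratic remainders of the terms are summable with constants from the second
  derivatives, so the remainder of the sum is O(|y - x|^2) directly, without a theorem on limits of
  derivatives.\<close>

lemma series_has_derivative:
  fixes f :: "'k \<Rightarrow> real^'n::finite \<Rightarrow> complex"
  assumes sm: "\<And>k. smooth_on UNIV (f k)"
    and B: "\<And>is. \<exists>M. M summable_on UNIV \<and> (\<forall>k x. norm (fold pd is (f k) x) \<le> M k)"
  shows "((\<lambda>x. \<Sum>\<^sub>\<infinity>k. f k x) has_derivative (\<lambda>h. \<Sum>i\<in>UNIV. (h $ i) *\<^sub>R (\<Sum>\<^sub>\<infinity>k. pd i (f k) x))) (at x)"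
proof -
  obtain M where M: "\<And>is. M is summable_on UNIV" "\<And>is k x. norm (fold pd is (f k) x) \<le> M is k"
    using B by metis
  have s0: "((\<lambda>k. f k y) has_sum (\<Sum>\<^sub>\<infinity>k. f k y)) UNIV" for y
    using M(2)[of "[]"] by (intro has_sum_infsum summable_on_norm_comparison(1)[OF M(1)[of "[]"]]) simp
  have s1: "((\<lambda>k. pd i (f k) x) has_sum (\<Sum>\<^sub>\<infinity>k. pd i (f k) x)) UNIV" for i
    using M(2)[of "[i]"] by (intro has_sum_infsum summable_on_norm_comparison(1)[OF M(1)[of "[i]"]]) simp
  define C where "C = (\<Sum>i\<in>UNIV. \<Sum>j\<in>UNIV. \<Sum>\<^sub>\<infinity>k. M [i, j] k)"
  have sM: "((\<lambda>k. \<Sum>i\<in>UNIV. \<Sum>j\<in>UNIV. M [i, j] k) has_sum C) UNIV"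
    unfolding C_def by (intro has_sum_sum_finite has_sum_infsum M(1))
  have M0: "0 \<le> M is k" for "is" k using M(2)[of "is" k 0] norm_ge_zero order_trans by blast
  have C0: "0 \<le> C" unfolding C_def by (intro sum_nonneg infsum_nonneg M0)
  let ?F = "\<lambda>x. \<Sum>\<^sub>\<infinity>k. f k x" and ?D = "\<lambda>h. \<Sum>i\<in>UNIV. (h $ i) *\<^sub>R (\<Sum>\<^sub>\<infinity>k. pd i (f k) x)"
  have rem: "norm (?F y - ?F x - ?D (y - x)) \<le> C * norm (y - x) ^ 2" for y
  proof (rule norm_infsum_le)
    show "((\<lambda>k. f k y - f k x - (\<Sum>i\<in>UNIV. ((y - x) $ i) *\<^sub>R pd i (f k) x)) has_sum (?F y - ?F x - ?D (y - x))) UNIV"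
      by (intro has_sum_minus s0 has_sum_sum_finite has_sum_scaleR s1)
    show "((\<lambda>k. (\<Sum>i\<in>UNIV. \<Sum>j\<in>UNIV. M [i, j] k) * norm (y - x) ^ 2) has_sum C * norm (y - x) ^ 2) UNIV"
      by (intro has_sum_cmult_left sM)
    show "norm (f k y - f k x - (\<Sum>i\<in>UNIV. ((y - x) $ i) *\<^sub>R pd i (f k) x))
        \<le> (\<Sum>i\<in>UNIV. \<Sum>j\<in>UNIV. M [i, j] k) * norm (y - x) ^ 2" for k
      using M(2)[of "[_, _]"] by (intro second_order_remainder sm) auto
  qed
  have bl: "bounded_linear ?D"
    by (intro bounded_linear_sum bounded_linear_scaleR_left[THEN bounded_linear_compose] bounded_linear_vec_nth)
  show ?thesis
    unfolding has_derivative_at_alt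
  proof (intro conjI bl allI impI)
    fix e :: real assume e: "e > 0"
    show "\<exists>d>0. \<forall>y. norm (y - x) < d \<longrightarrow> norm (?F y - ?F x - ?D (y - x)) \<le> e * norm (y - x)"
    \<comment> \<open>C + 1 instead of C, since C may be 0.\<close>
    proof (intro exI[of _ "e / (C + 1)"] conjI allI impI)
      fix y assume "norm (y - x) < e / (C + 1)"
      then have "(C + 1) * norm (y - x) \<le> e" using C0 by (simp add: field_simps)
      then have "C * norm (y - x) \<le> e" by (rule order_trans[rotated]) (simp add: distrib_right)
      then have "C * norm (y - x) ^ 2 \<le> e * norm (y - x)"
        by (simp add: power2_eq_square mult_right_mono flip: mult.assoc)
      then show "norm (?F y - ?F x - ?D (y - x)) \<le> e * norm (y - x)" using rem[of y] by linarith
    qed (use e C0 in auto)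
  qed
qed

lemma pd_series:
  fixes f :: "'k \<Rightarrow> real^'n::finite \<Rightarrow> complex"
  assumes "\<And>k. smooth_on UNIV (f k)"
    and "\<And>is. \<exists>M. M summable_on UNIV \<and> (\<forall>k x. norm (fold pd is (f k) x) \<le> M k)"
  shows "pd i (\<lambda>x. \<Sum>\<^sub>\<infinity>k. f k x) = (\<lambda>x. \<Sum>\<^sub>\<infinity>k. pd i (f k) x)"
proof
  fix x
  show "pd i (\<lambda>x. \<Sum>\<^sub>\<infinity>k. f k x) x = (\<Sum>\<^sub>\<infinity>k. pd i (f k) x)"
    unfolding pd_eqI[OF series_has_derivative[OF assms]]
    by (subst sum.remove[of _ i]) (auto simp: axis_def intro!: sum.neutral)
qed

lemma fold_pd_series:
  fixes f :: "'k \<Rightarrow> real^'n::finite \<Rightarrow> complex"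
  assumes "\<And>k. smooth_on UNIV (f k)"
    and "\<And>is. \<exists>M. M summable_on UNIV \<and> (\<forall>k x. norm (fold pd is (f k) x) \<le> M k)"
  shows "fold pd js (\<lambda>x. \<Sum>\<^sub>\<infinity>k. f k x) = (\<lambda>x. \<Sum>\<^sub>\<infinity>k. fold pd js (f k) x)"
  using assms
proof (induction js arbitrary: f)
  case (Cons i js)
  have "fold pd js (\<lambda>x. \<Sum>\<^sub>\<infinity>k. pd i (f k) x) = (\<lambda>x. \<Sum>\<^sub>\<infinity>k. fold pd js (pd i (f k)) x)"
  proof (rule Cons.IH)
    show "\<exists>M. M summable_on UNIV \<and> (\<forall>k x. norm (fold pd is (pd i (f k)) x) \<le> M k)" for "is"
      using Cons.prems(2)[of "i # is"] by simp
  qed (rule smooth_on_pd[OF Cons.prems(1)])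
  then show ?case by (simp add: pd_series[OF Cons.prems])
qed simp

lemma smooth_series:
  fixes f :: "'k \<Rightarrow> real^'n::finite \<Rightarrow> complex"
  assumes "\<And>k. smooth_on UNIV (f k)"
    and "\<And>is. \<exists>M. M summable_on UNIV \<and> (\<forall>k x. norm (fold pd is (f k) x) \<le> M k)"
  shows "smooth_on UNIV (\<lambda>x. \<Sum>\<^sub>\<infinity>k. f k x)"
proof -
  have "Ck m UNIV (\<lambda>x. \<Sum>\<^sub>\<infinity>k. f k x)" for m
    using assms
  proof (induction m arbitrary: f)
    case (Suc m)
    have "Ck m UNIV (\<lambda>x. \<Sum>\<^sub>\<infinity>k. pd i (f k) x)" for i
    proof (rule Suc.IH)
      show "\<exists>M. M summable_on UNIV \<and> (\<forall>k x. norm (fold pd is (pd i (f k)) x) \<le> M k)" for "is"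
        using Suc.prems(2)[of "i # is"] by simp
    qed (rule smooth_on_pd[OF Suc.prems(1)])
    moreover have "(\<lambda>x. \<Sum>\<^sub>\<infinity>k. f k x) differentiable_on UNIV"
      using series_has_derivative[OF Suc.prems] by (auto simp: differentiable_on_def differentiable_def)
    ultimately show ?case by (simp add: pd_series[OF Suc.prems])
  qed simp
  then show ?thesis by (simp add: smooth_on_iff_Ck)
qed

subsection \<open>Fourier series\<close>

lemma wave_series_summable:
  assumes "(\<lambda>k. norm (c k)) summable_on A"
  shows "(\<lambda>k. c k * wave k x) summable_on A"
  by (rule summable_on_norm_comparison[OF assms]) (simp add: norm_mult)

lemma wave_series_continuous:
  fixes c :: "('n::finite \<Rightarrow> int) \<Rightarrow> complex"
  assumes "(\<lambda>k. norm (c k)) summable_on UNIV"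
  shows "continuous_on A (\<lambda>x. \<Sum>\<^sub>\<infinity>k. c k * wave k x)"
proof -
  have "uniform_limit A (\<lambda>X y. \<Sum>k\<in>X. c k * wave k y) (\<lambda>x. \<Sum>\<^sub>\<infinity>k. c k * wave k x) (finite_subsets_at_top UNIV)"
    using assms by (intro Weierstrass_m_test_general) (auto simp: norm_mult)
  then show ?thesis
    by (rule uniform_limit_theorem[rotated])
       (auto intro!: always_eventually continuous_intros)
qed

lemma integral_wave_series:
  fixes c :: "('n::finite \<Rightarrow> int) \<Rightarrow> complex"
  assumes c: "(\<lambda>k. norm (c k)) summable_on UNIV" and g: "continuous_on C g" and C: "compact C"
  shows "((\<lambda>k. c k * (LINT y|lborel. indicator C y *\<^sub>R (g y * wave k y)))
    has_sum (LINT y|lborel. indicator C y *\<^sub>R (g y * (\<Sum>\<^sub>\<infinity>k. c k * wave k y)))) UNIV"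
proof -
  have "compact (g ` C)" by (intro compact_continuous_image g C)
  then obtain M0 where "\<And>y. y \<in> C \<Longrightarrow> norm (g y) \<le> M0"
    by (force dest!: compact_imp_bounded simp: bounded_iff)
  then have M: "norm (g y) \<le> max M0 0" if "y \<in> C" for y using that by fastforce
  define M where "M = max M0 0"
  have fin: "C \<in> sets lborel" "emeasure lborel C < \<infinity>"
    using emeasure_compact_finite[OF C] C by (auto simp: borel_compact)
  have int: "integrable lborel (\<lambda>y. indicator C y *\<^sub>R (g y * u y))" if "continuous_on C u" for u
    using that by (intro borel_integrable_compact C continuous_intros g)
  show ?thesis
  proof (rule has_sum_of_tail_bound[OF c, of _ _ "measure lborel C * M"])
    fix F :: "('n \<Rightarrow> int) set" assume F: "finite F"
    let ?S = "\<lambda>y. \<Sum>\<^sub>\<infinity>k. c k * wave k y" and ?T = "infsum (\<lambda>k. norm (c k)) (- F)"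
    have tail: "?S y - (\<Sum>k\<in>F. c k * wave k y) = (\<Sum>\<^sub>\<infinity>k\<in>-F. c k * wave k y)" for y
      by (rule infsum_Compl[OF wave_series_summable[OF c] F])
    have tb: "norm (?S y - (\<Sum>k\<in>F. c k * wave k y)) \<le> ?T" for y
      unfolding tail
      by (rule summable_on_norm_comparison(2)[OF summable_on_subset_banach[OF c]]) (auto simp: norm_mult)
    have "(LINT y|lborel. indicator C y *\<^sub>R (g y * ?S y)) - (\<Sum>k\<in>F. c k * (LINT y|lborel. indicator C y *\<^sub>R (g y * wave k y)))
       = (LINT y|lborel. indicator C y *\<^sub>R (g y * ?S y) - (\<Sum>k\<in>F. c k * (indicator C y *\<^sub>R (g y * wave k y))))"
    proof -
      have i1: "integrable lborel (\<lambda>y. indicator C y *\<^sub>R (g y * ?S y))"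
        by (intro int wave_series_continuous c)
      have i2: "integrable lborel (\<lambda>y. c k * (indicator C y *\<^sub>R (g y * wave k y)))" for k
        by (intro integrable_mult_right int continuous_intros)
      show ?thesis
        by (simp only: Bochner_Integration.integral_diff[OF i1 Bochner_Integration.integrable_sum[OF i2]]
            Bochner_Integration.integral_sum[OF i2] integral_mult_right_zero)
    qed
    also have "\<dots> = (LINT y|lborel. indicator C y *\<^sub>R (g y * (?S y - (\<Sum>k\<in>F. c k * wave k y))))"
      by (intro Bochner_Integration.integral_cong)
         (auto simp: indicator_def sum_distrib_left right_diff_distrib mult_ac)
    also have "norm \<dots> \<le> (LINT y|lborel. indicator C y * (M * ?T))"
    proof (rule Bochner_Integration.integral_norm_bound_integral)
      show "integrable lborel (\<lambda>y. indicator C y *\<^sub>R (g y * (?S y - (\<Sum>k\<in>F. c k * wave k y))))"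
        by (intro int continuous_intros wave_series_continuous c)
      show "integrable lborel (\<lambda>y. indicator C y * (M * ?T))"
        using fin by (intro integrable_mult_left integrable_real_indicator) auto
      show "norm (indicator C y *\<^sub>R (g y * (?S y - (\<Sum>k\<in>F. c k * wave k y)))) \<le> indicator C y * (M * ?T)" for y
        using M[of y] tb[of y] by (auto simp: indicator_def norm_mult M_def intro!: mult_mono)
    qed
    also have "\<dots> = measure lborel C * M * ?T" using fin by simp
    finally show "norm ((LINT y|lborel. indicator C y *\<^sub>R (g y * ?S y)) - (\<Sum>k\<in>F. c k * (LINT y|lborel. indicator C y *\<^sub>R (g y * wave k y))))
       \<le> measure lborel C * M * ?T" .
  qed
qed

lemma integral_wave_series_test:
  fixes c :: "('n::finite \<Rightarrow> int) \<Rightarrow> complex"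
  assumes c: "(\<lambda>k. norm (c k)) summable_on UNIV" and K: "compact K"
    and g: "continuous_on UNIV g" "\<And>x. x \<notin> K \<Longrightarrow> g x = 0"
  shows "((\<lambda>k. c k * (LINT y|lborel. g y * wave k y)) has_sum (LINT y|lborel. g y * (\<Sum>\<^sub>\<infinity>k. c k * wave k y))) UNIV"
proof -
  have "indicator K y *\<^sub>R (g y * u) = g y * u" for u y
    using g(2) by (auto simp: indicator_def)
  then show ?thesis
    using integral_wave_series[OF c continuous_on_subset[OF g(1) subset_UNIV] K] by (simp only:)
qed

text \<open>Termwise integration leaves a single coefficient, so f and its series have the same
  integrals against all waves over the box; \<open>fourier_uniqueness\<close> identifies them in its
  interior.\<close>

lemma fourier_inversion:
  fixes f :: "real^'n::finite \<Rightarrow> complex"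
  assumes f: "continuous_on UNIV f" "\<And>x. x \<notin> K \<Longrightarrow> f x = 0" "K \<subseteq> pbox z"
    and s: "(\<lambda>k. norm (fc f k)) summable_on UNIV" and x: "x \<in> pobox z"
  shows "((\<lambda>k. fc f k * wave k x) has_sum f x) UNIV"
proof -
  define S where "S y = (\<Sum>\<^sub>\<infinity>k. fc f k * wave k y)" for y
  have Sc: "continuous_on A S" for A
    unfolding S_def[abs_def] by (rule wave_series_continuous[OF s])
  define p where "p = complex_of_real ((2 * pi) ^ CARD('n))"
  have p0: "p \<noteq> 0" by (simp add: p_def)
  have fc_int: "(LINT y|lborel. indicator (pbox z) y *\<^sub>R (f y * wave l y)) = p * fc f (\<lambda>j. - l j)" for l
  proof -
    have "indicator (pbox z) y *\<^sub>R (f y * wave l y) = wave (\<lambda>j. - (- l j)) y * f y" for y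
      using f(2,3) by (cases "y \<in> pbox z") (auto simp: indicator_def)
    moreover have "fc f (\<lambda>j. - l j) = inverse p * (LINT y|lborel. wave (\<lambda>j. - (- l j)) y * f y)"
      by (simp add: fc_def p_def)
    ultimately show ?thesis using p0 by simp
  qed
  have "f x - S x = 0"
  proof (rule fourier_uniqueness[where h = "\<lambda>y. f y - S y" and z = z, OF _ _ x])
    show "continuous_on UNIV (\<lambda>y. f y - S y)" by (intro continuous_intros f Sc)
    fix l :: "'n \<Rightarrow> int"
    have ww: "(LINT y|lborel. indicator (pbox z) y *\<^sub>R (wave l y * wave k y)) = (if k = (\<lambda>j. - l j) then p else 0)" for k
    proof -
      have "(\<lambda>j. l j + k j) = (\<lambda>_. 0) \<longleftrightarrow> k = (\<lambda>j. - l j)"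
        by (auto simp: fun_eq_iff eq_neg_iff_add_eq_0 add.commute)
      then show ?thesis by (simp add: wave_mult integral_wave_period p_def)
    qed
    have "((\<lambda>k. fc f k * (if k = (\<lambda>j. - l j) then p else 0)) has_sum
        (LINT y|lborel. indicator (pbox z) y *\<^sub>R (wave l y * S y))) UNIV"
      using integral_wave_series[OF s continuous_on_wave[of "pbox z" l] compact_cbox] by (simp only: ww S_def)
    moreover have "((\<lambda>k. fc f k * (if k = (\<lambda>j. - l j) then p else 0)) has_sum (fc f (\<lambda>j. - l j) * p)) UNIV"
      by (rule has_sum_finite_neutralI[of "{\<lambda>j. - l j}"]) auto
    ultimately have "(LINT y|lborel. indicator (pbox z) y *\<^sub>R (wave l y * S y)) = fc f (\<lambda>j. - l j) * p"
      by (rule has_sum_unique)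
    then have "(LINT y|lborel. indicator (pbox z) y *\<^sub>R (f y * wave l y)) - (LINT y|lborel. indicator (pbox z) y *\<^sub>R (wave l y * S y)) = 0"
      by (simp add: fc_int)
    also have "(LINT y|lborel. indicator (pbox z) y *\<^sub>R (f y * wave l y)) - (LINT y|lborel. indicator (pbox z) y *\<^sub>R (wave l y * S y))
       = (LINT y|lborel. indicator (pbox z) y *\<^sub>R (f y * wave l y) - indicator (pbox z) y *\<^sub>R (wave l y * S y))"
      by (intro Bochner_Integration.integral_diff[symmetric] borel_integrable_compact compact_cbox continuous_intros Sc
          continuous_on_subset[OF f(1)]) auto
    also have "\<dots> = (LINT y|lborel. indicator (pbox z) y *\<^sub>R ((f y - S y) * wave l y))"
      by (simp add: algebra_simps)
    finally show "(LINT y|lborel. indicator (pbox z) y *\<^sub>R ((f y - S y) * wave l y)) = 0" .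
  qed
  then have "f x = S x" by simp
  then show ?thesis
    using has_sum_infsum[OF wave_series_summable[OF s, of x]] by (simp add: S_def)
qed

lemma fc_summable:
  fixes K :: "(real^'n::finite) set"
  assumes "compact K" "f \<in> test_functions_in K"
  shows "(\<lambda>k. norm (fc f k) * jap k ^ s) summable_on UNIV"
proof -
  obtain C where C: "\<And>k. norm (fc f k) * jap k ^ (s + 2 * CARD('n)) \<le> C"
    using fc_rapid_decay[OF assms] by blast
  show ?thesis
    by (rule summable_on_of_decay[of _ C]) (use C in \<open>auto simp: power_add mult.assoc\<close>)
qed

section \<open>Symbols with tame constants\<close>

text \<open>
  \<open>A\<close> controls the coefficients of the operator and the inverse of its ellipticity number;
  a quantity is tame if it is bounded by a fixed power of \<open>A\<close>.
\<close>

locale growth =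
  fixes I :: "'i set" and A :: "'i \<Rightarrow> real"
  assumes A_ge_1: "\<And>i. i \<in> I \<Longrightarrow> 1 \<le> A i"
begin

definition tame :: "('i \<Rightarrow> real) \<Rightarrow> bool" where
  "tame F \<longleftrightarrow> (\<exists>C\<ge>0. \<exists>N. \<forall>i\<in>I. F i \<le> C * A i ^ N)"

lemma A_pos: "i \<in> I \<Longrightarrow> 0 < A i" "i \<in> I \<Longrightarrow> 0 \<le> A i"
  using A_ge_1[of i] by auto

lemma A_power_mono: "i \<in> I \<Longrightarrow> M \<le> N \<Longrightarrow> A i ^ M \<le> A i ^ N"
  by (intro power_increasing A_ge_1)

lemma tameE:
  assumes "tame F"
  obtains C N where "0 \<le> C" "\<And>i. i \<in> I \<Longrightarrow> F i \<le> C * A i ^ N"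
  using assms unfolding tame_def by blast

lemma tameI: "0 \<le> C \<Longrightarrow> (\<And>i. i \<in> I \<Longrightarrow> F i \<le> C * A i ^ N) \<Longrightarrow> tame F"
  unfolding tame_def by blast

lemma tame_const: "tame (\<lambda>_. c)"
  by (rule tameI[of "\<bar>c\<bar>" _ 0]) auto

lemma tame_A: "tame A"
  by (rule tameI[of 1 _ 1]) auto

lemma tame_mono: "tame G \<Longrightarrow> (\<And>i. i \<in> I \<Longrightarrow> F i \<le> G i) \<Longrightarrow> tame F"
  unfolding tame_def by (meson order_trans)

lemma tame_add:
  assumes "tame F" "tame G"
  shows "tame (\<lambda>i. F i + G i)"
proof -
  obtain C M where C: "0 \<le> C" "\<And>i. i \<in> I \<Longrightarrow> F i \<le> C * A i ^ M" by (rule tameE[OF assms(1)]) blast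
  obtain D N where D: "0 \<le> D" "\<And>i. i \<in> I \<Longrightarrow> G i \<le> D * A i ^ N" by (rule tameE[OF assms(2)]) blast
  show ?thesis
  proof (rule tameI[of "C + D"])
    fix i assume i: "i \<in> I"
    have "F i + G i \<le> C * A i ^ M + D * A i ^ N" using C D i by (intro add_mono)
    also have "\<dots> \<le> C * A i ^ (M + N) + D * A i ^ (M + N)"
      using C D i by (intro add_mono mult_left_mono A_power_mono) auto
    finally show "F i + G i \<le> (C + D) * A i ^ (M + N)" by (simp add: distrib_right)
  qed (use C D in auto)
qed

lemma tame_mult:
  assumes "tame F" "tame G" "\<And>i. i \<in> I \<Longrightarrow> 0 \<le> G i"
  shows "tame (\<lambda>i. F i * G i)"
proof -
  obtain C M where C: "0 \<le> C" "\<And>i. i \<in> I \<Longrightarrow> F i \<le> C * A i ^ M" by (rule tameE[OF assms(1)]) blast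
  obtain D N where D: "0 \<le> D" "\<And>i. i \<in> I \<Longrightarrow> G i \<le> D * A i ^ N" by (rule tameE[OF assms(2)]) blast
  show ?thesis
  proof (rule tameI[of "C * D"])
    fix i assume i: "i \<in> I"
    have "F i * G i \<le> (C * A i ^ M) * (D * A i ^ N)"
      using C D i assms(3) A_pos by (intro mult_mono) auto
    then show "F i * G i \<le> (C * D) * A i ^ (M + N)" by (simp add: power_add mult_ac)
  qed (use C D in auto)
qed

lemma tame_power: "tame F \<Longrightarrow> (\<And>i. i \<in> I \<Longrightarrow> 0 \<le> F i) \<Longrightarrow> tame (\<lambda>i. F i ^ n)"
proof (induction n)
  case (Suc n)
  then have "tame (\<lambda>i. F i * F i ^ n)" by (intro tame_mult) auto
  then show ?case by simp
qed (simp add: tame_const)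

section \<open>Symbols on the integer lattice with tame constants\<close>

definition ubd :: "real \<Rightarrow> ('i \<Rightarrow> ('n::finite \<Rightarrow> int) \<Rightarrow> complex) \<Rightarrow> bool" where
  "ubd s f \<longleftrightarrow> (\<exists>T. tame T \<and> (\<forall>i\<in>I. 0 \<le> T i \<and> (\<forall>k. norm (f i k) \<le> T i * jap k powr s)))"

lemma ubdI: "tame T \<Longrightarrow> (\<And>i. i \<in> I \<Longrightarrow> 0 \<le> T i) \<Longrightarrow>
    (\<And>i k. i \<in> I \<Longrightarrow> norm (f i k) \<le> T i * jap k powr s) \<Longrightarrow> ubd s f"
  unfolding ubd_def by blast

lemma ubdE:
  assumes "ubd s f"
  obtains T where "tame T" "\<And>i. i \<in> I \<Longrightarrow> 0 \<le> T i" "\<And>i k. i \<in> I \<Longrightarrow> norm (f i k) \<le> T i * jap k powr s"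
  using assms unfolding ubd_def by blast

lemma ubd_mono:
  assumes "ubd s f" "s \<le> t" shows "ubd t f"
proof -
  obtain T where T: "tame T" "\<And>i. i \<in> I \<Longrightarrow> 0 \<le> T i" "\<And>i k. i \<in> I \<Longrightarrow> norm (f i k) \<le> T i * jap k powr s"
    by (rule ubdE[OF assms(1)]) blast
  have "T i * jap k powr s \<le> T i * jap k powr t" if "i \<in> I" for i and k :: "'a \<Rightarrow> int"
    using T(2)[OF that] assms(2) jap_ge_1[of k] by (intro mult_left_mono powr_mono) auto
  with T(3) have "norm (f i k) \<le> T i * jap k powr t" if "i \<in> I" for i k
    using order_trans that by blast
  with T(1,2) show ?thesis by (rule ubdI)
qed

lemma ubd_add:
  assumes "ubd s f" "ubd s g" shows "ubd s (\<lambda>i k. f i k + g i k)"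
proof -
  obtain T where T: "tame T" "\<And>i. i \<in> I \<Longrightarrow> 0 \<le> T i" "\<And>i k. i \<in> I \<Longrightarrow> norm (f i k) \<le> T i * jap k powr s"
    by (rule ubdE[OF assms(1)]) blast
  obtain U where U: "tame U" "\<And>i. i \<in> I \<Longrightarrow> 0 \<le> U i" "\<And>i k. i \<in> I \<Longrightarrow> norm (g i k) \<le> U i * jap k powr s"
    by (rule ubdE[OF assms(2)]) blast
  show ?thesis
    using T U by (intro ubdI[of "\<lambda>i. T i + U i"] tame_add)
      (auto simp: distrib_right intro!: order_trans[OF norm_triangle_ineq] add_mono)
qed

lemma ubd_mult:
  assumes "ubd s f" "ubd t g" shows "ubd (s + t) (\<lambda>i k. f i k * g i k)"
proof -
  obtain T where T: "tame T" "\<And>i. i \<in> I \<Longrightarrow> 0 \<le> T i" "\<And>i k. i \<in> I \<Longrightarrow> norm (f i k) \<le> T i * jap k powr s"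
    by (rule ubdE[OF assms(1)]) blast
  obtain U where U: "tame U" "\<And>i. i \<in> I \<Longrightarrow> 0 \<le> U i" "\<And>i k. i \<in> I \<Longrightarrow> norm (g i k) \<le> U i * jap k powr t"
    by (rule ubdE[OF assms(2)]) blast
  show ?thesis
  proof (intro ubdI[of "\<lambda>i. T i * U i"] tame_mult T U)
    fix i k assume i: "i \<in> I"
    have "norm (f i k * g i k) \<le> (T i * jap k powr s) * (U i * jap k powr t)"
      unfolding norm_mult using T U i by (intro mult_mono) auto
    then show "norm (f i k * g i k) \<le> (T i * U i) * jap k powr (s + t)"
      by (simp add: powr_add mult_ac)
  qed (use T U in auto)
qed

definition sh :: "'n \<Rightarrow> int \<Rightarrow> (('n \<Rightarrow> int) \<Rightarrow> complex) \<Rightarrow> ('n \<Rightarrow> int) \<Rightarrow> complex" where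
  "sh j d g k = g (k(j := k j + d))"

definition fd :: "'n \<Rightarrow> (('n \<Rightarrow> int) \<Rightarrow> complex) \<Rightarrow> ('n \<Rightarrow> int) \<Rightarrow> complex" where
  "fd j g k = sh j 1 g k - g k"

lemma fd_const [simp]: "fd j (\<lambda>_. c) = (\<lambda>_. 0)"
  by (simp add: fd_def sh_def fun_eq_iff)

lemma jap_shift_le: "jap (k(j := k j + d)) \<le> (1 + \<bar>of_int d\<bar>) * jap k"
proof -
  have "k(j := k j + d) = (\<lambda>i. k i + (if i = j then d else 0))" by auto
  moreover have "jap (\<lambda>i. if i = j then d else 0) = 1 + \<bar>of_int d\<bar>"
  proof -
    have "(\<Sum>i\<in>UNIV. \<bar>real_of_int (if i = j then d else 0)\<bar>) = (\<Sum>i\<in>UNIV. if i = j then \<bar>real_of_int d\<bar> else 0)"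
      by (intro sum.cong) auto
    then show ?thesis by (simp add: jap_def)
  qed
  ultimately show ?thesis using jap_add_le[of k "\<lambda>i. if i = j then d else 0"] by (simp add: mult.commute)
qed

lemma jap_le_shift: "jap k \<le> (1 + \<bar>of_int d\<bar>) * jap (k(j := k j + d))"
  using jap_shift_le[of "k(j := k j + d)" j "- d"] by simp

text \<open>For negative s the comparison is reversed, regarding k as a shift of the shifted
  point.\<close>

lemma jap_shift_powr: "jap (k(j := k j + d)) powr s \<le> (1 + \<bar>of_int d\<bar>) powr \<bar>s\<bar> * jap k powr s"
proof (cases "0 \<le> s")
  case True
  then show ?thesis
    using powr_mono2[OF True _ jap_shift_le[of k j d]] by (simp add: powr_mult)
next
  case False
  let ?c = "1 + \<bar>real_of_int d\<bar>"
  have "jap k \<le> ?c * jap (k(j := k j + d))" by (rule jap_le_shift)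
  then have "jap k / ?c \<le> jap (k(j := k j + d))" by (simp add: divide_le_eq mult.commute add_pos_nonneg)
  then have "jap (k(j := k j + d)) powr s \<le> (jap k / ?c) powr s"
    using False by (intro powr_mono2') (auto simp: add_pos_nonneg)
  also have "\<dots> = ?c powr \<bar>s\<bar> * jap k powr s"
    using False by (simp add: powr_divide powr_minus field_simps)
  finally show ?thesis .
qed

lemma ubd_sh:
  assumes "ubd s f" shows "ubd s (\<lambda>i. sh j d (f i))"
proof -
  obtain T where T: "tame T" "\<And>i. i \<in> I \<Longrightarrow> 0 \<le> T i" "\<And>i k. i \<in> I \<Longrightarrow> norm (f i k) \<le> T i * jap k powr s"
    by (rule ubdE[OF assms(1)]) blast
  let ?c = "(1 + \<bar>real_of_int d\<bar>) powr \<bar>s\<bar>"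
  show ?thesis
  proof (rule ubdI[of "\<lambda>i. T i * ?c"])
    show "tame (\<lambda>i. T i * ?c)" by (rule tame_mult[OF T(1) tame_const]) simp
    show "0 \<le> T i * ?c" if "i \<in> I" for i using T(2)[OF that] by simp
    fix i k assume i: "i \<in> I"
    have "norm (sh j d (f i) k) \<le> T i * jap (k(j := k j + d)) powr s"
      unfolding sh_def by (rule T(3)[OF i])
    also have "\<dots> \<le> T i * (?c * jap k powr s)"
      by (intro mult_left_mono jap_shift_powr T i)
    finally show "norm (sh j d (f i) k) \<le> T i * ?c * jap k powr s" by (simp add: mult_ac)
  qed
qed

text \<open>The discrete counterpart of the class S^s_{1,0} of pseudodifferential calculus:
  differences replace derivatives in the frequency, \<open>l\<close> of them are controlled, and
  each lowers the order by one.\<close>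

primrec symb :: "nat \<Rightarrow> real \<Rightarrow> ('i \<Rightarrow> ('n::finite \<Rightarrow> int) \<Rightarrow> complex) \<Rightarrow> bool" where
  "symb 0 s f \<longleftrightarrow> ubd s f"
| "symb (Suc l) s f \<longleftrightarrow> ubd s f \<and> (\<forall>j. symb l (s - 1) (\<lambda>i. fd j (f i)))"

lemma symb_ubd: "symb l s f \<Longrightarrow> ubd s f"
  by (cases l) auto

lemma symb_Suc_imp: "symb (Suc l) s f \<Longrightarrow> symb l s f"
  by (induction l arbitrary: s f) auto

lemma symb_mono: "symb l s f \<Longrightarrow> s \<le> t \<Longrightarrow> symb l t f"
proof (induction l arbitrary: s t f)
  case (Suc l)
  have "symb l (t - 1) (\<lambda>i. fd j (f i))" for j
    by (rule Suc.IH[of "s - 1"]) (use Suc.prems in simp_all)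
  moreover have "ubd t f" by (rule ubd_mono[OF symb_ubd]) (rule Suc.prems)+
  ultimately show ?case by simp
next
  case 0
  then show ?case using ubd_mono[of s f t] by simp
qed

lemma symb_add: "symb l s f \<Longrightarrow> symb l s g \<Longrightarrow> symb l s (\<lambda>i k. f i k + g i k)"
proof (induction l arbitrary: s f g)
  case (Suc l)
  have "(\<lambda>i. fd j (\<lambda>k. f i k + g i k)) = (\<lambda>i k. fd j (f i) k + fd j (g i) k)" for j
    by (simp add: fd_def sh_def fun_eq_iff)
  moreover have "symb l (s - 1) (\<lambda>i k. fd j (f i) k + fd j (g i) k)" for j
    using Suc.prems by (intro Suc.IH) auto
  ultimately show ?case using Suc.prems by (auto intro: ubd_add)
qed (auto intro: ubd_add)

lemma symb_sh: "symb l s f \<Longrightarrow> symb l s (\<lambda>i. sh j d (f i))"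
proof (induction l arbitrary: s f)
  case (Suc l)
  have "(\<lambda>i. fd j' (sh j d (f i))) = (\<lambda>i. sh j d (fd j' (f i)))" for j'
  proof (intro ext)
    fix i k
    have "(k(j' := k j' + 1))(j := (k(j' := k j' + 1)) j + d) = (k(j := k j + d))(j' := (k(j := k j + d)) j' + 1)"
      by auto
    then show "fd j' (sh j d (f i)) k = sh j d (fd j' (f i)) k" by (simp only: fd_def sh_def)
  qed
  then show ?case using Suc by (auto intro: ubd_sh)
qed (auto intro: ubd_sh)

text \<open>The Leibniz rule for differences carries a shifted factor: fd (f g) = (fd f) g + (sh f)
  (fd g). Hence the need for stability under \<open>sh\<close>.\<close>

lemma symb_mult: "symb l s f \<Longrightarrow> symb l t g \<Longrightarrow> symb l (s + t) (\<lambda>i k. f i k * g i k)"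
proof (induction l arbitrary: s t f g)
  case (Suc l)
  have e: "(\<lambda>i. fd j (\<lambda>k. f i k * g i k)) = (\<lambda>i k. fd j (f i) k * g i k + sh j 1 (f i) k * fd j (g i) k)" for j
    by (simp add: fd_def sh_def fun_eq_iff algebra_simps)
  have "symb l (s + t - 1) (\<lambda>i. fd j (\<lambda>k. f i k * g i k))" for j
    unfolding e
  proof (rule symb_add)
    have "symb l ((s - 1) + t) (\<lambda>i k. fd j (f i) k * g i k)"
      by (rule Suc.IH[OF _ symb_Suc_imp[OF Suc.prems(2)]]) (use Suc.prems in simp)
    then show "symb l (s + t - 1) (\<lambda>i k. fd j (f i) k * g i k)" by (simp add: algebra_simps)
    have "symb l (s + (t - 1)) (\<lambda>i k. sh j 1 (f i) k * fd j (g i) k)"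
      by (rule Suc.IH[OF symb_sh[OF symb_Suc_imp[OF Suc.prems(1)]]]) (use Suc.prems in simp)
    then show "symb l (s + t - 1) (\<lambda>i k. sh j 1 (f i) k * fd j (g i) k)" by (simp add: algebra_simps)
  qed
  then show ?case using Suc.prems by (auto intro: ubd_mult)
qed (auto intro: ubd_mult)

text \<open>By fd (1/f) = - (fd f) (1/f) (sh (1/f)), the differences of 1/f reduce to those of f and
  to 1/f with one difference less; the only analytic input beyond f being a symbol is the lower
  bound of |f| contained in \<open>inv\<close>.\<close>

lemma symb_inverse:
  assumes nz: "\<And>i k. f i k \<noteq> 0" and inv: "ubd (- s) (\<lambda>i k. inverse (f i k))"
  shows "symb l s f \<Longrightarrow> symb l (- s) (\<lambda>i k. inverse (f i k))"
proof (induction l)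
  case (Suc l)
  let ?g = "\<lambda>i k. inverse (f i k)"
  have g: "symb l (- s) ?g" by (rule Suc.IH[OF symb_Suc_imp[OF Suc.prems]])
  have e: "(\<lambda>i. fd j (?g i)) = (\<lambda>i k. ((- 1) * fd j (f i) k) * ?g i k * sh j 1 (?g i) k)" for j
    using nz by (auto simp: fd_def sh_def fun_eq_iff field_simps)
  have m1: "symb l 0 (\<lambda>i k. - 1)"
  proof (induction l)
    case 0
    show ?case by (auto intro!: ubdI[of "\<lambda>_. 1"] tame_const)
  next
    case (Suc l)
    have "symb l t (\<lambda>i k. 0)" for l and t :: real
      by (induction l arbitrary: t) (auto intro!: ubdI[of "\<lambda>_. 0"] tame_const simp: fd_def sh_def)
    then show ?case by (auto intro!: ubdI[of "\<lambda>_. 1"] tame_const simp: fd_def sh_def)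
  qed
  have "symb l (0 + (s - 1) + - s + - s) (\<lambda>i. fd j (?g i))" for j
    unfolding e using Suc.prems by (intro symb_mult m1 g symb_sh) auto
  moreover have "0 + (s - 1) + - s + - s = - s - 1" by simp
  ultimately have "symb l (- s - 1) (\<lambda>i. fd j (?g i))" for j by (simp only:)
  then show ?case using inv by simp
qed (use inv in simp)

lemma symb_zero: "symb l s (\<lambda>i k. 0)"
  by (induction l arbitrary: s) (auto intro!: ubdI[of "\<lambda>_. 0"] tame_const simp: fd_def sh_def)

lemma symb_const: "tame (\<lambda>i. norm (c i)) \<Longrightarrow> symb l 0 (\<lambda>i k. c i)"
  by (cases l) (auto intro!: ubdI[of "\<lambda>i. norm (c i)"] symb_zero simp: fd_def sh_def)

lemma symb_coord: "symb l 1 (\<lambda>i k. of_int (k j))"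
proof -
  have u: "ubd 1 (\<lambda>i k. of_int (k j))"
    using abs_le_jap by (auto intro!: ubdI[of "\<lambda>_. 1"] tame_const)
  have e: "fd j' (\<lambda>k. of_int (k j)) = (\<lambda>k. if j = j' then 1 else 0)" for j'
    by (auto simp: fd_def sh_def fun_eq_iff)
  have "symb l 0 (\<lambda>i. fd j' (\<lambda>k. of_int (k j)))" for l j'
    unfolding e by (intro symb_const tame_const)
  then show ?thesis using u by (cases l) auto
qed

lemma symb_sum: "(\<And>a. a \<in> S \<Longrightarrow> symb l s (f a)) \<Longrightarrow> symb l s (\<lambda>i k. \<Sum>a\<in>S. f a i k)"
  by (induction S rule: infinite_finite_induct) (auto intro: symb_zero symb_add)

lemma symb_power: "symb l s f \<Longrightarrow> symb l (real n * s) (\<lambda>i k. f i k ^ n)"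
proof (induction n)
  case 0
  show ?case using symb_const[of "\<lambda>_. 1" l] by (simp add: tame_const)
next
  case (Suc n)
  then have "symb l (s + real n * s) (\<lambda>i k. f i k * f i k ^ n)" by (intro symb_mult) auto
  then show ?case by (simp add: algebra_simps)
qed

lemma symb_prod:
  assumes "\<And>a. a \<in> S \<Longrightarrow> symb l (s a) (f a)" "finite S"
  shows "symb l (\<Sum>a\<in>S. s a) (\<lambda>i k. \<Prod>a\<in>S. f a i k)"
  using assms(2,1)
proof (induction S rule: finite_induct)
  case empty
  show ?case using symb_const[of "\<lambda>_. 1" l] by (simp add: tame_const)
next
  case (insert a S)
  then have "symb l (s a + (\<Sum>a\<in>S. s a)) (\<lambda>i k. f a i k * (\<Prod>a\<in>S. f a i k))"
    by (intro symb_mult) auto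
  with insert show ?case by simp
qed

text \<open>On the support R^N jap^(-N) is at least 1, so every negative order is reached at the
  price of a power of R, which is tame. A difference at most doubles the radius and the bound. This
  is how frequencies excluded in dependence on the index are paid for.\<close>

lemma symb_finite_support:
  assumes R: "tame R" "\<And>i. i \<in> I \<Longrightarrow> 1 \<le> R i" and T: "tame T" "\<And>i. i \<in> I \<Longrightarrow> 0 \<le> T i"
    and f: "\<And>i k. i \<in> I \<Longrightarrow> norm (f i k) \<le> T i" "\<And>i k. i \<in> I \<Longrightarrow> R i < jap k \<Longrightarrow> f i k = 0"
  shows "symb l s f"
proof -
  have u: "ubd s f" if R: "tame R" "\<And>i. i \<in> I \<Longrightarrow> 1 \<le> R i" and T: "tame T" "\<And>i. i \<in> I \<Longrightarrow> 0 \<le> T i"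
    and f: "\<And>i k. i \<in> I \<Longrightarrow> norm (f i k) \<le> T i" "\<And>i k. i \<in> I \<Longrightarrow> R i < jap k \<Longrightarrow> f i k = 0" for s R T f
  proof (rule ubd_mono)
    define N where "N = nat \<lceil>- s\<rceil>"
    have Ns: "- real N \<le> s" by (simp add: N_def) linarith
    show "- real N \<le> s" by (rule Ns)
    show "ubd (- real N) f"
    proof (intro ubdI[of "\<lambda>i. T i * R i ^ N"] tame_mult tame_power R T)
      fix i k assume i: "i \<in> I"
      show "norm (f i k) \<le> T i * R i ^ N * jap k powr (- real N)"
      proof (cases "R i < jap k")
        case True
        then show ?thesis using f(2)[OF i True] T(2)[OF i] R(2)[OF i] by simp
      next
        case False
        then have "jap k ^ N \<le> R i ^ N" by (intro power_mono) auto
        then have "1 \<le> R i ^ N * jap k powr (- real N)"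
          by (simp add: powr_minus powr_realpow field_simps)
        then have "T i * 1 \<le> T i * (R i ^ N * jap k powr (- real N))"
          by (intro mult_left_mono T i)
        then show ?thesis using f(1)[OF i, of k] by (simp add: mult.assoc)
      qed
    qed (use R T in \<open>auto intro!: mult_nonneg_nonneg zero_le_power intro: order_trans[of 0 1]\<close>)
  qed
  show ?thesis
    using assms
  proof (induction l arbitrary: s f R T)
    case 0
    then show ?case using u[of R T f s] by simp
  next
    case (Suc l)
    have "symb l (s - 1) (\<lambda>i. fd j (f i))" for j
    proof (rule Suc.IH[of "\<lambda>i. R i * 2" "\<lambda>i. T i * 2"])
      show "tame (\<lambda>i. R i * 2)" "tame (\<lambda>i. T i * 2)"
        using Suc.prems by (auto intro!: tame_mult tame_const)
      show "1 \<le> R i * 2" "0 \<le> T i * 2" if "i \<in> I" for i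
        using Suc.prems(2,4)[OF that] by auto
      fix i k assume i: "i \<in> I"
      show "norm (fd j (f i) k) \<le> T i * 2"
      proof -
        have "norm (sh j 1 (f i) k) \<le> T i" unfolding sh_def by (rule Suc.prems(5)[OF i])
        then show ?thesis
          unfolding fd_def using Suc.prems(5)[OF i, of k] norm_triangle_ineq4[of "sh j 1 (f i) k" "f i k"] by linarith
      qed
      assume "R i * 2 < jap k"
      moreover have "jap k \<le> 2 * jap (k(j := k j + 1))" using jap_le_shift[of k 1 j] by simp
      ultimately have "R i < jap (k(j := k j + 1))" "R i < jap k"
        using Suc.prems(2)[OF i] by linarith+
      then show "fd j (f i) k = 0" using Suc.prems(6)[OF i] by (simp add: fd_def sh_def)
    qed
    moreover have "ubd s f" using Suc.prems u[of R T f s] by simp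
    ultimately show ?case by simp
  qed
qed

end

text \<open>The negative discrete Laplacian, with the sign that makes it correspond to
  multiplication by the nonnegative function \<open>theta\<close>. As a second difference it lowers
  the order of a symbol by 2.\<close>

definition lap :: "(('n::finite \<Rightarrow> int) \<Rightarrow> complex) \<Rightarrow> ('n \<Rightarrow> int) \<Rightarrow> complex" where
  "lap g k = (\<Sum>j\<in>UNIV. 2 * g k - g (k(j := k j + 1)) - g (k(j := k j - 1)))"

context growth begin

lemma symb_lap:
  assumes "symb (Suc (Suc l)) s f" shows "symb l (s - 2) (\<lambda>i. lap (f i))"
proof -
  have e: "lap g k = (\<Sum>j\<in>UNIV. (- 1) * sh j (- 1) (fd j (fd j g)) k)" for g :: "('a \<Rightarrow> int) \<Rightarrow> complex" and k
    unfolding lap_def by (intro sum.cong) (auto simp: fd_def sh_def)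
  have "symb l (s - 2) (\<lambda>i. sh j (- 1) (fd j (fd j (f i))))" for j
    using assms by (intro symb_sh) auto
  then have "symb l (0 + (s - 2)) (\<lambda>i k. (- 1) * sh j (- 1) (fd j (fd j (f i))) k)" for j
    by (intro symb_mult symb_const tame_const)
  then have "symb l (s - 2) (\<lambda>i k. \<Sum>j\<in>UNIV. (- 1) * sh j (- 1) (fd j (fd j (f i))) k)"
    by (intro symb_sum) simp
  moreover have "(\<lambda>i. lap (f i)) = (\<lambda>i k. \<Sum>j\<in>UNIV. (- 1) * sh j (- 1) (fd j (fd j (f i))) k)"
    by (intro ext e)
  ultimately show ?thesis by simp
qed

lemma ubd_lap_power:
  assumes "symb (2 * B) s f" shows "ubd (s - 2 * real B) (\<lambda>i. (lap ^^ B) (f i))"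
  using assms
proof (induction B arbitrary: s f)
  case (Suc B)
  have "ubd (s - 2 - 2 * real B) (\<lambda>i. (lap ^^ B) (lap (f i)))"
    using Suc.prems by (intro Suc.IH symb_lap) simp
  then show ?case by (simp add: algebra_simps funpow_swap1 del: funpow.simps add: funpow_Suc_right)
qed simp

end

lemma wave_series_shift:
  fixes c :: "('n::finite \<Rightarrow> int) \<Rightarrow> complex"
  assumes "((\<lambda>k. c k * wave k x) has_sum S) UNIV"
  shows "((\<lambda>k. c (k(j := k j + d)) * wave k x) has_sum (cis (- of_int d * x $ j) * S)) UNIV"
proof -
  have b: "bij_betw (\<lambda>k::'n \<Rightarrow> int. k(j := k j + d)) UNIV UNIV"
    by (rule bij_betwI[of _ _ _ "\<lambda>k. k(j := k j - d)"]) auto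
  have "wave (k(j := k j + d)) x = cis (of_int d * x $ j) * wave k x" for k
  proof -
    have "(\<Sum>i\<in>UNIV. of_int ((k(j := k j + d)) i) * x $ i) = (\<Sum>i\<in>UNIV. of_int (k i) * x $ i + (if i = j then of_int d * x $ j else 0))"
      by (intro sum.cong) (auto simp: algebra_simps)
    then show ?thesis by (simp add: wave_def sum.distrib cis_mult add.commute)
  qed
  moreover have "((\<lambda>k. c (k(j := k j + d)) * wave (k(j := k j + d)) x) has_sum S) UNIV"
    using has_sum_reindex_bij_betw[OF b, of "\<lambda>k. c k * wave k x" S] assms by simp
  ultimately have "((\<lambda>k. c (k(j := k j + d)) * (cis (of_int d * x $ j) * wave k x)) has_sum S) UNIV"
    by simp
  from has_sum_cmult_right[OF this, of "cis (- of_int d * x $ j)"]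
  show ?thesis by (simp add: mult_ac cis_mult flip: mult.assoc[of "cis _" "cis _"])
qed

lemma wave_series_lap:
  fixes c :: "('n::finite \<Rightarrow> int) \<Rightarrow> complex"
  assumes "((\<lambda>k. c k * wave k x) has_sum S) UNIV"
  shows "((\<lambda>k. lap c k * wave k x) has_sum (of_real (theta x) * S)) UNIV"
proof -
  have "((\<lambda>k. \<Sum>j\<in>UNIV. 2 * (c k * wave k x) - c (k(j := k j + 1)) * wave k x - c (k(j := k j + (- 1))) * wave k x)
     has_sum (\<Sum>j\<in>UNIV. 2 * S - cis (- of_int 1 * x $ j) * S - cis (- of_int (- 1) * x $ j) * S)) UNIV"
    by (intro has_sum_sum_finite has_sum_minus has_sum_cmult_right assms wave_series_shift)
  moreover have "(\<Sum>j\<in>UNIV. 2 * S - cis (- of_int 1 * x $ j) * S - cis (- of_int (- 1) * x $ j) * S) = of_real (theta x) * S"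
  proof -
    have "2 * S - cis (- of_int 1 * x $ j) * S - cis (- of_int (- 1) * x $ j) * S = of_real (2 - 2 * cos (x $ j)) * S" for j
      by (simp add: complex_eq_iff algebra_simps)
    then show ?thesis by (simp add: theta_def sum_distrib_right)
  qed
  moreover have "(\<Sum>j\<in>UNIV. 2 * (c k * wave k x) - c (k(j := k j + 1)) * wave k x - c (k(j := k j + (- 1))) * wave k x)
      = lap c k * wave k x" for k
    unfolding lap_def sum_distrib_right by (intro sum.cong) (auto simp: left_diff_distrib)
  ultimately show ?thesis by simp
qed

lemma wave_series_lap_power:
  assumes "((\<lambda>k. c k * wave k x) has_sum S) UNIV"
  shows "((\<lambda>k. (lap ^^ B) c k * wave k x) has_sum (of_real (theta x) ^ B * S)) UNIV"
proof (induction B)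
  case (Suc B)
  from wave_series_lap[OF this] show ?case by (simp add: mult.assoc)
qed (use assms in simp)

section \<open>The parametrix\<close>

text \<open>The operator 1 - Laplacian.\<close>

definition bessel :: "(real^'n::finite \<Rightarrow> complex) \<Rightarrow> real^'n \<Rightarrow> complex" where
  "bessel v x = v x - (\<Sum>j\<in>UNIV. pd j (pd j v) x)"

lemma fc_add:
  assumes "compact K" "f \<in> test_functions_in K" "g \<in> test_functions_in K"
  shows "fc (\<lambda>x. f x + g x) k = fc f k + fc g k"
proof -
  have "integrable lborel (\<lambda>x. wave (\<lambda>j. - k j) x * f x)" "integrable lborel (\<lambda>x. wave (\<lambda>j. - k j) x * g x)"
    using assms by (auto intro!: test_function_integrable[OF assms(1)] test_functions_mult_smooth smooth_wave)
  then show ?thesis by (simp add: fc_def distrib_left)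
qed

lemma fc_cmult: "fc (\<lambda>x. c * f x) k = c * fc f k"
  by (simp add: fc_def mult.left_commute[of _ c])

lemma fc_sum:
  assumes "compact K" "\<And>a. a \<in> S \<Longrightarrow> f a \<in> test_functions_in K"
  shows "fc (\<lambda>x. \<Sum>a\<in>S. f a x) k = (\<Sum>a\<in>S. fc (f a) k)"
  using assms(2)
proof (induction S rule: infinite_finite_induct)
  case (insert a S)
  then show ?case
    using fc_add[OF assms(1), of "f a" "\<lambda>x. \<Sum>a\<in>S. f a x" k] by (simp add: test_functions_sum)
qed (simp_all add: fc_def)

text \<open>The symbol of the n-th power of \<open>bessel\<close>. Division by it lowers the order
  by 2 n, just enough for absolute convergence whatever the order m of the operator, including m =
  0.\<close>

definition bsym :: "('n::finite \<Rightarrow> int) \<Rightarrow> complex" where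
  "bsym k = (1 + (\<Sum>j\<in>UNIV. (of_int (k j))\<^sup>2)) ^ CARD('n)"

lemma bessel_test:
  assumes "compact K" "v \<in> test_functions_in K"
  shows "bessel v \<in> test_functions_in K" "fc (bessel v) k = (1 + (\<Sum>j\<in>UNIV. (of_int (k j))\<^sup>2)) * fc v k"
proof -
  have d: "pd j (pd j v) \<in> test_functions_in K" for j
    using assms by (intro test_functions_pd compact_imp_closed)
  have e: "bessel v = (\<lambda>x. v x + (- 1) * (\<Sum>j\<in>UNIV. pd j (pd j v) x))"
    by (simp add: bessel_def fun_eq_iff)
  show "bessel v \<in> test_functions_in K"
    unfolding e by (intro test_functions_add test_functions_cmult test_functions_sum d assms)
  have "fc (bessel v) k = fc v k - (\<Sum>j\<in>UNIV. fc (pd j (pd j v)) k)"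
  proof -
    have "fc (bessel v) k = fc v k + fc (\<lambda>x. (- 1) * (\<Sum>j\<in>UNIV. pd j (pd j v) x)) k"
      unfolding e by (intro fc_add[OF assms] test_functions_cmult test_functions_sum d)
    also have "fc (\<lambda>x. (- 1) * (\<Sum>j\<in>UNIV. pd j (pd j v) x)) k = (- 1) * (\<Sum>j\<in>UNIV. fc (pd j (pd j v)) k)"
      unfolding fc_cmult fc_sum[OF assms(1) d] ..
    finally show ?thesis by simp
  qed
  also have "\<dots> = (1 + (\<Sum>j\<in>UNIV. (of_int (k j))\<^sup>2)) * fc v k"
    using fc_pd[OF assms(1)] assms(2) test_functions_pd[OF compact_imp_closed[OF assms(1)] assms(2)]
    by (simp add: distrib_right sum_distrib_right power2_eq_square sum_negf flip: mult.assoc)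
       (simp add: mult_ac sum_negf)
  finally show "fc (bessel v) k = (1 + (\<Sum>j\<in>UNIV. (of_int (k j))\<^sup>2)) * fc v k" .
qed

lemma bessel_power_test:
  assumes "compact K" "v \<in> test_functions_in K"
  shows "(bessel ^^ N) v \<in> test_functions_in K"
    "fc ((bessel ^^ N) v) k = (1 + (\<Sum>j\<in>UNIV. (of_int (k j))\<^sup>2)) ^ N * fc v k"
proof -
  have "(bessel ^^ N) v \<in> test_functions_in K \<and> fc ((bessel ^^ N) v) k = (1 + (\<Sum>j\<in>UNIV. (of_int (k j))\<^sup>2)) ^ N * fc v k"
    by (induction N) (use assms bessel_test[OF assms(1)] in \<open>auto simp: mult.assoc\<close>)
  then show "(bessel ^^ N) v \<in> test_functions_in K"
    "fc ((bessel ^^ N) v) k = (1 + (\<Sum>j\<in>UNIV. (of_int (k j))\<^sup>2)) ^ N * fc v k" by auto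
qed

text \<open>A Fourier multiplier with summable coefficients is convolution with a continuous kernel;
  this is how the locality of a multiplier is read off from the zeros of its kernel.\<close>

lemma convolution_wave_series:
  fixes c :: "('n::finite \<Rightarrow> int) \<Rightarrow> complex"
  assumes c: "(\<lambda>k. norm (c k)) summable_on UNIV" and K: "compact K" and f: "f \<in> test_functions_in K"
  shows "((\<lambda>k. c k * fc f k * wave k x) has_sum
    (inverse (of_real ((2 * pi) ^ CARD('n))) * (LINT y|lborel. f y * (\<Sum>\<^sub>\<infinity>k. c k * wave k (x - y))))) UNIV"
proof -
  let ?p = "inverse (complex_of_real ((2 * pi) ^ CARD('n)))"
  \<comment> \<open>The kernel depends on x - y while the integral is taken against waves in y, so
    the frequency changes sign.\<close>
  define m where "m k = (\<lambda>j::'n. - k j)" for k :: "'n \<Rightarrow> int"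
  have b: "bij_betw m UNIV UNIV" by (rule bij_betwI[of _ _ _ m]) (auto simp: m_def)
  have mm: "m (m k) = k" for k by (simp add: m_def)
  define d where "d k = c (m k) * wave (m k) x" for k
  have d: "(\<lambda>k. norm (d k)) summable_on UNIV"
    using summable_on_reindex_bij_betw[OF b, of "\<lambda>k. norm (c k)"] c by (simp add: d_def norm_mult)
  have dw: "(\<Sum>\<^sub>\<infinity>k. d k * wave k y) = (\<Sum>\<^sub>\<infinity>k. c k * wave k (x - y))" for y
  proof -
    have "c k * wave k (x - y) = d (m k) * wave (m k) y" for k
      by (simp add: d_def mm wave_diff flip: m_def)
    then show ?thesis using infsum_reindex_bij_betw[OF b, of "\<lambda>k. d k * wave k y"] by simp
  qed
  have "((\<lambda>k. d k * (LINT y|lborel. f y * wave k y)) has_sum (LINT y|lborel. f y * (\<Sum>\<^sub>\<infinity>k. d k * wave k y))) UNIV"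
    using f by (intro integral_wave_series_test[OF d K] test_function_continuous[OF f]) (auto simp: test_functions_in_def)
  then have "((\<lambda>k. d (m k) * (LINT y|lborel. f y * wave (m k) y)) has_sum (LINT y|lborel. f y * (\<Sum>\<^sub>\<infinity>k. c k * wave k (x - y)))) UNIV"
    using has_sum_reindex_bij_betw[OF b, of "\<lambda>k. d k * (LINT y|lborel. f y * wave k y)"] by (simp add: dw)
  from has_sum_cmult_right[OF this, of ?p]
  show ?thesis
    by (simp add: d_def mm fc_def m_def mult_ac)
qed

text \<open>Inside the ball of radius 2 pi the only zero of \<open>theta\<close> is the origin, and
  \<zeta> vanishes near it. Elsewhere zeros of \<open>theta\<close> do not matter, since \<zeta> is
  0 there; the convention inverse 0 = 0 gives the value 0.\<close>

lemma theta_power_divide: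
  fixes \<zeta> :: "real^'n::finite \<Rightarrow> complex"
  assumes "\<zeta> \<in> test_functions_in (cball 0 R)" "R < 2 * pi" "0 < r" "\<And>x. norm x \<le> r \<Longrightarrow> \<zeta> x = 0"
  shows "(\<lambda>x. \<zeta> x * inverse (of_real (theta x) ^ B)) \<in> test_functions_in (cball 0 R)"
    "\<zeta> x * inverse (of_real (theta x) ^ B) * of_real (theta x) ^ B = \<zeta> x"
proof -
  let ?\<eta> = "\<lambda>x. \<zeta> x * inverse (of_real (theta x) ^ B)"
  have z: "\<zeta> x = 0" if "R < norm x" for x using assms(1) that by (auto simp: test_functions_in_def)
  have "smooth_on UNIV ?\<eta>"
  proof (rule smooth_on_local)
    fix x :: "real^'n"
    consider "norm x < r" | "0 < norm x" "norm x < 2 * pi" | "R < norm x"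
      using assms(2,3) by linarith
    then show "\<exists>U. open U \<and> x \<in> U \<and> smooth_on U ?\<eta>"
    proof cases
      case 1
      have "smooth_on (ball 0 r) ?\<eta>"
        by (rule smooth_on_cong[OF _ _ smooth_on_const[of _ 0]]) (auto simp: assms(4))
      then show ?thesis using 1 by (intro exI[of _ "ball 0 r"]) auto
    next
      case 2
      let ?U = "ball 0 (2 * pi) - {0::real^'n}"
      have o: "open ?U" by (intro open_Diff) auto
      have "smooth_on ?U ?\<eta>"
      proof (intro smooth_on_mult smooth_on_inverse smooth_on_power o)
        show "smooth_on ?U \<zeta>" "smooth_on ?U (\<lambda>x. complex_of_real (theta x))"
          using assms(1) smooth_theta by (auto intro: smooth_on_subset simp: test_functions_in_def)
        show "complex_of_real (theta x) ^ B \<noteq> 0" if "x \<in> ?U" for x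
          using theta_pos[of x] that by simp
      qed
      then show ?thesis using 2 o by (intro exI[of _ ?U]) auto
    next
      case 3
      have "smooth_on (- cball 0 R) ?\<eta>"
        by (rule smooth_on_cong[OF _ _ smooth_on_const[of _ 0]]) (auto simp: z open_Compl)
      then show ?thesis using 3 by (intro exI[of _ "- cball 0 R"]) (auto simp: open_Compl)
    qed
  qed
  then show "?\<eta> \<in> test_functions_in (cball 0 R)"
    using assms(1) by (auto simp: test_functions_in_def)
  show "?\<eta> x * of_real (theta x) ^ B = \<zeta> x"
  proof (cases "\<zeta> x = 0")
    case False
    have "norm x \<le> R"
    proof (rule ccontr)
      assume "\<not> norm x \<le> R"
      then show False using z[of x] False by simp
    qed
    moreover have "x \<noteq> 0" using False assms(3) assms(4)[of 0] by auto
    ultimately have "norm x \<le> R" "x \<noteq> 0" by auto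
    then show ?thesis using theta_pos[of x] assms(2) by simp
  qed simp
qed

locale elliptic_family = growth I A for I :: "'i set" and A +
  fixes m :: nat and b :: "'i \<Rightarrow> ('n::finite \<Rightarrow> nat) \<Rightarrow> complex"
  assumes coeff_le: "\<And>i \<alpha>. i \<in> I \<Longrightarrow> mi_order \<alpha> \<le> m \<Longrightarrow> norm (b i \<alpha>) \<le> A i"
    and ellipticity: "\<And>i \<xi>. i \<in> I \<Longrightarrow> norm \<xi> = 1 \<Longrightarrow> inverse (A i) \<le> norm (principal_symbol m (b i) \<xi>)"
begin

section \<open>The symbol of the operator and its lower bound\<close>

definition sym :: "'i \<Rightarrow> ('n \<Rightarrow> int) \<Rightarrow> complex" where
  "sym i k = (\<Sum>\<alpha> | mi_order \<alpha> \<le> m. b i \<alpha> * (\<Prod>j\<in>UNIV. of_int (k j) ^ \<alpha> j))"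

definition coeff_sum :: "'i \<Rightarrow> real" where
  "coeff_sum i = (\<Sum>\<alpha> | mi_order \<alpha> \<le> m. norm (b i \<alpha>))"

text \<open>The first factor is the Euclidean radius beyond which the terms of lower order are at
  most half the principal part, whose lower bound has the constant 1/A. The second converts
  \<open>jap k\<close>, which is at most 1 + n |k|, into the Euclidean norm.\<close>

definition R :: "'i \<Rightarrow> real" where
  "R i = (2 * coeff_sum i * A i + 1) * (1 + real CARD('n))"

lemma coeff_sum_nonneg: "0 \<le> coeff_sum i"
  by (simp add: coeff_sum_def sum_nonneg)

lemma coeff_sum_tame: "tame coeff_sum"
proof (rule tame_mono)
  let ?c = "real (card {\<alpha>::'n \<Rightarrow> nat. mi_order \<alpha> \<le> m})"
  show "tame (\<lambda>i. A i * ?c)" by (intro tame_mult tame_A tame_const) auto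
  show "coeff_sum i \<le> A i * ?c" if "i \<in> I" for i
    unfolding coeff_sum_def using coeff_le[OF that] sum_bounded_above[of "{\<alpha>::'n \<Rightarrow> nat. mi_order \<alpha> \<le> m}" "\<lambda>\<alpha>. norm (b i \<alpha>)" "A i"]
    by (simp add: mult.commute)
qed

lemma R_tame: "tame R"
proof -
  have "tame (\<lambda>i. (coeff_sum i * 2 * A i + 1) * (1 + real CARD('n)))"
    by (intro tame_mult tame_add tame_const coeff_sum_tame tame_A) (auto simp: A_pos)
  then show ?thesis by (simp add: R_def[abs_def] mult_ac)
qed

lemma R_ge_1: "i \<in> I \<Longrightarrow> 1 \<le> R i"
proof -
  assume i: "i \<in> I"
  have "1 * 1 \<le> (2 * coeff_sum i * A i + 1) * (1 + real CARD('n))"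
    using coeff_sum_nonneg[of i] A_pos[OF i] by (intro mult_mono) auto
  then show ?thesis by (simp add: R_def)
qed

lemma monomial_le:
  assumes "\<And>j. \<bar>x j\<bar> \<le> (t::real)"
  shows "\<bar>\<Prod>j\<in>UNIV. x j ^ \<alpha> j\<bar> \<le> t ^ mi_order \<alpha>"
proof -
  have "\<bar>\<Prod>j\<in>UNIV. x j ^ \<alpha> j\<bar> \<le> (\<Prod>j\<in>UNIV. t ^ \<alpha> j)"
    unfolding abs_prod power_abs using assms by (intro prod_mono conjI power_mono) auto
  then show ?thesis by (simp add: mi_order_def power_sum)
qed

lemma norm_sym_le: "norm (sym i k) \<le> coeff_sum i * jap k ^ m"
proof -
  show "norm (sym i k) \<le> coeff_sum i * jap k ^ m"
    unfolding sym_def coeff_sum_def sum_distrib_right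
  proof (rule sum_norm_le)
    fix \<alpha> :: "'n \<Rightarrow> nat" assume \<alpha>: "\<alpha> \<in> {\<alpha>. mi_order \<alpha> \<le> m}"
    have "\<bar>\<Prod>j\<in>UNIV. real_of_int (k j) ^ \<alpha> j\<bar> \<le> jap k ^ mi_order \<alpha>"
      by (intro monomial_le abs_le_jap)
    also have "\<dots> \<le> jap k ^ m" using \<alpha> by (intro power_increasing jap_ge_1) auto
    finally have "\<bar>\<Prod>j\<in>UNIV. real_of_int (k j) ^ \<alpha> j\<bar> \<le> jap k ^ m" .
    moreover have "(\<Prod>j\<in>UNIV. of_int (k j) ^ \<alpha> j) = complex_of_real (\<Prod>j\<in>UNIV. real_of_int (k j) ^ \<alpha> j)"
      by simp
    ultimately show "norm (b i \<alpha> * (\<Prod>j\<in>UNIV. of_int (k j) ^ \<alpha> j)) \<le> norm (b i \<alpha>) * jap k ^ m"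
      unfolding norm_mult by (intro mult_left_mono) (simp_all only: norm_of_real norm_ge_zero)
  qed
qed

text \<open>With t = |k|, homogeneity and ellipticity give |top| \<ge> t^m / A, while the remaining
  terms are at most \<open>coeff_sum\<close> t^(m-1), which is at most t^m / (2 A) in the given
  range.\<close>

lemma sym_lower:
  assumes i: "i \<in> I" and k: "R i \<le> jap k"
  shows "jap k ^ m \<le> 2 * (1 + real CARD('n)) ^ m * A i * norm (sym i k)"
proof -
  define \<xi> :: "real^'n" where "\<xi> = (\<chi> j. of_int (k j))"
  define t where "t = norm \<xi>"
  have comp: "\<bar>real_of_int (k j)\<bar> \<le> t" for j
    using component_le_norm_cart[of \<xi> j] by (simp add: \<xi>_def t_def)
  have "(\<Sum>j\<in>UNIV. \<bar>real_of_int (k j)\<bar>) \<le> real CARD('n) * t"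
    using sum_bounded_above[of UNIV "\<lambda>j. \<bar>real_of_int (k j)\<bar>" t] comp by simp
  then have jt: "jap k \<le> 1 + real CARD('n) * t" by (simp add: jap_def)
  define X where "X = 2 * coeff_sum i * A i + 1"
  have X1: "1 \<le> X" using coeff_sum_nonneg[of i] A_pos[OF i] by (simp add: X_def)
  have "real CARD('n) * X \<le> real CARD('n) * t"
  proof -
    have "R i = X + real CARD('n) * X" by (simp add: R_def X_def algebra_simps)
    then show ?thesis using k jt X1 by linarith
  qed
  then have tX: "X \<le> t" by simp
  have t1: "1 \<le> t" using X1 tX by linarith
  have Ai: "0 < A i" by (rule A_pos[OF i])
  have jt2: "jap k \<le> (1 + real CARD('n)) * t" using jt t1 by (simp add: distrib_right)
  let ?mon = "\<lambda>\<alpha>. complex_of_real (\<Prod>j\<in>UNIV. real_of_int (k j) ^ \<alpha> j)"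
  define low where "low = (\<Sum>\<alpha> | mi_order \<alpha> < m. b i \<alpha> * ?mon \<alpha>)"
  define top where "top = (\<Sum>\<alpha> | mi_order \<alpha> = m. b i \<alpha> * ?mon \<alpha>)"
  have fin: "finite {\<alpha>::'n \<Rightarrow> nat. mi_order \<alpha> < m}" "finite {\<alpha>::'n \<Rightarrow> nat. mi_order \<alpha> = m}"
    using finite_mi_order[of m] by (auto elim!: rev_finite_subset)
  have "{\<alpha>::'n \<Rightarrow> nat. mi_order \<alpha> \<le> m} = {\<alpha>. mi_order \<alpha> = m} \<union> {\<alpha>. mi_order \<alpha> < m}" by auto
  then have split: "sym i k = top + low"
    unfolding sym_def top_def low_def using fin by (subst sum.union_disjoint[symmetric]) auto
  have "top = of_real (t ^ m) * principal_symbol m (b i) (\<xi> /\<^sub>R t)"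
    unfolding top_def principal_symbol_def sum_distrib_left
  proof (intro sum.cong refl)
    fix \<alpha> :: "'n \<Rightarrow> nat" assume "\<alpha> \<in> {\<alpha>. mi_order \<alpha> = m}"
    then have "t ^ m = (\<Prod>j\<in>UNIV. t ^ \<alpha> j)" by (simp add: mi_order_def power_sum[symmetric])
    then have "(\<Prod>j\<in>UNIV. real_of_int (k j) ^ \<alpha> j) = t ^ m * (\<Prod>j\<in>UNIV. (\<xi> /\<^sub>R t) $ j ^ \<alpha> j)"
    proof -
      have cancel: "t * (inverse t * x) = x" for x using t1 by simp
      show ?thesis
        unfolding \<open>t ^ m = _\<close> by (simp add: \<xi>_def cancel flip: prod.distrib power_mult_distrib)
    qed
    then show "b i \<alpha> * ?mon \<alpha> = of_real (t ^ m) * (b i \<alpha> * of_real (\<Prod>j\<in>UNIV. (\<xi> /\<^sub>R t) $ j ^ \<alpha> j))"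
      by (simp only: of_real_mult mult_ac)
  qed
  moreover have "norm (\<xi> /\<^sub>R t) = 1" using t1 by (simp flip: t_def)
  ultimately have "t ^ m * inverse (A i) \<le> norm top"
    using ellipticity[OF i, of "\<xi> /\<^sub>R t"] t1 by (simp add: norm_mult norm_power)
  then have top: "t ^ m \<le> A i * norm top" using Ai by (simp add: field_simps)
  \<comment> \<open>Multiplication by t avoids the exponent m - 1, which would be wrong as a natural
    number for m = 0; then \<open>low\<close> is an empty sum.\<close>
  have "norm low * t \<le> coeff_sum i * t ^ m"
  proof -
    have "norm (low * of_real t) \<le> (\<Sum>\<alpha>\<in>{\<alpha>::'n \<Rightarrow> nat. mi_order \<alpha> < m}. norm (b i \<alpha>) * t ^ m)"
      unfolding low_def sum_distrib_right
    proof (rule sum_norm_le)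
      fix \<alpha> :: "'n \<Rightarrow> nat" assume \<alpha>: "\<alpha> \<in> {\<alpha>. mi_order \<alpha> < m}"
      have "\<bar>\<Prod>j\<in>UNIV. real_of_int (k j) ^ \<alpha> j\<bar> * t \<le> t ^ mi_order \<alpha> * t"
        using t1 by (intro mult_right_mono monomial_le comp) auto
      also have "\<dots> = t ^ Suc (mi_order \<alpha>)" by simp
      also have "\<dots> \<le> t ^ m" using \<alpha> t1 by (intro power_increasing) auto
      finally have "norm (?mon \<alpha>) * t \<le> t ^ m" by (simp only: norm_of_real)
      then have "norm (b i \<alpha>) * (norm (?mon \<alpha>) * t) \<le> norm (b i \<alpha>) * t ^ m"
        by (intro mult_left_mono) auto
      then show "norm (b i \<alpha> * ?mon \<alpha> * of_real t) \<le> norm (b i \<alpha>) * t ^ m"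
        using t1 by (simp only: norm_mult norm_of_real mult.assoc abs_of_nonneg)
    qed
    also have "\<dots> \<le> coeff_sum i * t ^ m"
      unfolding coeff_sum_def sum_distrib_right using t1 by (intro sum_mono2 finite_mi_order) auto
    finally show ?thesis using t1 by (simp add: norm_mult)
  qed
  then have "2 * A i * (norm low * t) \<le> 2 * A i * (coeff_sum i * t ^ m)" using Ai by (intro mult_left_mono) auto
  also have "\<dots> = (X - 1) * t ^ m" by (simp add: X_def)
  also have "\<dots> \<le> t * t ^ m" using tX t1 by (intro mult_right_mono) auto
  finally have "(2 * A i * norm low) * t \<le> t ^ m * t" by (simp add: mult_ac)
  then have low: "2 * A i * norm low \<le> t ^ m" using t1 by (simp add: mult_le_cancel_right)
  have "norm top \<le> norm (sym i k) + norm low"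
    using norm_triangle_ineq4[of "sym i k" low] by (simp add: split)
  then have "2 * A i * norm top \<le> 2 * A i * norm (sym i k) + 2 * A i * norm low"
    using Ai mult_left_mono[of "norm top" "norm (sym i k) + norm low" "2 * A i"] by (simp add: distrib_left)
  then have main: "t ^ m \<le> 2 * A i * norm (sym i k)" using top low by linarith
  have "jap k ^ m \<le> ((1 + real CARD('n)) * t) ^ m" using jt2 by (intro power_mono) auto
  also have "\<dots> = (1 + real CARD('n)) ^ m * t ^ m" by (simp add: power_mult_distrib)
  also have "\<dots> \<le> (1 + real CARD('n)) ^ m * (2 * A i * norm (sym i k))"
    by (intro mult_left_mono main) auto
  finally show ?thesis by (simp add: mult_ac)
qed

lemma symb_sym: "symb l (real m) sym"
proof -
  have "symb l (real m) (\<lambda>i k. b i \<alpha> * (\<Prod>j\<in>UNIV. of_int (k j) ^ \<alpha> j))" if \<alpha>: "mi_order \<alpha> \<le> m" for \<alpha> :: "'n \<Rightarrow> nat"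
  proof (rule symb_mono)
    show "symb l (0 + (\<Sum>j\<in>UNIV. real (\<alpha> j) * 1)) (\<lambda>i k. b i \<alpha> * (\<Prod>j\<in>UNIV. of_int (k j) ^ \<alpha> j))"
      by (intro symb_mult symb_const symb_prod symb_power symb_coord tame_mono[OF tame_A] coeff_le \<alpha>) auto
    show "0 + (\<Sum>j\<in>UNIV. real (\<alpha> j) * 1) \<le> real m" using \<alpha> by (simp add: mi_order_def flip: of_nat_sum)
  qed
  then show ?thesis unfolding sym_def[abs_def] by (intro symb_sum) auto
qed

text \<open>The value 1 at the excluded frequencies, and at all indices outside I, makes the
  function nonzero without exception, as \<open>symb_inverse\<close> demands.\<close>

definition pt :: "'i \<Rightarrow> ('n \<Rightarrow> int) \<Rightarrow> complex" where
  "pt i k = (if i \<in> I \<and> R i \<le> jap k then sym i k else 1)"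

lemma pt_nonzero: "pt i k \<noteq> 0"
proof (cases "i \<in> I \<and> R i \<le> jap k")
  case True
  have "0 < jap k ^ m" by simp
  also have "\<dots> \<le> 2 * (1 + real CARD('n)) ^ m * A i * norm (sym i k)" using True by (intro sym_lower) auto
  finally show ?thesis using True by (auto simp: pt_def)
qed (auto simp: pt_def)

text \<open>For each index in I the change from \<open>sym\<close> affects only frequencies with
  \<open>jap k < R i\<close>, so it is a symbol of every order.\<close>

lemma symb_pt: "symb l (real m) pt"
proof -
  have "symb l (real m) (\<lambda>i k. pt i k - sym i k)"
  proof (rule symb_finite_support[OF R_tame])
    show "tame (\<lambda>i. 1 + coeff_sum i * R i ^ m)"
      by (intro tame_add tame_const tame_mult tame_power R_tame coeff_sum_tame)
         (use R_ge_1 in \<open>auto intro: order_trans[OF zero_le_one]\<close>)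
    show "0 \<le> 1 + coeff_sum i * R i ^ m" if "i \<in> I" for i
      using coeff_sum_nonneg[of i] R_ge_1[OF that] by simp
    fix i k assume i: "i \<in> I"
    show "R i < jap k \<Longrightarrow> pt i k - sym i k = 0" using i by (simp add: pt_def)
    show "norm (pt i k - sym i k) \<le> 1 + coeff_sum i * R i ^ m"
    proof (cases "R i \<le> jap k")
      case True
      then show ?thesis using i coeff_sum_nonneg[of i] R_ge_1[OF i] by (simp add: pt_def)
    next
      case False
      then have "coeff_sum i * jap k ^ m \<le> coeff_sum i * R i ^ m"
        using coeff_sum_nonneg by (intro mult_left_mono power_mono) auto
      then show ?thesis
        using False norm_sym_le[of i k] norm_triangle_ineq4[of 1 "sym i k"] by (simp add: pt_def)
    qed
  qed (rule R_ge_1)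
  from symb_add[OF symb_sym this] show ?thesis by simp
qed

lemma ubd_inverse_pt: "ubd (- real m) (\<lambda>i k. inverse (pt i k))"
proof (rule ubdI)
  let ?C = "2 * (1 + real CARD('n)) ^ m"
  show "tame (\<lambda>i. A i * ?C + R i ^ m)"
    by (intro tame_add tame_mult tame_A tame_power R_tame tame_const) (use R_ge_1 in \<open>auto intro: order_trans[OF zero_le_one]\<close>)
  fix i assume i: "i \<in> I"
  show nn: "0 \<le> A i * ?C + R i ^ m"
    using A_pos[OF i] R_ge_1[OF i] by (intro add_nonneg_nonneg mult_nonneg_nonneg) auto
  fix k :: "'n \<Rightarrow> int"
  have jp: "jap k powr (- real m) = inverse (jap k ^ m)" by (simp add: powr_minus powr_realpow)
  show "norm (inverse (pt i k)) \<le> (A i * ?C + R i ^ m) * jap k powr (- real m)"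
  proof (cases "R i \<le> jap k")
    case True
    have "0 < norm (sym i k)" using pt_nonzero[of i k] True i by (simp add: pt_def)
    then have "inverse (norm (sym i k)) \<le> A i * ?C * inverse (jap k ^ m)"
      using sym_lower[OF i True] by (simp add: field_simps)
    also have "\<dots> \<le> (A i * ?C + R i ^ m) * inverse (jap k ^ m)"
      using R_ge_1[OF i] by (intro mult_right_mono) auto
    finally show ?thesis using True i by (simp add: pt_def norm_inverse jp)
  next
    case False
    then have "jap k ^ m \<le> R i ^ m" by (intro power_mono) auto
    then have "1 \<le> R i ^ m * inverse (jap k ^ m)" by (simp add: field_simps)
    also have "\<dots> \<le> (A i * ?C + R i ^ m) * inverse (jap k ^ m)"
      using A_pos[OF i] by (intro mult_right_mono) auto
    finally show ?thesis using False by (simp add: pt_def jp)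
  qed
qed

lemma bsym_eq: "bsym k = of_real ((1 + (\<Sum>j\<in>UNIV. (real_of_int (k j))\<^sup>2)) ^ CARD('n))" for k :: "'n \<Rightarrow> int"
  by (simp add: bsym_def)

lemma bsym_nonzero: "bsym k \<noteq> 0" for k :: "'n \<Rightarrow> int"
proof -
  have "0 < 1 + (\<Sum>j\<in>UNIV. (real_of_int (k j))\<^sup>2)" by (intro add_pos_nonneg sum_nonneg) auto
  then show ?thesis unfolding bsym_eq of_real_eq_0_iff power_eq_0_iff by simp
qed

lemma symb_bsym: "symb l (2 * real CARD('n)) (\<lambda>i. bsym :: ('n \<Rightarrow> int) \<Rightarrow> complex)"
proof -
  have "symb l 2 (\<lambda>i k. (of_int (k j))\<^sup>2)" for j :: 'n
    using symb_power[OF symb_coord, of l 2 j] by simp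
  then have "symb l 2 (\<lambda>i k::'n \<Rightarrow> int. 1 + (\<Sum>j\<in>UNIV. (of_int (k j))\<^sup>2))"
    by (intro symb_add symb_sum symb_mono[OF symb_const[of "\<lambda>_. 1"]] tame_const) auto
  from symb_power[OF this, of "CARD('n)"] show ?thesis
    unfolding bsym_def[abs_def] by (simp add: mult.commute)
qed

lemma norm_inverse_bsym_le:
  fixes k :: "'n \<Rightarrow> int"
  shows "norm (inverse (bsym k)) \<le> (1 + real CARD('n)) ^ (2 * CARD('n)) * jap k powr (- 2 * real CARD('n))"
proof -
  define s where "s = 1 + (\<Sum>j\<in>UNIV. (real_of_int (k j))\<^sup>2)"
  have s1: "1 \<le> s" by (simp add: s_def sum_nonneg)
  have "\<bar>real_of_int (k j)\<bar> \<le> sqrt s" for j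
    using member_le_sum[of j UNIV "\<lambda>j. (real_of_int (k j))\<^sup>2"] by (intro real_le_rsqrt) (simp add: s_def)
  then have "(\<Sum>j\<in>UNIV. \<bar>real_of_int (k j)\<bar>) \<le> real CARD('n) * sqrt s"
    using sum_bounded_above[of UNIV "\<lambda>j. \<bar>real_of_int (k j)\<bar>" "sqrt s"] by simp
  moreover have "1 \<le> sqrt s" using s1 by simp
  ultimately have "jap k \<le> (1 + real CARD('n)) * sqrt s" unfolding jap_def distrib_right by linarith
  then have "jap k ^ (2 * CARD('n)) \<le> ((1 + real CARD('n)) * sqrt s) ^ (2 * CARD('n))"
    by (intro power_mono) auto
  also have "\<dots> = (1 + real CARD('n)) ^ (2 * CARD('n)) * s ^ CARD('n)"
    using s1 by (simp add: power_mult_distrib power_mult)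
  finally have "inverse (s ^ CARD('n)) \<le> (1 + real CARD('n)) ^ (2 * CARD('n)) * inverse (jap k ^ (2 * CARD('n)))"
    using s1 by (simp add: field_simps)
  moreover have "jap k powr (- 2 * real CARD('n)) = inverse (jap k ^ (2 * CARD('n)))"
    using powr_realpow[OF jap_pos(1)[of k], of "2 * CARD('n)"] by (simp add: powr_minus)
  moreover have "norm (inverse (bsym k)) = inverse (s ^ CARD('n))"
    using s1 unfolding bsym_eq s_def[symmetric] by (simp add: norm_inverse norm_power)
  ultimately show ?thesis by simp
qed

text \<open>Of order - m - 2 n, hence summable; the factor \<open>bsym\<close> is given back on the
  side of the test function.\<close>

definition amp :: "'i \<Rightarrow> ('n \<Rightarrow> int) \<Rightarrow> complex" where
  "amp i k = inverse (pt i k) * inverse (bsym k)"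

lemma symb_amp: "symb l (- real m - 2 * real CARD('n)) amp"
proof -
  have "symb l (- real m + - (2 * real CARD('n))) (\<lambda>i k. inverse (pt i k) * inverse (bsym k))"
  proof (intro symb_mult symb_inverse pt_nonzero bsym_nonzero ubd_inverse_pt symb_pt symb_bsym)
    show "ubd (- (2 * real CARD('n))) (\<lambda>i k. inverse (bsym (k :: 'n \<Rightarrow> int)))"
      using norm_inverse_bsym_le by (intro ubdI[of "\<lambda>_. (1 + real CARD('n)) ^ (2 * CARD('n))"] tame_const) auto
  qed
  then show ?thesis by (simp add: amp_def[abs_def])
qed

lemma ubd_summable:
  fixes f :: "'i \<Rightarrow> ('n \<Rightarrow> int) \<Rightarrow> complex"
  assumes "ubd s f" "s + real r \<le> - 2 * real CARD('n)"
  obtains T where "tame T" "\<And>i. i \<in> I \<Longrightarrow> 0 \<le> T i"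
    "\<And>i. i \<in> I \<Longrightarrow> (\<lambda>k. norm (f i k) * jap k ^ r) summable_on UNIV"
    "\<And>i. i \<in> I \<Longrightarrow> infsum (\<lambda>k. norm (f i k) * jap k ^ r) UNIV \<le> T i"
proof -
  obtain T where T: "tame T" "\<And>i. i \<in> I \<Longrightarrow> 0 \<le> T i" "\<And>i k. i \<in> I \<Longrightarrow> norm (f i k) \<le> T i * jap k powr s"
    by (rule ubdE[OF assms(1)]) blast
  let ?J = "infsum (\<lambda>k::'n \<Rightarrow> int. inverse (jap k ^ (2 * CARD('n)))) UNIV"
  have le: "norm (f i k) * jap k ^ r * jap k ^ (2 * CARD('n)) \<le> T i" if i: "i \<in> I" for i k
  proof -
    have "norm (f i k) * jap k ^ r * jap k ^ (2 * CARD('n)) \<le> T i * jap k powr s * jap k ^ r * jap k ^ (2 * CARD('n))"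
      by (intro mult_right_mono T i) auto
    also have "\<dots> = T i * jap k powr (s + real r + real (2 * CARD('n)))"
      by (simp only: powr_add powr_realpow[OF jap_pos(1)] mult.assoc)
    also have "\<dots> \<le> T i * jap k powr 0"
      using assms(2) jap_ge_1[of k] T(2)[OF i] by (intro mult_left_mono powr_mono) auto
    finally show ?thesis by simp
  qed
  have J: "0 \<le> ?J" by (intro infsum_nonneg) auto
  show thesis
  proof (rule that[of "\<lambda>i. T i * ?J"])
    show "tame (\<lambda>i. T i * ?J)" using T J by (intro tame_mult tame_const) auto
    fix i assume i: "i \<in> I"
    show "0 \<le> T i * ?J" using J T(2)[OF i] by simp
    show "(\<lambda>k. norm (f i k) * jap k ^ r) summable_on UNIV"
      by (rule summable_on_of_decay(1)[of _ "T i"]) (use le[OF i] in auto)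
    show "infsum (\<lambda>k. norm (f i k) * jap k ^ r) UNIV \<le> T i * ?J"
      by (rule summable_on_of_decay(2)) (use le[OF i] in auto)
  qed
qed

lemma amp_summable: "i \<in> I \<Longrightarrow> (\<lambda>k. norm (amp i k)) summable_on UNIV"
proof -
  assume i: "i \<in> I"
  show ?thesis by (rule ubd_summable[OF symb_ubd[OF symb_amp], of 0]) (use i in auto)
qed

definition gper :: "'i \<Rightarrow> real^'n \<Rightarrow> complex" where
  "gper i x = (\<Sum>\<^sub>\<infinity>k. amp i k * wave k x)"

text \<open>
  Multiplication by \<open>theta\<^sup>s\<close> acts on the coefficients as \<open>s\<close> discrete Laplacians, which lower the
  order of the symbol; so \<open>gper\<close> is smooth away from the zeros of \<open>theta\<close>.
\<close>

lemma fc_gper_decay: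
  fixes \<zeta> :: "real^'n \<Rightarrow> complex"
  assumes \<zeta>: "\<zeta> \<in> test_functions_in (cball 0 S)" "S < 2 * pi" "0 < r" "\<And>x. norm x \<le> r \<Longrightarrow> \<zeta> x = 0"
  obtains T where "tame T" "\<And>i. i \<in> I \<Longrightarrow> 0 \<le> T i" "\<And>i k. i \<in> I \<Longrightarrow> norm (fc (\<lambda>x. \<zeta> x * gper i x) k) * jap k ^ s \<le> T i"
proof -
  \<comment> \<open>Now \<zeta> gper = \<eta> (theta^s gper), and the second factor has the
    coefficients \<open>(lap ^^ s) (amp i)\<close>, of order lower by 2 s. The coefficients to be
    estimated are their convolution with those of the test function \<eta>; s of the gained powers
    are spent on the weight.\<close>
  define \<eta> where "\<eta> x = \<zeta> x * inverse (complex_of_real (theta x) ^ s)" for x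
  have \<eta>: "\<eta> \<in> test_functions_in (cball 0 S)" "\<eta> x * of_real (theta x) ^ s = \<zeta> x" for x
    unfolding \<eta>_def using theta_power_divide[OF \<zeta>] by auto
  obtain C where C: "0 \<le> C" "\<And>k. norm (fc \<eta> k) * jap k ^ s \<le> C"
    using fc_rapid_decay[OF compact_cball \<eta>(1), of s] by blast
  have "ubd (- real m - 2 * real CARD('n) - 2 * real s) (\<lambda>i. (lap ^^ s) (amp i))"
    by (rule ubd_lap_power[OF symb_amp])
  then obtain T where T: "tame T" "\<And>i. i \<in> I \<Longrightarrow> 0 \<le> T i"
    "\<And>i. i \<in> I \<Longrightarrow> (\<lambda>k. norm ((lap ^^ s) (amp i) k) * jap k ^ s) summable_on UNIV"
    "\<And>i. i \<in> I \<Longrightarrow> infsum (\<lambda>k. norm ((lap ^^ s) (amp i) k) * jap k ^ s) UNIV \<le> T i"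
    by (rule ubd_summable[where r = s]) auto
  show thesis
  proof (rule that[of "\<lambda>i. T i * C"])
    show "tame (\<lambda>i. T i * C)" using T C by (intro tame_mult tame_const) auto
    fix i assume i: "i \<in> I"
    show "0 \<le> T i * C" using T(2)[OF i] C by simp
    fix k :: "'n \<Rightarrow> int"
    let ?c = "(lap ^^ s) (amp i)"
    have sc: "(\<lambda>l. norm (?c l)) summable_on UNIV"
      by (rule summable_on_comparison_test[OF T(3)[OF i]])
         (use one_le_power[OF jap_ge_1] in \<open>auto simp: mult_le_cancel_left1\<close>)
    have series: "(\<Sum>\<^sub>\<infinity>l. ?c l * wave l x) = of_real (theta x) ^ s * gper i x" for x
      unfolding gper_def
      by (intro infsumI wave_series_lap_power has_sum_infsum wave_series_summable amp_summable i)
    let ?p = "inverse (complex_of_real ((2 * pi) ^ CARD('n)))"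
    have "((\<lambda>l. ?c l * (LINT y|lborel. (wave (\<lambda>j. - k j) y * \<eta> y) * wave l y)) has_sum
        (LINT y|lborel. (wave (\<lambda>j. - k j) y * \<eta> y) * (\<Sum>\<^sub>\<infinity>l. ?c l * wave l y))) UNIV"
    proof (rule integral_wave_series_test[OF sc compact_cball[of 0 S]])
      have t: "(\<lambda>y. wave (\<lambda>j. - k j) y * \<eta> y) \<in> test_functions_in (cball 0 S)"
        by (rule test_functions_mult_smooth[OF \<eta>(1) smooth_wave])
      show "continuous_on UNIV (\<lambda>y. wave (\<lambda>j. - k j) y * \<eta> y)" by (rule test_function_continuous[OF t])
      show "wave (\<lambda>j. - k j) x * \<eta> x = 0" if "x \<notin> cball 0 S" for x
        using t that by (simp add: test_functions_in_def)
    qed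
    from has_sum_cmult_right[OF this, of ?p]
    have "((\<lambda>l. ?p * (?c l * (LINT y|lborel. (wave (\<lambda>j. - k j) y * \<eta> y) * wave l y))) has_sum
        (?p * (LINT y|lborel. (wave (\<lambda>j. - k j) y * \<eta> y) * (\<Sum>\<^sub>\<infinity>l. ?c l * wave l y)))) UNIV" .
    moreover have "?p * (?c l * (LINT y|lborel. (wave (\<lambda>j. - k j) y * \<eta> y) * wave l y)) = ?c l * fc \<eta> (\<lambda>j. k j - l j)" for l
    proof -
      have "(wave (\<lambda>j. - k j) y * \<eta> y) * wave l y = wave (\<lambda>j. - (k j - l j)) y * \<eta> y" for y
        using wave_mult[of "\<lambda>j. - k j" y l] by (simp add: mult_ac)
      then show ?thesis by (simp only: fc_def mult_ac)
    qed
    moreover have "?p * (LINT y|lborel. (wave (\<lambda>j. - k j) y * \<eta> y) * (\<Sum>\<^sub>\<infinity>l. ?c l * wave l y)) = fc (\<lambda>x. \<zeta> x * gper i x) k"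
    proof -
      have "(wave (\<lambda>j. - k j) y * \<eta> y) * (\<Sum>\<^sub>\<infinity>l. ?c l * wave l y) = wave (\<lambda>j. - k j) y * (\<zeta> y * gper i y)" for y
        unfolding series \<eta>(2)[of y, symmetric] by (simp only: mult_ac)
      then show ?thesis by (simp only: fc_def)
    qed
    ultimately have hs: "((\<lambda>l. ?c l * fc \<eta> (\<lambda>j. k j - l j)) has_sum fc (\<lambda>x. \<zeta> x * gper i x) k) UNIV"
      by (simp only:)
    have "norm (fc (\<lambda>x. \<zeta> x * gper i x) k * of_real (jap k ^ s)) \<le> infsum (\<lambda>l. norm (?c l) * jap l ^ s) UNIV * C"
    proof (rule norm_infsum_le)
      show "((\<lambda>l. ?c l * fc \<eta> (\<lambda>j. k j - l j) * of_real (jap k ^ s)) has_sum (fc (\<lambda>x. \<zeta> x * gper i x) k * of_real (jap k ^ s))) UNIV"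
        by (rule has_sum_cmult_left[OF hs])
      show "((\<lambda>l. norm (?c l) * jap l ^ s * C) has_sum (infsum (\<lambda>l. norm (?c l) * jap l ^ s) UNIV * C)) UNIV"
        by (intro has_sum_cmult_left has_sum_infsum T i)
      fix l :: "'n \<Rightarrow> int"
      \<comment> \<open>The weight is split: one part goes to the symbol, which has powers to spare,
        the other to the rapidly decreasing coefficients of \<eta>.\<close>
      have "jap k \<le> jap l * jap (\<lambda>j. k j - l j)" using jap_add_le[of l "\<lambda>j. k j - l j"] by simp
      then have "jap k ^ s \<le> jap l ^ s * jap (\<lambda>j. k j - l j) ^ s"
        by (subst power_mult_distrib[symmetric]) (intro power_mono, auto)
      then have "norm (fc \<eta> (\<lambda>j. k j - l j)) * jap k ^ s \<le> norm (fc \<eta> (\<lambda>j. k j - l j)) * (jap l ^ s * jap (\<lambda>j. k j - l j) ^ s)"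
        by (intro mult_left_mono) auto
      also have "\<dots> = jap l ^ s * (norm (fc \<eta> (\<lambda>j. k j - l j)) * jap (\<lambda>j. k j - l j) ^ s)" by simp
      also have "\<dots> \<le> jap l ^ s * C" by (intro mult_left_mono C) auto
      finally have "norm (?c l) * (norm (fc \<eta> (\<lambda>j. k j - l j)) * jap k ^ s) \<le> norm (?c l) * (jap l ^ s * C)"
        by (intro mult_left_mono) auto
      then show "norm (?c l * fc \<eta> (\<lambda>j. k j - l j) * of_real (jap k ^ s)) \<le> norm (?c l) * jap l ^ s * C"
        by (simp add: norm_mult norm_power mult.assoc)
    qed
    also have "\<dots> \<le> T i * C" by (intro mult_right_mono T i C)
    finally show "norm (fc (\<lambda>x. \<zeta> x * gper i x) k) * jap k ^ s \<le> T i * C"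
      by (simp add: norm_mult norm_power)
  qed
qed


text \<open>Removing \<zeta> gper from the kernel costs only the rapidly decreasing coefficients
  \<phi> and leaves a kernel that vanishes at distances from \<delta> to 5 \<delta>; the last clause
  is this locality in terms of coefficients. The growth of \<gamma> is estimated crudely, since it
  will only meet rapidly decreasing sequences.\<close>

theorem parametrix_exists:
  fixes \<delta> :: real
  assumes \<delta>: "0 < \<delta>" "\<delta> \<le> 1/2"
  obtains \<gamma> \<rho> T0 T where
    "tame T0" "\<And>i k. i \<in> I \<Longrightarrow> norm (\<gamma> i k) \<le> T0 i * jap k ^ (2 * CARD('n))"
    "\<And>s. tame (T s)" "\<And>s i k. i \<in> I \<Longrightarrow> norm (\<rho> i k) * jap k ^ s \<le> T s i"
    "\<And>i k. i \<in> I \<Longrightarrow> sym i k * \<gamma> i k = 1 - \<rho> i k"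
    "\<And>i K v x x0. i \<in> I \<Longrightarrow> compact K \<Longrightarrow> K \<subseteq> ball x0 \<delta> \<Longrightarrow> v \<in> test_functions_in K \<Longrightarrow>
       2 * \<delta> \<le> norm (x - x0) \<Longrightarrow> norm (x - x0) < 4 * \<delta> \<Longrightarrow>
       ((\<lambda>k. \<gamma> i k * fc v k * wave k x) has_sum 0) UNIV"
proof -
  \<comment> \<open>\<psi> isolates the singularity of the kernel at the origin. \<omega> confines
    \<zeta> to one period box and is 1 up to 5 \<delta>, a bound for all distances between x and the
    support of v.\<close>
  obtain \<psi> :: "real^'n \<Rightarrow> complex" where \<psi>: "smooth_on UNIV \<psi>"
    "\<And>x. norm (x - 0) \<le> \<delta>/2 \<Longrightarrow> \<psi> x = 1" "\<And>x. \<delta> \<le> norm (x - 0) \<Longrightarrow> \<psi> x = 0"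
    by (rule smooth_cutoff[of "\<delta>/2" \<delta> 0]) (use \<delta> in auto)
  obtain \<omega> :: "real^'n \<Rightarrow> complex" where \<omega>: "smooth_on UNIV \<omega>"
    "\<And>x. norm (x - 0) \<le> 5 * \<delta> \<Longrightarrow> \<omega> x = 1" "\<And>x. 6 * \<delta> \<le> norm (x - 0) \<Longrightarrow> \<omega> x = 0"
    by (rule smooth_cutoff[of "5 * \<delta>" "6 * \<delta>" 0]) (use \<delta> in auto)
  define \<zeta> where "\<zeta> x = \<omega> x * (1 - \<psi> x)" for x
  have pi3: "6 * \<delta> < pi" using \<delta> pi_gt3 by linarith
  have \<zeta>: "\<zeta> \<in> test_functions_in (cball 0 (6 * \<delta>))"
    unfolding test_functions_in_def \<zeta>_def
    using \<omega>(3) by (auto intro!: smooth_on_mult smooth_on_minus smooth_on_const \<psi> \<omega>)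
  have \<zeta>0: "norm x \<le> \<delta>/2 \<Longrightarrow> \<zeta> x = 0" for x using \<psi>(2)[of x] by (simp add: \<zeta>_def)
  have box: "cball 0 (6 * \<delta>) \<subseteq> pbox (0::real^'n)"
  proof
    fix x :: "real^'n" assume "x \<in> cball 0 (6 * \<delta>)"
    then have "\<bar>x $ j\<bar> \<le> pi" for j using component_le_norm_cart[of x j] pi3 by simp
    then show "x \<in> pbox 0" by (simp add: mem_box_cart abs_le_iff minus_le_iff)
  qed
  have inbox: "x \<in> pobox 0" if "norm x < 6 * \<delta>" for x :: "real^'n"
  proof -
    have "\<bar>x $ j\<bar> < pi" for j using component_le_norm_cart[of x j] pi3 that by simp
    then show ?thesis by (simp add: mem_box_cart abs_less_iff minus_less_iff)
  qed
  define F where "F i x = \<zeta> x * gper i x" for i x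
  define \<phi> where "\<phi> i k = fc (F i) k" for i k
  have "\<exists>T. tame T \<and> (\<forall>i\<in>I. 0 \<le> T i) \<and> (\<forall>i\<in>I. \<forall>k. norm (\<phi> i k) * jap k ^ s \<le> T i)" for s
  proof -
    have "6 * \<delta> < 2 * pi" "0 < \<delta> / 2" using pi3 pi_gt_zero \<delta> by linarith+
    then show ?thesis
      unfolding \<phi>_def F_def using fc_gper_decay[OF \<zeta>, of "\<delta>/2" s] \<zeta>0 by metis
  qed
  then obtain P where P: "\<And>s. tame (P s)" "\<And>s i. i \<in> I \<Longrightarrow> 0 \<le> P s i"
    "\<And>s i k. i \<in> I \<Longrightarrow> norm (\<phi> i k) * jap k ^ s \<le> P s i" by metis
  have \<phi>s: "(\<lambda>k. norm (\<phi> i k)) summable_on UNIV" if "i \<in> I" for i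
    by (rule summable_on_of_decay(1)[of _ "P (2 * CARD('n)) i"]) (use P that in auto)
  have Fc: "continuous_on UNIV (F i)" if "i \<in> I" for i
    unfolding F_def[abs_def] gper_def[abs_def]
    by (intro continuous_intros wave_series_continuous amp_summable that test_function_continuous[OF \<zeta>])
  have Finv: "((\<lambda>k. \<phi> i k * wave k x) has_sum F i x) UNIV" if "i \<in> I" "norm x < 6 * \<delta>" for i x
    unfolding \<phi>_def
  proof (rule fourier_inversion[OF Fc[OF that(1)] _ box])
    show "F i x = 0" if "x \<notin> cball 0 (6 * \<delta>)" for x
      using \<zeta> that by (simp add: F_def test_functions_in_def)
    show "(\<lambda>k. norm (fc (F i) k)) summable_on UNIV" using \<phi>s[OF that(1)] by (simp add: \<phi>_def)
  qed (rule inbox[OF that(2)])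
  define \<gamma> where "\<gamma> i k = (amp i k - \<phi> i k) * bsym k" for i k
  \<comment> \<open>Solved from sym \<gamma> = 1 - \<rho>: the first summand stems from the
    frequencies at which \<open>pt\<close> replaced the symbol, the second from \<phi>.\<close>
  define \<rho> where "\<rho> i k = (if R i \<le> jap k then 0 else 1 - sym i k) + sym i k * \<phi> i k * bsym k" for i k
  obtain U where U: "\<And>k::'n \<Rightarrow> int. norm (bsym k) \<le> U * jap k ^ (2 * CARD('n))" "0 \<le> U"
  proof
    fix k :: "'n \<Rightarrow> int"
    have "1 \<le> (jap k)\<^sup>2" by (rule one_le_power[OF jap_ge_1])
    moreover have "(\<Sum>j\<in>UNIV. (real_of_int (k j))\<^sup>2) \<le> real CARD('n) * (jap k)\<^sup>2"
      using sum_bounded_above[of UNIV "\<lambda>j. (real_of_int (k j))\<^sup>2" "(jap k)\<^sup>2"] abs_le_jap[of k]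
      by (simp add: abs_le_square_iff[symmetric])
    ultimately have "1 + (\<Sum>j\<in>UNIV. (real_of_int (k j))\<^sup>2) \<le> (1 + real CARD('n)) * (jap k)\<^sup>2"
      by (simp add: distrib_right)
    then have "(1 + (\<Sum>j\<in>UNIV. (real_of_int (k j))\<^sup>2)) ^ CARD('n) \<le> ((1 + real CARD('n)) * (jap k)\<^sup>2) ^ CARD('n)"
      by (intro power_mono add_nonneg_nonneg sum_nonneg) auto
    moreover have "norm (bsym k) = (1 + (\<Sum>j\<in>UNIV. (real_of_int (k j))\<^sup>2)) ^ CARD('n)"
      unfolding bsym_eq norm_of_real by (rule abs_of_nonneg, rule zero_le_power) (simp add: sum_nonneg)
    ultimately show "norm (bsym k) \<le> (1 + real CARD('n)) ^ CARD('n) * jap k ^ (2 * CARD('n))"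
      by (simp add: power_mult_distrib power_mult)
  qed auto
  obtain TA where TA: "tame TA" "\<And>i. i \<in> I \<Longrightarrow> 0 \<le> TA i"
    "\<And>i k. i \<in> I \<Longrightarrow> norm (amp i k) \<le> TA i * jap k powr (- real m - 2 * real CARD('n))"
    by (rule ubdE[OF symb_ubd[OF symb_amp]]) blast
  have amp1: "norm (amp i k) \<le> TA i" if "i \<in> I" for i k
  proof -
    have "jap k powr (- real m - 2 * real CARD('n)) \<le> jap k powr 0"
      by (intro powr_mono jap_ge_1) auto
    then have "TA i * jap k powr (- real m - 2 * real CARD('n)) \<le> TA i * 1"
      using TA(2)[OF that] by (intro mult_left_mono) auto
    then show ?thesis using TA(3)[OF that, of k] by simp
  qed
  show thesis
  \<comment> \<open>In the bound for \<rho>, the condition jap k < R i turns jap k ^ s into R i ^ s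
    in the first summand. In the second, m powers are spent on \<open>sym\<close>, 2 n on
    \<open>bsym\<close> and s on the weight, all taken from the decay of \<phi>.\<close>
  proof (rule that[of "\<lambda>i. (TA i + P 0 i) * U" \<gamma> "\<lambda>s i. (1 + coeff_sum i * R i ^ m) * R i ^ s + coeff_sum i * (P (m + s + 2 * CARD('n)) i * U)" \<rho>])
    show "tame (\<lambda>i. (TA i + P 0 i) * U)"
      by (intro tame_mult tame_add TA P tame_const U)
    show "norm (\<gamma> i k) \<le> (TA i + P 0 i) * U * jap k ^ (2 * CARD('n))" if "i \<in> I" for i k
    proof -
      have "norm (amp i k - \<phi> i k) \<le> TA i + P 0 i"
        using amp1[OF that, of k] P(3)[OF that, of k 0] norm_triangle_ineq4[of "amp i k" "\<phi> i k"] by simp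
      then have "norm (amp i k - \<phi> i k) * norm (bsym k) \<le> (TA i + P 0 i) * (U * jap k ^ (2 * CARD('n)))"
        using TA(2)[OF that] P(2)[OF that] by (intro mult_mono U) auto
      then show ?thesis by (simp add: \<gamma>_def norm_mult mult.assoc)
    qed
    have R0: "i \<in> I \<Longrightarrow> 0 \<le> R i" for i using R_ge_1[of i] by simp
    show "tame (\<lambda>i. (1 + coeff_sum i * R i ^ m) * R i ^ s + coeff_sum i * (P (m + s + 2 * CARD('n)) i * U))" for s
      by (intro tame_mult tame_add P tame_const tame_power R_tame coeff_sum_tame)
         (auto simp: R0 P U coeff_sum_nonneg)
    show "norm (\<rho> i k) * jap k ^ s \<le> (1 + coeff_sum i * R i ^ m) * R i ^ s + coeff_sum i * (P (m + s + 2 * CARD('n)) i * U)"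
      if i: "i \<in> I" for s i k
    proof -
      have 1: "norm (if R i \<le> jap k then 0 else 1 - sym i k) * jap k ^ s \<le> (1 + coeff_sum i * R i ^ m) * R i ^ s"
      proof (cases "R i \<le> jap k")
        case True
        then show ?thesis using R0[OF i] coeff_sum_nonneg by simp
      next
        case False
        have "coeff_sum i * jap k ^ m \<le> coeff_sum i * R i ^ m"
          using False coeff_sum_nonneg by (intro mult_left_mono power_mono) auto
        then have "norm (1 - sym i k) \<le> 1 + coeff_sum i * R i ^ m"
          using norm_sym_le[of i k] norm_triangle_ineq4[of 1 "sym i k"] by simp
        then show ?thesis
          using False coeff_sum_nonneg R0[OF i] by (auto intro!: mult_mono power_mono)
      qed
      have "norm (sym i k * \<phi> i k * bsym k) * jap k ^ s = norm (sym i k) * (norm (\<phi> i k) * norm (bsym k)) * jap k ^ s"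
        by (simp add: norm_mult mult_ac)
      also have "\<dots> \<le> (coeff_sum i * jap k ^ m) * (norm (\<phi> i k) * (U * jap k ^ (2 * CARD('n)))) * jap k ^ s"
        by (intro mult_mono norm_sym_le U mult_nonneg_nonneg coeff_sum_nonneg) auto
      also have "\<dots> = coeff_sum i * ((norm (\<phi> i k) * jap k ^ (m + s + 2 * CARD('n))) * U)"
        by (simp add: power_add mult_ac)
      also have "\<dots> \<le> coeff_sum i * (P (m + s + 2 * CARD('n)) i * U)"
        by (intro mult_left_mono mult_right_mono P i U coeff_sum_nonneg)
      finally have 2: "norm (sym i k * \<phi> i k * bsym k) * jap k ^ s \<le> coeff_sum i * (P (m + s + 2 * CARD('n)) i * U)" .
      have "norm (\<rho> i k) * jap k ^ s \<le> (norm (if R i \<le> jap k then 0 else 1 - sym i k) + norm (sym i k * \<phi> i k * bsym k)) * jap k ^ s"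
        unfolding \<rho>_def by (intro mult_right_mono norm_triangle_ineq) auto
      then show ?thesis using 1 2 by (simp add: distrib_right)
    qed
    show "sym i k * \<gamma> i k = 1 - \<rho> i k" if "i \<in> I" for i k
    proof -
      have "sym i k * amp i k * bsym k = (if R i \<le> jap k then 1 else sym i k)"
        using pt_nonzero[of i k] bsym_nonzero[of k] that by (auto simp: amp_def pt_def field_simps)
      then show ?thesis by (simp add: \<gamma>_def \<rho>_def algebra_simps)
    qed
    fix i K v and x x0 :: "real^'n"
    assume i: "i \<in> I" and K: "compact K" "K \<subseteq> ball x0 \<delta>" and v: "v \<in> test_functions_in K"
      and x: "2 * \<delta> \<le> norm (x - x0)" "norm (x - x0) < 4 * \<delta>"
    \<comment> \<open>\<open>bsym\<close> is moved onto v: f is again a test function supported in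
      K, and the remaining multiplier amp - \<phi> is summable, hence a convolution with a
      continuous kernel.\<close>
    define f where "f = (bessel ^^ CARD('n)) v"
    have f: "f \<in> test_functions_in K" "\<And>k. fc f k = bsym k * fc v k"
      unfolding f_def bsym_def using bessel_power_test[OF K(1) v] by auto
    let ?c = "\<lambda>k. amp i k - \<phi> i k"
    have cs: "(\<lambda>k. norm (?c k)) summable_on UNIV"
    proof (rule summable_on_comparison_test)
      show "(\<lambda>k. norm (amp i k) + norm (\<phi> i k)) summable_on UNIV"
        by (intro summable_on_add amp_summable \<phi>s i)
    qed (auto intro: norm_triangle_ineq4)
    have z: "f y * (\<Sum>\<^sub>\<infinity>k. ?c k * wave k (x - y)) = 0" for y
    proof (cases "y \<in> K")
      case False
      then show ?thesis using f(1) by (simp add: test_functions_in_def)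
    next
      case True
      then have y: "norm (y - x0) < \<delta>" using K(2) by (auto simp: dist_norm norm_minus_commute)
      have "norm (x - x0) \<le> norm (x - y) + norm (y - x0)" using norm_triangle_ineq[of "x - y" "y - x0"] by simp
      then have lo: "\<delta> \<le> norm (x - y)" using x y by linarith
      have "norm (x - y) \<le> norm (x - x0) + norm (y - x0)" using norm_triangle_ineq4[of "x - x0" "y - x0"] by simp
      then have hi: "norm (x - y) < 5 * \<delta>" using x y by linarith
      have "((\<lambda>k. amp i k * wave k (x - y) - \<phi> i k * wave k (x - y)) has_sum (gper i (x - y) - F i (x - y))) UNIV"
        unfolding gper_def using hi \<delta>
        by (intro has_sum_minus Finv has_sum_infsum wave_series_summable amp_summable i) auto
      then have "(\<Sum>\<^sub>\<infinity>k. ?c k * wave k (x - y)) = gper i (x - y) - F i (x - y)"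
        by (intro infsumI) (simp add: left_diff_distrib)
      also have "\<dots> = 0"
        using \<omega>(2)[of "x - y"] \<psi>(3)[of "x - y"] lo hi by (simp add: F_def \<zeta>_def)
      finally show ?thesis by simp
    qed
    have "((\<lambda>k. ?c k * fc f k * wave k x) has_sum 0) UNIV"
      using convolution_wave_series[OF cs K(1) f(1), of x] by (simp add: z)
    then show "((\<lambda>k. \<gamma> i k * fc v k * wave k x) has_sum 0) UNIV"
      by (simp add: f(2) \<gamma>_def mult_ac)
  qed
qed

end

section \<open>Localized Fourier series\<close>

lemma wave_cutoff_derivs:
  fixes \<kappa> :: "real^'n::finite \<Rightarrow> complex"
  assumes L: "compact L" and \<kappa>: "\<kappa> \<in> test_functions_in L"
  obtains C where "0 \<le> C" "\<And>k x. norm (fold pd is (\<lambda>x. \<kappa> x * wave k x) x) \<le> C * jap k ^ length is"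
proof -
  have "\<exists>C\<ge>0. \<forall>k x. norm (fold pd is (\<lambda>x. \<kappa> x * wave k x) x) \<le> C * jap k ^ length is"
    using \<kappa>
  proof (induction "is" arbitrary: \<kappa>)
    case Nil
    obtain M where "0 \<le> M" "\<And>x. norm (\<kappa> x) \<le> M" using test_functions_bounded[OF L Nil] by blast
    then show ?case by (intro exI[of _ M]) (auto simp: norm_mult)
  next
    case (Cons i js)
    have sk: "smooth_on UNIV \<kappa>" using Cons.prems by (simp add: test_functions_in_def)
    obtain C1 where C1: "0 \<le> C1" "\<And>k x. norm (fold pd js (\<lambda>x. pd i \<kappa> x * wave k x) x) \<le> C1 * jap k ^ length js"
      using Cons.IH[OF test_functions_pd[OF compact_imp_closed[OF L] Cons.prems], of i] by blast
    obtain C2 where C2: "0 \<le> C2" "\<And>k x. norm (fold pd js (\<lambda>x. \<kappa> x * wave k x) x) \<le> C2 * jap k ^ length js"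
      using Cons.IH[OF Cons.prems] by blast
    show ?case
    proof (intro exI[of _ "C1 + C2"] conjI allI)
      fix k and x :: "real^'n"
      have sw: "smooth_on UNIV (\<lambda>x. \<kappa> x * wave k x)" "smooth_on UNIV (\<lambda>x. pd i \<kappa> x * wave k x)"
        by (intro smooth_on_mult smooth_wave sk smooth_on_pd open_UNIV)+
      have "pd i (\<lambda>x. \<kappa> x * wave k x) = (\<lambda>x. pd i \<kappa> x * wave k x + (\<i> * of_int (k i)) * (\<kappa> x * wave k x))"
      proof
        fix y :: "real^'n"
        show "pd i (\<lambda>x. \<kappa> x * wave k x) y = pd i \<kappa> y * wave k y + (\<i> * of_int (k i)) * (\<kappa> y * wave k y)"
          unfolding pd_mult[OF smooth_on_diff[OF open_UNIV sk UNIV_I] smooth_on_diff[OF open_UNIV smooth_wave UNIV_I]] pd_wave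
          by simp
      qed
      then have "fold pd (i # js) (\<lambda>x. \<kappa> x * wave k x) x
          = fold pd js (\<lambda>x. pd i \<kappa> x * wave k x) x + (\<i> * of_int (k i)) * fold pd js (\<lambda>x. \<kappa> x * wave k x) x"
        using fold_pd_add[OF open_UNIV sw(2) smooth_on_cmult[OF open_UNIV sw(1)], of x js "\<i> * of_int (k i)"]
          fold_pd_cmult[OF open_UNIV sw(1), of x js "\<i> * of_int (k i)"] by simp
      also have "norm \<dots> \<le> C1 * jap k ^ length js * jap k + jap k * (C2 * jap k ^ length js)"
      proof (rule order_trans[OF norm_triangle_ineq], rule add_mono)
        show "norm (fold pd js (\<lambda>x. pd i \<kappa> x * wave k x) x) \<le> C1 * jap k ^ length js * jap k"
          using C1(2)[of k x] mult_left_mono[OF jap_ge_1[of k], of "C1 * jap k ^ length js"] C1(1) by simp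
        show "norm (\<i> * of_int (k i) * fold pd js (\<lambda>x. \<kappa> x * wave k x) x) \<le> jap k * (C2 * jap k ^ length js)"
          unfolding norm_mult using abs_le_jap[of k i] C2 by (intro mult_mono) (auto simp: norm_mult)
      qed
      finally show "norm (fold pd (i # js) (\<lambda>x. \<kappa> x * wave k x) x) \<le> (C1 + C2) * jap k ^ length (i # js)"
        by (simp add: algebra_simps)
    qed (use C1 C2 in auto)
  qed
  then show thesis using that by blast
qed

definition rapid :: "(('n::finite \<Rightarrow> int) \<Rightarrow> complex) \<Rightarrow> bool" where
  "rapid d \<longleftrightarrow> (\<forall>s. (\<lambda>k. norm (d k) * jap k ^ s) summable_on UNIV)"

lemma rapidD: "rapid d \<Longrightarrow> (\<lambda>k. norm (d k) * jap k ^ s) summable_on UNIV"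
  by (simp add: rapid_def)

lemma rapid_norm: "rapid d \<Longrightarrow> (\<lambda>k. norm (d k)) summable_on UNIV"
  using rapidD[of d 0] by simp

lemma rapidI:
  fixes d :: "('n::finite \<Rightarrow> int) \<Rightarrow> complex"
  assumes "\<And>s. \<exists>C. \<forall>k. norm (d k) * jap k ^ s \<le> C"
  shows "rapid d"
  unfolding rapid_def
proof
  fix s
  obtain C where C: "\<And>k. norm (d k) * jap k ^ (s + 2 * CARD('n)) \<le> C" using assms by blast
  show "(\<lambda>k. norm (d k) * jap k ^ s) summable_on UNIV"
    by (rule summable_on_of_decay(1)[of _ C]) (use C in \<open>auto simp: power_add mult.assoc\<close>)
qed

lemma rapid_mult:
  fixes d e :: "('n::finite \<Rightarrow> int) \<Rightarrow> complex"
  assumes "rapid d" "\<And>k. norm (e k) \<le> C * jap k ^ r"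
  shows "rapid (\<lambda>k. e k * d k)"
  unfolding rapid_def
proof
  fix s
  show "(\<lambda>k. norm (e k * d k) * jap k ^ s) summable_on UNIV"
  proof (rule summable_on_comparison_test)
    show "(\<lambda>k. C * (norm (d k) * jap k ^ (r + s))) summable_on UNIV"
      by (intro summable_on_cmult_right rapidD assms)
    show "norm (e k * d k) * jap k ^ s \<le> C * (norm (d k) * jap k ^ (r + s))" for k
      using mult_right_mono[OF assms(2)[of k], of "norm (d k) * jap k ^ s"]
      by (simp add: norm_mult power_add mult_ac)
  qed auto
qed

lemma rapid_fc:
  assumes "compact K" "f \<in> test_functions_in K" shows "rapid (fc f)"
  unfolding rapid_def using fc_summable[OF assms] by blast

lemma rapid_restrict: "rapid d \<Longrightarrow> rapid (\<lambda>k. if k \<in> F then 0 else d k)"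
  using rapid_mult[of d "\<lambda>k. if k \<in> F then 0 else 1" 1 0]
  by (simp add: if_distrib[of "\<lambda>x. x * _"] cong: if_cong)

lemma smooth_wave_series:
  fixes d :: "('n::finite \<Rightarrow> int) \<Rightarrow> complex"
  assumes d: "rapid d"
  shows "smooth_on UNIV (\<lambda>x. \<Sum>\<^sub>\<infinity>k. d k * wave k x)"
    and "((\<lambda>k. d k * (\<Prod>i\<leftarrow>is. \<i> * of_int (k i)) * wave k x) has_sum fold pd is (\<lambda>x. \<Sum>\<^sub>\<infinity>k. d k * wave k x) x) UNIV"
proof -
  have s: "smooth_on UNIV (\<lambda>x. d k * wave k x)" for k by (intro smooth_on_cmult smooth_wave open_UNIV)
  have f: "fold pd js (\<lambda>x. d k * wave k x) x = d k * (\<Prod>i\<leftarrow>js. \<i> * of_int (k i)) * wave k x" for js k x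
    by (simp add: fold_pd_cmult[OF open_UNIV smooth_wave] fold_pd_wave)
  have p: "norm (\<Prod>i\<leftarrow>js. \<i> * complex_of_int (k i)) \<le> jap k ^ length js" for js :: "'n list" and k
    by (induction js) (auto simp: norm_mult abs_le_jap intro!: mult_mono)
  have M: "(\<lambda>k. norm (d k) * jap k ^ length js) summable_on UNIV"
    "norm (fold pd js (\<lambda>x. d k * wave k x) x) \<le> norm (d k) * jap k ^ length js" for js k x
    using rapidD[OF d] p by (auto simp: f norm_mult intro!: mult_left_mono)
  have B: "\<exists>M. M summable_on UNIV \<and> (\<forall>k x. norm (fold pd js (\<lambda>x. d k * wave k x) x) \<le> M k)" for js
    using M by blast
  show "smooth_on UNIV (\<lambda>x. \<Sum>\<^sub>\<infinity>k. d k * wave k x)" by (rule smooth_series[OF s B])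
  have "((\<lambda>k. fold pd is (\<lambda>x. d k * wave k x) x) has_sum (\<Sum>\<^sub>\<infinity>k. fold pd is (\<lambda>x. d k * wave k x) x)) UNIV"
    by (intro has_sum_infsum summable_on_norm_comparison(1)[OF M(1)[of "is"]] M(2))
  then show "((\<lambda>k. d k * (\<Prod>i\<leftarrow>is. \<i> * of_int (k i)) * wave k x) has_sum fold pd is (\<lambda>x. \<Sum>\<^sub>\<infinity>k. d k * wave k x) x) UNIV"
    unfolding fold_pd_series[OF s B] by (simp only: f)
qed

text \<open>The constant \<open>C\<close> is passed in because it depends only on \<kappa> and
  \<open>is\<close>; the resulting bound is uniform over all coefficient sequences, in particular
  over \<epsilon>.\<close>

lemma cutoff_wave_series:
  fixes \<kappa> :: "real^'n::finite \<Rightarrow> complex"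
  assumes L: "compact L" and \<kappa>: "\<kappa> \<in> test_functions_in L" and d: "rapid d"
    and C: "0 \<le> C" "\<And>k x. norm (fold pd is (\<lambda>x. \<kappa> x * wave k x) x) \<le> C * jap k ^ length is"
  shows "(\<lambda>x. \<kappa> x * (\<Sum>\<^sub>\<infinity>k. d k * wave k x)) \<in> test_functions_in L"
    and "norm (fold pd is (\<lambda>x. \<kappa> x * (\<Sum>\<^sub>\<infinity>k. d k * wave k x)) x) \<le> C * infsum (\<lambda>k. norm (d k) * jap k ^ length is) UNIV"
proof -
  show "(\<lambda>x. \<kappa> x * (\<Sum>\<^sub>\<infinity>k. d k * wave k x)) \<in> test_functions_in L"
    using test_functions_mult_smooth[OF \<kappa> smooth_wave_series(1)[OF d]] by (simp add: mult.commute)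
  let ?f = "\<lambda>k x. d k * (\<kappa> x * wave k x)"
  have e: "(\<lambda>x. \<kappa> x * (\<Sum>\<^sub>\<infinity>k. d k * wave k x)) = (\<lambda>x. \<Sum>\<^sub>\<infinity>k. ?f k x)"
    by (simp add: mult.left_commute[of _ "\<kappa> _"] infsum_cmult_right')
  have sk: "smooth_on UNIV (\<lambda>x. \<kappa> x * wave k x)" for k
    using \<kappa> by (intro smooth_on_mult smooth_wave) (auto simp: test_functions_in_def)
  have s: "smooth_on UNIV (?f k)" for k
    by (intro smooth_on_cmult sk open_UNIV)
  have f: "fold pd js (?f k) x = d k * fold pd js (\<lambda>x. \<kappa> x * wave k x) x" for js k x
    by (simp add: fold_pd_cmult[OF open_UNIV sk])
  have B: "\<exists>M. M summable_on UNIV \<and> (\<forall>k x. norm (fold pd js (?f k) x) \<le> M k)" for js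
  proof -
    obtain D where D: "\<And>k x. norm (fold pd js (\<lambda>x. \<kappa> x * wave k x) x) \<le> D * jap k ^ length js"
      using wave_cutoff_derivs[OF L \<kappa>] by blast
    have "(\<lambda>k. norm (d k) * jap k ^ length js * D) summable_on UNIV"
      by (intro summable_on_cmult_left rapidD d)
    moreover have "norm (fold pd js (?f k) x) \<le> norm (d k) * jap k ^ length js * D" for k x
      using mult_left_mono[OF D[of k x], of "norm (d k)"] unfolding f norm_mult by (simp add: mult_ac)
    ultimately show ?thesis by blast
  qed
  have "norm (\<Sum>\<^sub>\<infinity>k. fold pd is (?f k) x) \<le> infsum (\<lambda>k. C * (norm (d k) * jap k ^ length is)) UNIV"
  proof (rule summable_on_norm_comparison(2))
    show "(\<lambda>k. C * (norm (d k) * jap k ^ length is)) summable_on UNIV"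
      by (intro summable_on_cmult_right rapidD d)
    show "norm (fold pd is (?f k) x) \<le> C * (norm (d k) * jap k ^ length is)" for k
      using mult_left_mono[OF C(2)[of k x], of "norm (d k)"] unfolding f norm_mult by (simp add: mult_ac)
  qed
  then show "norm (fold pd is (\<lambda>x. \<kappa> x * (\<Sum>\<^sub>\<infinity>k. d k * wave k x)) x) \<le> C * infsum (\<lambda>k. norm (d k) * jap k ^ length is) UNIV"
    unfolding e fold_pd_series[OF s B] by (simp add: infsum_cmult_right')
qed

lemma C_norm_le:
  assumes "0 \<le> B" "\<And>\<alpha> x. mi_order \<alpha> \<le> j \<Longrightarrow> x \<in> K \<Longrightarrow> norm (pderivs \<alpha> f x) \<le> B"
  shows "C_norm K j f \<le> B"
  unfolding C_norm_def using assms by (intro cSup_least) auto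

lemma distributions_bound: "T \<in> distributions \<Omega> \<Longrightarrow> compact L \<Longrightarrow> L \<subseteq> \<Omega> \<Longrightarrow>
    \<exists>j. \<exists>c>0. \<forall>f\<in>test_functions_in L. norm (T f) \<le> c * C_norm L j f"
  by (simp add: distributions_def)

lemma distributions_add: "T \<in> distributions \<Omega> \<Longrightarrow> f \<in> test_functions_in L \<Longrightarrow> g \<in> test_functions_in L \<Longrightarrow>
    compact L \<Longrightarrow> L \<subseteq> \<Omega> \<Longrightarrow> T (\<lambda>x. f x + g x) = T f + T g"
  unfolding distributions_def test_functions_def by blast

lemma distributions_cmult: "T \<in> distributions \<Omega> \<Longrightarrow> f \<in> test_functions_in L \<Longrightarrow>
    compact L \<Longrightarrow> L \<subseteq> \<Omega> \<Longrightarrow> T (\<lambda>x. a * f x) = a * T f"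
  unfolding distributions_def test_functions_def by blast

lemma distributions_zero: "T \<in> distributions \<Omega> \<Longrightarrow> T (\<lambda>x. 0) = 0"
  using distributions_cmult[of T \<Omega> "\<lambda>x. 0" "{}" 0] by (auto simp: test_functions_in_def smooth_on_const)

lemma distributions_sum:
  assumes "T \<in> distributions \<Omega>" "compact L" "L \<subseteq> \<Omega>" "\<And>a. a \<in> F \<Longrightarrow> f a \<in> test_functions_in L"
  shows "T (\<lambda>x. \<Sum>a\<in>F. f a x) = (\<Sum>a\<in>F. T (f a))"
  using assms(4)
proof (induction F rule: infinite_finite_induct)
  case (insert a F)
  then show ?case
    using distributions_add[OF assms(1), of "f a" L "\<lambda>x. \<Sum>a\<in>F. f a x"] assms(2,3)
    by (simp add: test_functions_sum)
qed (simp_all add: distributions_zero[OF assms(1)])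

text \<open>On L the distribution has some finite order j, so its value on the tail of the cut-off
  series is controlled by the tail of the sum of |d k| jap k ^ j.\<close>

lemma distribution_wave_series:
  fixes \<kappa> :: "real^'n::finite \<Rightarrow> complex"
  assumes T: "T \<in> distributions \<Omega>" and L: "compact L" "L \<subseteq> \<Omega>" and \<kappa>: "\<kappa> \<in> test_functions_in L" and d: "rapid d"
  shows "((\<lambda>k. d k * T (\<lambda>x. \<kappa> x * wave k x)) has_sum T (\<lambda>x. \<kappa> x * (\<Sum>\<^sub>\<infinity>k. d k * wave k x))) UNIV"
proof -
  obtain j c where jc: "c > 0" "\<And>f. f \<in> test_functions_in L \<Longrightarrow> norm (T f) \<le> c * C_norm L j f"
    using distributions_bound[OF T L] by auto
  have "\<exists>C\<ge>0. \<forall>k x. norm (fold pd is (\<lambda>x. \<kappa> x * wave k x) x) \<le> C * jap k ^ length is" for "is"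
    by (rule wave_cutoff_derivs[OF L(1) \<kappa>, of "is"]) blast
  then obtain C where C: "\<And>is. 0 \<le> C is" "\<And>is k x. norm (fold pd is (\<lambda>x. \<kappa> x * wave k x) x) \<le> C is * jap k ^ length is"
    by metis
  define D where "D = (\<Sum>\<alpha> | mi_order \<alpha> \<le> j. C (mi_list \<alpha>))"
  have D0: "0 \<le> D" unfolding D_def by (intro sum_nonneg C)
  have DC: "C (mi_list \<alpha>) \<le> D" if "mi_order \<alpha> \<le> j" for \<alpha>
    unfolding D_def using that by (intro member_le_sum finite_mi_order C) auto
  have kw: "(\<lambda>x. \<kappa> x * wave k x) \<in> test_functions_in L" for k
    using test_functions_mult_smooth[OF \<kappa> smooth_wave[of k]] by (simp add: mult.commute)
  show ?thesis
  proof (rule has_sum_of_tail_bound[OF rapidD[OF d, of j], of _ _ "c * D"])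
    fix F :: "('n \<Rightarrow> int) set" assume F: "finite F"
    let ?e = "\<lambda>k. if k \<in> F then 0 else d k"
    let ?H = "\<lambda>x. \<kappa> x * (\<Sum>\<^sub>\<infinity>k. ?e k * wave k x)"
    have e: "rapid ?e" by (rule rapid_restrict[OF d])
    have H: "?H \<in> test_functions_in L" by (rule cutoff_wave_series(1)[OF L(1) \<kappa> e C])
    have split: "\<kappa> x * (\<Sum>\<^sub>\<infinity>k. d k * wave k x) = (\<Sum>k\<in>F. d k * (\<kappa> x * wave k x)) + ?H x" for x
    proof -
      have "(\<Sum>\<^sub>\<infinity>k. ?e k * wave k x) = (\<Sum>\<^sub>\<infinity>k\<in>-F. d k * wave k x)"
        by (rule infsum_cong_neutral) auto
      also have "\<dots> = (\<Sum>\<^sub>\<infinity>k. d k * wave k x) - (\<Sum>k\<in>F. d k * wave k x)"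
        by (rule infsum_Compl[symmetric, OF wave_series_summable[OF rapid_norm[OF d]] F])
      finally have e: "(\<Sum>\<^sub>\<infinity>k. d k * wave k x) = (\<Sum>k\<in>F. d k * wave k x) + (\<Sum>\<^sub>\<infinity>k. ?e k * wave k x)" by simp
      show ?thesis
        unfolding e by (simp only: distrib_left sum_distrib_left mult.left_commute[of "\<kappa> x"])
    qed
    have "T (\<lambda>x. \<kappa> x * (\<Sum>\<^sub>\<infinity>k. d k * wave k x)) = T (\<lambda>x. \<Sum>k\<in>F. d k * (\<kappa> x * wave k x)) + T ?H"
      unfolding split by (rule distributions_add[OF T _ H L]) (intro test_functions_sum test_functions_cmult kw)
    also have "T (\<lambda>x. \<Sum>k\<in>F. d k * (\<kappa> x * wave k x)) = (\<Sum>k\<in>F. d k * T (\<lambda>x. \<kappa> x * wave k x))"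
      by (subst distributions_sum[OF T L]) (auto intro!: test_functions_cmult kw sum.cong distributions_cmult[OF T _ L])
    finally have "T (\<lambda>x. \<kappa> x * (\<Sum>\<^sub>\<infinity>k. d k * wave k x)) - (\<Sum>k\<in>F. d k * T (\<lambda>x. \<kappa> x * wave k x)) = T ?H" by simp
    also have "norm \<dots> \<le> c * C_norm L j ?H" by (rule jc(2)[OF H])
    also have "\<dots> \<le> c * (D * infsum (\<lambda>k. norm (d k) * jap k ^ j) (- F))"
    proof (intro mult_left_mono C_norm_le)
      have nn: "0 \<le> infsum (\<lambda>k. norm (d k) * jap k ^ j) (- F)" by (intro infsum_nonneg) auto
      then show "0 \<le> D * infsum (\<lambda>k. norm (d k) * jap k ^ j) (- F)" using D0 by simp
      fix \<alpha> :: "'n \<Rightarrow> nat" and x assume \<alpha>: "mi_order \<alpha> \<le> j"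
      have "norm (pderivs \<alpha> ?H x) \<le> C (mi_list \<alpha>) * infsum (\<lambda>k. norm (?e k) * jap k ^ length (mi_list \<alpha>)) UNIV"
        unfolding pderivs_eq_fold by (rule cutoff_wave_series(2)[OF L(1) \<kappa> e C])
      also have "infsum (\<lambda>k. norm (?e k) * jap k ^ length (mi_list \<alpha>)) UNIV \<le> infsum (\<lambda>k. norm (?e k) * jap k ^ j) UNIV"
        using \<alpha> by (intro infsum_mono rapidD e mult_left_mono power_increasing jap_ge_1) (auto simp: length_mi_list)
      also have "infsum (\<lambda>k. norm (?e k) * jap k ^ j) UNIV = infsum (\<lambda>k. norm (d k) * jap k ^ j) (- F)"
        by (rule infsum_cong_neutral) auto
      finally show "norm (pderivs \<alpha> ?H x) \<le> D * infsum (\<lambda>k. norm (d k) * jap k ^ j) (- F)"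
        using C(1)[of "mi_list \<alpha>"] DC[OF \<alpha>] nn by (meson mult_left_mono mult_right_mono order_trans)
    qed (use jc in simp)
    finally show "norm (T (\<lambda>x. \<kappa> x * (\<Sum>\<^sub>\<infinity>k. d k * wave k x)) - (\<Sum>k\<in>F. d k * T (\<lambda>x. \<kappa> x * wave k x)))
        \<le> c * D * infsum (\<lambda>k. norm (d k) * jap k ^ j) (- F)" by (simp add: mult.assoc)
  qed
qed

section \<open>Constant coefficient operators on functions\<close>

definition cop :: "nat \<Rightarrow> (('n \<Rightarrow> nat) \<Rightarrow> complex) \<Rightarrow> (real^'n::finite \<Rightarrow> complex) \<Rightarrow> real^'n \<Rightarrow> complex" where
  "cop m r f x = (\<Sum>\<alpha> | mi_order \<alpha> \<le> m. r \<alpha> * Dop \<alpha> f x)"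

lemma cop_cong_open:
  assumes "open U" "x \<in> U" "\<And>y. y \<in> U \<Longrightarrow> f y = g y"
  shows "cop m r f x = cop m r g x"
  unfolding cop_def Dop_def pderivs_eq_fold using fold_pd_cong_open[OF assms(1,3,2)] by simp

lemma cop_zero [simp]: "cop m r (\<lambda>_. 0) x = 0"
  by (simp add: cop_def Dop_def pderivs_eq_fold fold_pd_zero)

lemma cop_test:
  assumes "compact K" "f \<in> test_functions_in K"
  shows "cop m r f \<in> test_functions_in K"
  unfolding cop_def[abs_def] Dop_def pderivs_eq_fold
  by (intro test_functions_sum test_functions_cmult test_functions_fold_pd compact_imp_closed assms)

lemma (in elliptic_family) cop_wave_series:
  fixes d :: "('n \<Rightarrow> int) \<Rightarrow> complex"
  assumes d: "rapid d"
  shows "((\<lambda>k. sym i k * d k * wave k x) has_sum cop m (b i) (\<lambda>x. \<Sum>\<^sub>\<infinity>k. d k * wave k x) x) UNIV"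
proof -
  \<comment> \<open>The factor in \<open>Dop\<close> cancels the i that every derivative of a wave
    produces; only the monomial in k remains.\<close>
  have mon: "(- \<i>) ^ mi_order \<alpha> * (\<Prod>j\<leftarrow>mi_list \<alpha>. \<i> * of_int (k j)) = (\<Prod>j\<in>UNIV. of_int (k j) ^ \<alpha> j)"
    for \<alpha> :: "'n \<Rightarrow> nat" and k
  proof -
    have "(- \<i>) ^ length js * (\<Prod>j\<leftarrow>js. \<i> * complex_of_int (k j)) = (\<Prod>j\<leftarrow>js. of_int (k j))" for js :: "'n list"
      by (induction js) (auto simp: algebra_simps)
    moreover have "(\<Prod>j\<leftarrow>mi_list \<alpha>. complex_of_int (k j)) = (\<Prod>j\<in>UNIV. of_int (k j) ^ \<alpha> j)"
    proof -
      have "(\<Prod>j\<leftarrow>concat (map (\<lambda>i. replicate (\<alpha> i) i) js). complex_of_int (k j)) = (\<Prod>j\<leftarrow>js. of_int (k j) ^ \<alpha> j)" for js :: "'n list"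
        by (induction js) (auto simp: prod_list_replicate)
      then show ?thesis
        using coordinates[where 'n='n] prod.distinct_set_conv_list[of coordinates "\<lambda>j. of_int (k j) ^ \<alpha> j :: complex"]
        by (simp add: mi_list_def)
    qed
    ultimately show ?thesis by (metis length_mi_list)
  qed
  have "((\<lambda>k. \<Sum>\<alpha> | mi_order \<alpha> \<le> m. b i \<alpha> * ((- \<i>) ^ mi_order \<alpha> * (d k * (\<Prod>j\<leftarrow>mi_list \<alpha>. \<i> * of_int (k j)) * wave k x)))
      has_sum cop m (b i) (\<lambda>x. \<Sum>\<^sub>\<infinity>k. d k * wave k x) x) UNIV"
    unfolding cop_def Dop_def pderivs_eq_fold
    by (intro has_sum_sum_finite has_sum_cmult_right smooth_wave_series d)
  moreover have "(\<Sum>\<alpha> | mi_order \<alpha> \<le> m. b i \<alpha> * ((- \<i>) ^ mi_order \<alpha> * (d k * (\<Prod>j\<leftarrow>mi_list \<alpha>. \<i> * of_int (k j)) * wave k x)))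
      = sym i k * d k * wave k x" for k
  proof -
    have "b i \<alpha> * ((- \<i>) ^ mi_order \<alpha> * (d k * (\<Prod>j\<leftarrow>mi_list \<alpha>. \<i> * of_int (k j)) * wave k x))
        = b i \<alpha> * ((- \<i>) ^ mi_order \<alpha> * (\<Prod>j\<leftarrow>mi_list \<alpha>. \<i> * of_int (k j))) * d k * wave k x" for \<alpha>
      by (simp only: mult_ac)
    then show ?thesis by (simp only: mon sym_def sum_distrib_right)
  qed
  ultimately show ?thesis by (simp only:)
qed

text \<open>
  \<open>\<kappa> G\<close> solves the equation up to the smooth remainder \<open>\<kappa> E\<close>, because \<open>G\<close> vanishes where \<open>\<kappa>\<close> varies.
\<close>

lemma (in elliptic_family) parametrix_identity:
  fixes x0 :: "real^'n"
  assumes i: "i \<in> I" and \<delta>: "0 < \<delta>" "\<delta> \<le> 1/2"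
    and g: "\<And>k. norm (\<gamma> k) \<le> C * jap k ^ r" "\<And>k. sym i k * \<gamma> k = 1 - \<rho> k"
    and rh: "\<And>k. norm (\<rho> k) \<le> C'"
    and K: "compact K" "K \<subseteq> ball x0 \<delta>" and v: "v \<in> test_functions_in K"
    and G0: "\<And>x. 2 * \<delta> \<le> norm (x - x0) \<Longrightarrow> norm (x - x0) < 4 * \<delta> \<Longrightarrow> ((\<lambda>k. \<gamma> k * fc v k * wave k x) has_sum 0) UNIV"
    and \<kappa>: "smooth_on UNIV \<kappa>" "\<And>x. norm (x - x0) \<le> 3 * \<delta> \<Longrightarrow> \<kappa> x = 1" "\<And>x. 4 * \<delta> \<le> norm (x - x0) \<Longrightarrow> \<kappa> x = 0"
  shows "v x = cop m (b i) (\<lambda>x. \<kappa> x * (\<Sum>\<^sub>\<infinity>k. \<gamma> k * fc v k * wave k x)) x + \<kappa> x * (\<Sum>\<^sub>\<infinity>k. \<rho> k * fc v k * wave k x)"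
proof -
  have rv: "rapid (fc v)" by (rule rapid_fc[OF K(1) v])
  have rd: "rapid (\<lambda>k. \<gamma> k * fc v k)" by (rule rapid_mult[OF rv g(1)])
  have re: "rapid (\<lambda>k. \<rho> k * fc v k)" by (rule rapid_mult[OF rv, of _ C' 0]) (use rh in simp)
  define G where "G x = (\<Sum>\<^sub>\<infinity>k. \<gamma> k * fc v k * wave k x)" for x
  define E where "E x = (\<Sum>\<^sub>\<infinity>k. \<rho> k * fc v k * wave k x)" for x
  have Kbox: "K \<subseteq> pbox x0"
  proof
    fix x assume "x \<in> K"
    then have "norm (x - x0) < \<delta>" using K(2) by (auto simp: dist_norm norm_minus_commute)
    then have "\<bar>x $ j - x0 $ j\<bar> \<le> pi" for j
      using component_le_norm_cart[of "x - x0" j] \<delta> pi_gt3 by simp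
    then show "x \<in> pbox x0" by (simp add: mem_box_cart abs_le_iff) (smt (verit))
  qed
  \<comment> \<open>Since 4 \<delta> \<le> 2 < pi, Fourier inversion of v is available on this whole
    ball.\<close>
  have main: "cop m (b i) G x = v x - E x" if x: "norm (x - x0) < 4 * \<delta>" for x
  proof -
    have "\<bar>x $ j - x0 $ j\<bar> < pi" for j
      using component_le_norm_cart[of "x - x0" j] x \<delta> pi_gt3 by simp
    then have "x \<in> pobox x0" by (simp add: mem_box_cart abs_less_iff) (smt (verit))
    then have "((\<lambda>k. fc v k * wave k x) has_sum v x) UNIV"
      using v by (intro fourier_inversion[OF test_function_continuous[OF v] _ Kbox rapid_norm[OF rv]]) (auto simp: test_functions_in_def)
    moreover have "((\<lambda>k. \<rho> k * fc v k * wave k x) has_sum E x) UNIV"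
      unfolding E_def by (intro has_sum_infsum wave_series_summable rapid_norm re)
    ultimately have "((\<lambda>k. fc v k * wave k x - \<rho> k * fc v k * wave k x) has_sum (v x - E x)) UNIV"
      by (rule has_sum_minus)
    moreover have "fc v k * wave k x - \<rho> k * fc v k * wave k x = sym i k * (\<gamma> k * fc v k) * wave k x" for k
      using g(2)[of k] by (simp add: left_diff_distrib flip: mult.assoc)
    ultimately have "((\<lambda>k. sym i k * (\<gamma> k * fc v k) * wave k x) has_sum (v x - E x)) UNIV" by simp
    moreover have "((\<lambda>k. sym i k * (\<gamma> k * fc v k) * wave k x) has_sum cop m (b i) G x) UNIV"
      unfolding G_def[abs_def] by (rule cop_wave_series[OF rd])
    ultimately show ?thesis using has_sum_unique by blast
  qed
  have Gz: "G x = 0" if "2 * \<delta> \<le> norm (x - x0)" "norm (x - x0) < 4 * \<delta>" for x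
    unfolding G_def by (rule infsumI[OF G0[OF that]])
  show ?thesis
    unfolding G_def[symmetric] E_def[symmetric]
  proof (cases "norm (x - x0) < 3 * \<delta>")
    case True
    have "cop m (b i) (\<lambda>x. \<kappa> x * G x) x = cop m (b i) G x"
      by (rule cop_cong_open[of "ball x0 (3 * \<delta>)"]) (use True \<kappa>(2) in \<open>auto simp: dist_norm norm_minus_commute\<close>)
    then show "v x = cop m (b i) (\<lambda>x. \<kappa> x * G x) x + \<kappa> x * E x"
      using main[of x] True \<delta> \<kappa>(2)[of x] by simp
  next
    \<comment> \<open>Here v x = 0, and \<kappa> G vanishes at all points farther than 2 \<delta>
      from x0: by \<open>Gz\<close> below 4 \<delta> and by \<kappa> from there on.\<close>
    case False
    have vx: "v x = 0"
    proof (rule ccontr)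
      assume "v x \<noteq> 0"
      then have "x \<in> ball x0 \<delta>" using v K by (auto simp: test_functions_in_def)
      then show False using False \<delta> by (simp add: dist_norm norm_minus_commute)
    qed
    let ?O = "- cball x0 (2 * \<delta>)"
    have "cop m (b i) (\<lambda>x. \<kappa> x * G x) x = cop m (b i) (\<lambda>_. 0) x"
    proof (rule cop_cong_open[of ?O])
      show "\<kappa> y * G y = 0" if "y \<in> ?O" for y
        using that Gz[of y] \<kappa>(3)[of y] by (cases "norm (y - x0) < 4 * \<delta>") (auto simp: dist_norm norm_minus_commute)
    qed (use False \<delta> in \<open>auto simp: dist_norm norm_minus_commute open_Compl\<close>)
    moreover have "\<kappa> x * E x = 0"
    proof (cases "norm (x - x0) < 4 * \<delta>")
      case True
      \<comment> \<open>\<open>main\<close> is read backwards: G = 0 on an open set around x forces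
        E x = v x = 0, so the remainder needs no correction either.\<close>
      have "cop m (b i) G x = cop m (b i) (\<lambda>_. 0) x"
      proof (rule cop_cong_open[of "ball x0 (4 * \<delta>) - cball x0 (2 * \<delta>)"])
        show "G y = 0" if "y \<in> ball x0 (4 * \<delta>) - cball x0 (2 * \<delta>)" for y
          using that by (intro Gz) (auto simp: dist_norm norm_minus_commute)
      qed (use True False \<delta> in \<open>auto simp: dist_norm norm_minus_commute open_Diff\<close>)
      then show ?thesis using main[OF True] vx by simp
    qed (use \<kappa>(3) in simp)
    ultimately show "v x = cop m (b i) (\<lambda>x. \<kappa> x * G x) x + \<kappa> x * E x" using vx by simp
  qed
qed

section \<open>Asymptotic bounds of nets\<close>

text \<open>One-sided, without absolute values, so that it is monotone under plain inequalities; for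
  functions nonnegative on the index interval it agrees with the Landau symbol
  (\<open>bnd_iff_bigo\<close>).\<close>

definition bnd :: "(real \<Rightarrow> real) \<Rightarrow> real \<Rightarrow> bool" where
  "bnd F a \<longleftrightarrow> (\<exists>C\<ge>0. \<forall>\<^sub>F \<epsilon> in at_right 0. F \<epsilon> \<le> C * \<epsilon> powr a)"

lemma eventually_unit: "\<forall>\<^sub>F \<epsilon> in at_right (0::real). \<epsilon> \<in> {0<..1}"
  using eventually_at_right_real[of 0 1] by (rule eventually_mono) auto

lemma bnd_mono:
  assumes "bnd G a" "\<forall>\<^sub>F \<epsilon> in at_right 0. F \<epsilon> \<le> G \<epsilon>" shows "bnd F a"
proof -
  obtain C where C: "C \<ge> 0" "\<forall>\<^sub>F \<epsilon> in at_right 0. G \<epsilon> \<le> C * \<epsilon> powr a" using assms(1) by (auto simp: bnd_def)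
  have "\<forall>\<^sub>F \<epsilon> in at_right 0. F \<epsilon> \<le> C * \<epsilon> powr a"
    using assms(2) C(2) by eventually_elim (rule order_trans)
  with C(1) show ?thesis by (auto simp: bnd_def)
qed

lemma bnd_mono_unit: "bnd G a \<Longrightarrow> (\<And>\<epsilon>. \<epsilon> \<in> {0<..1} \<Longrightarrow> F \<epsilon> \<le> G \<epsilon>) \<Longrightarrow> bnd F a"
  by (erule bnd_mono) (rule eventually_mono[OF eventually_unit])

lemma bnd_weaken:
  assumes "bnd F a" "b \<le> a" shows "bnd F b"
proof -
  obtain C where C: "C \<ge> 0" "\<forall>\<^sub>F \<epsilon> in at_right 0. F \<epsilon> \<le> C * \<epsilon> powr a" using assms(1) by (auto simp: bnd_def)
  have "\<forall>\<^sub>F \<epsilon> in at_right 0. F \<epsilon> \<le> C * \<epsilon> powr b"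
    using C(2) eventually_unit
  proof eventually_elim
    case (elim \<epsilon>)
    have "\<epsilon> powr a \<le> \<epsilon> powr b" using elim(2) assms(2) by (intro powr_mono') auto
    then show ?case using elim(1) mult_left_mono[OF _ C(1)] order_trans by blast
  qed
  with C(1) show ?thesis by (auto simp: bnd_def)
qed

lemma bnd_add:
  assumes "bnd F a" "bnd G a" shows "bnd (\<lambda>\<epsilon>. F \<epsilon> + G \<epsilon>) a"
proof -
  obtain C where C: "C \<ge> 0" "\<forall>\<^sub>F \<epsilon> in at_right 0. F \<epsilon> \<le> C * \<epsilon> powr a" using assms(1) by (auto simp: bnd_def)
  obtain D where D: "D \<ge> 0" "\<forall>\<^sub>F \<epsilon> in at_right 0. G \<epsilon> \<le> D * \<epsilon> powr a" using assms(2) by (auto simp: bnd_def)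
  have "\<forall>\<^sub>F \<epsilon> in at_right 0. F \<epsilon> + G \<epsilon> \<le> (C + D) * \<epsilon> powr a"
    using C(2) D(2) by eventually_elim (simp add: distrib_right)
  with C D show ?thesis by (auto simp: bnd_def intro!: exI[of _ "C + D"])
qed

lemma bnd_mult:
  assumes "bnd F a" "bnd G b" "\<And>\<epsilon>. \<epsilon> \<in> {0<..1} \<Longrightarrow> 0 \<le> G \<epsilon>" shows "bnd (\<lambda>\<epsilon>. F \<epsilon> * G \<epsilon>) (a + b)"
proof -
  obtain C where C: "C \<ge> 0" "\<forall>\<^sub>F \<epsilon> in at_right 0. F \<epsilon> \<le> C * \<epsilon> powr a" using assms(1) by (auto simp: bnd_def)
  obtain D where D: "D \<ge> 0" "\<forall>\<^sub>F \<epsilon> in at_right 0. G \<epsilon> \<le> D * \<epsilon> powr b" using assms(2) by (auto simp: bnd_def)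
  have "\<forall>\<^sub>F \<epsilon> in at_right 0. F \<epsilon> * G \<epsilon> \<le> (C * D) * \<epsilon> powr (a + b)"
    using C(2) D(2) eventually_unit
  proof eventually_elim
    case (elim \<epsilon>)
    have "F \<epsilon> * G \<epsilon> \<le> (C * \<epsilon> powr a) * (D * \<epsilon> powr b)"
      using elim assms(3)[OF elim(3)] C D by (intro mult_mono) auto
    then show ?case by (simp add: powr_add mult_ac)
  qed
  with C D show ?thesis by (auto simp: bnd_def intro!: exI[of _ "C * D"])
qed

lemma bnd_const: "bnd (\<lambda>_. c) 0"
  unfolding bnd_def
  by (intro exI[of _ "\<bar>c\<bar>"]) (auto intro!: eventually_mono[OF eventually_unit])

lemma bnd_powr: "bnd (\<lambda>\<epsilon>. \<epsilon> powr a) a"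
  unfolding bnd_def by (intro exI[of _ 1]) auto

lemma bnd_cmult: "bnd F a \<Longrightarrow> 0 \<le> c \<Longrightarrow> bnd (\<lambda>\<epsilon>. F \<epsilon> * c) a"
  using bnd_mult[of F a "\<lambda>_. c" 0] by (simp add: bnd_const)

lemma bnd_sum: "(\<And>i. i \<in> S \<Longrightarrow> bnd (F i) a) \<Longrightarrow> bnd (\<lambda>\<epsilon>. \<Sum>i\<in>S. F i \<epsilon>) a"
proof (induction S rule: infinite_finite_induct)
  case (insert i S)
  then show ?case by (simp add: bnd_add)
qed (auto simp: bnd_def intro!: exI[of _ 0])

lemma bnd_iff_bigo:
  assumes "\<And>\<epsilon>. \<epsilon> \<in> {0<..1} \<Longrightarrow> 0 \<le> F \<epsilon>"
  shows "F \<in> O[at_right 0](\<lambda>\<epsilon>. \<epsilon> powr a) \<longleftrightarrow> bnd F a"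
proof
  assume "F \<in> O[at_right 0](\<lambda>\<epsilon>. \<epsilon> powr a)"
  then obtain c where c: "c > 0" "\<forall>\<^sub>F \<epsilon> in at_right 0. norm (F \<epsilon>) \<le> c * norm (\<epsilon> powr a)"
    by (rule landau_o.bigE)
  have "\<forall>\<^sub>F \<epsilon> in at_right 0. F \<epsilon> \<le> c * \<epsilon> powr a" using c(2) by eventually_elim auto
  then show "bnd F a" using c(1) by (auto simp: bnd_def intro!: exI[of _ c])
next
  assume "bnd F a"
  then obtain C where C: "C \<ge> 0" "\<forall>\<^sub>F \<epsilon> in at_right 0. F \<epsilon> \<le> C * \<epsilon> powr a" by (auto simp: bnd_def)
  show "F \<in> O[at_right 0](\<lambda>\<epsilon>. \<epsilon> powr a)"
    by (rule bigoI[of _ C]) (use C(2) eventually_unit in \<open>eventually_elim, use assms in auto\<close>)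
qed

lemma moderate_iff: "moderate r \<longleftrightarrow> (\<exists>N::nat. bnd (\<lambda>\<epsilon>. norm (r \<epsilon>)) (- real N))"
  by (simp add: moderate_def bnd_iff_bigo)

lemma negligible_iff: "negligible_net r \<longleftrightarrow> (\<forall>q::nat. bnd (\<lambda>\<epsilon>. norm (r \<epsilon>)) (real q))"
  by (simp add: negligible_net_def bnd_iff_bigo)

lemma abs_gnum_eqI: "moderate r \<Longrightarrow> moderate s \<Longrightarrow> negligible_net (\<lambda>\<epsilon>. r \<epsilon> - s \<epsilon>) \<Longrightarrow> abs_gnum r = abs_gnum s"
  using Quotient3_rel[OF Quotient3_gnum, of r s] by (simp add: net_eq_def)

lemma abs_gnum_eqD:
  assumes "abs_gnum r = abs_gnum s" "moderate r" "moderate s"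
  shows "negligible_net (\<lambda>\<epsilon>. r \<epsilon> - s \<epsilon>)"
  using Quotient3_rel[OF Quotient3_gnum, of r s] assms by (simp add: net_eq_def negligible_zero)

lemma moderate_rep: "moderate (rep_gnum c)"
  using Quotient3_rep_reflp[OF Quotient3_gnum, of c] by (simp add: net_eq_def)

lemma abs_rep_gnum: "abs_gnum (rep_gnum c) = c"
  by (rule Quotient3_abs_rep[OF Quotient3_gnum])

subsection \<open>Suprema on compact sets\<close>

lemma sup_norm_le: "0 \<le> B \<Longrightarrow> (\<And>x. x \<in> K \<Longrightarrow> norm (g x) \<le> B) \<Longrightarrow> sup_norm K g \<le> B"
  unfolding sup_norm_def by (intro cSup_least) auto

lemma sup_norm_bdd:
  assumes "compact K" "continuous_on K g"
  shows "bdd_above (insert 0 ((\<lambda>x. norm (g x)) ` K))"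
  using compact_continuous_image[OF continuous_on_norm[OF assms(2)] assms(1)]
  by (auto dest: compact_imp_bounded bounded_imp_bdd_above)

lemma sup_norm_ge: "compact K \<Longrightarrow> continuous_on K g \<Longrightarrow> x \<in> K \<Longrightarrow> norm (g x) \<le> sup_norm K g"
  unfolding sup_norm_def by (intro cSup_upper sup_norm_bdd) auto

lemma sup_norm_nonneg: "compact K \<Longrightarrow> continuous_on K g \<Longrightarrow> 0 \<le> sup_norm K g"
  unfolding sup_norm_def by (intro cSup_upper sup_norm_bdd) auto

lemma sup_norm_cong: "(\<And>x. x \<in> K \<Longrightarrow> f x = g x) \<Longrightarrow> sup_norm K f = sup_norm K g"
  unfolding sup_norm_def by (metis (mono_tags, lifting) image_cong)

abbreviation dsup :: "(real^'n::finite) set \<Rightarrow> 'n list \<Rightarrow> 'n net \<Rightarrow> real \<Rightarrow> real" where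
  "dsup K is u \<epsilon> \<equiv> sup_norm K (fold pd is (u \<epsilon>))"

lemma smooth_continuous_fold_pd:
  "smooth_on \<Omega> f \<Longrightarrow> K \<subseteq> \<Omega> \<Longrightarrow> continuous_on K (fold pd is f)"
  by (meson continuous_on_subset smooth_on_imp_continuous smooth_on_fold_pd)

lemma dsup_nonneg: "u \<in> smooth_nets \<Omega> \<Longrightarrow> compact K \<Longrightarrow> K \<subseteq> \<Omega> \<Longrightarrow> \<epsilon> \<in> {0<..1} \<Longrightarrow> 0 \<le> dsup K is u \<epsilon>"
  by (intro sup_norm_nonneg smooth_continuous_fold_pd[of \<Omega>]) (auto simp: smooth_nets_def)

lemma dsup_ge: "u \<in> smooth_nets \<Omega> \<Longrightarrow> compact K \<Longrightarrow> K \<subseteq> \<Omega> \<Longrightarrow> \<epsilon> \<in> {0<..1} \<Longrightarrow> x \<in> K \<Longrightarrow>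
    norm (fold pd is (u \<epsilon>) x) \<le> dsup K is u \<epsilon>"
  by (intro sup_norm_ge smooth_continuous_fold_pd[of \<Omega>]) (auto simp: smooth_nets_def)

lemma bigo_pderivs_iff:
  assumes "u \<in> smooth_nets \<Omega>" "compact K" "K \<subseteq> \<Omega>"
  shows "(\<lambda>\<epsilon>. sup_norm K (pderivs \<alpha> (u \<epsilon>))) \<in> O[at_right 0](\<lambda>\<epsilon>. \<epsilon> powr a) \<longleftrightarrow> bnd (dsup K (mi_list \<alpha>) u) a"
  unfolding pderivs_eq_fold by (rule bnd_iff_bigo) (rule dsup_nonneg[OF assms])

lemma dsup_mi_list:
  fixes "is" :: "'n::finite list"
  obtains \<alpha> where "\<And>\<Omega> u K a. open \<Omega> \<Longrightarrow> u \<in> smooth_nets \<Omega> \<Longrightarrow> K \<subseteq> \<Omega> \<Longrightarrow>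
    bnd (dsup K (mi_list \<alpha>) u) a \<Longrightarrow> bnd (dsup K is u) a"
proof -
  obtain \<alpha> where \<alpha>: "\<And>\<Omega> f x. open \<Omega> \<Longrightarrow> smooth_on \<Omega> f \<Longrightarrow> x \<in> \<Omega> \<Longrightarrow> fold pd is f x = pderivs \<alpha> f x"
    using fold_pd_eq_pderivs[of "is"] by metis
  show thesis
  proof (rule that[of \<alpha>])
    fix \<Omega> u K a
    assume *: "open \<Omega>" "u \<in> smooth_nets \<Omega>" "K \<subseteq> \<Omega>" "bnd (dsup K (mi_list \<alpha>) u) a"
    show "bnd (dsup K is u) a"
    proof (rule bnd_mono_unit[OF *(4)])
      fix \<epsilon> :: real assume "\<epsilon> \<in> {0<..1}"
      then have "fold pd is (u \<epsilon>) x = fold pd (mi_list \<alpha>) (u \<epsilon>) x" if "x \<in> K" for x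
        using \<alpha>[OF *(1), of "u \<epsilon>" x] * that by (auto simp: smooth_nets_def pderivs_eq_fold)
      then have "dsup K is u \<epsilon> = dsup K (mi_list \<alpha>) u \<epsilon>" by (rule sup_norm_cong)
      then show "dsup K is u \<epsilon> \<le> dsup K (mi_list \<alpha>) u \<epsilon>" by simp
    qed
  qed
qed

lemma moderate_nets_iff:
  assumes "open \<Omega>"
  shows "u \<in> moderate_nets \<Omega> \<longleftrightarrow> u \<in> smooth_nets \<Omega> \<and>
    (\<forall>K is. compact K \<and> K \<subseteq> \<Omega> \<longrightarrow> (\<exists>N::nat. bnd (dsup K is u) (- real N)))"
proof (cases "u \<in> smooth_nets \<Omega>")
  case True
  show ?thesis
  proof
    assume m: "u \<in> moderate_nets \<Omega>"
    show "u \<in> smooth_nets \<Omega> \<and> (\<forall>K is. compact K \<and> K \<subseteq> \<Omega> \<longrightarrow> (\<exists>N::nat. bnd (dsup K is u) (- real N)))"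
    proof (intro conjI True allI impI)
      fix K "is" assume K: "compact K \<and> K \<subseteq> \<Omega>"
      obtain \<alpha> where \<alpha>: "\<And>K a. K \<subseteq> \<Omega> \<Longrightarrow> bnd (dsup K (mi_list \<alpha>) u) a \<Longrightarrow> bnd (dsup K is u) a"
        using dsup_mi_list[of "is"] assms True by metis
      have "\<exists>N::nat. (\<lambda>\<epsilon>. sup_norm K (pderivs \<alpha> (u \<epsilon>))) \<in> O[at_right 0](\<lambda>\<epsilon>. \<epsilon> powr (- real N))"
        using m K by (simp add: moderate_nets_def)
      then show "\<exists>N::nat. bnd (dsup K is u) (- real N)"
        using \<alpha> K bigo_pderivs_iff[OF True] by blast
    qed
  next
    assume "u \<in> smooth_nets \<Omega> \<and> (\<forall>K is. compact K \<and> K \<subseteq> \<Omega> \<longrightarrow> (\<exists>N::nat. bnd (dsup K is u) (- real N)))"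
    then show "u \<in> moderate_nets \<Omega>"
      using bigo_pderivs_iff[OF True] by (simp add: moderate_nets_def)
  qed
qed (simp add: moderate_nets_def)

lemma negligible_nets_iff:
  assumes "open \<Omega>"
  shows "u \<in> negligible_nets \<Omega> \<longleftrightarrow> u \<in> smooth_nets \<Omega> \<and>
    (\<forall>K is. compact K \<and> K \<subseteq> \<Omega> \<longrightarrow> (\<forall>q::nat. bnd (dsup K is u) (real q)))"
proof (cases "u \<in> smooth_nets \<Omega>")
  case True
  show ?thesis
  proof
    assume m: "u \<in> negligible_nets \<Omega>"
    show "u \<in> smooth_nets \<Omega> \<and> (\<forall>K is. compact K \<and> K \<subseteq> \<Omega> \<longrightarrow> (\<forall>q::nat. bnd (dsup K is u) (real q)))"
    proof (intro conjI True allI impI)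
      fix K "is" and q :: nat assume K: "compact K \<and> K \<subseteq> \<Omega>"
      obtain \<alpha> where \<alpha>: "\<And>K a. K \<subseteq> \<Omega> \<Longrightarrow> bnd (dsup K (mi_list \<alpha>) u) a \<Longrightarrow> bnd (dsup K is u) a"
        using dsup_mi_list[of "is"] assms True by metis
      have "(\<lambda>\<epsilon>. sup_norm K (pderivs \<alpha> (u \<epsilon>))) \<in> O[at_right 0](\<lambda>\<epsilon>. \<epsilon> powr real q)"
        using m K by (simp add: negligible_nets_def)
      then show "bnd (dsup K is u) (real q)"
        using \<alpha> K bigo_pderivs_iff[OF True] by blast
    qed
  next
    assume "u \<in> smooth_nets \<Omega> \<and> (\<forall>K is. compact K \<and> K \<subseteq> \<Omega> \<longrightarrow> (\<forall>q::nat. bnd (dsup K is u) (real q)))"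
    then show "u \<in> negligible_nets \<Omega>"
      using bigo_pderivs_iff[OF True] by (simp add: negligible_nets_def)
  qed
qed (simp add: negligible_nets_def)

lemma moderate_smooth: "u \<in> moderate_nets \<Omega> \<Longrightarrow> u \<in> smooth_nets \<Omega>"
  by (simp add: moderate_nets_def)

lemma smooth_netsD: "u \<in> smooth_nets \<Omega> \<Longrightarrow> \<epsilon> \<in> {0<..1} \<Longrightarrow> smooth_on \<Omega> (u \<epsilon>)"
  by (simp add: smooth_nets_def)

definition regular_net :: "(real^'n::finite) set \<Rightarrow> 'n net \<Rightarrow> bool" where
  "regular_net \<Omega> u \<longleftrightarrow> (\<forall>K. compact K \<and> K \<subseteq> \<Omega> \<longrightarrow> (\<exists>N::nat. \<forall>is. bnd (dsup K is u) (- real N)))"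

lemma regular_net_iff:
  fixes \<Omega> :: "(real^'n::finite) set"
  assumes "open \<Omega>" "u \<in> smooth_nets \<Omega>"
  shows "(\<forall>K. compact K \<and> K \<subseteq> \<Omega> \<longrightarrow>
     (\<exists>N::nat. \<forall>\<alpha>. (\<lambda>\<epsilon>. sup_norm K (pderivs \<alpha> (u \<epsilon>))) \<in> O[at_right 0](\<lambda>\<epsilon>. \<epsilon> powr (- real N)))) \<longleftrightarrow> regular_net \<Omega> u"
proof -
  have "(\<forall>\<alpha>. bnd (dsup K (mi_list \<alpha>) u) a) \<longleftrightarrow> (\<forall>is. bnd (dsup K is u) a)" if "K \<subseteq> \<Omega>" for K a
  proof
    assume *: "\<forall>\<alpha>. bnd (dsup K (mi_list \<alpha>) u) a"
    show "\<forall>is. bnd (dsup K is u) a"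
    proof
      fix "is" :: "'n list"
      obtain \<alpha> where "\<And>\<Omega> u K a. open \<Omega> \<Longrightarrow> u \<in> smooth_nets \<Omega> \<Longrightarrow> K \<subseteq> \<Omega> \<Longrightarrow>
          bnd (dsup K (mi_list \<alpha>) u) a \<Longrightarrow> bnd (dsup K is u) a"
        using dsup_mi_list[of "is"] by blast
      then show "bnd (dsup K is u) a" using assms that * by blast
    qed
  qed blast
  then show ?thesis
    unfolding regular_net_def using bigo_pderivs_iff[OF assms(2)] by simp
qed

lemma fold_pd_cop:
  assumes "open \<Omega>" "smooth_on \<Omega> f" "x \<in> \<Omega>"
  shows "fold pd is (cop m r f) x = (\<Sum>\<alpha> | mi_order \<alpha> \<le> m. r \<alpha> * ((- \<i>) ^ mi_order \<alpha> * fold pd (mi_list \<alpha> @ is) f x))"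
proof -
  have s: "smooth_on \<Omega> (\<lambda>x. (- \<i>) ^ mi_order \<alpha> * fold pd (mi_list \<alpha>) f x)" for \<alpha>
    by (intro smooth_on_cmult smooth_on_fold_pd assms)
  have "fold pd is (cop m r f) x = (\<Sum>\<alpha> | mi_order \<alpha> \<le> m. fold pd is (\<lambda>x. r \<alpha> * ((- \<i>) ^ mi_order \<alpha> * fold pd (mi_list \<alpha>) f x)) x)"
    unfolding cop_def[abs_def] Dop_def pderivs_eq_fold
    by (intro fold_pd_sum[OF assms(1)] smooth_on_cmult s assms)
  moreover have "fold pd is (\<lambda>x. r \<alpha> * ((- \<i>) ^ mi_order \<alpha> * fold pd (mi_list \<alpha>) f x)) x
      = r \<alpha> * ((- \<i>) ^ mi_order \<alpha> * fold pd (mi_list \<alpha> @ is) f x)" for \<alpha>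
    using fold_pd_cmult[OF assms(1) s assms(3)]
      fold_pd_cmult[OF assms(1) smooth_on_fold_pd[OF assms(2)] assms(3), of "is" "(- \<i>) ^ mi_order \<alpha>"] by simp
  ultimately show ?thesis by (simp only:)
qed

lemma smooth_on_cop: "open \<Omega> \<Longrightarrow> smooth_on \<Omega> f \<Longrightarrow> smooth_on \<Omega> (cop m r f)"
  unfolding cop_def[abs_def] Dop_def pderivs_eq_fold
  by (intro smooth_on_sum smooth_on_cmult smooth_on_fold_pd)

lemma dsup_cop_le:
  assumes "open \<Omega>" "u \<in> smooth_nets \<Omega>" "compact K" "K \<subseteq> \<Omega>" "\<epsilon> \<in> {0<..1}"
  shows "dsup K is (\<lambda>\<epsilon>. cop m (r \<epsilon>) (u \<epsilon>)) \<epsilon> \<le> (\<Sum>\<alpha> | mi_order \<alpha> \<le> m. norm (r \<epsilon> \<alpha>) * dsup K (mi_list \<alpha> @ is) u \<epsilon>)"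
proof (rule sup_norm_le)
  show "0 \<le> (\<Sum>\<alpha> | mi_order \<alpha> \<le> m. norm (r \<epsilon> \<alpha>) * dsup K (mi_list \<alpha> @ is) u \<epsilon>)"
    by (intro sum_nonneg mult_nonneg_nonneg dsup_nonneg[OF assms(2-5)] norm_ge_zero)
  fix x assume x: "x \<in> K"
  show "norm (fold pd is (cop m (r \<epsilon>) (u \<epsilon>)) x) \<le> (\<Sum>\<alpha> | mi_order \<alpha> \<le> m. norm (r \<epsilon> \<alpha>) * dsup K (mi_list \<alpha> @ is) u \<epsilon>)"
    unfolding fold_pd_cop[OF assms(1) smooth_netsD[OF assms(2,5)] subsetD[OF assms(4) x]]
    using dsup_ge[OF assms(2-5) x]
    by (intro sum_norm_le) (auto simp: norm_mult norm_power simp del: fold_append intro!: mult_left_mono)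
qed

lemma cop_smooth_nets: "open \<Omega> \<Longrightarrow> u \<in> smooth_nets \<Omega> \<Longrightarrow> (\<lambda>\<epsilon>. cop m (r \<epsilon>) (u \<epsilon>)) \<in> smooth_nets \<Omega>"
  by (simp add: smooth_nets_def smooth_on_cop)

lemma bnd_finite_uniform:
  assumes "finite S" "\<And>i. i \<in> S \<Longrightarrow> \<exists>N::nat. bnd (F i) (- real N)"
  obtains N :: nat where "\<And>i. i \<in> S \<Longrightarrow> bnd (F i) (- real N)"
proof -
  obtain N where N: "\<And>i. i \<in> S \<Longrightarrow> bnd (F i) (- real (N i))" using assms(2) by metis
  show thesis
  proof (rule that[of "\<Sum>i\<in>S. N i"])
    fix i assume i: "i \<in> S"
    then have "N i \<le> (\<Sum>i\<in>S. N i)" using assms(1) by (intro member_le_sum) auto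
    then show "bnd (F i) (- real (\<Sum>i\<in>S. N i))" by (intro bnd_weaken[OF N[OF i]]) (simp only: neg_le_iff_le of_nat_le_iff)
  qed
qed

lemma moderate_bnd:
  assumes "open \<Omega>" "u \<in> moderate_nets \<Omega>" "compact K" "K \<subseteq> \<Omega>"
  shows "\<exists>N::nat. bnd (dsup K is u) (- real N)"
  using assms(2-4) unfolding moderate_nets_iff[OF assms(1)] by simp

lemma moderate_bnd_uniform:
  fixes h :: "('n::finite \<Rightarrow> nat) \<Rightarrow> 'n list"
  assumes "open \<Omega>" "u \<in> moderate_nets \<Omega>" "compact K" "K \<subseteq> \<Omega>"
  obtains N :: nat where "\<And>\<alpha>. mi_order \<alpha> \<le> m \<Longrightarrow> bnd (dsup K (h \<alpha>) u) (- real N)"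
  by (rule bnd_finite_uniform[OF finite_mi_order[of m], of "\<lambda>\<alpha>. dsup K (h \<alpha>) u", OF moderate_bnd[OF assms]]) auto

lemma coeffs_uniform:
  fixes r :: "real \<Rightarrow> ('n::finite \<Rightarrow> nat) \<Rightarrow> complex"
  assumes "\<And>\<alpha>. moderate (\<lambda>\<epsilon>. r \<epsilon> \<alpha>)"
  obtains M :: nat where "\<And>\<alpha>. mi_order \<alpha> \<le> m \<Longrightarrow> bnd (\<lambda>\<epsilon>. norm (r \<epsilon> \<alpha>)) (- real M)"
  using bnd_finite_uniform[OF finite_mi_order[of m], of "\<lambda>\<alpha> \<epsilon>. norm (r \<epsilon> \<alpha>)"] assms
  by (auto simp: moderate_iff)

lemma cop_bnd:
  assumes "open \<Omega>" "u \<in> smooth_nets \<Omega>" "compact K" "K \<subseteq> \<Omega>"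
    and M: "\<And>\<alpha>. mi_order \<alpha> \<le> m \<Longrightarrow> bnd (\<lambda>\<epsilon>. norm (r \<epsilon> \<alpha>)) (- real M)"
    and a: "\<And>\<alpha>. mi_order \<alpha> \<le> m \<Longrightarrow> bnd (dsup K (mi_list \<alpha> @ is) u) a"
  shows "bnd (dsup K is (\<lambda>\<epsilon>. cop m (r \<epsilon>) (u \<epsilon>))) (a - real M)"
proof (rule bnd_mono_unit)
  have "bnd (\<lambda>\<epsilon>. \<Sum>\<alpha> | mi_order \<alpha> \<le> m. norm (r \<epsilon> \<alpha>) * dsup K (mi_list \<alpha> @ is) u \<epsilon>) (- real M + a)"
    by (intro bnd_sum bnd_mult M a dsup_nonneg[OF assms(2-4)]) auto
  then show "bnd (\<lambda>\<epsilon>. \<Sum>\<alpha> | mi_order \<alpha> \<le> m. norm (r \<epsilon> \<alpha>) * dsup K (mi_list \<alpha> @ is) u \<epsilon>) (a - real M)" by simp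
qed (rule dsup_cop_le[OF assms(1-4)])

lemma cop_moderate:
  assumes "open \<Omega>" "u \<in> moderate_nets \<Omega>" "\<And>\<alpha>. moderate (\<lambda>\<epsilon>. r \<epsilon> \<alpha>)"
  shows "(\<lambda>\<epsilon>. cop m (r \<epsilon>) (u \<epsilon>)) \<in> moderate_nets \<Omega>"
  unfolding moderate_nets_iff[OF assms(1)]
proof (intro conjI allI impI)
  show "(\<lambda>\<epsilon>. cop m (r \<epsilon>) (u \<epsilon>)) \<in> smooth_nets \<Omega>" by (intro cop_smooth_nets assms moderate_smooth)
  fix K "is" assume K: "compact K \<and> K \<subseteq> \<Omega>"
  obtain M :: nat where M: "\<And>\<alpha>. mi_order \<alpha> \<le> m \<Longrightarrow> bnd (\<lambda>\<epsilon>. norm (r \<epsilon> \<alpha>)) (- real M)"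
    by (rule coeffs_uniform[where m = m and r = r, OF assms(3)]) blast
  obtain N :: nat where N: "\<And>\<alpha>. mi_order \<alpha> \<le> m \<Longrightarrow> bnd (dsup K (mi_list \<alpha> @ is) u) (- real N)"
    by (rule moderate_bnd_uniform[OF assms(1,2), of K m "\<lambda>\<alpha>. mi_list \<alpha> @ is"]) (use K in auto)
  have "bnd (dsup K is (\<lambda>\<epsilon>. cop m (r \<epsilon>) (u \<epsilon>))) (- real N - real M)"
    using K N by (intro cop_bnd[OF assms(1) moderate_smooth[OF assms(2)] _ _ M]) (auto simp del: fold_append)
  then show "\<exists>N::nat. bnd (dsup K is (\<lambda>\<epsilon>. cop m (r \<epsilon>) (u \<epsilon>))) (- real N)"
    by (intro exI[of _ "N + M"]) (simp only: of_nat_add minus_add_distrib add_uminus_conv_diff simp_thms)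
qed

text \<open>There are finitely many coefficients, so a single M bounds them; the loss from N to N +
  M is the same for every derivative.\<close>

lemma cop_regular:
  assumes "open \<Omega>" "u \<in> smooth_nets \<Omega>" "regular_net \<Omega> u" "\<And>\<alpha>. moderate (\<lambda>\<epsilon>. r \<epsilon> \<alpha>)"
  shows "regular_net \<Omega> (\<lambda>\<epsilon>. cop m (r \<epsilon>) (u \<epsilon>))"
  unfolding regular_net_def
proof (intro allI impI)
  fix K assume K: "compact K \<and> K \<subseteq> \<Omega>"
  obtain M :: nat where M: "\<And>\<alpha>. mi_order \<alpha> \<le> m \<Longrightarrow> bnd (\<lambda>\<epsilon>. norm (r \<epsilon> \<alpha>)) (- real M)"
    by (rule coeffs_uniform[where m = m and r = r, OF assms(4)]) blast
  obtain N :: nat where N: "\<And>is. bnd (dsup K is u) (- real N)"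
    using assms(3) K unfolding regular_net_def by blast
  have "bnd (dsup K is (\<lambda>\<epsilon>. cop m (r \<epsilon>) (u \<epsilon>))) (- real N - real M)" for "is"
    using K N by (intro cop_bnd[OF assms(1,2) _ _ M]) (auto simp del: fold_append)
  then show "\<exists>N::nat. \<forall>is. bnd (dsup K is (\<lambda>\<epsilon>. cop m (r \<epsilon>) (u \<epsilon>))) (- real N)"
    by (intro exI[of _ "N + M"]) (simp only: of_nat_add minus_add_distrib add_uminus_conv_diff simp_thms)
qed

lemma cop_negligible:
  assumes "open \<Omega>" "u \<in> negligible_nets \<Omega>" "\<And>\<alpha>. moderate (\<lambda>\<epsilon>. r \<epsilon> \<alpha>)"
  shows "(\<lambda>\<epsilon>. cop m (r \<epsilon>) (u \<epsilon>)) \<in> negligible_nets \<Omega>"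
  unfolding negligible_nets_iff[OF assms(1)]
proof (intro conjI allI impI)
  have s: "u \<in> smooth_nets \<Omega>" using assms(2) by (simp add: negligible_nets_def)
  show "(\<lambda>\<epsilon>. cop m (r \<epsilon>) (u \<epsilon>)) \<in> smooth_nets \<Omega>" by (intro cop_smooth_nets assms s)
  fix K "is" and q :: nat assume K: "compact K \<and> K \<subseteq> \<Omega>"
  obtain M :: nat where M: "\<And>\<alpha>. mi_order \<alpha> \<le> m \<Longrightarrow> bnd (\<lambda>\<epsilon>. norm (r \<epsilon> \<alpha>)) (- real M)"
    by (rule coeffs_uniform[where m = m and r = r, OF assms(3)]) blast
  have "bnd (dsup K (mi_list \<alpha> @ is) u) (real (q + M))" for \<alpha>
    using assms(2) K unfolding negligible_nets_iff[OF assms(1)] by blast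
  then have "bnd (dsup K is (\<lambda>\<epsilon>. cop m (r \<epsilon>) (u \<epsilon>))) (real (q + M) - real M)"
    using K by (intro cop_bnd[OF assms(1) s _ _ M]) (auto simp del: fold_append)
  then show "bnd (dsup K is (\<lambda>\<epsilon>. cop m (r \<epsilon>) (u \<epsilon>))) (real q)" by simp
qed

lemma negligible_nets_add:
  assumes "open \<Omega>" "u \<in> negligible_nets \<Omega>" "v \<in> negligible_nets \<Omega>"
  shows "(\<lambda>\<epsilon> x. u \<epsilon> x + v \<epsilon> x) \<in> negligible_nets \<Omega>"
  unfolding negligible_nets_iff[OF assms(1)]
proof (intro conjI allI impI)
  have s: "u \<in> smooth_nets \<Omega>" "v \<in> smooth_nets \<Omega>" using assms(2,3) by (simp_all add: negligible_nets_def)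
  show "(\<lambda>\<epsilon> x. u \<epsilon> x + v \<epsilon> x) \<in> smooth_nets \<Omega>"
    using s by (auto simp: smooth_nets_def intro: smooth_on_add assms)
  fix K "is" and q :: nat assume K: "compact K \<and> K \<subseteq> \<Omega>"
  show "bnd (dsup K is (\<lambda>\<epsilon> x. u \<epsilon> x + v \<epsilon> x)) (real q)"
  proof (rule bnd_mono_unit)
    show "bnd (\<lambda>\<epsilon>. dsup K is u \<epsilon> + dsup K is v \<epsilon>) (real q)"
      using assms(2,3) K unfolding negligible_nets_iff[OF assms(1)] by (intro bnd_add) auto
    fix \<epsilon> :: real assume \<epsilon>: "\<epsilon> \<in> {0<..1}"
    show "dsup K is (\<lambda>\<epsilon> x. u \<epsilon> x + v \<epsilon> x) \<epsilon> \<le> dsup K is u \<epsilon> + dsup K is v \<epsilon>"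
    proof (rule sup_norm_le)
      show "0 \<le> dsup K is u \<epsilon> + dsup K is v \<epsilon>"
        using s K \<epsilon> by (intro add_nonneg_nonneg dsup_nonneg[of _ \<Omega>]) auto
      fix x assume x: "x \<in> K"
      then have "fold pd is (\<lambda>x. u \<epsilon> x + v \<epsilon> x) x = fold pd is (u \<epsilon>) x + fold pd is (v \<epsilon>) x"
        using K s \<epsilon> by (intro fold_pd_add[OF assms(1)]) (auto simp: smooth_nets_def)
      then show "norm (fold pd is (\<lambda>x. u \<epsilon> x + v \<epsilon> x) x) \<le> dsup K is u \<epsilon> + dsup K is v \<epsilon>"
        using dsup_ge[OF s(1) _ _ \<epsilon> x, of "is"] dsup_ge[OF s(2) _ _ \<epsilon> x, of "is"] K
          norm_triangle_ineq[of "fold pd is (u \<epsilon>) x" "fold pd is (v \<epsilon>) x"] by auto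
    qed
  qed
qed

lemma negligible_nets_uminus:
  assumes "open \<Omega>" "u \<in> negligible_nets \<Omega>"
  shows "(\<lambda>\<epsilon> x. - u \<epsilon> x) \<in> negligible_nets \<Omega>"
  unfolding negligible_nets_iff[OF assms(1)]
proof (intro conjI allI impI)
  have s: "u \<in> smooth_nets \<Omega>" using assms(2) by (simp add: negligible_nets_def)
  show "(\<lambda>\<epsilon> x. - u \<epsilon> x) \<in> smooth_nets \<Omega>"
    using s by (auto simp: smooth_nets_def intro: smooth_on_uminus assms)
  fix K "is" and q :: nat assume K: "compact K \<and> K \<subseteq> \<Omega>"
  show "bnd (dsup K is (\<lambda>\<epsilon> x. - u \<epsilon> x)) (real q)"
  proof (rule bnd_mono_unit)
    show "bnd (dsup K is u) (real q)" using assms(2) K unfolding negligible_nets_iff[OF assms(1)] by auto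
    fix \<epsilon> :: real assume \<epsilon>: "\<epsilon> \<in> {0<..1}"
    have "fold pd is (\<lambda>x. (- 1) * u \<epsilon> x) x = (- 1) * fold pd is (u \<epsilon>) x" if "x \<in> K" for x
      using K s \<epsilon> that by (intro fold_pd_cmult[OF assms(1)]) (auto simp: smooth_nets_def)
    then have "dsup K is (\<lambda>\<epsilon> x. - u \<epsilon> x) \<epsilon> = sup_norm K (\<lambda>x. - fold pd is (u \<epsilon>) x)"
      by (intro sup_norm_cong) simp
    then show "dsup K is (\<lambda>\<epsilon> x. - u \<epsilon> x) \<epsilon> \<le> dsup K is u \<epsilon>" by (simp add: sup_norm_def)
  qed
qed

section \<open>Classes and functionals\<close>

lemma colombeau_relI: "u \<in> moderate_nets \<Omega> \<Longrightarrow> v \<in> moderate_nets \<Omega> \<Longrightarrow> (\<lambda>\<epsilon> x. u \<epsilon> x - v \<epsilon> x) \<in> negligible_nets \<Omega> \<Longrightarrow> (u, v) \<in> colombeau_rel \<Omega>"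
  by (simp add: colombeau_rel_def)

lemma zero_negligible_nets: "open \<Omega> \<Longrightarrow> (\<lambda>\<epsilon> x. 0) \<in> negligible_nets \<Omega>"
  using sup_norm_le[of 0 _ "\<lambda>_. 0"]
  by (auto simp: negligible_nets_iff smooth_nets_def smooth_on_const fold_pd_zero bnd_def
      intro!: exI[of _ 0])

lemma colombeau_equiv:
  assumes "open \<Omega>"
  shows "equiv (moderate_nets \<Omega>) (colombeau_rel \<Omega>)"
proof (rule equivI)
  show "colombeau_rel \<Omega> \<subseteq> moderate_nets \<Omega> \<times> moderate_nets \<Omega>"
    by (auto simp: colombeau_rel_def)
  show "refl_on (moderate_nets \<Omega>) (colombeau_rel \<Omega>)"
    using zero_negligible_nets[OF assms] by (auto simp: refl_on_def colombeau_rel_def)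
  show "Relation.sym (colombeau_rel \<Omega>)"
  proof (rule symI)
    fix u v assume "(u, v) \<in> colombeau_rel \<Omega>"
    then show "(v, u) \<in> colombeau_rel \<Omega>"
      using negligible_nets_uminus[OF assms, of "\<lambda>\<epsilon> x. u \<epsilon> x - v \<epsilon> x"] by (simp add: colombeau_rel_def)
  qed
  show "trans (colombeau_rel \<Omega>)"
  proof (rule transI)
    fix u v w assume "(u, v) \<in> colombeau_rel \<Omega>" "(v, w) \<in> colombeau_rel \<Omega>"
    then show "(u, w) \<in> colombeau_rel \<Omega>"
      using negligible_nets_add[OF assms, of "\<lambda>\<epsilon> x. u \<epsilon> x - v \<epsilon> x" "\<lambda>\<epsilon> x. v \<epsilon> x - w \<epsilon> x"] by (simp add: colombeau_rel_def)
  qed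
qed

lemma class_eq: "open \<Omega> \<Longrightarrow> (u, v) \<in> colombeau_rel \<Omega> \<Longrightarrow> colombeau_class \<Omega> u = colombeau_class \<Omega> v"
  by (rule equiv_class_eq[OF colombeau_equiv])

lemma class_self: "open \<Omega> \<Longrightarrow> u \<in> moderate_nets \<Omega> \<Longrightarrow> u \<in> colombeau_class \<Omega> u"
  by (rule equiv_class_self[OF colombeau_equiv])

lemma class_in_colombeau: "u \<in> moderate_nets \<Omega> \<Longrightarrow> colombeau_class \<Omega> u \<in> colombeau \<Omega>"
  by (simp add: colombeau_def quotientI)

lemma colombeau_cases:
  assumes "open \<Omega>" "U \<in> colombeau \<Omega>" "u \<in> U"
  shows "u \<in> moderate_nets \<Omega>" "U = colombeau_class \<Omega> u"
proof -
  obtain v where v: "v \<in> moderate_nets \<Omega>" "U = colombeau_class \<Omega> v"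
    using assms(2) by (auto simp: colombeau_def elim: quotientE)
  then have "(v, u) \<in> colombeau_rel \<Omega>" using assms(3) by simp
  then show "u \<in> moderate_nets \<Omega>" "U = colombeau_class \<Omega> u"
    using class_eq[OF assms(1)] v by (auto simp: colombeau_rel_def)
qed

text \<open>The operator maps negligible nets to negligible nets, so all members of the union that
  defines \<open>apply_op\<close> coincide. Linearity holds only at points of \<Omega> and indices
  in (0,1], hence the comparison of derivatives through equality on an open set.\<close>

lemma apply_op_class:
  assumes "open \<Omega>" "u \<in> moderate_nets \<Omega>"
  shows "apply_op \<Omega> m c (colombeau_class \<Omega> u) = colombeau_class \<Omega> (\<lambda>\<epsilon>. cop m (\<lambda>\<alpha>. rep_gnum (c \<alpha>) \<epsilon>) (u \<epsilon>))"
proof -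
  let ?P = "\<lambda>u \<epsilon>. cop m (\<lambda>\<alpha>. rep_gnum (c \<alpha>) \<epsilon>) (u \<epsilon>)"
  have m: "moderate (\<lambda>\<epsilon>. rep_gnum (c \<alpha>) \<epsilon>)" for \<alpha> by (rule moderate_rep)
  have eq: "colombeau_class \<Omega> (?P v) = colombeau_class \<Omega> (?P u)" if v: "v \<in> colombeau_class \<Omega> u" for v
  proof (rule class_eq[OF assms(1)])
    have vm: "v \<in> moderate_nets \<Omega>" and n: "(\<lambda>\<epsilon> x. v \<epsilon> x - u \<epsilon> x) \<in> negligible_nets \<Omega>"
      using v negligible_nets_uminus[OF assms(1), of "\<lambda>\<epsilon> x. u \<epsilon> x - v \<epsilon> x"] by (auto simp: colombeau_rel_def)
    show "(?P v, ?P u) \<in> colombeau_rel \<Omega>"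
    proof (rule colombeau_relI)
      show "?P v \<in> moderate_nets \<Omega>" "?P u \<in> moderate_nets \<Omega>"
        using m vm assms by (auto intro!: cop_moderate)
      have N: "(\<lambda>\<epsilon>. cop m (\<lambda>\<alpha>. rep_gnum (c \<alpha>) \<epsilon>) (\<lambda>x. v \<epsilon> x - u \<epsilon> x)) \<in> negligible_nets \<Omega>"
        using cop_negligible[OF assms(1) n, of "\<lambda>\<epsilon> \<alpha>. rep_gnum (c \<alpha>) \<epsilon>"] m by simp
      have e: "cop m (\<lambda>\<alpha>. rep_gnum (c \<alpha>) \<epsilon>) (\<lambda>x. v \<epsilon> x - u \<epsilon> x) x = ?P v \<epsilon> x - ?P u \<epsilon> x" if "\<epsilon> \<in> {0<..1}" "x \<in> \<Omega>" for \<epsilon> x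
      proof -
        have s: "smooth_on \<Omega> (v \<epsilon>)" "smooth_on \<Omega> (u \<epsilon>)"
          using moderate_smooth[OF vm] moderate_smooth[OF assms(2)] that(1) by (auto simp: smooth_nets_def)
        have "fold pd (mi_list \<alpha>) (\<lambda>x. v \<epsilon> x - u \<epsilon> x) x = fold pd (mi_list \<alpha>) (v \<epsilon>) x - fold pd (mi_list \<alpha>) (u \<epsilon>) x" for \<alpha>
          using fold_pd_add[OF assms(1) s(1) smooth_on_cmult[OF assms(1) s(2), of "-1"] that(2), of "mi_list \<alpha>"]
            fold_pd_cmult[OF assms(1) s(2) that(2), of "mi_list \<alpha>" "-1"] by simp
        then show ?thesis
          by (simp add: cop_def Dop_def pderivs_eq_fold right_diff_distrib sum_subtractf)
      qed
      show "(\<lambda>\<epsilon> x. ?P v \<epsilon> x - ?P u \<epsilon> x) \<in> negligible_nets \<Omega>"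
        unfolding negligible_nets_iff[OF assms(1)]
      proof (intro conjI allI impI)
        show "(\<lambda>\<epsilon> x. ?P v \<epsilon> x - ?P u \<epsilon> x) \<in> smooth_nets \<Omega>"
          using moderate_smooth[OF vm] moderate_smooth[OF assms(2)] assms(1)
          by (auto simp: smooth_nets_def intro!: smooth_on_minus smooth_on_cop)
        fix K "is" and q :: nat assume K: "compact K \<and> K \<subseteq> \<Omega>"
        show "bnd (dsup K is (\<lambda>\<epsilon> x. ?P v \<epsilon> x - ?P u \<epsilon> x)) (real q)"
        proof (rule bnd_mono_unit)
          show "bnd (dsup K is (\<lambda>\<epsilon>. cop m (\<lambda>\<alpha>. rep_gnum (c \<alpha>) \<epsilon>) (\<lambda>x. v \<epsilon> x - u \<epsilon> x))) (real q)"
            using N K unfolding negligible_nets_iff[OF assms(1)] by blast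
          fix \<epsilon> :: real assume \<epsilon>: "\<epsilon> \<in> {0<..1}"
          have "fold pd is (\<lambda>x. ?P v \<epsilon> x - ?P u \<epsilon> x) x = fold pd is (cop m (\<lambda>\<alpha>. rep_gnum (c \<alpha>) \<epsilon>) (\<lambda>x. v \<epsilon> x - u \<epsilon> x)) x" if "x \<in> K" for x
            using K that e[OF \<epsilon>] by (intro fold_pd_cong_open[OF assms(1)]) auto
          then show "dsup K is (\<lambda>\<epsilon> x. ?P v \<epsilon> x - ?P u \<epsilon> x) \<epsilon> \<le> dsup K is (\<lambda>\<epsilon>. cop m (\<lambda>\<alpha>. rep_gnum (c \<alpha>) \<epsilon>) (\<lambda>x. v \<epsilon> x - u \<epsilon> x)) \<epsilon>"
            by (intro eq_refl sup_norm_cong)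
        qed
      qed
    qed
  qed
  have "apply_op \<Omega> m c (colombeau_class \<Omega> u) = (\<Union>v\<in>colombeau_class \<Omega> u. colombeau_class \<Omega> (?P v))"
    by (simp add: apply_op_def cop_def[abs_def])
  also have "\<dots> = (\<Union>v\<in>colombeau_class \<Omega> u. colombeau_class \<Omega> (?P u))"
    by (rule arg_cong[where f = Union], rule image_cong[OF refl eq])
  also have "\<dots> = colombeau_class \<Omega> (?P u)"
    using class_self[OF assms] by blast
  finally show ?thesis .
qed

lemma c_netsE:
  assumes "u \<in> c_nets V"
  obtains K where "compact K" "K \<subseteq> V" "\<And>\<epsilon>. \<epsilon> \<in> {0<..1} \<Longrightarrow> u \<epsilon> \<in> test_functions_in K" "u \<in> moderate_nets V"
  using assms by (auto simp: c_nets_def)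

lemma test_net_bnd_extend:
  assumes K: "compact K" and u: "\<And>\<epsilon>. \<epsilon> \<in> {0<..1} \<Longrightarrow> u \<epsilon> \<in> test_functions_in K" and b: "bnd (dsup K is u) a"
  shows "bnd (dsup L is u) a"
proof (rule bnd_mono_unit[OF b])
  fix \<epsilon> :: real assume \<epsilon>: "\<epsilon> \<in> {0<..1}"
  have t: "fold pd is (u \<epsilon>) \<in> test_functions_in K" by (intro test_functions_fold_pd compact_imp_closed K u \<epsilon>)
  have c: "continuous_on K (fold pd is (u \<epsilon>))" by (rule test_function_continuous[OF t])
  show "dsup L is u \<epsilon> \<le> dsup K is u \<epsilon>"
  proof (rule sup_norm_le[OF sup_norm_nonneg[OF K c]])
    fix x
    show "norm (fold pd is (u \<epsilon>) x) \<le> dsup K is u \<epsilon>"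
      using sup_norm_ge[OF K c, of x] sup_norm_nonneg[OF K c] t
      by (cases "x \<in> K") (auto simp: test_functions_in_def)
  qed
qed

lemma test_net_smooth: "(\<And>\<epsilon>. \<epsilon> \<in> {0<..1} \<Longrightarrow> u \<epsilon> \<in> test_functions_in K) \<Longrightarrow> u \<in> smooth_nets \<Omega>"
  unfolding smooth_nets_def test_functions_in_def using smooth_on_subset[OF _ subset_UNIV] by blast

lemma c_netsI:
  assumes "open V" "compact K" "K \<subseteq> V" "\<And>\<epsilon>. \<epsilon> \<in> {0<..1} \<Longrightarrow> u \<epsilon> \<in> test_functions_in K"
    "\<And>is. \<exists>N::nat. bnd (dsup K is u) (- real N)"
  shows "u \<in> c_nets V"
proof -
  have "u \<in> moderate_nets V"
    unfolding moderate_nets_iff[OF assms(1)]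
    using test_net_smooth[of u K] test_net_bnd_extend[OF assms(2)] assms(4,5) by meson
  then show ?thesis using assms unfolding c_nets_def by blast
qed

lemma c_nets_mono:
  assumes "open V" "open \<Omega>" "V \<subseteq> \<Omega>" "u \<in> c_nets V" shows "u \<in> c_nets \<Omega>"
proof -
  obtain K where K: "compact K" "K \<subseteq> V" "\<And>\<epsilon>. \<epsilon> \<in> {0<..1} \<Longrightarrow> u \<epsilon> \<in> test_functions_in K" "u \<in> moderate_nets V"
    by (rule c_netsE[OF assms(4)]) blast
  then show ?thesis
    using assms(3) by (intro c_netsI[OF assms(2) K(1)]) (auto simp: moderate_nets_iff[OF assms(1)])
qed

text \<open>Two representatives with compact supports in V vanish outside a common compact subset of
  V, so their difference, negligible on V, is negligible on \<Omega> as well.\<close>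

lemma gextend_class:
  assumes "open V" "open \<Omega>" "V \<subseteq> \<Omega>" and v: "v \<in> c_nets V"
  shows "gextend V \<Omega> (colombeau_class V v) = colombeau_class \<Omega> v"
proof -
  have eq: "colombeau_class \<Omega> u = colombeau_class \<Omega> v" if u: "u \<in> colombeau_class V v \<inter> c_nets V" for u
  proof (rule class_eq[OF assms(2)], rule colombeau_relI)
    have uc: "u \<in> c_nets V" using u by blast
    show "u \<in> moderate_nets \<Omega>" "v \<in> moderate_nets \<Omega>"
      using c_nets_mono[OF assms(1-3)] uc v by (auto simp: c_nets_def)
    obtain K where K: "compact K" "K \<subseteq> V" "\<And>\<epsilon>. \<epsilon> \<in> {0<..1} \<Longrightarrow> u \<epsilon> \<in> test_functions_in K"
      by (rule c_netsE[OF uc]) blast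
    obtain L where L: "compact L" "L \<subseteq> V" "\<And>\<epsilon>. \<epsilon> \<in> {0<..1} \<Longrightarrow> v \<epsilon> \<in> test_functions_in L"
      by (rule c_netsE[OF v]) blast
    have t: "(\<lambda>x. u \<epsilon> x - v \<epsilon> x) \<in> test_functions_in (K \<union> L)" if "\<epsilon> \<in> {0<..1}" for \<epsilon>
      using K(3)[OF that] L(3)[OF that] by (auto simp: test_functions_in_def intro: smooth_on_minus)
    have "(\<lambda>\<epsilon> x. u \<epsilon> x - v \<epsilon> x) \<in> negligible_nets V"
      using u negligible_nets_uminus[OF assms(1), of "\<lambda>\<epsilon> x. v \<epsilon> x - u \<epsilon> x"] by (simp add: colombeau_rel_def)
    then have "bnd (dsup (K \<union> L) is (\<lambda>\<epsilon> x. u \<epsilon> x - v \<epsilon> x)) (real q)" for "is" and q :: nat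
      using K L unfolding negligible_nets_iff[OF assms(1)] by (auto intro!: compact_Un)
    then show "(\<lambda>\<epsilon> x. u \<epsilon> x - v \<epsilon> x) \<in> negligible_nets \<Omega>"
      unfolding negligible_nets_iff[OF assms(2)]
      using test_net_smooth[of "\<lambda>\<epsilon> x. u \<epsilon> x - v \<epsilon> x", OF t] test_net_bnd_extend[of "K \<union> L" "\<lambda>\<epsilon> x. u \<epsilon> x - v \<epsilon> x", OF compact_Un[OF K(1) L(1)] t]
      by blast
  qed
  have "v \<in> colombeau_class V v \<inter> c_nets V"
    using class_self[OF assms(1)] v by (auto simp: c_nets_def)
  then show ?thesis
    unfolding gextend_def using eq by blast
qed

lemma cop_c_nets:
  assumes "open V" "v \<in> c_nets V" "\<And>\<alpha>. moderate (\<lambda>\<epsilon>. r \<epsilon> \<alpha>)"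
  shows "(\<lambda>\<epsilon>. cop m (r \<epsilon>) (v \<epsilon>)) \<in> c_nets V"
proof -
  obtain K where K: "compact K" "K \<subseteq> V" "\<And>\<epsilon>. \<epsilon> \<in> {0<..1} \<Longrightarrow> v \<epsilon> \<in> test_functions_in K" "v \<in> moderate_nets V"
    by (rule c_netsE[OF assms(2)]) blast
  have "(\<lambda>\<epsilon>. cop m (r \<epsilon>) (v \<epsilon>)) \<in> moderate_nets V"
    by (rule cop_moderate[OF assms(1) K(4)]) (rule assms(3))
  then show ?thesis
    unfolding c_nets_def using K(1,2) cop_test[OF K(1) K(3)] by blast
qed

lemma C_norm_le_sum_dsup:
  assumes "compact K" "f \<in> test_functions_in K"
  shows "C_norm K j f \<le> (\<Sum>\<alpha> | mi_order \<alpha> \<le> j. sup_norm K (fold pd (mi_list \<alpha>) f))"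
proof -
  have c: "continuous_on K (fold pd is f)" for "is"
    by (intro test_function_continuous[of _ K] test_functions_fold_pd compact_imp_closed assms)
  show ?thesis
  proof (rule C_norm_le)
    show "0 \<le> (\<Sum>\<alpha> | mi_order \<alpha> \<le> j. sup_norm K (fold pd (mi_list \<alpha>) f))"
      by (intro sum_nonneg sup_norm_nonneg assms c)
    fix \<alpha> :: "'a \<Rightarrow> nat" and x assume "mi_order \<alpha> \<le> j" "x \<in> K"
    then show "norm (pderivs \<alpha> f x) \<le> (\<Sum>\<alpha> | mi_order \<alpha> \<le> j. sup_norm K (fold pd (mi_list \<alpha>) f))"
      unfolding pderivs_eq_fold
      using sup_norm_ge[OF assms(1) c, of x "mi_list \<alpha>"]
        member_le_sum[of \<alpha> "{\<alpha>. mi_order \<alpha> \<le> j}" "\<lambda>\<alpha>. sup_norm K (fold pd (mi_list \<alpha>) f)"]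
        finite_mi_order[of j] sup_norm_nonneg[OF assms(1) c] by force
  qed
qed

text \<open>The conditions on the representing net in \<open>basic_functionals\<close>, separated so
  that the analysis deals with nets of distributions only.\<close>

definition basic_net :: "(real^'n::finite) set \<Rightarrow> (real \<Rightarrow> (real^'n \<Rightarrow> complex) \<Rightarrow> complex) \<Rightarrow> bool" where
  "basic_net \<Omega> S \<longleftrightarrow> (\<forall>\<epsilon>\<in>{0<..1}. S \<epsilon> \<in> distributions \<Omega>) \<and>
     (\<forall>K. compact K \<and> K \<subseteq> \<Omega> \<longrightarrow> (\<exists>(j::nat) (N::nat). \<exists>c>0. \<exists>\<eta>\<in>{0<..1}.
        \<forall>f\<in>test_functions_in K. \<forall>\<epsilon>\<in>{0<..\<eta>}.
          norm (S \<epsilon> f) \<le> c * \<epsilon> powr (- real N) * C_norm K j f))"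

lemma basic_net_moderate:
  assumes "open \<Omega>" "basic_net \<Omega> S" "v \<in> c_nets \<Omega>"
  shows "moderate (\<lambda>\<epsilon>. S \<epsilon> (v \<epsilon>))"
proof -
  obtain K where K: "compact K" "K \<subseteq> \<Omega>" "\<And>\<epsilon>. \<epsilon> \<in> {0<..1} \<Longrightarrow> v \<epsilon> \<in> test_functions_in K" "v \<in> moderate_nets \<Omega>"
    by (rule c_netsE[OF assms(3)]) blast
  obtain j N :: nat and c \<eta> where S: "c > 0" "\<eta> \<in> {0<..1}"
    "\<And>f \<epsilon>. f \<in> test_functions_in K \<Longrightarrow> \<epsilon> \<in> {0<..\<eta>} \<Longrightarrow> norm (S \<epsilon> f) \<le> c * \<epsilon> powr (- real N) * C_norm K j f"
    using assms(2) K(1,2) unfolding basic_net_def by metis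
  obtain M :: nat where M: "\<And>\<alpha>. mi_order \<alpha> \<le> j \<Longrightarrow> bnd (dsup K (mi_list \<alpha>) v) (- real M)"
    by (rule moderate_bnd_uniform[OF assms(1) K(4,1,2), of j mi_list]) auto
  have nn: "0 \<le> dsup K is v \<epsilon>" if "\<epsilon> \<in> {0<..1}" for "is" \<epsilon>
    by (rule dsup_nonneg[OF moderate_smooth[OF K(4)] K(1,2) that])
  have "bnd (\<lambda>\<epsilon>. (\<epsilon> powr (- real N) * c) * (\<Sum>\<alpha> | mi_order \<alpha> \<le> j. dsup K (mi_list \<alpha>) v \<epsilon>)) (- real N + - real M)"
    using S M nn by (intro bnd_mult bnd_cmult bnd_powr bnd_sum sum_nonneg) auto
  then have "bnd (\<lambda>\<epsilon>. norm (S \<epsilon> (v \<epsilon>))) (- real N + - real M)"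
  proof (rule bnd_mono)
    have "\<forall>\<^sub>F \<epsilon> in at_right 0. \<epsilon> \<in> {0<..<\<eta>}" by (rule eventually_at_right_real) (use S in auto)
    then show "\<forall>\<^sub>F \<epsilon> in at_right 0. norm (S \<epsilon> (v \<epsilon>)) \<le> (\<epsilon> powr (- real N) * c) * (\<Sum>\<alpha> | mi_order \<alpha> \<le> j. dsup K (mi_list \<alpha>) v \<epsilon>)"
    proof eventually_elim
      fix \<epsilon> assume \<epsilon>: "\<epsilon> \<in> {0<..<\<eta>}"
      then have \<epsilon>1: "\<epsilon> \<in> {0<..1}" using S(2) by auto
      have "norm (S \<epsilon> (v \<epsilon>)) \<le> c * \<epsilon> powr (- real N) * C_norm K j (v \<epsilon>)"
        using \<epsilon> K(3)[OF \<epsilon>1] by (intro S) auto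
      also have "\<dots> \<le> c * \<epsilon> powr (- real N) * (\<Sum>\<alpha> | mi_order \<alpha> \<le> j. dsup K (mi_list \<alpha>) v \<epsilon>)"
        using S(1) by (intro mult_left_mono C_norm_le_sum_dsup K \<epsilon>1) auto
      finally show "norm (S \<epsilon> (v \<epsilon>)) \<le> (\<epsilon> powr (- real N) * c) * (\<Sum>\<alpha> | mi_order \<alpha> \<le> j. dsup K (mi_list \<alpha>) v \<epsilon>)"
        by (simp add: mult_ac)
    qed
  qed
  then show ?thesis unfolding moderate_iff by (intro exI[of _ "N + M"]) simp
qed

lemma test_mult_local:
  assumes "open V" "compact K" "K \<subseteq> V" "smooth_on V f" "v \<in> test_functions_in K"
  shows "(\<lambda>x. f x * v x) \<in> test_functions_in K"
proof -
  have "smooth_on UNIV (\<lambda>x. f x * v x)"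
  proof (rule smooth_on_local)
    fix x :: "real^'a"
    show "\<exists>U. open U \<and> x \<in> U \<and> smooth_on U (\<lambda>x. f x * v x)"
    proof (cases "x \<in> K")
      case True
      have "smooth_on V (\<lambda>x. f x * v x)"
        using assms by (auto intro!: smooth_on_mult intro: smooth_on_subset simp: test_functions_in_def)
      then show ?thesis using True assms by blast
    next
      case False
      have o: "open (- K)" using assms(2) by (simp add: compact_imp_closed open_Compl)
      have "smooth_on (- K) (\<lambda>x. f x * v x)"
        by (rule smooth_on_cong[OF o _ smooth_on_const[of _ 0]]) (use assms(5) in \<open>auto simp: test_functions_in_def\<close>)
      then show ?thesis using False o by blast
    qed
  qed
  then show ?thesis using assms(5) by (auto simp: test_functions_in_def)
qed

lemma set_integral_test:
  assumes "K \<subseteq> V" "v \<in> test_functions_in K"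
  shows "(LINT x:V|lborel. f x * v x) = (LINT x|lborel. f x * v x)"
proof -
  have "indicator V x *\<^sub>R (f x * v x) = f x * v x" for x
    using assms by (auto simp: indicator_def test_functions_in_def)
  then show ?thesis by (simp add: set_lebesgue_integral_def)
qed

lemma norm_integral_le_dsup:
  assumes "open V" "compact K" "K \<subseteq> V" "u \<in> smooth_nets V" "v \<epsilon> \<in> test_functions_in K" "\<epsilon> \<in> {0<..1}"
  shows "norm (LINT x:V|lborel. u \<epsilon> x * v \<epsilon> x) \<le> dsup K [] u \<epsilon> * dsup K [] v \<epsilon> * measure lborel K"
proof -
  have t: "(\<lambda>x. u \<epsilon> x * v \<epsilon> x) \<in> test_functions_in K"
    by (rule test_mult_local[OF assms(1-3) smooth_netsD[OF assms(4,6)] assms(5)])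
  have "norm (LINT x|lborel. u \<epsilon> x * v \<epsilon> x) \<le> measure lborel K * (dsup K [] u \<epsilon> * dsup K [] v \<epsilon>)"
  proof (rule norm_integral_compact_support_le[OF test_function_continuous[OF t] assms(2)])
    show "u \<epsilon> x * v \<epsilon> x = 0" if "x \<notin> K" for x using t that by (simp add: test_functions_in_def)
    have 1: "norm (u \<epsilon> x) \<le> dsup K [] u \<epsilon>" if "x \<in> K" for x
      using dsup_ge[OF assms(4,2,3,6) that, of "[]"] by simp
    have 2: "norm (v \<epsilon> x) \<le> dsup K [] v \<epsilon>" if "x \<in> K" for x
      using sup_norm_ge[OF assms(2) test_function_continuous[OF assms(5)] that] by simp
    show "norm (u \<epsilon> x * v \<epsilon> x) \<le> dsup K [] u \<epsilon> * dsup K [] v \<epsilon>" if "x \<in> K" for x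
      unfolding norm_mult using 1[OF that] 2[OF that] norm_ge_zero order_trans by (intro mult_mono) blast+
  qed
  then show ?thesis using set_integral_test[OF assms(3,5)] by (simp add: mult.commute)
qed

lemma integral_pairing_bnd:
  assumes "open V" "u \<in> smooth_nets V" "compact K" "K \<subseteq> V" "\<And>\<epsilon>. \<epsilon> \<in> {0<..1} \<Longrightarrow> v \<epsilon> \<in> test_functions_in K"
    "bnd (dsup K [] u) a" "bnd (dsup K [] v) b"
  shows "bnd (\<lambda>\<epsilon>. norm (LINT x:V|lborel. u \<epsilon> x * v \<epsilon> x)) (a + b)"
proof (rule bnd_mono_unit)
  show "bnd (\<lambda>\<epsilon>. dsup K [] u \<epsilon> * dsup K [] v \<epsilon> * measure lborel K) (a + b)"
    using dsup_nonneg[OF test_net_smooth[of v K V] assms(3,4), of _ "[]"] assms(5)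
    by (intro bnd_cmult bnd_mult assms) auto
qed (use norm_integral_le_dsup[OF assms(1,3,4,2)] assms(5) in blast)

lemma integral_pairing_moderate:
  assumes "open V" "u \<in> moderate_nets V" "v \<in> c_nets V"
  shows "moderate (\<lambda>\<epsilon>. LINT x:V|lborel. u \<epsilon> x * v \<epsilon> x)"
proof -
  obtain K where K: "compact K" "K \<subseteq> V" "\<And>\<epsilon>. \<epsilon> \<in> {0<..1} \<Longrightarrow> v \<epsilon> \<in> test_functions_in K" "v \<in> moderate_nets V"
    by (rule c_netsE[OF assms(3)]) blast
  obtain M N :: nat where "bnd (dsup K [] u) (- real M)" "bnd (dsup K [] v) (- real N)"
    using moderate_bnd[OF assms(1,2) K(1,2)] moderate_bnd[OF assms(1) K(4,1,2)] by metis
  then have "bnd (\<lambda>\<epsilon>. norm (LINT x:V|lborel. u \<epsilon> x * v \<epsilon> x)) (- real M + - real N)"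
    by (intro integral_pairing_bnd[OF assms(1) moderate_smooth[OF assms(2)] K(1,2)] K(3))
  then show ?thesis unfolding moderate_iff by (intro exI[of _ "M + N"]) simp
qed

text \<open>A test net paired with a negligible difference of representatives gives a negligible
  number, so one representative decides.\<close>

lemma given_byI:
  assumes "open V" "w \<in> moderate_nets V"
    and T: "\<And>v. v \<in> c_nets V \<Longrightarrow> T (colombeau_class V v) = abs_gnum (\<lambda>\<epsilon>. LINT x:V|lborel. w \<epsilon> x * v \<epsilon> x)"
  shows "given_by V (colombeau_class V w) T"
  unfolding given_by_def
proof (intro ballI)
  fix u v assume u: "u \<in> colombeau_class V w" and v: "v \<in> c_nets V"
  obtain K where K: "compact K" "K \<subseteq> V" "\<And>\<epsilon>. \<epsilon> \<in> {0<..1} \<Longrightarrow> v \<epsilon> \<in> test_functions_in K" "v \<in> moderate_nets V"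
    by (rule c_netsE[OF v]) blast
  have um: "u \<in> moderate_nets V" and n: "(\<lambda>\<epsilon> x. w \<epsilon> x - u \<epsilon> x) \<in> negligible_nets V"
    using u by (auto simp: colombeau_rel_def)
  obtain N :: nat where N: "bnd (dsup K [] v) (- real N)"
    using moderate_bnd[OF assms(1) K(4,1,2)] by metis
  have "abs_gnum (\<lambda>\<epsilon>. LINT x:V|lborel. w \<epsilon> x * v \<epsilon> x) = abs_gnum (\<lambda>\<epsilon>. LINT x:V|lborel. u \<epsilon> x * v \<epsilon> x)"
  proof (rule abs_gnum_eqI)
    show "moderate (\<lambda>\<epsilon>. LINT x:V|lborel. w \<epsilon> x * v \<epsilon> x)" "moderate (\<lambda>\<epsilon>. LINT x:V|lborel. u \<epsilon> x * v \<epsilon> x)"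
      by (intro integral_pairing_moderate assms um v)+
    show "negligible_net (\<lambda>\<epsilon>. (LINT x:V|lborel. w \<epsilon> x * v \<epsilon> x) - (LINT x:V|lborel. u \<epsilon> x * v \<epsilon> x))"
      unfolding negligible_iff
    proof
      fix q :: nat
      have sn: "(\<lambda>\<epsilon> x. w \<epsilon> x - u \<epsilon> x) \<in> smooth_nets V" using n by (simp add: negligible_nets_def)
      have "bnd (dsup K [] (\<lambda>\<epsilon> x. w \<epsilon> x - u \<epsilon> x)) (real (q + N))"
        using n K unfolding negligible_nets_iff[OF assms(1)] by blast
      from integral_pairing_bnd[OF assms(1) sn K(1-3) this N]
      have "bnd (\<lambda>\<epsilon>. norm (LINT x:V|lborel. (w \<epsilon> x - u \<epsilon> x) * v \<epsilon> x)) (real q)" by simp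
      then show "bnd (\<lambda>\<epsilon>. norm ((LINT x:V|lborel. w \<epsilon> x * v \<epsilon> x) - (LINT x:V|lborel. u \<epsilon> x * v \<epsilon> x))) (real q)"
      proof (rule bnd_mono_unit)
        fix \<epsilon> :: real assume \<epsilon>: "\<epsilon> \<in> {0<..1}"
        have i: "integrable lborel (\<lambda>x. f \<epsilon> x * v \<epsilon> x)" if "f \<in> moderate_nets V" for f
          by (rule test_function_integrable[OF K(1) test_mult_local[OF assms(1) K(1,2) smooth_netsD[OF moderate_smooth[OF that] \<epsilon>] K(3)[OF \<epsilon>]]])
        show "norm ((LINT x:V|lborel. w \<epsilon> x * v \<epsilon> x) - (LINT x:V|lborel. u \<epsilon> x * v \<epsilon> x))
           \<le> norm (LINT x:V|lborel. (w \<epsilon> x - u \<epsilon> x) * v \<epsilon> x)"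
          unfolding set_integral_test[OF K(2) K(3)[OF \<epsilon>]]
          by (simp add: left_diff_distrib Bochner_Integration.integral_diff[OF i[OF assms(2)] i[OF um]])
      qed
    qed
  qed
  then show "T (colombeau_class V v) = abs_gnum (\<lambda>\<epsilon>. LINT x:V|lborel. u \<epsilon> x * v \<epsilon> x)" using T[OF v] by simp
qed

lemma integral_by_parts_local:
  assumes "open V" "compact K" "K \<subseteq> V" "smooth_on V f" "v \<in> test_functions_in K"
  shows "(LINT x|lborel. f x * fold pd is v x) = (- 1) ^ length is * (LINT x|lborel. fold pd is f x * v x)"
proof -
  have step: "(LINT x|lborel. f x * pd i v x) = - (LINT x|lborel. pd i f x * v x)"
    if f: "smooth_on V f" and v: "v \<in> test_functions_in K" for f v i
  proof -
    have pv: "pd i v \<in> test_functions_in K" by (rule test_functions_pd[OF compact_imp_closed[OF assms(2)] v])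
    have t: "(\<lambda>x. f x * v x) \<in> test_functions_in K" "(\<lambda>x. f x * pd i v x) \<in> test_functions_in K"
      "(\<lambda>x. pd i f x * v x) \<in> test_functions_in K"
      by (intro test_mult_local[OF assms(1-3)] f v pv smooth_on_pd)+
    have "pd i (\<lambda>x. f x * v x) x = pd i f x * v x + f x * pd i v x" for x
    proof (cases "x \<in> K")
      case True
      have "smooth_on UNIV v" using v by (simp add: test_functions_in_def)
      then show ?thesis
        using True assms(3) by (intro pd_mult smooth_on_diff[OF assms(1) f] smooth_on_diff[OF open_UNIV]) auto
    next
      case False
      then show ?thesis
        using fold_pd_vanish[OF compact_imp_closed[OF assms(2)], of "\<lambda>x. f x * v x" x "[i]"] pv v
        by (auto simp: test_functions_in_def)
    qed
    then have "0 = (LINT x|lborel. pd i f x * v x + f x * pd i v x)"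
      using integral_pd_zero[OF assms(2) t(1), of i] by simp
    then show ?thesis
      using test_function_integrable[OF assms(2) t(2)] test_function_integrable[OF assms(2) t(3)]
      by (simp add: add_eq_0_iff)
  qed
  show ?thesis
    using assms(4,5)
  proof (induction "is" arbitrary: f v)
    case (Cons i js)
    have "(LINT x|lborel. f x * fold pd (i # js) v x) = (- 1) ^ length js * (LINT x|lborel. fold pd js f x * pd i v x)"
      using Cons.IH[OF Cons.prems(1) test_functions_pd[OF compact_imp_closed[OF assms(2)] Cons.prems(2)]] by simp
    also have "(LINT x|lborel. fold pd js f x * pd i v x) = - (LINT x|lborel. pd i (fold pd js f) x * v x)"
      by (rule step[OF smooth_on_fold_pd[OF Cons.prems(1)] Cons.prems(2)])
    \<comment> \<open>Moving the derivatives one by one to f produces them in a different order from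
      \<open>fold\<close>; they commute on V, and off K the factor v is 0.\<close>
    also have "(LINT x|lborel. pd i (fold pd js f) x * v x) = (LINT x|lborel. fold pd (i # js) f x * v x)"
    proof (rule Bochner_Integration.integral_cong[OF refl])
      fix x
      show "pd i (fold pd js f) x * v x = fold pd (i # js) f x * v x"
        using fold_pd_move[OF assms(1) Cons.prems(1), of x js i] Cons.prems(2) assms(3)
        by (cases "x \<in> K") (auto simp: test_functions_in_def)
    qed
    finally show ?case by simp
  qed simp
qed

text \<open>Each integration by parts contributes one sign; together they are the signs of the
  transposed operator.\<close>

lemma integral_cop_transpose:
  assumes "open V" "compact K" "K \<subseteq> V" "smooth_on V f" "v \<in> test_functions_in K"
  shows "(LINT x|lborel. f x * cop m r v x) = (LINT x|lborel. cop m (\<lambda>\<alpha>. (- 1) ^ mi_order \<alpha> * r \<alpha>) f x * v x)"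
proof -
  have t1: "(\<lambda>x. f x * fold pd is v x) \<in> test_functions_in K" for "is"
    by (intro test_mult_local[OF assms(1-4)] test_functions_fold_pd compact_imp_closed assms)
  have t2: "(\<lambda>x. fold pd is f x * v x) \<in> test_functions_in K" for "is"
    by (intro test_mult_local[OF assms(1-3)] smooth_on_fold_pd assms)
  have "(LINT x|lborel. f x * cop m r v x)
      = (LINT x|lborel. (\<Sum>\<alpha> | mi_order \<alpha> \<le> m. (r \<alpha> * (- \<i>) ^ mi_order \<alpha>) * (f x * fold pd (mi_list \<alpha>) v x)))"
    by (simp add: cop_def Dop_def pderivs_eq_fold sum_distrib_left sum_distrib_right mult_ac)
  also have "\<dots> = (\<Sum>\<alpha> | mi_order \<alpha> \<le> m. (r \<alpha> * (- \<i>) ^ mi_order \<alpha>) * (LINT x|lborel. f x * fold pd (mi_list \<alpha>) v x))"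
    using test_function_integrable[OF assms(2) t1] by (simp add: Bochner_Integration.integral_sum)
  also have "\<dots> = (\<Sum>\<alpha> | mi_order \<alpha> \<le> m. (r \<alpha> * (- \<i>) ^ mi_order \<alpha>) * ((- 1) ^ mi_order \<alpha> * (LINT x|lborel. fold pd (mi_list \<alpha>) f x * v x)))"
    unfolding integral_by_parts_local[OF assms] length_mi_list ..
  also have "\<dots> = (\<Sum>\<alpha> | mi_order \<alpha> \<le> m. (((- 1) ^ mi_order \<alpha> * r \<alpha>) * (- \<i>) ^ mi_order \<alpha>) * (LINT x|lborel. fold pd (mi_list \<alpha>) f x * v x))"
    by (simp only: mult_ac)
  also have "\<dots> = (LINT x|lborel. (\<Sum>\<alpha> | mi_order \<alpha> \<le> m. (((- 1) ^ mi_order \<alpha> * r \<alpha>) * (- \<i>) ^ mi_order \<alpha>) * (fold pd (mi_list \<alpha>) f x * v x)))"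
    using test_function_integrable[OF assms(2) t2] by (simp add: Bochner_Integration.integral_sum)
  also have "\<dots> = (LINT x|lborel. cop m (\<lambda>\<alpha>. (- 1) ^ mi_order \<alpha> * r \<alpha>) f x * v x)"
    by (simp add: cop_def Dop_def pderivs_eq_fold sum_distrib_left sum_distrib_right mult_ac)
  finally show ?thesis .
qed

section \<open>Elliptic regularity for nets of distributions\<close>

lemma finite_short_lists: "finite {is::'n::finite list. length is \<le> s}"
  using finite_lists_length_le[OF finite[of "UNIV::'n set"], of s] by simp

lemma fc_le_sum_dsup:
  fixes K :: "(real^'n::finite) set"
  assumes "compact K"
  obtains C where "0 \<le> C" "\<And>f k. f \<in> test_functions_in K \<Longrightarrow>
    norm (fc f k) * jap k ^ s \<le> C * (\<Sum>is | length is \<le> s. sup_norm K (fold pd is f))"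
proof -
  obtain C where C: "0 \<le> C" "\<And>f M k. f \<in> test_functions_in K \<Longrightarrow>
    (\<And>is x. length is \<le> s \<Longrightarrow> norm (fold pd is f x) \<le> M) \<Longrightarrow> norm (fc f k) * jap k ^ s \<le> C * M"
    using fc_decay[OF assms, of s] by blast
  show thesis
  proof (rule that[OF C(1)])
    fix f k assume f: "f \<in> test_functions_in K"
    have t: "fold pd is f \<in> test_functions_in K" for "is"
      by (intro test_functions_fold_pd compact_imp_closed assms f)
    have nn: "0 \<le> sup_norm K (fold pd is f)" for "is"
      by (intro sup_norm_nonneg assms test_function_continuous[OF t])
    have "norm (fold pd is f x) \<le> (\<Sum>is | length is \<le> s. sup_norm K (fold pd is f))" if "length is \<le> s" for "is" x
    proof -
      have "norm (fold pd is f x) \<le> sup_norm K (fold pd is f)"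
        using sup_norm_ge[OF assms test_function_continuous[OF t], of x] nn t[of "is"]
        by (cases "x \<in> K") (auto simp: test_functions_in_def)
      also have "\<dots> \<le> (\<Sum>is | length is \<le> s. sup_norm K (fold pd is f))"
        using that by (intro member_le_sum finite_short_lists nn) auto
      finally show ?thesis .
    qed
    then show "norm (fc f k) * jap k ^ s \<le> C * (\<Sum>is | length is \<le> s. sup_norm K (fold pd is f))"
      by (intro C(2) f)
  qed
qed

text \<open>A Leibniz estimate without binomial coefficients. The constant is quantified before f
  and B, so it depends on \<kappa> and \<open>is\<close> only and serves a whole net.\<close>

lemma mult_cutoff_derivs:
  fixes \<kappa> :: "real^'n::finite \<Rightarrow> complex"
  assumes V: "open V" and L: "compact L" "L \<subseteq> V" and \<kappa>: "\<kappa> \<in> test_functions_in L"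
  shows "\<exists>C\<ge>0. \<forall>f B. smooth_on V f \<longrightarrow> (\<forall>js x. length js \<le> length is \<longrightarrow> x \<in> L \<longrightarrow> norm (fold pd js f x) \<le> B) \<longrightarrow>
    (\<forall>x\<in>L. norm (fold pd is (\<lambda>x. f x * \<kappa> x) x) \<le> C * B)"
  using \<kappa>
proof (induction "is" arbitrary: \<kappa>)
  case Nil
  obtain M where M: "0 \<le> M" "\<And>x. norm (\<kappa> x) \<le> M" using test_functions_bounded[OF L(1) Nil] by blast
  show ?case
  proof (intro exI[of _ M] conjI allI impI ballI)
    fix f :: "real^'n \<Rightarrow> complex" and B x
    assume B: "\<forall>js x. length js \<le> length ([] :: 'n list) \<longrightarrow> x \<in> L \<longrightarrow> norm (fold pd js f x) \<le> B" and x: "x \<in> L"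
    have "norm (f x) \<le> B" using B[rule_format, of "[]" x] x by simp
    then have "norm (f x) * norm (\<kappa> x) \<le> B * M"
      using M by (intro mult_mono) (auto intro: order_trans[OF norm_ge_zero])
    then show "norm (fold pd [] (\<lambda>x. f x * \<kappa> x) x) \<le> M * B" by (simp add: norm_mult mult.commute)
  qed (rule M)
next
  case (Cons i js)
  have pk: "pd i \<kappa> \<in> test_functions_in L" by (rule test_functions_pd[OF compact_imp_closed[OF L(1)] Cons.prems])
  obtain C1 where C1: "C1 \<ge> 0" "\<And>f B x. smooth_on V f \<Longrightarrow> (\<And>ks x. length ks \<le> length js \<Longrightarrow> x \<in> L \<Longrightarrow> norm (fold pd ks f x) \<le> B) \<Longrightarrow>
    x \<in> L \<Longrightarrow> norm (fold pd js (\<lambda>x. f x * \<kappa> x) x) \<le> C1 * B"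
    using Cons.IH[OF Cons.prems] by auto
  obtain C2 where C2: "C2 \<ge> 0" "\<And>f B x. smooth_on V f \<Longrightarrow> (\<And>ks x. length ks \<le> length js \<Longrightarrow> x \<in> L \<Longrightarrow> norm (fold pd ks f x) \<le> B) \<Longrightarrow>
    x \<in> L \<Longrightarrow> norm (fold pd js (\<lambda>x. f x * pd i \<kappa> x) x) \<le> C2 * B"
    using Cons.IH[OF pk] by auto
  show ?case
  proof (intro exI[of _ "C1 + C2"] conjI allI impI ballI)
    fix f :: "real^'n \<Rightarrow> complex" and B x
    assume f: "smooth_on V f" and x: "x \<in> L"
      and B: "\<forall>ks x. length ks \<le> length (i # js) \<longrightarrow> x \<in> L \<longrightarrow> norm (fold pd ks f x) \<le> B"
    have xV: "x \<in> V" using x L by blast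
    have sk: "smooth_on UNIV \<kappa>" using Cons.prems by (simp add: test_functions_in_def)
    have skV: "smooth_on V \<kappa>" "smooth_on V (pd i \<kappa>)" using smooth_on_subset[OF sk] smooth_on_pd by auto
    have "fold pd js (pd i (\<lambda>x. f x * \<kappa> x)) x = fold pd js (\<lambda>x. pd i f x * \<kappa> x + f x * pd i \<kappa> x) x"
      by (rule fold_pd_cong_open[OF V _ xV]) (intro pd_mult smooth_on_diff[OF V f] smooth_on_diff[OF V skV(1)])
    also have "\<dots> = fold pd js (\<lambda>x. pd i f x * \<kappa> x) x + fold pd js (\<lambda>x. f x * pd i \<kappa> x) x"
      by (rule fold_pd_add[OF V _ _ xV]) (intro smooth_on_mult V f skV smooth_on_pd)+
    also have "norm \<dots> \<le> C1 * B + C2 * B"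
    proof (rule order_trans[OF norm_triangle_ineq], rule add_mono)
      show "norm (fold pd js (\<lambda>x. pd i f x * \<kappa> x) x) \<le> C1 * B"
      proof (rule C1(2)[OF smooth_on_pd[OF f] _ x])
        fix ks :: "'n list" and x assume "length ks \<le> length js" "x \<in> L"
        then show "norm (fold pd ks (pd i f) x) \<le> B" using B[rule_format, of "i # ks" x] by simp
      qed
      show "norm (fold pd js (\<lambda>x. f x * pd i \<kappa> x) x) \<le> C2 * B"
        using B by (intro C2(2)[OF f _ x]) auto
    qed
    finally show "norm (fold pd (i # js) (\<lambda>x. f x * \<kappa> x) x) \<le> (C1 + C2) * B" by (simp add: distrib_right)
  qed (use C1 C2 in auto)
qed

lemma fc_cutoff_le:
  fixes \<kappa> :: "real^'n::finite \<Rightarrow> complex"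
  assumes V: "open V" and L: "compact L" "L \<subseteq> V" and \<kappa>: "\<kappa> \<in> test_functions_in L"
  obtains C where "0 \<le> C" "\<And>f k. smooth_on V f \<Longrightarrow>
    norm (fc (\<lambda>x. f x * \<kappa> x) k) * jap k ^ s \<le> C * (\<Sum>is | length is \<le> s. sup_norm L (fold pd is f))"
proof -
  obtain D where D: "\<And>is. 0 \<le> D is" "\<And>is f B x. smooth_on V f \<Longrightarrow>
    (\<And>js x. length js \<le> length is \<Longrightarrow> x \<in> L \<Longrightarrow> norm (fold pd js f x) \<le> B) \<Longrightarrow> x \<in> L \<Longrightarrow>
    norm (fold pd is (\<lambda>x. f x * \<kappa> x) x) \<le> D is * B"
    using mult_cutoff_derivs[OF assms] by metis
  obtain C where C: "0 \<le> C" "\<And>f k. f \<in> test_functions_in L \<Longrightarrow>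
    norm (fc f k) * jap k ^ s \<le> C * (\<Sum>is | length is \<le> s. sup_norm L (fold pd is f))"
    using fc_le_sum_dsup[OF L(1), of s] by blast
  show thesis
  proof (rule that[of "C * (\<Sum>is | length is \<le> s. D is)"])
    show "0 \<le> C * (\<Sum>is | length is \<le> s. D is)" using C D by (simp add: sum_nonneg)
    fix f k assume f: "smooth_on V f"
    define B where "B = (\<Sum>is | length is \<le> s. sup_norm L (fold pd is f))"
    have c: "continuous_on L (fold pd is f)" for "is" by (rule smooth_continuous_fold_pd[OF f L(2)])
    have nn: "0 \<le> sup_norm L (fold pd is f)" for "is" by (rule sup_norm_nonneg[OF L(1) c])
    have B: "norm (fold pd is f x) \<le> B" if "length is \<le> s" "x \<in> L" for "is" x
      using sup_norm_ge[OF L(1) c that(2), of "is"] that(1)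
        member_le_sum[of "is" "{is. length is \<le> s}" "\<lambda>is. sup_norm L (fold pd is f)"] nn finite_short_lists
      by (force simp: B_def)
    have "norm (fc (\<lambda>x. f x * \<kappa> x) k) * jap k ^ s \<le> C * (\<Sum>is | length is \<le> s. sup_norm L (fold pd is (\<lambda>x. f x * \<kappa> x)))"
      by (rule C(2)[OF test_mult_local[OF V L f \<kappa>]])
    also have "\<dots> \<le> C * (\<Sum>is | length is \<le> s. D is * B)"
    proof (intro mult_left_mono C sum_mono sup_norm_le)
      show "0 \<le> D is * B" for "is" using D nn by (auto simp: B_def intro!: mult_nonneg_nonneg sum_nonneg)
      fix "is" :: "'n list" and x assume "is \<in> {is. length is \<le> s}" and x: "x \<in> L"
      then show "norm (fold pd is (\<lambda>x. f x * \<kappa> x) x) \<le> D is * B"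
        using B by (intro D(2)[OF f _ x]) auto
    qed
    also have "\<dots> = C * (\<Sum>is | length is \<le> s. D is) * B" by (simp add: sum_distrib_right mult.assoc)
    finally show "norm (fc (\<lambda>x. f x * \<kappa> x) k) * jap k ^ s \<le> C * (\<Sum>is | length is \<le> s. D is) * (\<Sum>is | length is \<le> s. sup_norm L (fold pd is f))"
      by (simp add: B_def)
  qed
qed

text \<open>For small \<epsilon> one has S v = S (cop z) + S (\<kappa> E); by \<open>H\<close> the
  first term is the integral of u z up to a negligible net, and that integral and S (\<kappa> E) are
  series in the coefficients of v. The regularity clause holds because A enters only through tame
  factors, while the exponents coming from u and S do not depend on the derivative.\<close>

theorem elliptic_net_regularity:
  fixes b :: "real \<Rightarrow> ('n::finite \<Rightarrow> nat) \<Rightarrow> complex" and \<Omega> V :: "(real^'n) set"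
  assumes ef: "elliptic_family {0<..\<eta>0} A m b" and \<eta>0: "0 < \<eta>0" "\<eta>0 \<le> 1"
    and tm: "\<And>F. growth.tame {0<..\<eta>0} A F \<Longrightarrow> \<exists>N::nat. bnd F (- real N)"
    and o: "open V" "V \<subseteq> \<Omega>" "x0 \<in> V" and S: "basic_net \<Omega> S" and u: "u \<in> moderate_nets V"
    and H: "\<And>z. z \<in> c_nets V \<Longrightarrow> negligible_net (\<lambda>\<epsilon>. S \<epsilon> (cop m (b \<epsilon>) (z \<epsilon>)) - (LINT x:V|lborel. u \<epsilon> x * z \<epsilon> x))"
  obtains W w where "open W" "x0 \<in> W" "W \<subseteq> V" "w \<in> moderate_nets W"
    "\<And>v. v \<in> c_nets W \<Longrightarrow> negligible_net (\<lambda>\<epsilon>. S \<epsilon> (v \<epsilon>) - (LINT x:W|lborel. w \<epsilon> x * v \<epsilon> x))"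
    "(\<And>F. growth.tame {0<..\<eta>0} A F \<Longrightarrow> bnd F (- 1)) \<Longrightarrow> regular_net V u \<Longrightarrow> regular_net W w"
proof -
  interpret elliptic_family "{0<..\<eta>0}" A m b by (rule ef)

  \<comment> \<open>Choice of the radii and of the cutoff\<close>
  obtain r where r: "0 < r" "cball x0 r \<subseteq> V" using o by (meson open_contains_cball)
  \<comment> \<open>1/2 is the limit set by the period, r/4 keeps the support of \<kappa>, of radius
    4 \<delta>, inside V.\<close>
  define \<delta> where "\<delta> = min (1/2) (r/4)"
  have \<delta>: "0 < \<delta>" "\<delta> \<le> 1/2" "4 * \<delta> \<le> r" using r by (auto simp: \<delta>_def)
  define L where "L = cball x0 (4 * \<delta>)"
  have "L \<subseteq> cball x0 r" using \<delta>(3) by (simp add: L_def subset_cball)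
  then have L: "compact L" "L \<subseteq> V" "L \<subseteq> \<Omega>" using r(2) o(2) by (auto simp: L_def)
  define W where "W = ball x0 \<delta>"
  have W: "open W" "x0 \<in> W" "W \<subseteq> L" "W \<subseteq> V" using \<delta> L by (auto simp: W_def L_def)
  obtain \<gamma> \<rho> T0 T where T0: "tame T0" "\<And>i k. i \<in> {0<..\<eta>0} \<Longrightarrow> norm (\<gamma> i k) \<le> T0 i * jap k ^ (2 * CARD('n))"
    and T: "\<And>s. tame (T s)" "\<And>s i k. i \<in> {0<..\<eta>0} \<Longrightarrow> norm (\<rho> i k) * jap k ^ s \<le> T s i"
    and g\<rho>: "\<And>i k. i \<in> {0<..\<eta>0} \<Longrightarrow> sym i k * \<gamma> i k = 1 - \<rho> i k"
    and G0: "\<And>i K v x x0. i \<in> {0<..\<eta>0} \<Longrightarrow> compact K \<Longrightarrow> K \<subseteq> ball x0 \<delta> \<Longrightarrow> v \<in> test_functions_in K \<Longrightarrow>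
       2 * \<delta> \<le> norm (x - x0) \<Longrightarrow> norm (x - x0) < 4 * \<delta> \<Longrightarrow> ((\<lambda>k. \<gamma> i k * fc v k * wave k x) has_sum 0) UNIV"
    by (rule parametrix_exists[OF \<delta>(1,2)]) blast
  obtain \<kappa> :: "real^'n \<Rightarrow> complex" where \<kappa>0: "smooth_on UNIV \<kappa>"
    "\<And>x. norm (x - x0) \<le> 3 * \<delta> \<Longrightarrow> \<kappa> x = 1" "\<And>x. 4 * \<delta> \<le> norm (x - x0) \<Longrightarrow> \<kappa> x = 0"
    by (rule smooth_cutoff[of "3 * \<delta>" "4 * \<delta>" x0]) (use \<delta> in auto)
  have \<kappa>: "\<kappa> \<in> test_functions_in L"
    using \<kappa>0(1,3) by (auto simp: test_functions_in_def L_def dist_norm norm_minus_commute)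
  have kw: "(\<lambda>x. \<kappa> x * wave k x) \<in> test_functions_in L" for k
    using test_functions_mult_smooth[OF \<kappa> smooth_wave[of k]] by (simp add: mult.commute)
  have "\<exists>C\<ge>0. \<forall>k x. norm (fold pd is (\<lambda>x. \<kappa> x * wave k x) x) \<le> C * jap k ^ length is" for "is"
    by (rule wave_cutoff_derivs[OF L(1) \<kappa>, of "is"]) blast
  then obtain Ck where Ck: "\<And>is. 0 \<le> Ck is" "\<And>is k x. norm (fold pd is (\<lambda>x. \<kappa> x * wave k x) x) \<le> Ck is * jap k ^ length is"
    by metis

  \<comment> \<open>Growth of the distributions on localized exponentials\<close>
  obtain j N :: nat and c \<eta>1 where Sb: "c > 0" "\<eta>1 \<in> {0<..1}"
    "\<And>f \<epsilon>. f \<in> test_functions_in L \<Longrightarrow> \<epsilon> \<in> {0<..\<eta>1} \<Longrightarrow> norm (S \<epsilon> f) \<le> c * \<epsilon> powr (- real N) * C_norm L j f"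
    using S L(1,3) unfolding basic_net_def by metis
  have Sd: "S \<epsilon> \<in> distributions \<Omega>" if "\<epsilon> \<in> {0<..1}" for \<epsilon> using S that by (auto simp: basic_net_def)
  define D where "D = (\<Sum>\<alpha> | mi_order \<alpha> \<le> j. Ck (mi_list \<alpha>))"
  have D0: "0 \<le> D" unfolding D_def by (intro sum_nonneg Ck)
  have Cn: "C_norm L j (\<lambda>x. \<kappa> x * wave k x) \<le> D * jap k ^ j" for k
  proof (rule C_norm_le)
    fix \<alpha> :: "'n \<Rightarrow> nat" and x assume \<alpha>: "mi_order \<alpha> \<le> j"
    have "norm (pderivs \<alpha> (\<lambda>x. \<kappa> x * wave k x) x) \<le> Ck (mi_list \<alpha>) * jap k ^ length (mi_list \<alpha>)"
      unfolding pderivs_eq_fold by (rule Ck(2))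
    also have "\<dots> \<le> D * jap k ^ j"
      unfolding D_def using \<alpha> Ck(1)
      by (intro mult_mono member_le_sum finite_mi_order power_increasing jap_ge_1 sum_nonneg) (auto simp: length_mi_list)
    finally show "norm (pderivs \<alpha> (\<lambda>x. \<kappa> x * wave k x) x) \<le> D * jap k ^ j" .
  qed (use D0 in simp)
  define \<eta> where "\<eta> = min \<eta>0 \<eta>1"
  have \<eta>: "0 < \<eta>" using \<eta>0 Sb(2) by (auto simp: \<eta>_def)
  have \<eta>D: "\<epsilon> \<in> {0<..\<eta>0}" "\<epsilon> \<in> {0<..\<eta>1}" "\<epsilon> \<in> {0<..1}" if "\<epsilon> \<in> {0<..\<eta>}" for \<epsilon>
    using that \<eta>0 Sb(2) by (auto simp: \<eta>_def)
  have ev: "\<forall>\<^sub>F \<epsilon> in at_right 0. \<epsilon> \<in> {0<..\<eta>}"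
    using eventually_at_right_real[OF \<eta>] by (rule eventually_mono) auto
  have Sw: "norm (S \<epsilon> (\<lambda>x. \<kappa> x * wave k x)) \<le> c * D * \<epsilon> powr (- real N) * jap k ^ j" if "\<epsilon> \<in> {0<..\<eta>}" for \<epsilon> k
  proof -
    have "norm (S \<epsilon> (\<lambda>x. \<kappa> x * wave k x)) \<le> c * \<epsilon> powr (- real N) * C_norm L j (\<lambda>x. \<kappa> x * wave k x)"
      by (rule Sb(3)[OF kw \<eta>D(2)[OF that]])
    also have "\<dots> \<le> c * \<epsilon> powr (- real N) * (D * jap k ^ j)"
      using Sb(1) by (intro mult_left_mono Cn) auto
    finally show ?thesis by (simp add: mult_ac)
  qed

  \<comment> \<open>Fourier coefficients of the localized right-hand side\<close>
  define p where "p = complex_of_real ((2 * pi) ^ CARD('n))"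
  have p0: "p \<noteq> 0" by (simp add: p_def)
  have np: "norm (inverse p) \<le> 1"
  proof -
    have "1 \<le> (2 * pi) ^ CARD('n)" by (rule one_le_power) (use pi_ge_two in simp)
    then show ?thesis
      unfolding p_def norm_inverse norm_of_real by (intro inverse_le_1_iff[THEN iffD2] disjI2) (rule order_trans[OF _ abs_ge_self])
  qed
  define f where "f \<epsilon> x = u \<epsilon> x * \<kappa> x" for \<epsilon> x
  have us: "u \<in> smooth_nets V" by (rule moderate_smooth[OF u])
  have ft: "f \<epsilon> \<in> test_functions_in L" if "\<epsilon> \<in> {0<..1}" for \<epsilon>
    unfolding f_def by (rule test_mult_local[OF o(1) L(1,2) smooth_netsD[OF us that] \<kappa>])
  define Us where "Us s \<epsilon> = (\<Sum>is | length is \<le> s. dsup L is u \<epsilon>)" for s \<epsilon>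
  have Us0: "0 \<le> Us s \<epsilon>" if "\<epsilon> \<in> {0<..1}" for s \<epsilon>
    unfolding Us_def by (intro sum_nonneg dsup_nonneg[OF us L(1,2) that])
  define P where "P \<epsilon> k = (LINT y|lborel. f \<epsilon> y * wave k y)" for \<epsilon> k
  have "\<exists>C\<ge>0. \<forall>\<epsilon>\<in>{0<..1}. \<forall>k. norm (P \<epsilon> k) * jap k ^ s \<le> C * Us s \<epsilon>" for s
  proof -
    obtain C where C: "0 \<le> C" "\<And>f k. smooth_on V f \<Longrightarrow>
      norm (fc (\<lambda>x. f x * \<kappa> x) k) * jap k ^ s \<le> C * (\<Sum>is | length is \<le> s. sup_norm L (fold pd is f))"
      using fc_cutoff_le[OF o(1) L(1,2) \<kappa>, of s] by blast
    have "norm (P \<epsilon> k) * jap k ^ s \<le> (norm p * C) * Us s \<epsilon>" if "\<epsilon> \<in> {0<..1}" for \<epsilon> k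
    proof -
      have "P \<epsilon> k = p * fc (f \<epsilon>) (\<lambda>j. - k j)"
      proof -
        have "fc (f \<epsilon>) (\<lambda>j. - k j) = inverse p * (LINT y|lborel. wave (\<lambda>j. - (- k j)) y * f \<epsilon> y)"
          unfolding fc_def p_def ..
        then show ?thesis using p0 by (simp add: P_def mult.commute[of "wave _ _"])
      qed
      then have "norm (P \<epsilon> k) * jap k ^ s = norm p * (norm (fc (f \<epsilon>) (\<lambda>j. - k j)) * jap (\<lambda>j. - k j) ^ s)"
        by (simp add: norm_mult)
      also have "\<dots> \<le> norm p * (C * Us s \<epsilon>)"
        unfolding Us_def f_def by (intro mult_left_mono C(2) smooth_netsD[OF us that]) auto
      finally show ?thesis by simp
    qed
    then show ?thesis using C(1) by (intro exI[of _ "norm p * C"]) auto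
  qed
  then obtain CP where CP: "\<And>s. 0 \<le> CP s" "\<And>s \<epsilon> k. \<epsilon> \<in> {0<..1} \<Longrightarrow> norm (P \<epsilon> k) * jap k ^ s \<le> CP s * Us s \<epsilon>"
    by metis

  \<comment> \<open>The function \<open>w\<close> and its derivatives\<close>
  define Wc where "Wc \<epsilon> k = (if \<epsilon> \<in> {0<..\<eta>} then \<gamma> \<epsilon> k * P \<epsilon> k + \<rho> \<epsilon> k * S \<epsilon> (\<lambda>x. \<kappa> x * wave k x) else 0)" for \<epsilon> k
  \<comment> \<open>The 2 n powers of the frequency by which \<gamma> grows are paid with
    derivatives of u, the j powers from the order of the distributions with the decay of
    \<rho>.\<close>
  define Bs where "Bs s \<epsilon> = T0 \<epsilon> * (Us (s + 2 * CARD('n)) \<epsilon> * CP (s + 2 * CARD('n))) + T (s + j) \<epsilon> * (\<epsilon> powr (- real N) * (c * D))" for s \<epsilon>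
  have T0nn: "0 \<le> T0 \<epsilon>" if "\<epsilon> \<in> {0<..\<eta>0}" for \<epsilon>
    using order_trans[OF norm_ge_zero T0(2)[OF that, of "\<lambda>_. 0"]] by (simp add: jap_def)
  have Wb: "norm (Wc \<epsilon> k) * jap k ^ s \<le> Bs s \<epsilon>" if \<epsilon>: "\<epsilon> \<in> {0<..\<eta>}" for \<epsilon> k s
  proof -
    have "norm (Wc \<epsilon> k) * jap k ^ s \<le> (norm (\<gamma> \<epsilon> k) * norm (P \<epsilon> k) + norm (\<rho> \<epsilon> k) * norm (S \<epsilon> (\<lambda>x. \<kappa> x * wave k x))) * jap k ^ s"
      unfolding Wc_def using \<epsilon> norm_triangle_ineq[of "\<gamma> \<epsilon> k * P \<epsilon> k"]
      by (auto simp: norm_mult[symmetric] intro!: mult_right_mono)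
    also have "\<dots> = norm (\<gamma> \<epsilon> k) * (norm (P \<epsilon> k) * jap k ^ s) + norm (S \<epsilon> (\<lambda>x. \<kappa> x * wave k x)) * (norm (\<rho> \<epsilon> k) * jap k ^ s)"
      by (simp add: algebra_simps)
    also have "\<dots> \<le> (T0 \<epsilon> * jap k ^ (2 * CARD('n))) * (norm (P \<epsilon> k) * jap k ^ s)
        + (c * D * \<epsilon> powr (- real N) * jap k ^ j) * (norm (\<rho> \<epsilon> k) * jap k ^ s)"
      by (intro add_mono mult_right_mono T0(2) \<eta>D[OF \<epsilon>] Sw[OF \<epsilon>]) auto
    also have "\<dots> = T0 \<epsilon> * (norm (P \<epsilon> k) * jap k ^ (s + 2 * CARD('n))) + (c * D * \<epsilon> powr (- real N)) * (norm (\<rho> \<epsilon> k) * jap k ^ (s + j))"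
      by (simp add: power_add mult_ac)
    also have "\<dots> \<le> T0 \<epsilon> * (CP (s + 2 * CARD('n)) * Us (s + 2 * CARD('n)) \<epsilon>) + (c * D * \<epsilon> powr (- real N)) * T (s + j) \<epsilon>"
      using Sb(1) D0 by (intro add_mono mult_left_mono CP(2) T(2) \<eta>D[OF \<epsilon>] T0nn) auto
    finally show ?thesis by (simp add: Bs_def mult_ac)
  qed
  \<comment> \<open>The sum of \<open>Wc\<close> times the coefficients of v is the integral of v
    against a series in waves of the opposite frequency, hence the reflection.\<close>
  define m' where "m' k = (\<lambda>j::'n. - k j)" for k :: "'n \<Rightarrow> int"
  have bij: "bij_betw m' UNIV UNIV" by (rule bij_betwI[of _ _ _ m']) (auto simp: m'_def)
  have mm: "m' (m' k) = k" "jap (m' k) = jap k" for k by (simp_all add: m'_def)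
  define cc where "cc \<epsilon> k = Wc \<epsilon> (m' k)" for \<epsilon> k
  have ccb: "norm (cc \<epsilon> k) * jap k ^ s \<le> Bs s \<epsilon>" if "\<epsilon> \<in> {0<..\<eta>}" for \<epsilon> k s
    using Wb[OF that, of "m' k" s] by (simp add: cc_def mm)
  \<comment> \<open>The value 0 of \<open>Wc\<close> for \<epsilon> > \<eta> makes this hold, and
    hence w smooth, for every index.\<close>
  have cr: "rapid (cc \<epsilon>)" for \<epsilon>
  proof (cases "\<epsilon> \<in> {0<..\<eta>}")
    case True
    then show ?thesis using ccb by (intro rapidI) blast
  qed (auto simp: rapid_def cc_def[abs_def] Wc_def)
  define w where "w \<epsilon> y = inverse p * (\<Sum>\<^sub>\<infinity>k. cc \<epsilon> k * wave k y)" for \<epsilon> y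
  have sws: "smooth_on UNIV (\<lambda>y. \<Sum>\<^sub>\<infinity>k. cc \<epsilon> k * wave k y)" for \<epsilon> by (rule smooth_wave_series(1)[OF cr])
  have wsm: "smooth_on UNIV (w \<epsilon>)" for \<epsilon>
    unfolding w_def[abs_def] by (intro smooth_on_cmult sws open_UNIV)
  have wn: "w \<in> smooth_nets W" using smooth_on_subset[OF wsm subset_UNIV] by (auto simp: smooth_nets_def)
  define J where "J = infsum (\<lambda>k::'n \<Rightarrow> int. inverse (jap k ^ (2 * CARD('n)))) UNIV"
  have J0: "0 \<le> J" unfolding J_def by (intro infsum_nonneg) auto
  have wd: "norm (fold pd is (w \<epsilon>) y) \<le> Bs (length is + 2 * CARD('n)) \<epsilon> * J" if \<epsilon>: "\<epsilon> \<in> {0<..\<eta>}" for "is" \<epsilon> y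
  proof -
    have pr: "norm (\<Prod>i\<leftarrow>is. \<i> * complex_of_int (k i)) \<le> jap k ^ length is" for k
      by (induction "is") (auto simp: norm_mult abs_le_jap intro!: mult_mono)
    have dec: "norm (cc \<epsilon> k) * jap k ^ length is * jap k ^ (2 * CARD('n)) \<le> Bs (length is + 2 * CARD('n)) \<epsilon>" for k
      using ccb[OF \<epsilon>, of k "length is + 2 * CARD('n)"] by (simp add: power_add mult.assoc)
    have "norm (fold pd is (\<lambda>y. \<Sum>\<^sub>\<infinity>k. cc \<epsilon> k * wave k y) y) \<le> infsum (\<lambda>k. norm (cc \<epsilon> k) * jap k ^ length is) UNIV"
      by (rule norm_infsum_le[OF smooth_wave_series(2)[OF cr] has_sum_infsum[OF rapidD[OF cr]]])
         (auto simp: norm_mult intro!: mult_left_mono pr)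
    also have "\<dots> \<le> Bs (length is + 2 * CARD('n)) \<epsilon> * J"
      unfolding J_def by (rule summable_on_of_decay(2)) (use dec in auto)
    finally have 1: "norm (fold pd is (\<lambda>y. \<Sum>\<^sub>\<infinity>k. cc \<epsilon> k * wave k y) y) \<le> Bs (length is + 2 * CARD('n)) \<epsilon> * J" .
    have "fold pd is (w \<epsilon>) y = inverse p * fold pd is (\<lambda>y. \<Sum>\<^sub>\<infinity>k. cc \<epsilon> k * wave k y) y"
      unfolding w_def[abs_def] by (rule fold_pd_cmult[OF open_UNIV sws UNIV_I])
    then have "norm (fold pd is (w \<epsilon>) y) \<le> 1 * norm (fold pd is (\<lambda>y. \<Sum>\<^sub>\<infinity>k. cc \<epsilon> k * wave k y) y)"
      using np by (simp only: norm_mult) (intro mult_right_mono, auto)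
    then show ?thesis using 1 by simp
  qed
  have Bs0: "0 \<le> Bs s \<epsilon>" if "\<epsilon> \<in> {0<..\<eta>}" for s \<epsilon>
    using order_trans[OF _ Wb[OF that, of "\<lambda>_. 0" s]] by simp
  have wb: "bnd (dsup K is w) a" if "bnd (Bs (length is + 2 * CARD('n))) a" for K "is" a
  proof (rule bnd_mono[OF bnd_cmult[OF that J0]])
    show "\<forall>\<^sub>F \<epsilon> in at_right 0. dsup K is w \<epsilon> \<le> Bs (length is + 2 * CARD('n)) \<epsilon> * J"
      using ev by eventually_elim (intro sup_norm_le wd mult_nonneg_nonneg Bs0 J0)
  qed
  have bB: "bnd (Bs s) (- real (N1 + N3 + (N2 + N)))"
    if "bnd T0 (- real N1)" "bnd (T (s + j)) (- real N2)" "bnd (Us (s + 2 * CARD('n))) (- real N3)" for s N1 N2 N3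
  proof -
    have "bnd (\<lambda>\<epsilon>. T0 \<epsilon> * (Us (s + 2 * CARD('n)) \<epsilon> * CP (s + 2 * CARD('n)))) (- real N1 + - real N3)"
      using Us0 CP(1) by (intro bnd_mult bnd_cmult that) auto
    moreover have "bnd (\<lambda>\<epsilon>. T (s + j) \<epsilon> * (\<epsilon> powr (- real N) * (c * D))) (- real N2 + - real N)"
      using Sb(1) D0 by (intro bnd_mult bnd_cmult that bnd_powr) auto
    ultimately show ?thesis
      unfolding Bs_def by (intro bnd_add) (erule bnd_weaken, simp)+
  qed

  \<comment> \<open>Moderateness and regularity of \<open>w\<close>\<close>
  have wmod: "w \<in> moderate_nets W"
    unfolding moderate_nets_iff[OF W(1)]
  proof (intro conjI wn allI impI)
    fix K and "is" :: "'n list"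
    obtain N1 :: nat where N1: "bnd T0 (- real N1)" using tm[OF T0(1)] by blast
    obtain N2 :: nat where N2: "bnd (T (length is + 2 * CARD('n) + j)) (- real N2)" using tm[OF T(1)] by blast
    obtain N3 :: nat where "\<And>js. js \<in> {js. length js \<le> length is + 2 * CARD('n) + 2 * CARD('n)} \<Longrightarrow> bnd (dsup L js u) (- real N3)"
      by (rule bnd_finite_uniform[OF finite_short_lists, of "length is + 2 * CARD('n) + 2 * CARD('n)" "\<lambda>js. dsup L js u", OF moderate_bnd[OF o(1) u L(1,2)]]) blast
    then have "bnd (Us (length is + 2 * CARD('n) + 2 * CARD('n))) (- real N3)"
      unfolding Us_def by (intro bnd_sum)
    from wb[OF bB[OF N1 N2 this]] show "\<exists>N::nat. bnd (dsup K is w) (- real N)" by blast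
  qed
  \<comment> \<open>Each tame factor costs one power of 1/\<epsilon>, however large s is, and u
    costs N3 for all its derivatives; the exponent 1 + N3 + (1 + N) is therefore uniform.\<close>
  have wreg: "regular_net W w" if t1: "\<And>F. tame F \<Longrightarrow> bnd F (- 1)" and ru: "regular_net V u"
    unfolding regular_net_def
  proof (intro allI impI)
    fix K
    obtain N3 :: nat where N3: "\<And>is. bnd (dsup L is u) (- real N3)" using ru L unfolding regular_net_def by blast
    have N1: "bnd T0 (- real 1)" "bnd (T s) (- real 1)" for s using t1[OF T0(1)] t1[OF T(1)] by simp_all
    have U3: "bnd (Us s) (- real N3)" for s unfolding Us_def by (intro bnd_sum N3)
    show "\<exists>N::nat. \<forall>is. bnd (dsup K is w) (- real N)"
      by (intro exI[of _ "1 + N3 + (1 + N)"] allI wb bB N1 U3)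
  qed

  \<comment> \<open>Representation of the distributions by \<open>w\<close>\<close>
  have main: "negligible_net (\<lambda>\<epsilon>. S \<epsilon> (v \<epsilon>) - (LINT x:W|lborel. w \<epsilon> x * v \<epsilon> x))" if v: "v \<in> c_nets W" for v
  proof -
    obtain K where K: "compact K" "K \<subseteq> W" "\<And>\<epsilon>. \<epsilon> \<in> {0<..1} \<Longrightarrow> v \<epsilon> \<in> test_functions_in K" "v \<in> moderate_nets W"
      by (rule c_netsE[OF v]) blast
    have KL: "K \<subseteq> L" using K(2) W(3) by blast
    have Kb: "K \<subseteq> ball x0 \<delta>" using K(2) by (simp add: W_def)
    define d where "d \<epsilon> k = \<gamma> \<epsilon> k * fc (v \<epsilon>) k" for \<epsilon> k
    define e where "e \<epsilon> k = \<rho> \<epsilon> k * fc (v \<epsilon>) k" for \<epsilon> k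
    have rv: "rapid (fc (v \<epsilon>))" if "\<epsilon> \<in> {0<..1}" for \<epsilon> by (rule rapid_fc[OF K(1) K(3)[OF that]])
    have \<rho>b: "norm (\<rho> \<epsilon> k) \<le> T 0 \<epsilon>" if "\<epsilon> \<in> {0<..\<eta>}" for \<epsilon> k
      using T(2)[OF \<eta>D(1)[OF that], of k 0] by simp
    have rd: "rapid (d \<epsilon>)" "rapid (e \<epsilon>)" if \<epsilon>: "\<epsilon> \<in> {0<..\<eta>}" for \<epsilon>
      unfolding d_def[abs_def] e_def[abs_def]
      using rapid_mult[OF rv[OF \<eta>D(3)[OF \<epsilon>]] T0(2)[OF \<eta>D(1)[OF \<epsilon>]]]
        rapid_mult[OF rv[OF \<eta>D(3)[OF \<epsilon>]], of "\<rho> \<epsilon>" "T 0 \<epsilon>" 0] \<rho>b[OF \<epsilon>] by auto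
    \<comment> \<open>A net in \<open>c_nets\<close> needs values for all indices, while the
      parametrix exists for small ones only; 0 fills the gap.\<close>
    define z where "z \<epsilon> = (if \<epsilon> \<in> {0<..\<eta>} then (\<lambda>x. \<kappa> x * (\<Sum>\<^sub>\<infinity>k. d \<epsilon> k * wave k x)) else (\<lambda>_. 0))" for \<epsilon>
    have zt: "z \<epsilon> \<in> test_functions_in L" for \<epsilon>
    proof (cases "\<epsilon> \<in> {0<..\<eta>}")
      case True
      then show ?thesis using cutoff_wave_series(1)[OF L(1) \<kappa> rd(1)[OF True] Ck] by (simp add: z_def)
    next
      case False
      have "(\<lambda>_. 0) \<in> test_functions_in L" by (simp add: test_functions_in_def smooth_on_const)
      with False show ?thesis by (simp only: z_def if_False)
    qed
    have zc: "z \<in> c_nets V"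
    proof (rule c_netsI[OF o(1) L(1,2) zt])
      fix "is" :: "'n list"
      define s where "s = length is + 2 * CARD('n) + 2 * CARD('n)"
      obtain C where C: "0 \<le> C" "\<And>f k. f \<in> test_functions_in K \<Longrightarrow>
        norm (fc f k) * jap k ^ s \<le> C * (\<Sum>is | length is \<le> s. sup_norm K (fold pd is f))"
        using fc_le_sum_dsup[OF K(1), of s] by blast
      define Vs where "Vs \<epsilon> = (\<Sum>is | length is \<le> s. dsup K is v \<epsilon>)" for \<epsilon>
      have Vs0: "0 \<le> Vs \<epsilon>" if "\<epsilon> \<in> {0<..1}" for \<epsilon>
        unfolding Vs_def by (intro sum_nonneg dsup_nonneg[OF moderate_smooth[OF K(4)] K(1,2) that])
      obtain N1 :: nat where N1: "bnd T0 (- real N1)" using tm[OF T0(1)] by blast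
      obtain N2 :: nat where "\<And>js. js \<in> {js. length js \<le> s} \<Longrightarrow> bnd (dsup K js v) (- real N2)"
        by (rule bnd_finite_uniform[OF finite_short_lists, of s "\<lambda>js. dsup K js v", OF moderate_bnd[OF W(1) K(4,1,2)]]) blast
      then have N2: "bnd Vs (- real N2)" unfolding Vs_def by (intro bnd_sum)
      have "bnd (\<lambda>\<epsilon>. T0 \<epsilon> * (Vs \<epsilon> * (C * J * Ck is))) (- real N1 + - real N2)"
        using Vs0 C(1) J0 Ck(1) by (intro bnd_mult bnd_cmult N1 N2) auto
      then have "bnd (dsup L is z) (- real N1 + - real N2)"
      proof (rule bnd_mono)
        show "\<forall>\<^sub>F \<epsilon> in at_right 0. dsup L is z \<epsilon> \<le> T0 \<epsilon> * (Vs \<epsilon> * (C * J * Ck is))"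
          using ev
        proof eventually_elim
          fix \<epsilon> assume \<epsilon>: "\<epsilon> \<in> {0<..\<eta>}"
          have dec: "norm (d \<epsilon> k) * jap k ^ length is * jap k ^ (2 * CARD('n)) \<le> T0 \<epsilon> * (C * Vs \<epsilon>)" for k
          proof -
            have "norm (d \<epsilon> k) * jap k ^ length is * jap k ^ (2 * CARD('n))
                \<le> (T0 \<epsilon> * jap k ^ (2 * CARD('n))) * norm (fc (v \<epsilon>) k) * jap k ^ length is * jap k ^ (2 * CARD('n))"
              unfolding d_def norm_mult by (intro mult_right_mono T0(2) \<eta>D[OF \<epsilon>]) auto
            also have "\<dots> = T0 \<epsilon> * (norm (fc (v \<epsilon>) k) * jap k ^ s)" unfolding s_def power_add by (simp only: mult_ac)
            also have "\<dots> \<le> T0 \<epsilon> * (C * Vs \<epsilon>)"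
              unfolding Vs_def by (intro mult_left_mono C(2) K(3) T0nn \<eta>D[OF \<epsilon>])
            finally show ?thesis .
          qed
          have "infsum (\<lambda>k. norm (d \<epsilon> k) * jap k ^ length is) UNIV \<le> T0 \<epsilon> * (C * Vs \<epsilon>) * J"
            unfolding J_def by (rule summable_on_of_decay(2)) (use dec in auto)
          then have "Ck is * infsum (\<lambda>k. norm (d \<epsilon> k) * jap k ^ length is) UNIV \<le> Ck is * (T0 \<epsilon> * (C * Vs \<epsilon>) * J)"
            by (intro mult_left_mono Ck)
          then have b1: "norm (fold pd is (z \<epsilon>) x) \<le> T0 \<epsilon> * (Vs \<epsilon> * (C * J * Ck is))" for x
            using cutoff_wave_series(2)[OF L(1) \<kappa> rd(1)[OF \<epsilon>] Ck(1)[of "is"] Ck(2), of x] \<epsilon>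
            by (simp add: z_def mult_ac)
          show "dsup L is z \<epsilon> \<le> T0 \<epsilon> * (Vs \<epsilon> * (C * J * Ck is))"
            using b1 order_trans[OF norm_ge_zero b1] by (intro sup_norm_le) auto
        qed
      qed
      then show "\<exists>N::nat. bnd (dsup L is z) (- real N)" by (intro exI[of _ "N1 + N2"]) simp
    qed
    \<comment> \<open>An exact identity for small \<epsilon>: the only error is the one that
      \<open>H\<close> declares negligible for z.\<close>
    have eq: "S \<epsilon> (v \<epsilon>) - (LINT x:W|lborel. w \<epsilon> x * v \<epsilon> x) = S \<epsilon> (cop m (b \<epsilon>) (z \<epsilon>)) - (LINT x:V|lborel. u \<epsilon> x * z \<epsilon> x)"
      if \<epsilon>: "\<epsilon> \<in> {0<..\<eta>}" for \<epsilon>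
    proof -
      note \<epsilon>D = \<eta>D[OF \<epsilon>]
      have vt: "v \<epsilon> \<in> test_functions_in K" by (rule K(3)[OF \<epsilon>D(3)])
      have z\<epsilon>: "z \<epsilon> = (\<lambda>x. \<kappa> x * (\<Sum>\<^sub>\<infinity>k. d \<epsilon> k * wave k x))" using \<epsilon> by (simp add: z_def)
      let ?E = "\<lambda>x. \<kappa> x * (\<Sum>\<^sub>\<infinity>k. e \<epsilon> k * wave k x)"
      have Et: "?E \<in> test_functions_in L" by (rule cutoff_wave_series(1)[OF L(1) \<kappa> rd(2)[OF \<epsilon>] Ck])
      have "v \<epsilon> x = cop m (b \<epsilon>) (z \<epsilon>) x + ?E x" for x
        unfolding z\<epsilon> d_def e_def
        by (rule parametrix_identity[OF \<epsilon>D(1) \<delta>(1,2) T0(2)[OF \<epsilon>D(1)] g\<rho>[OF \<epsilon>D(1)] \<rho>b[OF \<epsilon>] K(1) Kb vt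
              G0[OF \<epsilon>D(1) K(1) Kb vt] \<kappa>0])
      then have "v \<epsilon> = (\<lambda>x. cop m (b \<epsilon>) (z \<epsilon>) x + ?E x)" by (rule ext)
      then have Sv: "S \<epsilon> (v \<epsilon>) = S \<epsilon> (cop m (b \<epsilon>) (z \<epsilon>)) + S \<epsilon> ?E"
        using distributions_add[OF Sd[OF \<epsilon>D(3)] cop_test[OF L(1) zt] Et L(1,3)] by simp
      have h1: "((\<lambda>k. e \<epsilon> k * S \<epsilon> (\<lambda>x. \<kappa> x * wave k x)) has_sum S \<epsilon> ?E) UNIV"
        by (rule distribution_wave_series[OF Sd[OF \<epsilon>D(3)] L(1,3) \<kappa> rd(2)[OF \<epsilon>]])
      have h2: "((\<lambda>k. d \<epsilon> k * P \<epsilon> k) has_sum (LINT x:V|lborel. u \<epsilon> x * z \<epsilon> x)) UNIV"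
      proof -
        have "(LINT x:V|lborel. u \<epsilon> x * z \<epsilon> x) = (LINT x|lborel. f \<epsilon> x * (\<Sum>\<^sub>\<infinity>k. d \<epsilon> k * wave k x))"
          unfolding set_integral_test[OF L(2) zt] by (simp add: z\<epsilon> f_def mult.assoc)
        then show ?thesis
          unfolding P_def using ft[OF \<epsilon>D(3)]
          by (simp only:) (intro integral_wave_series_test[OF rapid_norm[OF rd(1)[OF \<epsilon>]] L(1)] test_function_continuous[OF ft[OF \<epsilon>D(3)]],
             simp add: test_functions_in_def)
      qed
      have "((\<lambda>k. d \<epsilon> k * P \<epsilon> k + e \<epsilon> k * S \<epsilon> (\<lambda>x. \<kappa> x * wave k x)) has_sum ((LINT x:V|lborel. u \<epsilon> x * z \<epsilon> x) + S \<epsilon> ?E)) UNIV"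
        by (rule has_sum_add[OF h2 h1])
      moreover have "d \<epsilon> k * P \<epsilon> k + e \<epsilon> k * S \<epsilon> (\<lambda>x. \<kappa> x * wave k x) = Wc \<epsilon> k * fc (v \<epsilon>) k" for k
        using \<epsilon> by (simp add: Wc_def d_def e_def algebra_simps)
      ultimately have h3: "((\<lambda>k. Wc \<epsilon> k * fc (v \<epsilon>) k) has_sum ((LINT x:V|lborel. u \<epsilon> x * z \<epsilon> x) + S \<epsilon> ?E)) UNIV"
        by (simp only:)
      have Ws: "(\<lambda>k. norm (Wc \<epsilon> k)) summable_on UNIV"
        using rapid_norm[OF cr[of \<epsilon>]] summable_on_reindex_bij_betw[OF bij, of "\<lambda>k. norm (Wc \<epsilon> k)"] by (simp add: cc_def)
      \<comment> \<open>At the point 0 the convolution formula becomes a Parseval identity between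
        coefficients and integral.\<close>
      have "((\<lambda>k. Wc \<epsilon> k * fc (v \<epsilon>) k * wave k 0) has_sum
          (inverse p * (LINT y|lborel. v \<epsilon> y * (\<Sum>\<^sub>\<infinity>k. Wc \<epsilon> k * wave k (0 - y))))) UNIV"
        unfolding p_def by (rule convolution_wave_series[OF Ws K(1) vt])
      moreover have "(\<Sum>\<^sub>\<infinity>k. Wc \<epsilon> k * wave k (0 - y)) = (\<Sum>\<^sub>\<infinity>k. cc \<epsilon> k * wave k y)" for y
      proof -
        have "Wc \<epsilon> k * wave k (0 - y) = cc \<epsilon> (m' k) * wave (m' k) y" for k
          unfolding wave_diff by (simp add: cc_def mm) (simp add: m'_def)
        then show ?thesis using infsum_reindex_bij_betw[OF bij, of "\<lambda>k. cc \<epsilon> k * wave k y"] by simp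
      qed
      ultimately have "((\<lambda>k. Wc \<epsilon> k * fc (v \<epsilon>) k) has_sum (inverse p * (LINT y|lborel. v \<epsilon> y * (\<Sum>\<^sub>\<infinity>k. cc \<epsilon> k * wave k y)))) UNIV"
        by simp
      from has_sum_unique[OF h3 this]
      have "(LINT x:V|lborel. u \<epsilon> x * z \<epsilon> x) + S \<epsilon> ?E = (LINT y|lborel. inverse p * (v \<epsilon> y * (\<Sum>\<^sub>\<infinity>k. cc \<epsilon> k * wave k y)))"
        by simp
      also have "\<dots> = (LINT x:W|lborel. w \<epsilon> x * v \<epsilon> x)"
        unfolding set_integral_test[OF K(2) vt] by (simp add: w_def mult_ac)
      finally have "(LINT x:W|lborel. w \<epsilon> x * v \<epsilon> x) = (LINT x:V|lborel. u \<epsilon> x * z \<epsilon> x) + S \<epsilon> ?E" ..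
      then show ?thesis unfolding Sv by simp
    qed
    show ?thesis
      unfolding negligible_iff
    proof
      fix q :: nat
      have "bnd (\<lambda>\<epsilon>. norm (S \<epsilon> (cop m (b \<epsilon>) (z \<epsilon>)) - (LINT x:V|lborel. u \<epsilon> x * z \<epsilon> x))) (real q)"
        using H[OF zc] by (simp add: negligible_iff)
      then show "bnd (\<lambda>\<epsilon>. norm (S \<epsilon> (v \<epsilon>) - (LINT x:W|lborel. w \<epsilon> x * v \<epsilon> x))) (real q)"
        by (rule bnd_mono) (use ev in \<open>eventually_elim, simp only: eq order_refl\<close>)
    qed
  qed
  show thesis by (rule that[OF W(1,2,4) wmod main wreg])
qed

section \<open>Ellipticity\<close>

lemma bnd_power: "bnd F (- real M) \<Longrightarrow> (\<And>\<epsilon>. 0 \<le> F \<epsilon>) \<Longrightarrow> bnd (\<lambda>\<epsilon>. F \<epsilon> ^ N) (- real (M * N))"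
proof (induction N)
  case 0
  then show ?case using bnd_const[of 1] by simp
next
  case (Suc N)
  have "bnd (\<lambda>\<epsilon>. F \<epsilon> * F \<epsilon> ^ N) (- real M + - real (M * N))"
    by (rule bnd_mult[OF Suc.prems(1) Suc.IH[OF Suc.prems]]) (simp add: Suc.prems(2))
  then show ?case by (simp add: algebra_simps)
qed

text \<open>The slow scale property reduced to natural exponents and small \<epsilon>, the form in
  which powers of A are estimated.\<close>

definition slow :: "(real \<Rightarrow> real) \<Rightarrow> bool" where
  "slow F \<longleftrightarrow> (\<forall>N. bnd (\<lambda>\<epsilon>. F \<epsilon> ^ N) (- 1))"

lemma slow_mono:
  assumes "slow G" "\<forall>\<^sub>F \<epsilon> in at_right 0. 0 \<le> F \<epsilon> \<and> F \<epsilon> \<le> G \<epsilon>"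
  shows "slow F"
  unfolding slow_def
proof
  fix N
  have "bnd (\<lambda>\<epsilon>. G \<epsilon> ^ N) (- 1)" using assms(1) by (simp add: slow_def)
  then show "bnd (\<lambda>\<epsilon>. F \<epsilon> ^ N) (- 1)"
  proof (rule bnd_mono)
    show "\<forall>\<^sub>F \<epsilon> in at_right 0. F \<epsilon> ^ N \<le> G \<epsilon> ^ N"
      using assms(2) by eventually_elim (simp add: power_mono)
  qed
qed

lemma slow_cmult:
  assumes "slow F" "0 \<le> c" shows "slow (\<lambda>\<epsilon>. F \<epsilon> * c)"
  using assms by (simp add: slow_def power_mult_distrib bnd_cmult)

lemma slow_const: "slow (\<lambda>_. c)"
  unfolding slow_def by (intro allI bnd_weaken[OF bnd_const]) simp

text \<open>F + G is at most 2 max (F, G), and a power of the maximum is at most the sum of the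
  powers; no binomial expansion is needed.\<close>

lemma slow_add:
  assumes "slow F" "slow G" "\<And>\<epsilon>. 0 \<le> F \<epsilon>" "\<And>\<epsilon>. 0 \<le> G \<epsilon>"
  shows "slow (\<lambda>\<epsilon>. F \<epsilon> + G \<epsilon>)"
proof -
  have "slow (\<lambda>\<epsilon>. max (F \<epsilon>) (G \<epsilon>))"
    unfolding slow_def
  proof
    fix N
    have "bnd (\<lambda>\<epsilon>. F \<epsilon> ^ N + G \<epsilon> ^ N) (- 1)" using assms by (intro bnd_add) (simp_all add: slow_def)
    then show "bnd (\<lambda>\<epsilon>. max (F \<epsilon>) (G \<epsilon>) ^ N) (- 1)"
      by (rule bnd_mono) (intro always_eventually allI, auto simp: max_def assms(3,4))
  qed
  then have "slow (\<lambda>\<epsilon>. max (F \<epsilon>) (G \<epsilon>) * 2)" by (rule slow_cmult) simp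
  then show ?thesis
    by (rule slow_mono) (intro always_eventually allI, auto simp: max_def assms(3,4))
qed

lemma slow_sum:
  assumes "\<And>i. i \<in> J \<Longrightarrow> slow (F i)" "\<And>i \<epsilon>. 0 \<le> F i \<epsilon>"
  shows "slow (\<lambda>\<epsilon>. \<Sum>i\<in>J. F i \<epsilon>)"
  using assms
proof (induction J rule: infinite_finite_induct)
  case (insert x J)
  then show ?case by (auto intro!: slow_add sum_nonneg)
qed (simp_all add: slow_const)

lemma slow_scale_slow:
  assumes "slow_scale \<omega>" shows "slow (\<lambda>\<epsilon>. norm (\<omega> \<epsilon>))"
  unfolding slow_def
proof
  fix N
  show "bnd (\<lambda>\<epsilon>. norm (\<omega> \<epsilon>) ^ N) (- 1)"
  proof (cases "N = 0")
    case True
    then show ?thesis using bnd_weaken[OF bnd_const[of 1], of "- 1"] by simp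
  next
    case False
    obtain c where c: "0 < c" "\<forall>\<epsilon>\<in>{0<..1}. norm (\<omega> \<epsilon>) powr real N \<le> c * inverse \<epsilon>"
      using assms unfolding slow_scale_def by (meson of_nat_0_le_iff)
    have "bnd (\<lambda>\<epsilon>. \<epsilon> powr (- 1) * c) (- 1)" using c by (intro bnd_cmult bnd_powr) auto
    then show ?thesis
    proof (rule bnd_mono_unit)
      fix \<epsilon> :: real assume \<epsilon>: "\<epsilon> \<in> {0<..1}"
      have "norm (\<omega> \<epsilon>) ^ N = norm (\<omega> \<epsilon>) powr real N"
        using False by (cases "norm (\<omega> \<epsilon>) = 0") (simp_all add: powr_realpow)
      then show "norm (\<omega> \<epsilon>) ^ N \<le> \<epsilon> powr (- 1) * c"
        using c(2) \<epsilon> by (auto simp: powr_minus mult.commute)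
    qed
  qed
qed

text \<open>A multiple of \<epsilon> is the right scale for changing representatives: inverses of
  slow scale nets do not decay faster.\<close>

lemma negligible_eventually_le:
  assumes "negligible_net r" "0 < d"
  shows "\<forall>\<^sub>F \<epsilon> in at_right 0. norm (r \<epsilon>) \<le> d * \<epsilon>"
proof -
  have "bnd (\<lambda>\<epsilon>. norm (r \<epsilon>)) (real 2)" using assms(1) unfolding negligible_iff by blast
  then obtain C where C: "0 \<le> C" "\<forall>\<^sub>F \<epsilon> in at_right 0. norm (r \<epsilon>) \<le> C * \<epsilon> powr 2" unfolding bnd_def by auto
  have "\<forall>\<^sub>F \<epsilon>::real in at_right 0. \<epsilon> \<in> {0<..<d / (C + 1)}"
    by (rule eventually_at_right_real) (use C assms in auto)
  with C(2) show ?thesis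
  proof eventually_elim
    fix \<epsilon> :: real assume 1: "norm (r \<epsilon>) \<le> C * \<epsilon> powr 2" and 2: "\<epsilon> \<in> {0<..<d / (C + 1)}"
    have "C * \<epsilon> \<le> d" using 2 C(1) by (auto simp: field_simps)
    then have "C * \<epsilon> * \<epsilon> \<le> d * \<epsilon>" using 2 by (intro mult_right_mono) auto
    moreover have "\<epsilon> powr 2 = \<epsilon> * \<epsilon>" using 2 by (simp add: powr_numeral power2_eq_square)
    ultimately show "norm (r \<epsilon>) \<le> d * \<epsilon>" using 1 by (simp add: mult.assoc)
  qed
qed

definition sphere_inf :: "nat \<Rightarrow> (('n::finite \<Rightarrow> nat) \<Rightarrow> complex) \<Rightarrow> real" where
  "sphere_inf m r = (INF \<xi>\<in>{\<xi>::real^'n. norm \<xi> = 1}. norm (principal_symbol m r \<xi>))"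

lemma sphere_nonempty: "{\<xi>::real^'n::finite. norm \<xi> = 1} \<noteq> {}"
proof -
  have "norm (axis undefined 1 :: real^'n) = 1" by (rule norm_axis_1)
  then show ?thesis by blast
qed

lemma sphere_inf_le: "norm \<xi> = 1 \<Longrightarrow> sphere_inf m r \<le> norm (principal_symbol m r \<xi>)"
  unfolding sphere_inf_def by (rule cINF_lower) (auto intro!: bdd_belowI[of _ 0])

lemma sphere_inf_nonneg: "0 \<le> sphere_inf m r"
  unfolding sphere_inf_def by (rule cINF_greatest[OF sphere_nonempty]) simp

lemma norm_principal_symbol_diff_le:
  fixes \<xi> :: "real^'n::finite"
  assumes "norm \<xi> = 1"
  shows "norm (principal_symbol m r \<xi> - principal_symbol m s \<xi>) \<le> (\<Sum>\<alpha> | mi_order \<alpha> = m. norm (r \<alpha> - s \<alpha>))"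
proof -
  have 1: "\<bar>\<Prod>i\<in>UNIV. (\<xi> $ i) ^ \<alpha> i\<bar> \<le> 1" for \<alpha> :: "'n \<Rightarrow> nat"
    unfolding abs_prod using component_le_norm_cart[of \<xi>] assms
    by (intro prod_le_1) (auto simp: power_abs intro!: power_le_one)
  have "principal_symbol m r \<xi> - principal_symbol m s \<xi>
      = (\<Sum>\<alpha> | mi_order \<alpha> = m. (r \<alpha> - s \<alpha>) * of_real (\<Prod>i\<in>UNIV. (\<xi> $ i) ^ \<alpha> i))"
    by (simp add: principal_symbol_def sum_subtractf left_diff_distrib)
  also have "norm \<dots> \<le> (\<Sum>\<alpha> | mi_order \<alpha> = m. norm (r \<alpha> - s \<alpha>) * 1)"
    by (rule sum_norm_le, unfold norm_mult norm_of_real, intro mult_left_mono 1) auto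
  finally show ?thesis by simp
qed

text \<open>Monomials are at most 1 on the unit sphere. Thus negligible changes of the coefficients
  change the infimum negligibly, and comparison with zero coefficients shows that it is
  moderate.\<close>

lemma sphere_inf_diff_le:
  "\<bar>sphere_inf m r - sphere_inf m s\<bar> \<le> (\<Sum>\<alpha> | mi_order \<alpha> = m. norm (r \<alpha> - s \<alpha>))"
proof -
  have *: "sphere_inf m r - (\<Sum>\<alpha> | mi_order \<alpha> = m. norm (r \<alpha> - s \<alpha>)) \<le> sphere_inf m s" for r s :: "('n::finite \<Rightarrow> nat) \<Rightarrow> complex"
  proof (subst (2) sphere_inf_def, rule cINF_greatest[OF sphere_nonempty])
    fix \<xi> :: "real^'n" assume "\<xi> \<in> {\<xi>. norm \<xi> = 1}"
    then show "sphere_inf m r - (\<Sum>\<alpha> | mi_order \<alpha> = m. norm (r \<alpha> - s \<alpha>)) \<le> norm (principal_symbol m s \<xi>)"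
      using sphere_inf_le[of \<xi> m r] norm_principal_symbol_diff_le[of \<xi> m r s]
        norm_triangle_ineq2[of "principal_symbol m r \<xi>" "principal_symbol m s \<xi>"] by simp
  qed
  show ?thesis using *[of r s] *[of s r] by (simp add: norm_minus_commute abs_le_iff)
qed

text \<open>Transposition multiplies all coefficients of order m by the common sign (-1)^m, so it
  preserves ellipticity.\<close>

lemma sphere_inf_cmult:
  fixes r :: "('n::finite \<Rightarrow> nat) \<Rightarrow> complex"
  assumes "norm z = 1" shows "sphere_inf m (\<lambda>\<alpha>. z * r \<alpha>) = sphere_inf m r"
proof -
  have "principal_symbol m (\<lambda>\<alpha>. z * r \<alpha>) \<xi> = z * principal_symbol m r \<xi>" for \<xi> :: "real^'n"
    by (simp add: principal_symbol_def sum_distrib_left mult.assoc)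
  then show ?thesis using assms by (simp add: sphere_inf_def norm_mult)
qed

lemma moderate_sphere_inf:
  fixes r :: "real \<Rightarrow> ('n::finite \<Rightarrow> nat) \<Rightarrow> complex"
  assumes "\<And>\<alpha>. moderate (\<lambda>\<epsilon>. r \<epsilon> \<alpha>)" shows "moderate (\<lambda>\<epsilon>. sphere_inf m (r \<epsilon>))"
proof -
  obtain M :: nat where M: "\<And>\<alpha>. mi_order \<alpha> \<le> m \<Longrightarrow> bnd (\<lambda>\<epsilon>. norm (r \<epsilon> \<alpha>)) (- real M)"
    by (rule coeffs_uniform[of r m]) (use assms in auto)
  have "bnd (\<lambda>\<epsilon>. \<Sum>\<alpha> | mi_order \<alpha> = m. norm (r \<epsilon> \<alpha>)) (- real M)" by (intro bnd_sum M) auto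
  then have "bnd (\<lambda>\<epsilon>. norm (sphere_inf m (r \<epsilon>))) (- real M)"
  proof (rule bnd_mono_unit)
    fix \<epsilon> :: real
    have "sphere_inf m (\<lambda>_::'n \<Rightarrow> nat. 0) \<le> 0"
    proof -
      obtain \<xi> :: "real^'n" where "norm \<xi> = 1" using sphere_nonempty by blast
      from sphere_inf_le[OF this, of m "\<lambda>_. 0"] show ?thesis by (simp add: principal_symbol_def)
    qed
    then show "norm (sphere_inf m (r \<epsilon>)) \<le> (\<Sum>\<alpha> | mi_order \<alpha> = m. norm (r \<epsilon> \<alpha>))"
      using sphere_inf_diff_le[of m "r \<epsilon>" "\<lambda>_. 0"] sphere_inf_nonneg[of m "r \<epsilon>"] by simp
  qed
  then show ?thesis unfolding moderate_iff by blast
qed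

text \<open>\<open>rep_gnum\<close> chooses a representative of the transposed coefficient
  independently of the one of \<open>c \<alpha>\<close>; the two are related only up to a negligible
  net.\<close>

lemma transpose_coeffs_rep:
  fixes c :: "'n::finite coeffs"
  shows "negligible_net (\<lambda>\<epsilon>. rep_gnum (transpose_coeffs c \<alpha>) \<epsilon> - (- 1) ^ mi_order \<alpha> * rep_gnum (c \<alpha>) \<epsilon>)"
proof -
  have mod: "moderate (\<lambda>\<epsilon>. (- 1) ^ mi_order \<alpha> * rep_gnum (c \<alpha>) \<epsilon>)"
    by (rule moderate_mult[OF moderate_const moderate_rep])
  have "abs_gnum (\<lambda>\<epsilon>. (- 1) ^ k * r \<epsilon>) = (- 1) ^ k * abs_gnum r" if r: "moderate r" for k and r :: "real \<Rightarrow> complex"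
  proof (induction k)
    case (Suc k)
    have "moderate (\<lambda>\<epsilon>. (- 1) ^ k * r \<epsilon>)" by (rule moderate_mult[OF moderate_const r])
    then have "net_eq (\<lambda>\<epsilon>. (- 1) ^ k * r \<epsilon>) (\<lambda>\<epsilon>. (- 1) ^ k * r \<epsilon>)" by (simp add: net_eq_def negligible_zero)
    from uminus_gnum.abs_eq[OF this] Suc show ?case by simp
  qed simp
  from this[OF moderate_rep[of "c \<alpha>"], of "mi_order \<alpha>"]
  have "abs_gnum (rep_gnum (transpose_coeffs c \<alpha>)) = abs_gnum (\<lambda>\<epsilon>. (- 1) ^ mi_order \<alpha> * rep_gnum (c \<alpha>) \<epsilon>)"
    by (simp add: abs_rep_gnum transpose_coeffs_def)
  from abs_gnum_eqD[OF this moderate_rep mod] show ?thesis .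
qed

lemma ellipticity_number_transpose:
  fixes c :: "'n::finite coeffs"
  shows "ellipticity_number m c = abs_gnum (\<lambda>\<epsilon>. sphere_inf m (\<lambda>\<alpha>. rep_gnum (transpose_coeffs c \<alpha>) \<epsilon>))"
proof -
  let ?b = "\<lambda>\<epsilon> \<alpha>. rep_gnum (transpose_coeffs c \<alpha>) \<epsilon>" and ?r = "\<lambda>\<epsilon> \<alpha>. rep_gnum (c \<alpha>) \<epsilon>"
  have le: "norm (sphere_inf m (?r \<epsilon>) - sphere_inf m (?b \<epsilon>))
      \<le> (\<Sum>\<alpha> | mi_order \<alpha> = m. norm (?b \<epsilon> \<alpha> - (- 1) ^ mi_order \<alpha> * ?r \<epsilon> \<alpha>))" for \<epsilon>
    using sphere_inf_diff_le[of m "\<lambda>\<alpha>. (- 1) ^ m * ?r \<epsilon> \<alpha>" "?b \<epsilon>"] sphere_inf_cmult[of "(- 1) ^ m" m "?r \<epsilon>"]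
    by (simp add: norm_power norm_minus_commute)
  have "abs_gnum (\<lambda>\<epsilon>. sphere_inf m (?r \<epsilon>)) = abs_gnum (\<lambda>\<epsilon>. sphere_inf m (?b \<epsilon>))"
  proof (intro abs_gnum_eqI moderate_sphere_inf moderate_rep)
    show "negligible_net (\<lambda>\<epsilon>. sphere_inf m (?r \<epsilon>) - sphere_inf m (?b \<epsilon>))"
      unfolding negligible_iff
    proof
      fix q :: nat
      have "bnd (\<lambda>\<epsilon>. \<Sum>\<alpha> | mi_order \<alpha> = m. norm (?b \<epsilon> \<alpha> - (- 1) ^ mi_order \<alpha> * ?r \<epsilon> \<alpha>)) (real q)"
        by (intro bnd_sum transpose_coeffs_rep[unfolded negligible_iff, rule_format])
      then show "bnd (\<lambda>\<epsilon>. norm (sphere_inf m (?r \<epsilon>) - sphere_inf m (?b \<epsilon>))) (real q)"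
        by (rule bnd_mono_unit) (rule le)
    qed
  qed
  then show ?thesis by (simp add: ellipticity_number_def sphere_inf_def)
qed

text \<open>If y represents the inverse, then e y = 1 up to a negligible net, so e y \<ge> 1/2 and
  1/e \<le> 2 |y| for small \<epsilon>.\<close>

lemma elliptic_inverse_moderate:
  fixes e :: "real \<Rightarrow> real"
  assumes "moderate e" "\<And>\<epsilon>. 0 \<le> e \<epsilon>" "abs_gnum e dvd 1"
  obtains N :: nat where "bnd (\<lambda>\<epsilon>. inverse (e \<epsilon>)) (- real N)" "\<forall>\<^sub>F \<epsilon> in at_right 0. 0 < e \<epsilon>"
proof -
  obtain z where z: "1 = abs_gnum e * z" using assms(3) by (rule dvdE)
  define y where "y = rep_gnum z"
  have y: "moderate y" "z = abs_gnum y" by (simp_all add: y_def moderate_rep abs_rep_gnum)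
  have "net_eq e e" "net_eq y y" using assms(1) y(1) by (simp_all add: net_eq_def negligible_zero)
  then have "abs_gnum (\<lambda>\<epsilon>. e \<epsilon> * y \<epsilon>) = abs_gnum (\<lambda>_. 1)"
    using z y(2) times_gnum.abs_eq one_gnum.abs_eq by metis
  then have "negligible_net (\<lambda>\<epsilon>. e \<epsilon> * y \<epsilon> - 1)"
    by (rule abs_gnum_eqD) (intro moderate_mult assms(1) y(1) moderate_const)+
  then have "\<forall>\<^sub>F \<epsilon> in at_right 0. norm (e \<epsilon> * y \<epsilon> - 1) \<le> 1 / 2 * \<epsilon>" by (rule negligible_eventually_le) simp
  with eventually_unit have ev: "\<forall>\<^sub>F \<epsilon> in at_right 0. 0 < e \<epsilon> \<and> inverse (e \<epsilon>) \<le> norm (y \<epsilon>) * 2"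
  proof eventually_elim
    fix \<epsilon> :: real assume "\<epsilon> \<in> {0<..1}" "norm (e \<epsilon> * y \<epsilon> - 1) \<le> 1 / 2 * \<epsilon>"
    then have "\<epsilon> \<le> 1" "\<bar>e \<epsilon> * y \<epsilon> - 1\<bar> \<le> \<epsilon> / 2" by auto
    then have 1: "1 / 2 \<le> e \<epsilon> * y \<epsilon>" by linarith
    then have pos: "0 < e \<epsilon>" using assms(2)[of \<epsilon>] by (cases "e \<epsilon> = 0") auto
    have "e \<epsilon> * y \<epsilon> \<le> e \<epsilon> * \<bar>y \<epsilon>\<bar>" using pos by (intro mult_left_mono) auto
    then have "1 \<le> e \<epsilon> * (\<bar>y \<epsilon>\<bar> * 2)" using 1 by linarith
    then show "0 < e \<epsilon> \<and> inverse (e \<epsilon>) \<le> norm (y \<epsilon>) * 2" using pos by (simp add: field_simps)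
  qed
  obtain N :: nat where "bnd (\<lambda>\<epsilon>. norm (y \<epsilon>)) (- real N)" using y(1) unfolding moderate_iff by blast
  then have "bnd (\<lambda>\<epsilon>. norm (y \<epsilon>) * 2) (- real N)" by (rule bnd_cmult) simp
  then have "bnd (\<lambda>\<epsilon>. inverse (e \<epsilon>)) (- real N)"
    by (rule bnd_mono) (use ev in eventually_elim, simp)
  then show thesis by (rule that) (use ev in eventually_elim, simp)
qed

text \<open>The lower bound is given for some representative x, not for e. Since \<omega> \<le>
  c/\<epsilon>, the bound 1/\<omega> is at least \<epsilon>/c; the negligible difference is at most
  \<epsilon>/(2 c) and leaves half of it, so 1/e \<le> 2 \<omega>.\<close>

lemma elliptic_inverse_slow:
  fixes e :: "real \<Rightarrow> real"
  assumes "moderate e" "\<And>\<epsilon>. 0 \<le> e \<epsilon>" "slow_scale_invertible (abs_gnum e)"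
  shows "slow (\<lambda>\<epsilon>. inverse (e \<epsilon>))" "\<forall>\<^sub>F \<epsilon> in at_right 0. 0 < e \<epsilon>"
proof -
  obtain \<omega> :: "real \<Rightarrow> real" and x where \<omega>: "slow_scale \<omega>" "\<And>\<epsilon>. \<epsilon> \<in> {0<..1} \<Longrightarrow> 0 < \<omega> \<epsilon>"
    and x: "moderate x" "abs_gnum x = abs_gnum e"
    and le: "\<forall>\<^sub>F \<epsilon> in at_right 0. inverse (\<omega> \<epsilon>) \<le> norm (x \<epsilon>)"
    using assms(3) unfolding slow_scale_invertible_def representatives_def by blast
  obtain c where c: "0 < c" "\<forall>\<epsilon>\<in>{0<..1}. norm (\<omega> \<epsilon>) powr 1 \<le> c * inverse \<epsilon>"
    using \<omega>(1) unfolding slow_scale_def by (meson zero_le_one)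
  have "negligible_net (\<lambda>\<epsilon>. x \<epsilon> - e \<epsilon>)" by (rule abs_gnum_eqD[OF x(2,1) assms(1)])
  then have "\<forall>\<^sub>F \<epsilon> in at_right 0. norm (x \<epsilon> - e \<epsilon>) \<le> 1 / (2 * c) * \<epsilon>"
    by (rule negligible_eventually_le) (use c in simp)
  with eventually_unit le have ev: "\<forall>\<^sub>F \<epsilon> in at_right 0. 0 < e \<epsilon> \<and> inverse (e \<epsilon>) \<le> norm (\<omega> \<epsilon>) * 2"
  proof eventually_elim
    fix \<epsilon> :: real assume \<epsilon>: "\<epsilon> \<in> {0<..1}" and 1: "inverse (\<omega> \<epsilon>) \<le> norm (x \<epsilon>)"
      and 2: "norm (x \<epsilon> - e \<epsilon>) \<le> 1 / (2 * c) * \<epsilon>"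
    note p = \<omega>(2)[OF \<epsilon>]
    have "\<omega> \<epsilon> \<le> c * inverse \<epsilon>" using c(2) \<epsilon> p by force
    then have "\<epsilon> / c \<le> inverse (\<omega> \<epsilon>)" using \<epsilon> c(1) p by (auto simp: field_simps)
    then have "1 / (2 * c) * \<epsilon> \<le> inverse (\<omega> \<epsilon>) / 2" by simp
    moreover have "norm (x \<epsilon>) \<le> norm (x \<epsilon> - e \<epsilon>) + e \<epsilon>" using assms(2)[of \<epsilon>] by auto
    ultimately have 3: "inverse (\<omega> \<epsilon>) / 2 \<le> e \<epsilon>" using 1 2 by linarith
    moreover have "0 < inverse (\<omega> \<epsilon>) / 2" using p by simp
    ultimately have "0 < e \<epsilon>" by linarith
    then show "0 < e \<epsilon> \<and> inverse (e \<epsilon>) \<le> norm (\<omega> \<epsilon>) * 2" using 3 p by (auto simp: field_simps)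
  qed
  have "slow (\<lambda>\<epsilon>. norm (\<omega> \<epsilon>) * 2)" by (rule slow_cmult[OF slow_scale_slow[OF \<omega>(1)]]) simp
  then show "slow (\<lambda>\<epsilon>. inverse (e \<epsilon>))"
    by (rule slow_mono) (use ev in eventually_elim, simp)
  show "\<forall>\<^sub>F \<epsilon> in at_right 0. 0 < e \<epsilon>" using ev by eventually_elim simp
qed

lemma slow_scale_number_slow:
  assumes "moderate r" "abs_gnum r \<in> slow_scale_numbers"
  shows "slow (\<lambda>\<epsilon>. norm (r \<epsilon>))"
proof -
  obtain x and \<omega> :: "real \<Rightarrow> complex" where x: "moderate x" "abs_gnum x = abs_gnum r" and \<omega>: "slow_scale \<omega>" "x \<in> O[at_right 0](\<omega>)"
    using assms(2) unfolding slow_scale_numbers_def representatives_def by blast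
  obtain k where k: "0 < k" "\<forall>\<^sub>F \<epsilon> in at_right 0. norm (x \<epsilon>) \<le> k * norm (\<omega> \<epsilon>)"
    using \<omega>(2) by (rule landau_o.bigE)
  have "negligible_net (\<lambda>\<epsilon>. x \<epsilon> - r \<epsilon>)" by (rule abs_gnum_eqD[OF x(2,1) assms(1)])
  then have "\<forall>\<^sub>F \<epsilon> in at_right 0. norm (x \<epsilon> - r \<epsilon>) \<le> 1 * \<epsilon>" by (rule negligible_eventually_le) simp
  with eventually_unit k(2) have ev: "\<forall>\<^sub>F \<epsilon> in at_right 0. 0 \<le> norm (r \<epsilon>) \<and> norm (r \<epsilon>) \<le> norm (\<omega> \<epsilon>) * k + 1"
  proof eventually_elim
    fix \<epsilon> :: real assume "\<epsilon> \<in> {0<..1}" "norm (x \<epsilon>) \<le> k * norm (\<omega> \<epsilon>)" "norm (x \<epsilon> - r \<epsilon>) \<le> 1 * \<epsilon>"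
    then show "0 \<le> norm (r \<epsilon>) \<and> norm (r \<epsilon>) \<le> norm (\<omega> \<epsilon>) * k + 1"
      using norm_triangle_ineq2[of "r \<epsilon>" "x \<epsilon>"] by (auto simp: norm_minus_commute mult.commute)
  qed
  have "slow (\<lambda>\<epsilon>. norm (\<omega> \<epsilon>) * k + 1)"
    using k(1) by (intro slow_add slow_cmult slow_scale_slow \<omega> slow_const) auto
  then show ?thesis using ev by (rule slow_mono)
qed

section \<open>Hypoellipticity\<close>

text \<open>The elementary direction: where T is a function, integration by parts moves the
  transposed operator back onto it. The second transposition is undone by the explicit signs in
  \<open>w\<close>.\<close>

lemma transpose_integral_given_by:
  fixes V \<Omega> :: "(real^'n::finite) set" and c :: "'n coeffs" and m :: nat
  assumes o: "open V" "open \<Omega>" "V \<subseteq> \<Omega>" and u: "u \<in> moderate_nets V" "U = colombeau_class V u"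
    and g: "given_by V U (restrict_functional \<Omega> V T)"
  defines "w \<equiv> \<lambda>\<epsilon>. cop m (\<lambda>\<alpha>. (- 1) ^ mi_order \<alpha> * rep_gnum (transpose_coeffs c \<alpha>) \<epsilon>) (u \<epsilon>)"
  shows "w \<in> moderate_nets V" "given_by V (colombeau_class V w) (restrict_functional \<Omega> V (apply_op_functional \<Omega> m c T))"
proof -
  let ?b = "\<lambda>\<epsilon> \<alpha>. rep_gnum (transpose_coeffs c \<alpha>) \<epsilon>"
  show w: "w \<in> moderate_nets V"
    unfolding w_def by (rule cop_moderate[OF o(1) u(1)]) (intro moderate_mult moderate_const moderate_rep)
  show "given_by V (colombeau_class V w) (restrict_functional \<Omega> V (apply_op_functional \<Omega> m c T))"
  proof (rule given_byI[OF o(1) w])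
    fix v assume v: "v \<in> c_nets V"
    obtain K where K: "compact K" "K \<subseteq> V" "\<And>\<epsilon>. \<epsilon> \<in> {0<..1} \<Longrightarrow> v \<epsilon> \<in> test_functions_in K" "v \<in> moderate_nets V"
      by (rule c_netsE[OF v]) blast
    define z where "z = (\<lambda>\<epsilon>. cop m (?b \<epsilon>) (v \<epsilon>))"
    have z: "z \<in> c_nets V" unfolding z_def by (rule cop_c_nets[OF o(1) v moderate_rep])
    have v\<Omega>: "v \<in> moderate_nets \<Omega>" using c_nets_mono[OF o v] by (auto simp: c_nets_def)
    have "restrict_functional \<Omega> V (apply_op_functional \<Omega> m c T) (colombeau_class V v) = T (colombeau_class \<Omega> z)"
      unfolding restrict_functional_def apply_op_functional_def gextend_class[OF o v] apply_op_class[OF o(2) v\<Omega>] z_def ..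
    also have "\<dots> = restrict_functional \<Omega> V T (colombeau_class V z)"
      unfolding restrict_functional_def gextend_class[OF o z] ..
    also have "\<dots> = abs_gnum (\<lambda>\<epsilon>. LINT x:V|lborel. u \<epsilon> x * z \<epsilon> x)"
      by (rule g[unfolded given_by_def u(2), rule_format, OF class_self[OF o(1) u(1)] z])
    also have "\<dots> = abs_gnum (\<lambda>\<epsilon>. LINT x:V|lborel. w \<epsilon> x * v \<epsilon> x)"
    proof (intro abs_gnum_eqI integral_pairing_moderate[OF o(1)] u(1) z w v)
      have "(LINT x:V|lborel. u \<epsilon> x * z \<epsilon> x) = (LINT x:V|lborel. w \<epsilon> x * v \<epsilon> x)" if \<epsilon>: "\<epsilon> \<in> {0<..1}" for \<epsilon>
        unfolding set_integral_test[OF K(2) K(3)[OF \<epsilon>]] z_def set_integral_test[OF K(2) cop_test[OF K(1) K(3)[OF \<epsilon>]]] w_def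
        by (rule integral_cop_transpose[OF o(1) K(1,2) smooth_netsD[OF moderate_smooth[OF u(1)] \<epsilon>] K(3)[OF \<epsilon>]])
      then show "negligible_net (\<lambda>\<epsilon>. (LINT x:V|lborel. u \<epsilon> x * z \<epsilon> x) - (LINT x:V|lborel. w \<epsilon> x * v \<epsilon> x))"
        unfolding negligible_iff by (intro allI bnd_mono_unit[OF bnd_powr]) simp
    qed
    finally show "restrict_functional \<Omega> V (apply_op_functional \<Omega> m c T) (colombeau_class V v)
      = abs_gnum (\<lambda>\<epsilon>. LINT x:V|lborel. w \<epsilon> x * v \<epsilon> x)" .
  qed
qed

lemma colombeau_infty_cases:
  fixes V :: "(real^'n::finite) set"
  assumes "open V" "U \<in> colombeau_infty V"
  obtains u where "u \<in> moderate_nets V" "U = colombeau_class V u" "regular_net V u"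
proof -
  obtain u where u: "u \<in> U" and U: "U \<in> colombeau V" and r: "\<forall>K. compact K \<and> K \<subseteq> V \<longrightarrow>
     (\<exists>N::nat. \<forall>\<alpha>. (\<lambda>\<epsilon>. sup_norm K (pderivs \<alpha> (u \<epsilon>))) \<in> O[at_right 0](\<lambda>\<epsilon>. \<epsilon> powr (- real N)))"
    using assms(2) unfolding colombeau_infty_def by blast
  note c = colombeau_cases[OF assms(1) U u]
  show thesis by (rule that[OF c]) (rule r[unfolded regular_net_iff[OF assms(1) moderate_smooth[OF c(1)]]])
qed

lemma class_in_colombeau_infty:
  fixes V :: "(real^'n::finite) set"
  assumes "open V" "u \<in> moderate_nets V" "regular_net V u"
  shows "colombeau_class V u \<in> colombeau_infty V"
  unfolding colombeau_infty_def
  by (rule CollectI, rule conjI[OF class_in_colombeau[OF assms(2)]], rule bexI[OF _ class_self[OF assms(1,2)]],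
      rule assms(3)[folded regular_net_iff[OF assms(1) moderate_smooth[OF assms(2)]]])

lemma colombeau_obtain:
  fixes V :: "(real^'n::finite) set"
  assumes "open V" "U \<in> colombeau V"
  obtains u where "u \<in> moderate_nets V" "U = colombeau_class V u"
proof -
  have "U \<noteq> {}" using assms in_quotient_imp_non_empty[OF colombeau_equiv[OF assms(1)]] by (simp add: colombeau_def)
  then obtain u where "u \<in> U" by blast
  from colombeau_cases[OF assms this] show thesis by (rule that)
qed

text \<open>Passes from functionals on classes to nets: T is replaced by its representing net, and
  the function that gives the operator applied to T supplies the hypothesis \<open>H\<close> of
  \<open>elliptic_net_regularity\<close>.\<close>

lemma elliptic_given_by:
  fixes c :: "'n::finite coeffs"
  assumes ef: "elliptic_family {0<..\<eta>0} A m (\<lambda>\<epsilon> \<alpha>. rep_gnum (transpose_coeffs c \<alpha>) \<epsilon>)" and \<eta>0: "0 < \<eta>0" "\<eta>0 \<le> 1"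
    and tm: "\<And>F. growth.tame {0<..\<eta>0} A F \<Longrightarrow> \<exists>N::nat. bnd F (- real N)"
    and o: "open V" "open \<Omega>" "V \<subseteq> \<Omega>" "x0 \<in> V" and T: "T \<in> basic_functionals \<Omega>" and u: "u \<in> moderate_nets V" "U = colombeau_class V u"
    and g: "given_by V U (restrict_functional \<Omega> V (apply_op_functional \<Omega> m c T))"
  obtains W w where "open W" "x0 \<in> W" "W \<subseteq> V" "w \<in> moderate_nets W"
    "given_by W (colombeau_class W w) (restrict_functional \<Omega> W T)"
    "(\<forall>F. growth.tame {0<..\<eta>0} A F \<longrightarrow> bnd F (- 1)) \<and> regular_net V u \<longrightarrow> regular_net W w"
proof -
  let ?b = "\<lambda>\<epsilon> \<alpha>. rep_gnum (transpose_coeffs c \<alpha>) \<epsilon>"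
  have "\<exists>S. basic_net \<Omega> S \<and> (\<forall>u\<in>c_nets \<Omega>. T (colombeau_class \<Omega> u) = abs_gnum (\<lambda>\<epsilon>. S \<epsilon> (u \<epsilon>)))"
    using T unfolding basic_functionals_def basic_net_def by (simp only: mem_Collect_eq conj_assoc)
  then obtain S where S: "basic_net \<Omega> S" and TS: "\<And>u. u \<in> c_nets \<Omega> \<Longrightarrow> T (colombeau_class \<Omega> u) = abs_gnum (\<lambda>\<epsilon>. S \<epsilon> (u \<epsilon>))"
    by metis
  have H: "negligible_net (\<lambda>\<epsilon>. S \<epsilon> (cop m (?b \<epsilon>) (z \<epsilon>)) - (LINT x:V|lborel. u \<epsilon> x * z \<epsilon> x))" if z: "z \<in> c_nets V" for z
  proof -
    have z\<Omega>: "z \<in> moderate_nets \<Omega>" using c_nets_mono[OF o(1-3) z] by (auto simp: c_nets_def)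
    have c\<Omega>: "(\<lambda>\<epsilon>. cop m (?b \<epsilon>) (z \<epsilon>)) \<in> c_nets \<Omega>"
      by (rule c_nets_mono[OF o(1-3) cop_c_nets[OF o(1) z moderate_rep]])
    have "abs_gnum (\<lambda>\<epsilon>. S \<epsilon> (cop m (?b \<epsilon>) (z \<epsilon>))) = restrict_functional \<Omega> V (apply_op_functional \<Omega> m c T) (colombeau_class V z)"
      unfolding restrict_functional_def apply_op_functional_def gextend_class[OF o(1-3) z] apply_op_class[OF o(2) z\<Omega>] TS[OF c\<Omega>] ..
    also have "\<dots> = abs_gnum (\<lambda>\<epsilon>. LINT x:V|lborel. u \<epsilon> x * z \<epsilon> x)"
      by (rule g[unfolded given_by_def u(2), rule_format, OF class_self[OF o(1) u(1)] z])
    finally show ?thesis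
      by (rule abs_gnum_eqD) (rule basic_net_moderate[OF o(2) S c\<Omega>], rule integral_pairing_moderate[OF o(1) u(1) z])
  qed
  show thesis
  proof (rule elliptic_net_regularity[OF ef \<eta>0 tm o(1,3,4) S u(1) H])
    fix W w
    assume W: "open W" "x0 \<in> W" "W \<subseteq> V" and w: "w \<in> moderate_nets W"
      and m: "\<And>v. v \<in> c_nets W \<Longrightarrow> negligible_net (\<lambda>\<epsilon>. S \<epsilon> (v \<epsilon>) - (LINT x:W|lborel. w \<epsilon> x * v \<epsilon> x))"
      and r: "(\<And>F. growth.tame {0<..\<eta>0} A F \<Longrightarrow> bnd F (- 1)) \<Longrightarrow> regular_net V u \<Longrightarrow> regular_net W w"
    have W\<Omega>: "W \<subseteq> \<Omega>" using W(3) o(3) by (rule order_trans)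
    have "given_by W (colombeau_class W w) (restrict_functional \<Omega> W T)"
    proof (rule given_byI[OF W(1) w])
      fix v assume v: "v \<in> c_nets W"
      note v\<Omega> = c_nets_mono[OF W(1) o(2) W\<Omega> v]
      show "restrict_functional \<Omega> W T (colombeau_class W v) = abs_gnum (\<lambda>\<epsilon>. LINT x:W|lborel. w \<epsilon> x * v \<epsilon> x)"
        unfolding restrict_functional_def gextend_class[OF W(1) o(2) W\<Omega> v] TS[OF v\<Omega>]
        by (rule abs_gnum_eqI[OF basic_net_moderate[OF o(2) S v\<Omega>] integral_pairing_moderate[OF W(1) w v] m[OF v]])
    qed
    then show thesis using r by (intro that[OF W w]) blast+
  qed
qed

lemma G_hypoellipticI:
  fixes c :: "'n::finite coeffs"
  assumes ef: "elliptic_family {0<..\<eta>0} A m (\<lambda>\<epsilon> \<alpha>. rep_gnum (transpose_coeffs c \<alpha>) \<epsilon>)" and \<eta>0: "0 < \<eta>0" "\<eta>0 \<le> 1"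
    and tm: "\<And>F. growth.tame {0<..\<eta>0} A F \<Longrightarrow> \<exists>N::nat. bnd F (- real N)"
  shows "G_hypoelliptic m c"
  unfolding G_hypoelliptic_def
proof (intro allI impI ballI)
  fix \<Omega> :: "(real^'n) set" and T assume \<Omega>: "open \<Omega>" and T: "T \<in> basic_functionals \<Omega>"
  have "(\<exists>V. open V \<and> x \<in> V \<and> V \<subseteq> \<Omega> \<and> (\<exists>U\<in>colombeau V. given_by V U (restrict_functional \<Omega> V (apply_op_functional \<Omega> m c T))))
    \<longleftrightarrow> (\<exists>V. open V \<and> x \<in> V \<and> V \<subseteq> \<Omega> \<and> (\<exists>U\<in>colombeau V. given_by V U (restrict_functional \<Omega> V T)))" for x
  \<comment> \<open>The first direction is elliptic regularity and passes to a smaller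
    neighbourhood; the converse applies the operator to the given function on the same one.\<close>
  proof (intro iffI; elim exE conjE bexE)
    fix V U assume V: "open V" "x \<in> V" "V \<subseteq> \<Omega>" and U: "U \<in> colombeau V"
      and g: "given_by V U (restrict_functional \<Omega> V (apply_op_functional \<Omega> m c T))"
    obtain u where u: "u \<in> moderate_nets V" "U = colombeau_class V u" by (rule colombeau_obtain[OF V(1) U])
    obtain W w where W: "open W" "x \<in> W" "W \<subseteq> V" "w \<in> moderate_nets W" "given_by W (colombeau_class W w) (restrict_functional \<Omega> W T)"
      by (rule elliptic_given_by[OF ef \<eta>0 tm V(1) \<Omega> V(3,2) T u g])
    show "\<exists>V. open V \<and> x \<in> V \<and> V \<subseteq> \<Omega> \<and> (\<exists>U\<in>colombeau V. given_by V U (restrict_functional \<Omega> V T))"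
      using W(1,2,3,5) V(3) class_in_colombeau[OF W(4)] by (intro exI[of _ W] conjI bexI[of _ "colombeau_class W w"]) auto
  next
    fix V U assume V: "open V" "x \<in> V" "V \<subseteq> \<Omega>" and U: "U \<in> colombeau V" and g: "given_by V U (restrict_functional \<Omega> V T)"
    obtain u where u: "u \<in> moderate_nets V" "U = colombeau_class V u" by (rule colombeau_obtain[OF V(1) U])
    note tr = transpose_integral_given_by[OF V(1) \<Omega> V(3) u g, of m c]
    show "\<exists>V. open V \<and> x \<in> V \<and> V \<subseteq> \<Omega> \<and> (\<exists>U\<in>colombeau V. given_by V U (restrict_functional \<Omega> V (apply_op_functional \<Omega> m c T)))"
      by (intro exI[of _ V] conjI V bexI, rule tr(2), rule class_in_colombeau[OF tr(1)])
  qed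
  then show "sing_supp_G \<Omega> (apply_op_functional \<Omega> m c T) = sing_supp_G \<Omega> T"
    unfolding sing_supp_G_def by simp
qed

lemma Ginf_hypoellipticI:
  fixes c :: "'n::finite coeffs"
  assumes ef: "elliptic_family {0<..\<eta>0} A m (\<lambda>\<epsilon> \<alpha>. rep_gnum (transpose_coeffs c \<alpha>) \<epsilon>)" and \<eta>0: "0 < \<eta>0" "\<eta>0 \<le> 1"
    and t1: "\<And>F. growth.tame {0<..\<eta>0} A F \<Longrightarrow> bnd F (- 1)"
  shows "Ginf_hypoelliptic m c"
  unfolding Ginf_hypoelliptic_def
proof (intro allI impI ballI)
  fix \<Omega> :: "(real^'n) set" and T assume \<Omega>: "open \<Omega>" and T: "T \<in> basic_functionals \<Omega>"
  have tm: "\<exists>N::nat. bnd F (- real N)" if "growth.tame {0<..\<eta>0} A F" for F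
    using t1[OF that] by (intro exI[of _ 1]) simp
  have "(\<exists>V. open V \<and> x \<in> V \<and> V \<subseteq> \<Omega> \<and> (\<exists>U\<in>colombeau_infty V. given_by V U (restrict_functional \<Omega> V (apply_op_functional \<Omega> m c T))))
    \<longleftrightarrow> (\<exists>V. open V \<and> x \<in> V \<and> V \<subseteq> \<Omega> \<and> (\<exists>U\<in>colombeau_infty V. given_by V U (restrict_functional \<Omega> V T)))" for x
  proof (intro iffI; elim exE conjE bexE)
    fix V U assume V: "open V" "x \<in> V" "V \<subseteq> \<Omega>" and U: "U \<in> colombeau_infty V"
      and g: "given_by V U (restrict_functional \<Omega> V (apply_op_functional \<Omega> m c T))"
    obtain u where u: "u \<in> moderate_nets V" "U = colombeau_class V u" and ru: "regular_net V u"
      by (rule colombeau_infty_cases[OF V(1) U])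
    obtain W w where W: "open W" "x \<in> W" "W \<subseteq> V" "w \<in> moderate_nets W" "given_by W (colombeau_class W w) (restrict_functional \<Omega> W T)"
      and rw: "(\<forall>F. growth.tame {0<..\<eta>0} A F \<longrightarrow> bnd F (- 1)) \<and> regular_net V u \<longrightarrow> regular_net W w"
      by (rule elliptic_given_by[OF ef \<eta>0 tm V(1) \<Omega> V(3,2) T u g])
    show "\<exists>V. open V \<and> x \<in> V \<and> V \<subseteq> \<Omega> \<and> (\<exists>U\<in>colombeau_infty V. given_by V U (restrict_functional \<Omega> V T))"
      using W(1,2,3,5) V(3) class_in_colombeau_infty[OF W(1,4)] rw ru t1
      by (intro exI[of _ W] conjI bexI[of _ "colombeau_class W w"]) auto
  next
    fix V U assume V: "open V" "x \<in> V" "V \<subseteq> \<Omega>" and U: "U \<in> colombeau_infty V" and g: "given_by V U (restrict_functional \<Omega> V T)"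
    obtain u where u: "u \<in> moderate_nets V" "U = colombeau_class V u" and ru: "regular_net V u"
      by (rule colombeau_infty_cases[OF V(1) U])
    note tr = transpose_integral_given_by[OF V(1) \<Omega> V(3) u g, of m c]
    have "regular_net V (\<lambda>\<epsilon>. cop m (\<lambda>\<alpha>. (- 1) ^ mi_order \<alpha> * rep_gnum (transpose_coeffs c \<alpha>) \<epsilon>) (u \<epsilon>))"
      by (rule cop_regular[OF V(1) moderate_smooth[OF u(1)] ru]) (intro moderate_mult moderate_const moderate_rep)
    then show "\<exists>V. open V \<and> x \<in> V \<and> V \<subseteq> \<Omega> \<and> (\<exists>U\<in>colombeau_infty V. given_by V U (restrict_functional \<Omega> V (apply_op_functional \<Omega> m c T)))"
      by - (intro exI[of _ V] conjI V bexI, rule tr(2), rule class_in_colombeau_infty[OF V(1) tr(1)])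
  qed
  then show "sing_supp_Ginf \<Omega> (apply_op_functional \<Omega> m c T) = sing_supp_Ginf \<Omega> T"
    unfolding sing_supp_Ginf_def by simp
qed

text \<open>The concrete choice of A. The summand 1 makes it at least 1, also at indices where the
  infimum vanishes and the inverse is 0 by convention.\<close>

definition ellipticity_bound :: "nat \<Rightarrow> (('n::finite \<Rightarrow> nat) \<Rightarrow> complex) \<Rightarrow> real" where
  "ellipticity_bound m r = 1 + (\<Sum>\<alpha> | mi_order \<alpha> \<le> m. norm (r \<alpha>)) + inverse (sphere_inf m r)"

lemma ellipticity_bound_ge_1: "1 \<le> ellipticity_bound m r"
  by (simp add: ellipticity_bound_def sum_nonneg sphere_inf_nonneg)

lemma eventually_elliptic_family:
  fixes b :: "real \<Rightarrow> ('n::finite \<Rightarrow> nat) \<Rightarrow> complex"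
  assumes "\<forall>\<^sub>F \<epsilon> in at_right 0. 0 < sphere_inf m (b \<epsilon>)"
  obtains \<eta>0 where "0 < \<eta>0" "\<eta>0 \<le> 1" "elliptic_family {0<..\<eta>0} (\<lambda>\<epsilon>. ellipticity_bound m (b \<epsilon>)) m b"
proof -
  obtain d :: real where d: "0 < d" "\<And>\<epsilon>. 0 < \<epsilon> \<Longrightarrow> \<epsilon> < d \<Longrightarrow> 0 < sphere_inf m (b \<epsilon>)"
    using assms unfolding eventually_at_right_field by blast
  \<comment> \<open>Halved because the index interval is closed on the right while positivity is
    known for \<epsilon> < d.\<close>
  define \<eta>0 where "\<eta>0 = min 1 (d / 2)"
  have "elliptic_family {0<..\<eta>0} (\<lambda>\<epsilon>. ellipticity_bound m (b \<epsilon>)) m b"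
  proof unfold_locales
    fix \<epsilon> assume \<epsilon>: "\<epsilon> \<in> {0<..\<eta>0}"
    show "1 \<le> ellipticity_bound m (b \<epsilon>)" by (rule ellipticity_bound_ge_1)
    show "norm (b \<epsilon> \<alpha>) \<le> ellipticity_bound m (b \<epsilon>)" if "mi_order \<alpha> \<le> m" for \<alpha>
    proof -
      have "norm (b \<epsilon> \<alpha>) \<le> (\<Sum>\<alpha> | mi_order \<alpha> \<le> m. norm (b \<epsilon> \<alpha>))"
        using that by (intro member_le_sum[of \<alpha> _ "\<lambda>\<alpha>. norm (b \<epsilon> \<alpha>)"] finite_mi_order) auto
      moreover have "0 \<le> inverse (sphere_inf m (b \<epsilon>))" using sphere_inf_nonneg[of m "b \<epsilon>"] by simp
      ultimately show ?thesis unfolding ellipticity_bound_def by linarith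
    qed
    fix \<xi> :: "real^'n" assume "norm \<xi> = 1"
    then have 1: "sphere_inf m (b \<epsilon>) \<le> norm (principal_symbol m (b \<epsilon>) \<xi>)" by (rule sphere_inf_le)
    have pos: "0 < sphere_inf m (b \<epsilon>)" using \<epsilon> d by (auto simp: \<eta>0_def)
    have "inverse (sphere_inf m (b \<epsilon>)) \<le> ellipticity_bound m (b \<epsilon>)" by (simp add: ellipticity_bound_def sum_nonneg)
    then have "inverse (ellipticity_bound m (b \<epsilon>)) \<le> inverse (inverse (sphere_inf m (b \<epsilon>)))"
      using pos by (intro le_imp_inverse_le) auto
    then show "inverse (ellipticity_bound m (b \<epsilon>)) \<le> norm (principal_symbol m (b \<epsilon>) \<xi>)" using 1 by simp
  qed
  then show thesis using d(1) by (intro that[of \<eta>0]) (auto simp: \<eta>0_def)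
qed

text \<open>The exponent is left as a function \<open>g\<close> of the power of A, so that one
  statement covers exponents that worsen with the power and the constant exponent -1.\<close>

lemma tame_bnd:
  assumes "growth.tame {0<..\<eta>0} A F" "growth {0<..\<eta>0} A" "0 < \<eta>0" "\<And>N. bnd (\<lambda>\<epsilon>. A \<epsilon> ^ N) (g N)"
  obtains N where "bnd F (g N)"
proof -
  obtain C N where C: "0 \<le> C" "\<And>\<epsilon>. \<epsilon> \<in> {0<..\<eta>0} \<Longrightarrow> F \<epsilon> \<le> C * A \<epsilon> ^ N"
    using assms(1) unfolding growth.tame_def[OF assms(2)] by blast
  have ev: "\<forall>\<^sub>F \<epsilon> in at_right 0. \<epsilon> \<in> {0<..<\<eta>0}" by (rule eventually_at_right_real[OF assms(3)])
  have "bnd F (g N)"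
    by (rule bnd_mono[OF bnd_cmult[OF assms(4) C(1)]]) (use ev in eventually_elim, use C(2) in \<open>auto simp: mult.commute\<close>)
  then show thesis by (rule that)
qed

theorem theorem3p5:
  fixes m :: nat and c :: "('n::finite \<Rightarrow> nat) \<Rightarrow> complex gnum"
  shows "(G_elliptic m c \<longrightarrow> G_hypoelliptic m c) \<and>
    ((\<forall>\<alpha>. mi_order \<alpha> \<le> m \<longrightarrow> c \<alpha> \<in> slow_scale_numbers) \<and> Ginf_elliptic m c
       \<longrightarrow> Ginf_hypoelliptic m c)"
proof (intro conjI impI)
  \<comment> \<open>The coefficients are those of the transposed operator, since that is the one to
    be inverted on test functions.\<close>
  define b where "b = (\<lambda>\<epsilon> \<alpha>. rep_gnum (transpose_coeffs c \<alpha>) \<epsilon>)"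
  define A where "A = (\<lambda>\<epsilon>. ellipticity_bound m (b \<epsilon>))"
  have A: "1 \<le> A \<epsilon>" "A \<epsilon> = 1 + (\<Sum>\<alpha> | mi_order \<alpha> \<le> m. norm (b \<epsilon> \<alpha>)) + inverse (sphere_inf m (b \<epsilon>))" for \<epsilon>
    unfolding A_def by (rule ellipticity_bound_ge_1, rule ellipticity_bound_def)
  have A0: "0 \<le> A \<epsilon>" for \<epsilon> using A(1)[of \<epsilon>] by linarith
  have g: "growth I A" for I by unfold_locales (rule A(1))
  have bm: "moderate (\<lambda>\<epsilon>. b \<epsilon> \<alpha>)" for \<alpha> unfolding b_def by (rule moderate_rep)
  have e: "moderate (\<lambda>\<epsilon>. sphere_inf m (b \<epsilon>))" by (rule moderate_sphere_inf[OF bm])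
  have en: "ellipticity_number m c = abs_gnum (\<lambda>\<epsilon>. sphere_inf m (b \<epsilon>))"
    unfolding b_def by (rule ellipticity_number_transpose)
  {
    assume "G_elliptic m c"
    then have "abs_gnum (\<lambda>\<epsilon>. sphere_inf m (b \<epsilon>)) dvd 1" by (simp add: G_elliptic_def en)
    then obtain N :: nat where N: "bnd (\<lambda>\<epsilon>. inverse (sphere_inf m (b \<epsilon>))) (- real N)"
      and pos: "\<forall>\<^sub>F \<epsilon> in at_right 0. 0 < sphere_inf m (b \<epsilon>)"
      by (rule elliptic_inverse_moderate[OF e sphere_inf_nonneg])
    obtain \<eta>0 where \<eta>0: "0 < \<eta>0" "\<eta>0 \<le> 1" and ef: "elliptic_family {0<..\<eta>0} A m b"
      unfolding A_def by (rule eventually_elliptic_family[OF pos])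
    obtain M :: nat where M: "\<And>\<alpha>. mi_order \<alpha> \<le> m \<Longrightarrow> bnd (\<lambda>\<epsilon>. norm (b \<epsilon> \<alpha>)) (- real M)"
      by (rule coeffs_uniform[of b m]) (use bm in auto)
    have "bnd A (- real (M + N))"
      unfolding A(2)[abs_def] by (intro bnd_add bnd_sum) (auto intro: bnd_weaken[OF bnd_const] bnd_weaken[OF M] bnd_weaken[OF N])
    \<comment> \<open>The exponent worsens with k: enough for moderateness of every derivative, but
      not for a bound uniform in the derivatives.\<close>
    then have AN: "bnd (\<lambda>\<epsilon>. A \<epsilon> ^ k) (- real ((M + N) * k))" for k by (rule bnd_power[OF _ A0])
    show "G_hypoelliptic m c"
    proof (rule G_hypoellipticI[OF ef[unfolded b_def] \<eta>0])
      fix F assume "growth.tame {0<..\<eta>0} A F"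
      then show "\<exists>N::nat. bnd F (- real N)"
        by (rule tame_bnd[OF _ g \<eta>0(1) AN]) blast
    qed
  }
  {
    assume "(\<forall>\<alpha>. mi_order \<alpha> \<le> m \<longrightarrow> c \<alpha> \<in> slow_scale_numbers) \<and> Ginf_elliptic m c"
    then have c: "\<And>\<alpha>. mi_order \<alpha> \<le> m \<Longrightarrow> c \<alpha> \<in> slow_scale_numbers" and el: "slow_scale_invertible (abs_gnum (\<lambda>\<epsilon>. sphere_inf m (b \<epsilon>)))"
      by (auto simp: Ginf_elliptic_def en)
    note sl = elliptic_inverse_slow[OF e sphere_inf_nonneg el]
    obtain \<eta>0 where \<eta>0: "0 < \<eta>0" "\<eta>0 \<le> 1" and ef: "elliptic_family {0<..\<eta>0} A m b"
      unfolding A_def by (rule eventually_elliptic_family[OF sl(2)])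
    \<comment> \<open>The negligible discrepancy between the chosen representatives is absorbed by
      adding 1.\<close>
    have sb: "slow (\<lambda>\<epsilon>. norm (b \<epsilon> \<alpha>))" if "mi_order \<alpha> \<le> m" for \<alpha>
    proof -
      have "slow (\<lambda>\<epsilon>. norm (rep_gnum (c \<alpha>) \<epsilon>))"
        by (rule slow_scale_number_slow[OF moderate_rep]) (simp add: abs_rep_gnum c[OF that])
      then have "slow (\<lambda>\<epsilon>. norm (rep_gnum (c \<alpha>) \<epsilon>) + 1)" by (rule slow_add[OF _ slow_const]) auto
      then show ?thesis
      proof (rule slow_mono)
        have "\<forall>\<^sub>F \<epsilon> in at_right 0. norm (b \<epsilon> \<alpha> - (- 1) ^ mi_order \<alpha> * rep_gnum (c \<alpha>) \<epsilon>) \<le> 1 * \<epsilon>"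
          unfolding b_def by (rule negligible_eventually_le[OF transpose_coeffs_rep]) simp
        with eventually_unit show "\<forall>\<^sub>F \<epsilon> in at_right 0. 0 \<le> norm (b \<epsilon> \<alpha>) \<and> norm (b \<epsilon> \<alpha>) \<le> norm (rep_gnum (c \<alpha>) \<epsilon>) + 1"
        proof eventually_elim
          fix \<epsilon> :: real assume "\<epsilon> \<in> {0<..1}" "norm (b \<epsilon> \<alpha> - (- 1) ^ mi_order \<alpha> * rep_gnum (c \<alpha>) \<epsilon>) \<le> 1 * \<epsilon>"
          then show "0 \<le> norm (b \<epsilon> \<alpha>) \<and> norm (b \<epsilon> \<alpha>) \<le> norm (rep_gnum (c \<alpha>) \<epsilon>) + 1"
            using norm_triangle_ineq2[of "b \<epsilon> \<alpha>" "(- 1) ^ mi_order \<alpha> * rep_gnum (c \<alpha>) \<epsilon>"]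
            by (auto simp: norm_mult norm_power)
        qed
      qed
    qed
    have "slow A"
      unfolding A(2)[abs_def]
      by (intro slow_add slow_sum slow_const sl(1) sb) (auto intro!: sum_nonneg add_nonneg_nonneg simp: sphere_inf_nonneg)
    \<comment> \<open>One exponent for all powers; this is where slow scale replaces moderate
      growth.\<close>
    then have AN: "bnd (\<lambda>\<epsilon>. A \<epsilon> ^ k) (- 1)" for k by (simp add: slow_def)
    show "Ginf_hypoelliptic m c"
    proof (rule Ginf_hypoellipticI[OF ef[unfolded b_def] \<eta>0])
      fix F assume "growth.tame {0<..\<eta>0} A F"
      then show "bnd F (- 1)" by (rule tame_bnd[OF _ g \<eta>0(1) AN])
    qed
  }
qed

end
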